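(* Let $A=\bigoplus_{n\in\mathbb{Z}}A^n$ be a (nonunitary) graded algebra with product $\mu_A$. Consider the graded algebra structure on $\partial_{-1}A=A\oplus A^{\#}[-1]$ (square-zero extension of $A$ by the bimodule $A^{\#}[-1]$), with product $m_2$, as well as the natural nondegenerate bilinear form $\gamma_A$ of degree $-1$. Given a good manageable special pre-Calabi-Yau structure $\{m_n\}_{n\in\mathbb{N}}$ on $A$, define the family of maps $\{\!\{\dots\}\!\}_p:A^{\otimes p}\to A^{\otimes p}$, $p\in\mathbb{N}$, by $$(f_1\otimes\dots\otimes f_p)\big(\{\!\{a_1,\dots,a_p\}\!\}_p\big)=s^{a_1,\dots,a_p}_{f_1,\dots,f_p}\,\gamma_A\big(m_{2p-1}(a_p,tf_p,\dots,a_2,tf_2,a_1),tf_1\big)$$ for all homogeneous $a_1,\dots,a_p\in A$ and $f_1,\dots,f_p\in A^{\#}$, where $$s^{a_1,\dots,a_p}_{f_1,\dots,f_p}=(-1)^{|a_p||f_1|+(p+1)(|a_p|+|f_1|)+\sum_{j=1}^p(p-j)|a_j|+\sum_{j=1}^p(j-1)|f_j|}\,(-1)^{\sum_{1\le i<j<p}|a_i||a_j|+\sum_{1<i<j\le p}|f_i||f_j|+\sum_{1<i\le j<p}|f_i||a_j|}.$$ Then $\{\{\!\{\dots\}\!\}_p\}_{p\in\mathbb{N}}$ determines a structure of double $P_\infty$-algebra on the graded algebra $A$. Moreover, the map $$\{\text{good manageable special pre-Calabi-Yau structures }\{m_n\}_{n\in\mathbb{N}}\text{ on }A\}\longrightarrow\{\text{double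 }P_\infty\text{-algebra structures }\{\{\!\{\dots\}\!\}_p\}_{p\in\mathbb{N}}\text{ on }A\}$$ sending $\{m_n\}_{n\in\mathbb{N}}$ to the family of brackets determined by the first displayed formula is a bijection.
   Context: **General conventions.** $\Bbbk$ is a field of characteristic zero; tensor products are over $\Bbbk$; $\mathbb{N}=\{1,2,\dots\}$. Gradings are cohomological by $\mathbb{Z}$; $V[m]^n=V^{n+m}$; $s_V^m:V\to V[m]$ is the map with underlying identity (so $|s^m_Vv|=|v|-m$). Koszul sign rule: $(f\otimes g)(v\otimes w)=(-1)^{|g||v|}f(v)\otimes g(w)$. $\tau_{V,W}(v\otimes w)=(-1)^{|v||w|}w\otimes v$, and for $\sigma\in\mathbb{S}_n$, $\tau_{V,n}(\sigma)(v_1\otimes\dots\otimes v_n)=(-1)^{\epsilon(\sigma,\bar v)}v_{\sigma^{-1}(1)}\otimes\dots\otimes v_{\sigma^{-1}(n)}$ with $\epsilon(\sigma,\bar v)=\sum_{i<j,\ \sigma^{-1}(i)>\sigma^{-1}(j)}|v_{\sigma^{-1}(i)}||v_{\sigma^{-1}(j)}|$, $\bar v=v_1\otimes\dots\otimes v_n$. $V^{\#}=\mathcal{H}om(V,\Bbbk)$ is the graded dual (spanned by homogeneous linear maps). Algebras are not assumed unital. **Double $P_\infty$-algebra.** A graded algebra $A$ with homogeneous maps $\{\!\{\dots\}\!\}_p:A^{\otimes p}\to A^{\otimes p}$ of degree $2-p$, $p\in\mathbb{N}$, such that: (i) $\tau_{A,p}(\sigma)\circ\{\!\{\dots\}\!\}_p\circ\tau_{A,p}(\sigma^{-1})=\operatorname{sgn}(\sigma)\{\!\{\dots\}\!\}_p$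 for all $\sigma\in\mathbb{S}_p$; (ii) for all $p\in\mathbb{N}$ and homogeneous $a_1,\dots,a_{p-1},a,b\in A$, $$\{\!\{a_1,\dots,a_{p-1},ab\}\!\}_p=\{\!\{a_1,\dots,a_{p-1},a\}\!\}_p\,b+(-1)^{|a|(p+\sum_{j=1}^{p-1}|a_j|)}a\,\{\!\{a_1,\dots,a_{p-1},b\}\!\}_p,$$ where $(v_1\otimes\dots\otimes v_p)b=v_1\otimes\dots\otimes v_{p-1}\otimes v_pb$ and $a(v_1\otimes\dots\otimes v_p)=av_1\otimes v_2\otimes\dots\otimes v_p$; (iii) for all $p\in\mathbb{N}$, $$\sum_{i=1}^p(-1)^{i(p+1)}\sum_{\sigma\in C_p}\operatorname{sgn}(\sigma)\,\tau_{A,p}(\sigma)\circ\{\!\{\dots\}\!\}_{i,p-i+1}\circ\tau_{A,p}(\sigma^{-1})=0,$$ where $C_p\subseteq\mathbb{S}_p$ is the subgroup of cyclic permutations (generated by $(1\,2\,\cdots\,p)$) and $\{\!\{\dots\}\!\}_{i,p-i+1}=(\{\!\{\dots\}\!\}_i\otimes\mathrm{id}_A^{\otimes(p-i)})\circ(\mathrm{id}_A^{\otimes(i-1)}\otimes\{\!\{\dots\}\!\}_{p-i+1})$. **$A_\infty$-algebras.** A (nonunitary) $A_\infty$-algebra is a graded space $B$ with maps $m_n:B^{\otimes n}\to B$, $n\in\mathbb{N}$, of degree $2-n$ with $\sum_{r+s+t=n,\ s\geq1,\ r,t\ge0}(-1)^{r+st}m_{r+1+t}\circ(\mathrm{id}^{\otimes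 r}\otimes m_s\otimes\mathrm{id}^{\otimes t})=0$ for all $n\in\mathbb{N}$. It is *essentially odd* if $m_{2i}=0$ for all $i>1$. It is *$e$-cyclic* for a nondegenerate bilinear form $\gamma:B\otimes B\to\Bbbk$ of degree $e$ if $\gamma\circ\tau_{B,B}=\gamma$ and $\gamma(m_n(a_1,\dots,a_n),a_0)=(-1)^{n+|a_0|\sum_{i=1}^n|a_i|}\gamma(m_n(a_0,\dots,a_{n-1}),a_n)$ for all $n$ and homogeneous $a_i\in B$. It is *$e$-ultracyclic* if it is $e$-cyclic, essentially odd, and for all $n\in\mathbb{N}$, $\varsigma\in\mathbb{S}_n$ and homogeneous $a_i,b_i\in B$, $$\gamma\big(m_{2n-1}(a_{\varsigma(1)},b_{\varsigma(1)},\dots,a_{\varsigma(n-1)},b_{\varsigma(n-1)},a_{\varsigma(n)}),b_{\varsigma(n)}\big)=(-1)^{\epsilon}\gamma\big(m_{2n-1}(a_1,b_1,\dots,a_{n-1},b_{n-1},a_n),b_n\big),$$ where $\epsilon=\epsilon(\theta_n(\varsigma^{-1}),a_1\otimes b_1\otimes\dots\otimes a_n\otimes b_n)$ and $\theta_n:\mathbb{S}_n\to\mathbb{S}_{2n}$ is given by $\theta_n(\varsigma)(2i)=2\varsigma(i)$, $\theta_n(\varsigma)(2i-1)=2\varsigma(i)-1$. **Graded algebra $\partial_{-1}A$.** Write $tf=s^{-1}f\in A^{\#}[-1]$ for $f\in A^{\#}$ (so $|tf|=|f|+1$). $A^{\#}$ is a graded $A$-bimodule via $(a\cdot f\cdot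 b)(c)=(-1)^{|a|(|f|+|b|+|c|)}f(bca)$, $A^{\#}[-1]$ via $a\cdot tf\cdot b=(-1)^{|a|}t(a\cdot f\cdot b)$, and $\partial_{-1}A=A\oplus A^{\#}[-1]$ has product $(a,x)(a',x')=(aa',x\cdot a'+a\cdot x')$. **Natural bilinear form** of degree $-1$ on $\partial_{-1}A$: $\gamma_A(tf,a)=(-1)^{|a||tf|}\gamma_A(a,tf)=f(a)$, $\gamma_A(a,b)=\gamma_A(tf,tg)=0$ for homogeneous $a,b\in A$, $f,g\in A^{\#}$. **Pre-Calabi-Yau structure** on $A$ (the case $d=0$ of $d$-pre-Calabi-Yau): a $(-1)$-cyclic $A_\infty$-algebra structure $\{m_n\}_{n\in\mathbb{N}}$ on $\partial_{-1}A$ for $\gamma_A$ with $m_n(A^{\otimes n})\subseteq A$ for all $n$. It is *manageable* if $m_2$ is the product of the square-zero extension $\partial_{-1}A=A\oplus A^{\#}[-1]$, that is, $m_2((a,x),(a',x'))=(aa',x\cdot a'+a\cdot x')$ for $a,a'\in A$ and $x,x'\in A^{\#}[-1]$; *special* if it is essentially odd and $(-1)$-ultracyclic (for $\gamma_A$); *good* if it is essentially odd and for every odd $n$ the map $m_n$ is good in the following sense: with $B_0=A$, $B_1=A^{\#}[-1]$ and $\mathscr{I}_n$ the set of $(i_1,\dots,i_n)\in\{0,1\}^n$ with $i_j\ne i_{j+1}$ for all $j$, $m_n$ vanishes on $B_{i_1}\otimes\dots\otimes B_{i_n}$ if $(i_1,\dots,i_n)\notin\mathscr{I}_n$ and sends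 it into $B_{i_1}$ if $(i_1,\dots,i_n)\in\mathscr{I}_n$.
   Formalization: "Special" asks the ultracyclic identity only for a_i in A, b_i in A^#[-1] (for all of ∂A the map is not onto); the bijection is on structures whose brackets exist in A^{⊗p}, which is all of them if each degree has finitely many splittings into degrees of A (otherwise they may not exist). *)

theory Defs
  imports
    Complex_Main
    "HOL-Library.Function_Algebras"
    "HOL-Library.Product_Plus"
    "HOL-Combinatorics.Permutations"
begin

section \<open>Graded vector spaces and graded algebras\<close>

text \<open>
  A graded space is a vector space (given by its scaling map \<open>s\<close>) together with a family
  \<open>G\<close> of subspaces of which it is the internal direct sum.
\<close>

definition graded_vs :: "('k::field \<Rightarrow> 'v::ab_group_add \<Rightarrow> 'v) \<Rightarrow> (int \<Rightarrow> 'v set) \<Rightarrow> bool" where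
  "graded_vs s G \<longleftrightarrow> vector_space s \<and> (\<forall>n. module.subspace s (G n)) \<and>
     (\<forall>v. \<exists>!c. (\<forall>n. c n \<in> G n) \<and> finite {n. c n \<noteq> 0} \<and> v = (\<Sum>n\<in>{n. c n \<noteq> 0}. c n))"

definition hcomp :: "(int \<Rightarrow> 'v::ab_group_add set) \<Rightarrow> 'v \<Rightarrow> int \<Rightarrow> 'v" where
  "hcomp G v = (THE c. (\<forall>n. c n \<in> G n) \<and> finite {n. c n \<noteq> 0} \<and> v = (\<Sum>n\<in>{n. c n \<noteq> 0}. c n))"

definition graded_algebra :: "('k::field \<Rightarrow> 'a::ring \<Rightarrow> 'a) \<Rightarrow> (int \<Rightarrow> 'a set) \<Rightarrow> bool" where
  "graded_algebra s G \<longleftrightarrow> graded_vs s G \<and>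
     (\<forall>c a b. s c (a * b) = s c a * b \<and> s c (a * b) = a * s c b) \<and>
     (\<forall>i j. \<forall>a\<in>G i. \<forall>b\<in>G j. a * b \<in> G (i + j))"

text \<open>\<open>homs G ds xs\<close>: the entries of \<open>xs\<close> are homogeneous, of the degrees listed in \<open>ds\<close>.\<close>

definition homs :: "(int \<Rightarrow> 'v set) \<Rightarrow> int list \<Rightarrow> 'v list \<Rightarrow> bool" where
  "homs G ds xs \<longleftrightarrow> list_all2 (\<lambda>d x. x \<in> G d) ds xs"

text \<open>Multilinearity of \<open>F\<close> in \<open>n\<close> arguments taken from the subspace \<open>C\<close>.\<close>

definition multilin ::
  "('k \<Rightarrow> 'v::ab_group_add \<Rightarrow> 'v) \<Rightarrow> ('k \<Rightarrow> 'w::ab_group_add \<Rightarrow> 'w) \<Rightarrow> 'v set \<Rightarrow> nat \<Rightarrow> ('v list \<Rightarrow> 'w) \<Rightarrow> bool"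
  where
  "multilin s s' C n F \<longleftrightarrow>
     (\<forall>xs i c x y. length xs = n \<and> set xs \<subseteq> C \<and> i < n \<and> x \<in> C \<and> y \<in> C \<longrightarrow>
        F (xs[i := s c x + y]) = s' c (F (xs[i := x])) + F (xs[i := y]))"

text \<open>
  A rule \<open>F\<close> that is given on homogeneous arguments and depends on their degrees (a Koszul sign,
  typically) is extended multilinearly by decomposing every argument into homogeneous components.
\<close>

definition hext ::
  "(int \<Rightarrow> 'v::ab_group_add set) \<Rightarrow> (int list \<Rightarrow> 'v list \<Rightarrow> 'w::comm_monoid_add) \<Rightarrow> 'v list \<Rightarrow> 'w" where
  "hext G F vs =
     (\<Sum>ds\<in>{ds. length ds = length vs \<and> (\<forall>i<length vs. hcomp G (vs ! i) (ds ! i) \<noteq> 0)}.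
        F ds (map2 (hcomp G) vs ds))"


section \<open>Tensor powers\<close>

text \<open>
  Over a field, the tensor power of order \<open>p\<close> of \<open>V\<close> embeds into the dual of the space of
  \<open>p\<close>-linear forms on \<open>V\<close>; it is the span there of the evaluations
  \<open>v\<^sub>1 \<otimes> \<dots> \<otimes> v\<^sub>p : \<phi> \<mapsto> \<phi> v\<^sub>1 \<dots> v\<^sub>p\<close>. Setting these
  to \<open>0\<close> off the multilinear forms makes equality of tensors equality of functions.
\<close>

type_synonym ('k, 'v) tensor = "('v list \<Rightarrow> 'k) \<Rightarrow> 'k"

definition tens :: "('k::field \<Rightarrow> 'v::ab_group_add \<Rightarrow> 'v) \<Rightarrow> 'v list \<Rightarrow> ('k, 'v) tensor" where
  "tens s vs = (\<lambda>\<phi>. if multilin s (*) UNIV (length vs) \<phi> then \<phi> vs else 0)"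

definition tscale :: "'k::field \<Rightarrow> ('k, 'v) tensor \<Rightarrow> ('k, 'v) tensor" where
  "tscale c t = (\<lambda>\<phi>. c * t \<phi>)"

definition tpow :: "('k::field \<Rightarrow> 'v::ab_group_add \<Rightarrow> 'v) \<Rightarrow> nat \<Rightarrow> ('k, 'v) tensor set" where
  "tpow s p = module.span tscale {tens s vs | vs. length vs = p}"

definition tpow_deg ::
  "('k::field \<Rightarrow> 'v::ab_group_add \<Rightarrow> 'v) \<Rightarrow> (int \<Rightarrow> 'v set) \<Rightarrow> nat \<Rightarrow> int \<Rightarrow> ('k, 'v) tensor set" where
  "tpow_deg s G p n =
     module.span tscale {tens s vs | ds vs. length vs = p \<and> homs G ds vs \<and> sum_list ds = n}"

text \<open>
  The linear map on a tensor power induced by a multilinear map \<open>F\<close> with values in tensors: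
  \<open>tlift F (tens s vs) = F vs\<close>.
\<close>

definition tlift :: "('v list \<Rightarrow> ('k, 'v) tensor) \<Rightarrow> ('k, 'v) tensor \<Rightarrow> ('k, 'v) tensor" where
  "tlift F t = (\<lambda>\<phi>. t (\<lambda>vs. F vs \<phi>))"

definition tprod ::
  "('k::field \<Rightarrow> 'v::ab_group_add \<Rightarrow> 'v) \<Rightarrow> ('k, 'v) tensor \<Rightarrow> ('k, 'v) tensor \<Rightarrow> ('k, 'v) tensor" where
  "tprod s t u = tlift (\<lambda>vs. tlift (\<lambda>ws. tens s (vs @ ws)) u) t"

text \<open>Permutations of \<open>p\<close> letters act on the positions \<open>0, \<dots>, p - 1\<close>.\<close>

definition koszul :: "(nat \<Rightarrow> nat) \<Rightarrow> int list \<Rightarrow> int" where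
  "koszul \<sigma> ds = (\<Sum>(i, j)\<in>{(i, j). i < j \<and> j < length ds \<and> inv \<sigma> i > inv \<sigma> j}. ds ! inv \<sigma> i * ds ! inv \<sigma> j)"

definition tperm ::
  "('k::field \<Rightarrow> 'v::ab_group_add \<Rightarrow> 'v) \<Rightarrow> (int \<Rightarrow> 'v set) \<Rightarrow> (nat \<Rightarrow> nat) \<Rightarrow> ('k, 'v) tensor \<Rightarrow> ('k, 'v) tensor"
  where
  "tperm s G \<sigma> =
     tlift (hext G (\<lambda>ds vs. tscale ((-1) powi koszul \<sigma> ds) (tens s (permute_list (inv \<sigma>) vs))))"

text \<open>
  \<open>tmap s G i F e H\<close> is \<open>F \<otimes> H\<close>, for \<open>F\<close> defined on the tensor power of order \<open>i\<close> and \<open>H\<close>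
  homogeneous of degree \<open>e\<close>, with the sign \<open>(F \<otimes> H)(v \<otimes> w) = (-1)\<^bsup>\<bar>H\<bar>\<bar>v\<bar>\<^esup> F v \<otimes> H w\<close>.
\<close>

definition tmap ::
  "('k::field \<Rightarrow> 'v::ab_group_add \<Rightarrow> 'v) \<Rightarrow> (int \<Rightarrow> 'v set) \<Rightarrow> nat \<Rightarrow> (('k, 'v) tensor \<Rightarrow> ('k, 'v) tensor) \<Rightarrow>
   int \<Rightarrow> (('k, 'v) tensor \<Rightarrow> ('k, 'v) tensor) \<Rightarrow> ('k, 'v) tensor \<Rightarrow> ('k, 'v) tensor" where
  "tmap s G i F e H =
     tlift (hext G (\<lambda>ds vs. tscale ((-1) powi (e * sum_list (take i ds)))
       (tprod s (F (tens s (take i vs))) (H (tens s (drop i vs))))))"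

text \<open>
  \<open>tpair G es fs t\<close> is \<open>(f\<^sub>1 \<otimes> \<dots> \<otimes> f\<^sub>p) t\<close> for functionals \<open>fs\<close> of degrees \<open>es\<close>. The Koszul rule
  applies here as well: moving \<open>f\<^sub>j\<close> past \<open>v\<^sub>i\<close>, \<open>i < j\<close>, contributes \<open>\<bar>f\<^sub>j\<bar>\<bar>v\<^sub>i\<bar>\<close>.
\<close>

definition tpair ::
  "(int \<Rightarrow> 'v::ab_group_add set) \<Rightarrow> int list \<Rightarrow> ('v \<Rightarrow> 'k::field) list \<Rightarrow> ('k, 'v) tensor \<Rightarrow> 'k" where
  "tpair G es fs t =
     t (hext G (\<lambda>ds vs. (-1) powi (\<Sum>(i, j)\<in>{(i, j). i < j \<and> j < length fs}. es ! j * ds ! i) *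
                         (\<Prod>i<length fs. (fs ! i) (vs ! i))))"


section \<open>Double P-infinity algebras\<close>

definition lmul :: "('k::field \<Rightarrow> 'a::ring \<Rightarrow> 'a) \<Rightarrow> 'a \<Rightarrow> ('k, 'a) tensor \<Rightarrow> ('k, 'a) tensor" where
  "lmul s a = tlift (\<lambda>vs. tens s ((a * hd vs) # tl vs))"

definition rmul :: "('k::field \<Rightarrow> 'a::ring \<Rightarrow> 'a) \<Rightarrow> ('k, 'a) tensor \<Rightarrow> 'a \<Rightarrow> ('k, 'a) tensor" where
  "rmul s t b = tlift (\<lambda>vs. tens s (butlast vs @ [last vs * b])) t"

definition cycle_perm :: "nat \<Rightarrow> nat \<Rightarrow> nat" where
  "cycle_perm p i = (if i < p then Suc i mod p else i)"

definition cyclic_perms :: "nat \<Rightarrow> (nat \<Rightarrow> nat) set" where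
  "cyclic_perms p = range (\<lambda>k. cycle_perm p ^^ k)"

text \<open>
  Families of linear endomorphisms of the tensor powers of order \<open>p \<ge> 1\<close>. Requiring the value
  \<open>0\<close> outside these spaces makes such a family determined by its members.
\<close>

definition bracket_family ::
  "('k::field \<Rightarrow> 'a::ring \<Rightarrow> 'a) \<Rightarrow> (nat \<Rightarrow> ('k, 'a) tensor \<Rightarrow> ('k, 'a) tensor) \<Rightarrow> bool" where
  "bracket_family s br \<longleftrightarrow>
     (\<forall>t. br 0 t = 0) \<and>
     (\<forall>p\<ge>1. (\<forall>t\<in>tpow s p. br p t \<in> tpow s p) \<and> (\<forall>t. t \<notin> tpow s p \<longrightarrow> br p t = 0) \<and>
        (\<forall>t\<in>tpow s p. \<forall>u\<in>tpow s p. \<forall>c. br p (tscale c t + u) = tscale c (br p t) + br p u))"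

text \<open>\<open>bracket_comp s G br i j\<close> is the composition with outer bracket of arity \<open>i\<close>, inner bracket of arity \<open>j\<close>.\<close>

definition bracket_comp ::
  "('k::field \<Rightarrow> 'a::ring \<Rightarrow> 'a) \<Rightarrow> (int \<Rightarrow> 'a set) \<Rightarrow> (nat \<Rightarrow> ('k, 'a) tensor \<Rightarrow> ('k, 'a) tensor) \<Rightarrow>
   nat \<Rightarrow> nat \<Rightarrow> ('k, 'a) tensor \<Rightarrow> ('k, 'a) tensor" where
  "bracket_comp s G br i j = tmap s G i (br i) 0 id \<circ> tmap s G (i - 1) id (2 - int j) (br j)"

definition double_P_inf ::
  "('k::field \<Rightarrow> 'a::ring \<Rightarrow> 'a) \<Rightarrow> (int \<Rightarrow> 'a set) \<Rightarrow> (nat \<Rightarrow> ('k, 'a) tensor \<Rightarrow> ('k, 'a) tensor) \<Rightarrow> bool" where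
  "double_P_inf s G br \<longleftrightarrow>
     bracket_family s br \<and>
     (\<forall>p\<ge>1. \<forall>n. \<forall>t\<in>tpow_deg s G p n. br p t \<in> tpow_deg s G p (n + 2 - int p)) \<and>
     (\<forall>p\<ge>1. \<forall>\<sigma>. \<sigma> permutes {..<p} \<longrightarrow>
        (\<forall>t\<in>tpow s p. tperm s G \<sigma> (br p (tperm s G (inv \<sigma>) t)) = tscale (of_int (sign \<sigma>)) (br p t))) \<and>
     (\<forall>p\<ge>1. \<forall>ds as d a d' b. length as = p - 1 \<and> homs G ds as \<and> a \<in> G d \<and> b \<in> G d' \<longrightarrow>
        br p (tens s (as @ [a * b])) =
          rmul s (br p (tens s (as @ [a]))) b +
          tscale ((-1) powi (d * (int p + sum_list ds))) (lmul s a (br p (tens s (as @ [b]))))) \<and>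
     (\<forall>p\<ge>1. \<forall>t\<in>tpow s p.
        (\<Sum>i = 1..p. tscale ((-1) powi (int i * (int p + 1)))
           (\<Sum>\<sigma>\<in>cyclic_perms p. tscale (of_int (sign \<sigma>))
              (tperm s G \<sigma> (bracket_comp s G br i (p - i + 1) (tperm s G (inv \<sigma>) t))))) = 0)"


section \<open>A-infinity algebras\<close>

text \<open>
  Structures on a graded subspace \<open>C\<close> of an ambient space, with homogeneous components
  \<open>G n \<subseteq> C\<close>. The map \<open>m\<^sub>n\<close> is given by the multilinear map \<open>m n\<close> on lists of length \<open>n\<close>
  over \<open>C\<close>, extended by \<open>0\<close> to all other lists, so that a structure is determined by its maps.
\<close>

definition A_infinity ::
  "('k::field \<Rightarrow> 'v::ab_group_add \<Rightarrow> 'v) \<Rightarrow> (int \<Rightarrow> 'v set) \<Rightarrow> 'v set \<Rightarrow> (nat \<Rightarrow> 'v list \<Rightarrow> 'v) \<Rightarrow> bool" where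
  "A_infinity s G C m \<longleftrightarrow>
     (\<forall>n xs. \<not> (n \<ge> 1 \<and> length xs = n \<and> set xs \<subseteq> C) \<longrightarrow> m n xs = 0) \<and>
     (\<forall>n\<ge>1. multilin s s C n (m n)) \<and>
     (\<forall>n\<ge>1. \<forall>ds xs. length xs = n \<and> homs G ds xs \<longrightarrow> m n xs \<in> G (sum_list ds + 2 - int n)) \<and>
     (\<forall>n\<ge>1. \<forall>ds xs. length xs = n \<and> homs G ds xs \<longrightarrow>
        (\<Sum>(r, q, t)\<in>{(r, q, t). r + q + t = n \<and> q \<ge> 1}.
           s ((-1) powi (int r + int q * int t + (2 - int q) * sum_list (take r ds)))
             (m (r + 1 + t) (take r xs @ [m q (take q (drop r xs))] @ drop (r + q) xs))) = 0)"

definition essentially_odd :: "(nat \<Rightarrow> 'v::zero list \<Rightarrow> 'v) \<Rightarrow> bool" where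
  "essentially_odd m \<longleftrightarrow> (\<forall>i>1. \<forall>xs. m (2 * i) xs = 0)"

definition nondegenerate_form ::
  "('k::field \<Rightarrow> 'v::ab_group_add \<Rightarrow> 'v) \<Rightarrow> (int \<Rightarrow> 'v set) \<Rightarrow> 'v set \<Rightarrow> int \<Rightarrow> ('v \<Rightarrow> 'v \<Rightarrow> 'k) \<Rightarrow> bool" where
  "nondegenerate_form s G C e \<gamma> \<longleftrightarrow>
     (\<forall>c. \<forall>x\<in>C. \<forall>y\<in>C. \<forall>z\<in>C. \<gamma> (s c x + y) z = c * \<gamma> x z + \<gamma> y z \<and> \<gamma> z (s c x + y) = c * \<gamma> z x + \<gamma> z y) \<and>
     (\<forall>i j. \<forall>x\<in>G i. \<forall>y\<in>G j. i + j + e \<noteq> 0 \<longrightarrow> \<gamma> x y = 0) \<and>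
     (\<forall>x\<in>C. x \<noteq> 0 \<longrightarrow> (\<exists>y\<in>C. \<gamma> x y \<noteq> 0)) \<and>
     (\<forall>y\<in>C. y \<noteq> 0 \<longrightarrow> (\<exists>x\<in>C. \<gamma> x y \<noteq> 0))"

definition cyclic_form ::
  "('k::field \<Rightarrow> 'v::ab_group_add \<Rightarrow> 'v) \<Rightarrow> (int \<Rightarrow> 'v set) \<Rightarrow> 'v set \<Rightarrow> int \<Rightarrow> ('v \<Rightarrow> 'v \<Rightarrow> 'k) \<Rightarrow>
   (nat \<Rightarrow> 'v list \<Rightarrow> 'v) \<Rightarrow> bool" where
  "cyclic_form s G C e \<gamma> m \<longleftrightarrow>
     nondegenerate_form s G C e \<gamma> \<and>
     (\<forall>i j. \<forall>x\<in>G i. \<forall>y\<in>G j. (-1) powi (i * j) * \<gamma> y x = \<gamma> x y) \<and>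
     (\<forall>n\<ge>1. \<forall>d\<^sub>0 a\<^sub>0 ds as. length as = n \<and> a\<^sub>0 \<in> G d\<^sub>0 \<and> homs G ds as \<longrightarrow>
        \<gamma> (m n as) a\<^sub>0 =
          (-1) powi (int n + d\<^sub>0 * sum_list ds) * \<gamma> (m n (a\<^sub>0 # butlast as)) (last as))"

text \<open>The list \<open>a\<^sub>1, b\<^sub>1, \<dots>, a\<^sub>n, b\<^sub>n\<close>.\<close>

definition interleave :: "'v list \<Rightarrow> 'v list \<Rightarrow> 'v list" where
  "interleave as bs = concat (map2 (\<lambda>a b. [a, b]) as bs)"

definition theta :: "(nat \<Rightarrow> nat) \<Rightarrow> nat \<Rightarrow> nat" where
  "theta \<sigma> k = 2 * \<sigma> (k div 2) + k mod 2"

text \<open>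
  The ultracyclicity identity for homogeneous \<open>a\<^sub>i \<in> X\<close> and \<open>b\<^sub>i \<in> Y\<close>. Ultracyclicity
  of an essentially odd cyclic structure on \<open>C\<close> is the case \<open>X = Y = C\<close>.
\<close>

definition ultracyclic_on ::
  "(int \<Rightarrow> 'v::ab_group_add set) \<Rightarrow> 'v set \<Rightarrow> 'v set \<Rightarrow> ('v \<Rightarrow> 'v \<Rightarrow> 'k::field) \<Rightarrow> (nat \<Rightarrow> 'v list \<Rightarrow> 'v) \<Rightarrow> bool" where
  "ultracyclic_on G X Y \<gamma> m \<longleftrightarrow>
     (\<forall>n\<ge>1. \<forall>\<sigma> ds as es bs.
        \<sigma> permutes {..<n} \<and> length as = n \<and> length bs = n \<and> homs G ds as \<and> homs G es bs \<and>
        set as \<subseteq> X \<and> set bs \<subseteq> Y \<longrightarrow>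
        (let as' = permute_list \<sigma> as; bs' = permute_list \<sigma> bs in
          \<gamma> (m (2 * n - 1) (butlast (interleave as' bs'))) (last bs') =
            (-1) powi koszul (theta (inv \<sigma>)) (interleave ds es) *
            \<gamma> (m (2 * n - 1) (butlast (interleave as bs))) (last bs)))"

lemma ultracyclic_on_mono:
  "ultracyclic_on G X Y \<gamma> m \<Longrightarrow> X' \<subseteq> X \<Longrightarrow> Y' \<subseteq> Y \<Longrightarrow> ultracyclic_on G X' Y' \<gamma> m"
  unfolding ultracyclic_on_def
  apply (intro allI impI)
  subgoal for n \<sigma> ds as es bs
    by (erule allE[of _ n], erule impE, assumption, erule allE[of _ \<sigma>], erule allE[of _ ds],
        erule allE[of _ as], erule allE[of _ es], erule allE[of _ bs]) (blast intro: subset_trans)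
  done


section \<open>The square-zero extension by the shifted graded dual\<close>

text \<open>\<open>dual_deg s G n\<close>: functionals of degree \<open>n\<close>. They map \<open>G m\<close> to degree \<open>m + n\<close> of the field.\<close>

definition dual_deg :: "('k::field \<Rightarrow> 'a::ab_group_add \<Rightarrow> 'a) \<Rightarrow> (int \<Rightarrow> 'a set) \<Rightarrow> int \<Rightarrow> ('a \<Rightarrow> 'k) set" where
  "dual_deg s G n = {f. Vector_Spaces.linear s (*) f \<and> (\<forall>m. m + n \<noteq> 0 \<longrightarrow> (\<forall>a\<in>G m. f a = 0))}"

definition gdual :: "('k::field \<Rightarrow> 'a::ab_group_add \<Rightarrow> 'a) \<Rightarrow> (int \<Rightarrow> 'a set) \<Rightarrow> ('a \<Rightarrow> 'k) set" where
  "gdual s G = module.span (\<lambda>c f x. c * f x) (\<Union>n. dual_deg s G n)"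

text \<open>An element \<open>(a, f)\<close> stands for \<open>a + t f\<close>, where \<open>\<bar>t f\<bar> = \<bar>f\<bar> + 1\<close>.\<close>

definition ext_scale ::
  "('k::field \<Rightarrow> 'a \<Rightarrow> 'a) \<Rightarrow> 'k \<Rightarrow> 'a \<times> ('a \<Rightarrow> 'k) \<Rightarrow> 'a \<times> ('a \<Rightarrow> 'k)" where
  "ext_scale s c = (\<lambda>(a, f). (s c a, \<lambda>x. c * f x))"

definition ext_space ::
  "('k::field \<Rightarrow> 'a::ab_group_add \<Rightarrow> 'a) \<Rightarrow> (int \<Rightarrow> 'a set) \<Rightarrow> ('a \<times> ('a \<Rightarrow> 'k)) set" where
  "ext_space s G = UNIV \<times> gdual s G"

definition ext_deg ::
  "('k::field \<Rightarrow> 'a::ab_group_add \<Rightarrow> 'a) \<Rightarrow> (int \<Rightarrow> 'a set) \<Rightarrow> int \<Rightarrow> ('a \<times> ('a \<Rightarrow> 'k)) set" where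
  "ext_deg s G n = G n \<times> dual_deg s G (n - 1)"

definition base_part :: "('a \<times> ('a \<Rightarrow> 'k::zero)) set" where
  "base_part = UNIV \<times> {0}"

definition dual_part ::
  "('k::field \<Rightarrow> 'a::ab_group_add \<Rightarrow> 'a) \<Rightarrow> (int \<Rightarrow> 'a set) \<Rightarrow> ('a \<times> ('a \<Rightarrow> 'k)) set" where
  "dual_part s G = {0} \<times> gdual s G"

text \<open>
  The form \<open>\<gamma>(t f, a) = (-1)\<^bsup>\<bar>a\<bar>\<bar>t f\<bar>\<^esup> \<gamma>(a, t f) = f a\<close>. As \<open>f a \<noteq> 0\<close> forces
  \<open>\<bar>t f\<bar> = 1 - \<bar>a\<bar>\<close>, the sign is \<open>1\<close> wherever it matters.
\<close>

definition nat_form :: "'a \<times> ('a \<Rightarrow> 'k::field) \<Rightarrow> 'a \<times> ('a \<Rightarrow> 'k) \<Rightarrow> 'k" where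
  "nat_form = (\<lambda>(a, f) (b, g). f b + g a)"

lemma nat_form_sign:
  assumes "a \<in> G i" "f \<in> dual_deg s G j"
  shows "nat_form (0, f) (a, 0) = f a"
    and "(-1) powi (i * (j + 1)) * nat_form (a, 0) (0, f) = f a"
proof -
  have "even (i * (j + 1))" if "f a \<noteq> 0"
  proof -
    have "i + j = 0" using assms that by (auto simp: dual_deg_def)
    then show ?thesis by presburger
  qed
  then show "(-1) powi (i * (j + 1)) * nat_form (a, 0) (0, f) = f a"
    by (cases "f a = 0") (auto simp: nat_form_def power_int_minus_left)
qed (simp add: nat_form_def)


section \<open>Pre-Calabi-Yau structures\<close>

definition pre_CY ::
  "('k::field \<Rightarrow> 'a::ring \<Rightarrow> 'a) \<Rightarrow> (int \<Rightarrow> 'a set) \<Rightarrow> (nat \<Rightarrow> ('a \<times> ('a \<Rightarrow> 'k)) list \<Rightarrow> 'a \<times> ('a \<Rightarrow> 'k)) \<Rightarrow> bool"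
  where
  "pre_CY s G m \<longleftrightarrow>
     A_infinity (ext_scale s) (ext_deg s G) (ext_space s G) m \<and>
     cyclic_form (ext_scale s) (ext_deg s G) (ext_space s G) (-1) nat_form m \<and>
     (\<forall>n\<ge>1. \<forall>xs. length xs = n \<and> set xs \<subseteq> base_part \<longrightarrow> m n xs \<in> base_part)"

text \<open>
  The square-zero product \<open>(a, t f)(a', t f') = (a a', t f \<cdot> a' + a \<cdot> t f')\<close> on homogeneous
  elements, the functional being evaluated at a homogeneous \<open>c\<close>: \<open>(t f \<cdot> a')(c) = f (a' c)\<close> and
  \<open>(a \<cdot> t f')(c) = (-1)\<^bsup>\<bar>a\<bar>\<^esup> (-1)\<^bsup>\<bar>a\<bar>(\<bar>f'\<bar> + \<bar>c\<bar>)\<^esup> f' (c a)\<close>.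
\<close>

definition manageable ::
  "('k::field \<Rightarrow> 'a::ring \<Rightarrow> 'a) \<Rightarrow> (int \<Rightarrow> 'a set) \<Rightarrow> (nat \<Rightarrow> ('a \<times> ('a \<Rightarrow> 'k)) list \<Rightarrow> 'a \<times> ('a \<Rightarrow> 'k)) \<Rightarrow> bool"
  where
  "manageable s G m \<longleftrightarrow>
     (\<forall>d e d' e'. \<forall>a\<in>G d. \<forall>f\<in>dual_deg s G e. \<forall>a'\<in>G d'. \<forall>f'\<in>dual_deg s G e'.
        fst (m 2 [(a, f), (a', f')]) = a * a' \<and>
        (\<forall>k. \<forall>c\<in>G k. snd (m 2 [(a, f), (a', f')]) c =
           f (a' * c) + (-1) powi d * (-1) powi (d * (e' + k)) * f' (c * a)))"

text \<open>
  The ultracyclicity identity is imposed for \<open>a\<^sub>i\<close> in the algebra and \<open>b\<^sub>i\<close> in the shifted dual.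
  Imposing it with the two roles exchanged as well would, from arity three on, force symmetries
  of the associated brackets beyond the skew-symmetry of a double P-infinity algebra.
\<close>

definition special ::
  "('k::field \<Rightarrow> 'a::ring \<Rightarrow> 'a) \<Rightarrow> (int \<Rightarrow> 'a set) \<Rightarrow> (nat \<Rightarrow> ('a \<times> ('a \<Rightarrow> 'k)) list \<Rightarrow> 'a \<times> ('a \<Rightarrow> 'k)) \<Rightarrow> bool"
  where
  "special s G m \<longleftrightarrow> essentially_odd m \<and>
     ultracyclic_on (ext_deg s G) base_part (dual_part s G) nat_form m"

lemma zero_in_gdual: "0 \<in> gdual (s :: 'k::field \<Rightarrow> 'a::ring \<Rightarrow> 'a) G"
proof -
  interpret D: module "\<lambda>c (f :: 'a \<Rightarrow> 'k) x. c * f x"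
    by unfold_locales (auto simp: fun_eq_iff algebra_simps)
  show ?thesis unfolding gdual_def by (rule D.span_zero)
qed

lemma special_if_ultracyclic:
  assumes "essentially_odd m" "ultracyclic_on (ext_deg s G) (ext_space s G) (ext_space s G) nat_form m"
  shows "special s G m"
  unfolding special_def using assms(1)
  by (auto intro!: ultracyclic_on_mono[OF assms(2)]
      simp: base_part_def dual_part_def ext_space_def zero_in_gdual)

definition good ::
  "('k::field \<Rightarrow> 'a::ring \<Rightarrow> 'a) \<Rightarrow> (int \<Rightarrow> 'a set) \<Rightarrow> (nat \<Rightarrow> ('a \<times> ('a \<Rightarrow> 'k)) list \<Rightarrow> 'a \<times> ('a \<Rightarrow> 'k)) \<Rightarrow> bool"
  where
  "good s G m \<longleftrightarrow> essentially_odd m \<and>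
     (let B = (\<lambda>i. if i then dual_part s G else base_part) in
      \<forall>n is xs. odd n \<and> length is = n \<and> list_all2 (\<lambda>i x. x \<in> B i) is xs \<longrightarrow>
        (if \<forall>j. Suc j < n \<longrightarrow> is ! j \<noteq> is ! Suc j then m n xs \<in> B (hd is) else m n xs = 0))"

definition good_manageable_special_pre_CY ::
  "('k::field \<Rightarrow> 'a::ring \<Rightarrow> 'a) \<Rightarrow> (int \<Rightarrow> 'a set) \<Rightarrow>
   (nat \<Rightarrow> ('a \<times> ('a \<Rightarrow> 'k)) list \<Rightarrow> 'a \<times> ('a \<Rightarrow> 'k)) set" where
  "good_manageable_special_pre_CY s G = {m. pre_CY s G m \<and> manageable s G m \<and> special s G m \<and> good s G m}"


section \<open>The brackets of a pre-Calabi-Yau structure\<close>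

text \<open>The exponent of the sign, for \<open>a\<^sub>j\<close> and \<open>f\<^sub>j\<close> of degrees \<open>ds ! (j - 1)\<close> and \<open>es ! (j - 1)\<close>.\<close>

definition bracket_sign :: "nat \<Rightarrow> int list \<Rightarrow> int list \<Rightarrow> int" where
  "bracket_sign p ds es =
     (let a = (\<lambda>j. ds ! (j - 1)); f = (\<lambda>j. es ! (j - 1)) in
       a p * f 1 + (int p + 1) * (a p + f 1) +
       (\<Sum>j = 1..p. (int p - int j) * a j) + (\<Sum>j = 1..p. (int j - 1) * f j) +
       (\<Sum>(i, j)\<in>{(i, j). 1 \<le> i \<and> i < j \<and> j < p}. a i * a j) +
       (\<Sum>(i, j)\<in>{(i, j). 1 < i \<and> i < j \<and> j \<le> p}. f i * f j) +
       (\<Sum>(i, j)\<in>{(i, j). 1 < i \<and> i \<le> j \<and> j < p}. f i * a j))"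

text \<open>The list \<open>a\<^sub>p, t f\<^sub>p, \<dots>, a\<^sub>2, t f\<^sub>2, a\<^sub>1\<close>.\<close>

definition bracket_args :: "'a::zero list \<Rightarrow> ('a \<Rightarrow> 'k::zero) list \<Rightarrow> ('a \<times> ('a \<Rightarrow> 'k)) list" where
  "bracket_args as fs =
     concat (map (\<lambda>i. [(as ! i, 0), (0, fs ! i)]) (rev [1..<length as])) @ [(as ! 0, 0)]"

definition brackets_of ::
  "('k::field \<Rightarrow> 'a::ring \<Rightarrow> 'a) \<Rightarrow> (int \<Rightarrow> 'a set) \<Rightarrow> (nat \<Rightarrow> ('a \<times> ('a \<Rightarrow> 'k)) list \<Rightarrow> 'a \<times> ('a \<Rightarrow> 'k)) \<Rightarrow>
   (nat \<Rightarrow> ('k, 'a) tensor \<Rightarrow> ('k, 'a) tensor) \<Rightarrow> bool" where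
  "brackets_of s G m br \<longleftrightarrow>
     bracket_family s br \<and>
     (\<forall>p\<ge>1. \<forall>ds as es fs.
        length as = p \<and> homs G ds as \<and> length fs = p \<and> homs (dual_deg s G) es fs \<longrightarrow>
        tpair G es fs (br p (tens s as)) =
          (-1) powi bracket_sign p ds es * nat_form (m (2 * p - 1) (bracket_args as fs)) (0, fs ! 0))"

definition bracket_map ::
  "('k::field \<Rightarrow> 'a::ring \<Rightarrow> 'a) \<Rightarrow> (int \<Rightarrow> 'a set) \<Rightarrow> (nat \<Rightarrow> ('a \<times> ('a \<Rightarrow> 'k)) list \<Rightarrow> 'a \<times> ('a \<Rightarrow> 'k)) \<Rightarrow>
   (nat \<Rightarrow> ('k, 'a) tensor \<Rightarrow> ('k, 'a) tensor)" where
  "bracket_map s G m = (THE br. brackets_of s G m br)"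

text \<open>
  Every homogeneous component of every tensor power of the algebra is a finite sum of products
  of homogeneous components. This holds for instance when the grading is bounded on one side. Without
  such a condition the right-hand side of the formula defining the brackets may only
  define an element of a completion of the tensor power.
\<close>

definition finite_splittings :: "(int \<Rightarrow> 'a::zero set) \<Rightarrow> bool" where
  "finite_splittings G \<longleftrightarrow>
     (\<forall>p n. finite {ds. length ds = p \<and> sum_list ds = n \<and> (\<forall>d\<in>set ds. G d \<noteq> {0})})"

end

theory Submission
  imports Defs
begin

text \<open>
  Cyclicity encodes the maps \<open>m\<^sub>n\<close> by the scalars \<open>W(w) = \<gamma>(m(w\<^sub>1, \<dots>, w\<^sub>n), w\<^sub>n\<^sub>+\<^sub>1)\<close>, which change only by
  a sign under rotation of \<open>w\<close>. A good structure is supported on alternating words, so up to rotation on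
  the words \<open>a\<^sub>p, t f\<^sub>p, \<dots>, a\<^sub>1, t f\<^sub>1\<close>, where \<open>W\<close> is, up to sign, the evaluation of \<open>f\<^sub>1 \<otimes> \<dots> \<otimes> f\<^sub>p\<close> at the bracket of
  \<open>a\<^sub>1, \<dots>, a\<^sub>p\<close>. As tensors are separated by such evaluations, each axiom becomes an identity between
  values of \<open>W\<close>: skew-symmetry is ultracyclicity, the Leibniz rule is the Stasheff identity with an even
  number of inputs (only \<open>m\<^sub>2\<close> and one odd map are involved) and the Jacobi identity is the one with an odd number
  of inputs. Both sides of the Jacobi correspondence are sums over the ways to cut a cyclic word in two odd arcs, and
  the Stasheff sum meets each cut once.

  In the converse direction \<open>W\<close> is defined from the brackets on these words, extended to all words by rotation and by
  zero, and \<open>m\<^sub>n\<close> is recovered since \<open>\<gamma>\<close> is nondegenerate; the value in \<open>A\<close> exists because contracting a tensor of \<open>A \<otimes> \<dots> \<otimes> A\<close>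
  with \<open>p - 1\<close> functionals yields a vector of \<open>A\<close>. For the existence of the brackets, when only finitely many degree
  splittings occur, a multilinear form on functionals that is represented by a vector in every slot comes from a tensor.
\<close>

section \<open>Graded spaces and their duals\<close>

text \<open>All signs are compared by one mechanism: a form value can be nonzero only if its degrees
  have a prescribed sum (\<open>p - 2\<close> for p vectors and p functionals, \<open>p - 3\<close>
  for a composite of two brackets), so two exponents need to agree only modulo 2 and only under this
  constraint. In the Jacobi sums the p pairs of a vector and a shifted functional then have the odd
  total degree \<open>2p - 3\<close>, which is why rotations carry no sign there. A Stasheff
  identity with an even number of inputs lives on a cyclic word of odd length, so two neighbours
  have equal type; only the three products that touch one of these two letters can be nonzero, and
  they are the three terms of the Leibniz rule. The homogeneous pieces may be infinite-dimensional,
  so the existence of a bracket cannot be read off from a dual basis: the finiteness has to be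
  extracted from the mere fact that every slot is represented by a vector, uniformly in the other
  slots.\<close>

abbreviation sg :: "int \<Rightarrow> 'k::field" where "sg i \<equiv> (-1) powi i"

lemma sg_if: "(sg i :: 'k::field) = (if even i then 1 else -1)"
  by (simp add: power_int_minus_left)

lemma sg_add: "(sg (i + j) :: 'k::field) = sg i * sg j"
  by (simp add: sg_if)

lemma sg_cong: "even (i + j) \<Longrightarrow> (sg i :: 'k::field) = sg j"
  by (auto simp: sg_if)

lemma sg_sq: "(sg i :: 'k::field) * sg i = 1"
  by (simp add: sg_if)

lemma sg_neq: "(sg i :: 'k::field) \<noteq> 0"
  by (simp add: sg_if)

lemma sum_fun_app: "(\<Sum>i\<in>S. f i) x = (\<Sum>i\<in>S. f i x)" for f :: "'i \<Rightarrow> 'b \<Rightarrow> 'c::comm_monoid_add"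
  by (induction S rule: infinite_finite_induct) auto

text \<open>The definition of the graded dual writes this scaling as a lambda term; as a constant it
  can carry the vector space instance \<open>fsp\<close> (see \<open>fscale_eq\<close>).\<close>

definition fscale :: "'k::field \<Rightarrow> ('b \<Rightarrow> 'k) \<Rightarrow> 'b \<Rightarrow> 'k" where
  "fscale c f = (\<lambda>x. c * f x)"

interpretation fsp: vector_space fscale
  by unfold_locales (auto simp: fscale_def fun_eq_iff algebra_simps)

lemma fscale_eq: "(\<lambda>c f x. c * f x) = fscale"
  by (simp add: fun_eq_iff fscale_def)

interpretation tsp: vector_space tscale
  by unfold_locales (auto simp: tscale_def fun_eq_iff algebra_simps)

locale graded_alg =
  fixes s :: "'k::field_char_0 \<Rightarrow> 'a::ring \<Rightarrow> 'a" and G :: "int \<Rightarrow> 'a set"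
  assumes graded: "graded_algebra s G"

sublocale graded_alg \<subseteq> vector_space s
  using graded by (simp add: graded_algebra_def graded_vs_def)

context graded_alg begin

lemma G_subspace: "subspace (G n)"
  using graded by (simp add: graded_algebra_def graded_vs_def)

lemma G_zero: "0 \<in> G n" and G_add: "x \<in> G n \<Longrightarrow> y \<in> G n \<Longrightarrow> x + y \<in> G n"
  and G_scale: "x \<in> G n \<Longrightarrow> s c x \<in> G n"
  using G_subspace by (auto simp: subspace_def)

lemma scale_mult_left: "s c a * b = s c (a * b)" and scale_mult_right: "a * s c b = s c (a * b)"
  using graded unfolding graded_algebra_def by metis+

lemma G_mult: "a \<in> G i \<Longrightarrow> b \<in> G j \<Longrightarrow> a * b \<in> G (i + j)"
  using graded by (auto simp: graded_algebra_def)

abbreviation hc :: "'a \<Rightarrow> int \<Rightarrow> 'a" where "hc \<equiv> hcomp G"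

lemma hc_ex1: "\<exists>!c. (\<forall>n. c n \<in> G n) \<and> finite {n. c n \<noteq> 0} \<and> v = (\<Sum>n\<in>{n. c n \<noteq> 0}. c n)"
  using graded by (simp add: graded_algebra_def graded_vs_def)

lemma hc_props: "hc v n \<in> G n" "finite {n. hc v n \<noteq> 0}" "v = (\<Sum>n\<in>{n. hc v n \<noteq> 0}. hc v n)"
  using theI'[OF hc_ex1[of v]] unfolding hcomp_def by blast+

lemma hc_sum_superset: "finite N \<Longrightarrow> {n. hc v n \<noteq> 0} \<subseteq> N \<Longrightarrow> (\<Sum>n\<in>N. hc v n) = v"
  by (subst (2) hc_props(3)[of v]) (rule sum.mono_neutral_right, auto)

text \<open>\<open>hcomp\<close> is a definite description over finitely supported decompositions.
  Admitting any finite \<open>N\<close> that contains the support spares its exact computation, for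
  instance for sums in which terms may cancel.\<close>

lemma hc_eqI:
  assumes "\<And>n. c n \<in> G n" "finite N" "\<And>n. n \<notin> N \<Longrightarrow> c n = 0" "v = (\<Sum>n\<in>N. c n)"
  shows "hc v = c"
proof -
  have sub: "{n. c n \<noteq> 0} \<subseteq> N" using assms(3) by auto
  have "finite {n. c n \<noteq> 0}" using sub assms(2) finite_subset by blast
  moreover have "v = (\<Sum>n\<in>{n. c n \<noteq> 0}. c n)"
    unfolding assms(4) by (rule sum.mono_neutral_right) (use sub assms(2) in auto)
  ultimately show ?thesis
    unfolding hcomp_def using assms(1) by (intro the1_equality[OF hc_ex1]) auto
qed

lemma hc_linear: "hc (s c x + y) n = s c (hc x n) + hc y n"
proof -
  let ?N = "{n. hc x n \<noteq> 0} \<union> {n. hc y n \<noteq> 0}"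
  have "hc (s c x + y) = (\<lambda>n. s c (hc x n) + hc y n)"
  proof (rule hc_eqI[where N="?N"])
    show "s c x + y = (\<Sum>n\<in>?N. s c (hc x n) + hc y n)"
      by (simp add: sum.distrib scale_sum_right[symmetric] hc_sum_superset hc_props(2))
  qed (auto simp: hc_props G_add G_scale)
  then show ?thesis by simp
qed

lemma hc_hom: "v \<in> G d \<Longrightarrow> hc v n = (if n = d then v else 0)"
  by (subst hc_eqI[where N="{d}" and c="\<lambda>n. if n = d then v else 0"]) (auto simp: G_zero)

lemma hc_zero [simp]: "hc 0 n = 0"
  by (simp add: hc_hom[OF G_zero[of n]])

text \<open>An equational form of linearity for rewriting; \<open>linear_iff_linf\<close> connects
  it with the locale predicate in the definition of the dual.\<close>

definition linf :: "('a \<Rightarrow> 'k) \<Rightarrow> bool" where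
  "linf f \<longleftrightarrow> (\<forall>c x y. f (s c x + y) = c * f x + f y)"

lemma linfD: "linf f \<Longrightarrow> f (s c x + y) = c * f x + f y"
  by (simp add: linf_def)

lemma linf_zero: "linf f \<Longrightarrow> f 0 = 0"
  using linfD[of f 1 0 0] by simp

lemma linf_add: "linf f \<Longrightarrow> f (x + y) = f x + f y"
  using linfD[of f 1 x y] by simp

lemma linf_scale: "linf f \<Longrightarrow> f (s c x) = c * f x"
  using linfD[of f c x 0] by (simp add: linf_zero)

lemma linf_sum: "linf f \<Longrightarrow> f (\<Sum>i\<in>S. g i) = (\<Sum>i\<in>S. f (g i))"
  by (induction S rule: infinite_finite_induct) (auto simp: linf_zero linf_add)

lemma linear_iff_linf: "Vector_Spaces.linear s (*) f \<longleftrightarrow> linf f"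
proof
  assume "Vector_Spaces.linear s (*) f"
  then interpret F: Vector_Spaces.linear s "(*)" f .
  show "linf f" by (simp add: linf_def F.add F.scale)
next
  assume "linf f"
  have "vector_space ((*) :: 'k \<Rightarrow> 'k \<Rightarrow> 'k)" by unfold_locales (auto simp: algebra_simps)
  then show "Vector_Spaces.linear s (*) f"
    unfolding Vector_Spaces.linear_def module_hom_def module_hom_axioms_def
    by (simp add: vector_space_axioms module_axioms linf_add linf_scale \<open>linf f\<close> module_iff_vector_space)
qed

abbreviation dual :: "int \<Rightarrow> ('a \<Rightarrow> 'k) set" where "dual \<equiv> dual_deg s G"

lemma dual_iff: "f \<in> dual n \<longleftrightarrow> linf f \<and> (\<forall>m a. m + n \<noteq> 0 \<longrightarrow> a \<in> G m \<longrightarrow> f a = 0)"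
  by (auto simp: dual_deg_def linear_iff_linf)

lemma dual_linf: "f \<in> dual n \<Longrightarrow> linf f"
  and dual_vanish: "f \<in> dual n \<Longrightarrow> a \<in> G m \<Longrightarrow> m + n \<noteq> 0 \<Longrightarrow> f a = 0"
  by (auto simp: dual_iff)

text \<open>Only the component of degree -n survives a functional of degree n. Inserting -n in the
  index set covers the case that this component is zero.\<close>

lemma dual_hc: assumes "f \<in> dual n" shows "f (hc a (-n)) = f a"
proof -
  let ?N = "insert (-n) {m. hc a m \<noteq> 0}"
  have "f a = f (\<Sum>m\<in>?N. hc a m)"
    by (subst hc_sum_superset) (auto simp: hc_props)
  also have "\<dots> = (\<Sum>m\<in>?N. f (hc a m))"
    using assms by (simp add: linf_sum dual_linf)
  also have "\<dots> = (\<Sum>m\<in>{-n}. f (hc a m))"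
    by (rule sum.mono_neutral_right)
      (use assms hc_props in \<open>auto intro!: dual_vanish[of f n] simp: eq_neg_iff_add_eq_0\<close>)
  finally show ?thesis by simp
qed

lemma linf_comb: "linf f \<Longrightarrow> linf g \<Longrightarrow> linf (fscale c f + g)"
  by (simp add: linf_def fscale_def algebra_simps)

lemma dual_zero: "0 \<in> dual n" and dual_comb: "f \<in> dual n \<Longrightarrow> g \<in> dual n \<Longrightarrow> fscale c f + g \<in> dual n"
  by (simp_all add: dual_iff linf_comb) (auto simp: linf_def fscale_def)

lemma dual_subspace: "fsp.subspace (dual n)"
  unfolding fsp.subspace_def using dual_comb[of _ n _ 1] dual_comb[of _ n 0] dual_zero by auto

lemma gdual_span: "gdual s G = fsp.span (\<Union>n. dual n)"
  by (simp add: gdual_def fscale_eq)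

lemma gdual_subspace: "fsp.subspace (gdual s G)"
  unfolding gdual_span by (rule fsp.subspace_span)

lemma dual_gdual: "f \<in> dual n \<Longrightarrow> f \<in> gdual s G"
  unfolding gdual_span by (rule fsp.span_base) auto

lemma gdual_linf: assumes "f \<in> gdual s G" shows "linf f"
proof -
  have "fsp.subspace {f. linf f}"
    unfolding fsp.subspace_def using linf_comb[of _ _ 1] linf_comb[of _ 0] by (auto simp: linf_def fscale_def algebra_simps)
  then have "fsp.span (\<Union>n. dual n) \<subseteq> {f. linf f}"
    by (intro fsp.span_minimal) (auto simp: dual_linf)
  then show ?thesis using assms by (auto simp: gdual_span)
qed

section \<open>Homogeneous bases and coordinate functionals\<close>

definition Bs :: "int \<Rightarrow> 'a set" where
  "Bs n = (SOME B. B \<subseteq> G n \<and> independent B \<and> G n \<subseteq> span B)"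

lemma Bs: "Bs n \<subseteq> G n" "independent (Bs n)" "G n \<subseteq> span (Bs n)"
proof -
  have "\<exists>B. B \<subseteq> G n \<and> independent B \<and> G n \<subseteq> span B"
    using basis_exists[of "G n"] by metis
  from someI_ex[OF this] show "Bs n \<subseteq> G n" "independent (Bs n)" "G n \<subseteq> span (Bs n)"
    unfolding Bs_def by auto
qed

text \<open>Coordinates in a basis composed of bases of the homogeneous pieces. An index is any pair
  of a degree and a vector; if the vector is not in the chosen basis, the functional is
  zero.\<close>

definition co :: "int \<times> 'a \<Rightarrow> 'a \<Rightarrow> 'k" where
  "co i v = representation (Bs (fst i)) (hc v (fst i)) (snd i)"

lemma hc_span: "hc v n \<in> span (Bs n)"
  using Bs(3) hc_props(1) by blast

lemma co_dual: "co (n, b) \<in> dual (-n)"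
proof -
  have "linf (co (n, b))"
    unfolding linf_def co_def
    by (simp add: hc_linear representation_add representation_scale Bs hc_span span_scale)
  then show ?thesis
    by (auto simp: dual_iff co_def hc_hom representation_zero)
qed

lemma co_nz: "co i v \<noteq> 0 \<Longrightarrow> snd i \<in> Bs (fst i)"
  unfolding co_def by (rule representation_ne_zero)

lemma co_nz_G: "co i v \<noteq> 0 \<Longrightarrow> snd i \<in> G (fst i)"
  using co_nz Bs(1) by blast

lemma co_supp: "{i. co i v \<noteq> 0} \<subseteq> (SIGMA n:{n. hc v n \<noteq> 0}. {b. representation (Bs n) (hc v n) b \<noteq> 0})"
  by (auto simp: co_def representation_zero)

lemma co_fin: "finite {i. co i v \<noteq> 0}"
  by (rule finite_subset[OF co_supp]) (auto simp: hc_props finite_representation)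

lemma co_sum: assumes "finite S" "{i. co i v \<noteq> 0} \<subseteq> S"
  shows "(\<Sum>i\<in>S. s (co i v) (snd i)) = v"
proof -
  let ?R = "SIGMA n:{n. hc v n \<noteq> 0}. {b. representation (Bs n) (hc v n) b \<noteq> 0}"
  have "(\<Sum>i\<in>S. s (co i v) (snd i)) = (\<Sum>i\<in>{i. co i v \<noteq> 0}. s (co i v) (snd i))"
    using assms by (intro sum.mono_neutral_right) auto
  also have "\<dots> = (\<Sum>i\<in>?R. s (co i v) (snd i))"
    using co_supp by (intro sum.mono_neutral_left) (auto simp: hc_props finite_representation)
  also have "\<dots> = (\<Sum>n\<in>{n. hc v n \<noteq> 0}. \<Sum>b\<in>{b. representation (Bs n) (hc v n) b \<noteq> 0}. s (representation (Bs n) (hc v n) b) b)"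
    by (subst sum.Sigma) (auto simp: hc_props finite_representation co_def intro!: sum.cong)
  also have "\<dots> = (\<Sum>n\<in>{n. hc v n \<noteq> 0}. hc v n)"
    by (intro sum.cong refl sum_nonzero_representation_eq Bs hc_span)
  finally show ?thesis using hc_props(3)[of v] by simp
qed

text \<open>Coordinate functionals are homogeneous; when all of them vanish at a, the empty index
  set is admissible in the basis expansion \<open>co_sum\<close>.\<close>

lemma dual_separates: "(\<And>n f. f \<in> dual n \<Longrightarrow> f a = 0) \<Longrightarrow> a = 0"
  using co_sum[of "{}" a] co_dual by fastforce

lemma dual_detects_degree:
  assumes "\<And>e f. f \<in> dual e \<Longrightarrow> e \<noteq> - n \<Longrightarrow> f a = 0" shows "a \<in> G n"
proof -
  have "hc a m = 0" if "m \<noteq> n" for m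
  proof (rule dual_separates)
    fix e f assume f: "f \<in> dual e"
    show "f (hc a m) = 0"
    proof (cases "m + e = 0")
      case True
      then have "e = -m" by simp
      then show ?thesis using f dual_hc[OF f, of a] assms[OF f] that by simp
    qed (use dual_vanish[OF f hc_props(1)] in blast)
  qed
  then have "hc a n = a" using hc_sum_superset[of "{n}" a] by auto
  then show ?thesis using hc_props(1)[of a n] by simp
qed

lemma dual_extend:
  assumes "independent B" "B \<subseteq> G n"
  shows "\<exists>f\<in>dual (-n). \<forall>b\<in>B. f b = g b"
proof -
  have "vector_space ((*) :: 'k \<Rightarrow> 'k \<Rightarrow> 'k)" by unfold_locales (auto simp: algebra_simps)
  then interpret vp: vector_space_pair s "(*) :: 'k \<Rightarrow> 'k \<Rightarrow> 'k"
    by (simp add: vector_space_pair_def vector_space_axioms)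
  obtain h where h: "Vector_Spaces.linear s (*) h" "\<forall>b\<in>B. h b = g b"
    using vp.linear_independent_extend[OF assms(1)] by blast
  have lh: "linf h" using h(1) linear_iff_linf by blast
  \<comment> \<open>Precomposing with the projection to degree n makes the extension homogeneous
    without changing it on B.\<close>
  let ?f = "\<lambda>v. h (hc v n)"
  have "?f \<in> dual (-n)"
    using lh by (auto simp: dual_iff hc_hom linf_zero) (simp add: linf_def hc_linear)
  moreover have "\<forall>b\<in>B. ?f b = g b" using assms(2) h(2) by (auto simp: hc_hom)
  ultimately show ?thesis by (intro bexI[of _ ?f])
qed

end

section \<open>Multilinear forms and tensor powers\<close>

lemma multilinD:
  "multilin s s' C n F \<Longrightarrow> length xs = n \<Longrightarrow> set xs \<subseteq> C \<Longrightarrow> i < n \<Longrightarrow> x \<in> C \<Longrightarrow> y \<in> C \<Longrightarrow>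
    F (xs[i := s c x + y]) = s' c (F (xs[i := x])) + F (xs[i := y])"
  unfolding multilin_def by blast

text \<open>The entries are freed one at a time: k counts the leading entries that are arbitrary in
  \<open>C\<close>, and for one slot the admissible values form a subspace containing
  \<open>H\<close>. With \<open>S\<close> the zero subspace this says that vanishing on generators
  suffices.\<close>

lemma multilin_span:
  assumes vs: "vector_space s" and vs': "vector_space s'"
    and F: "multilin s s' C n F" and CH: "C = module.span s H" and S: "module.subspace s' S"
    and H: "\<And>xs. length xs = n \<Longrightarrow> set xs \<subseteq> H \<Longrightarrow> F xs \<in> S"
    and xs: "length xs = n" "set xs \<subseteq> C"
  shows "F xs \<in> S"
proof -
  interpret A: vector_space s by (rule vs)
  interpret B: vector_space s' by (rule vs')
  have HC: "H \<subseteq> C" unfolding CH by (rule A.span_superset)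
  have CS: "A.subspace C" unfolding CH by (rule A.subspace_span)
  have upd0: "F (ys[i := 0]) = 0" if "length ys = n" "set ys \<subseteq> C" "i < n" for ys i
    using multilinD[OF F that, of 0 0 1] A.subspace_0[OF CS] by simp
  have "F xs \<in> S" if "k \<le> n" "set (drop k xs) \<subseteq> H" "length xs = n" "set xs \<subseteq> C" for k xs
    using that
  proof (induction k arbitrary: xs)
    case 0
    then show ?case using H by simp
  next
    case (Suc k)
    let ?T = "{v \<in> C. F (xs[k := v]) \<in> S}"
    have kn: "k < n" using Suc by simp
    have sub: "set (xs[k := v]) \<subseteq> C" if "v \<in> C" for v
      using Suc.prems(4) that set_update_subset_insert[of xs k v] by auto
    have "A.span H \<subseteq> ?T"
    proof (rule A.span_minimal)
      show "H \<subseteq> ?T"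
      proof
        fix v assume v: "v \<in> H"
        have "drop k (xs[k := v]) = v # drop (Suc k) xs"
          using kn Suc.prems(3) by (metis Cons_nth_drop_Suc drop_update_cancel length_list_update lessI nth_list_update_eq)
        then have "F (xs[k := v]) \<in> S"
          using Suc v HC sub[of v] by (intro Suc.IH) auto
        then show "v \<in> ?T" using v HC by auto
      qed
      show "A.subspace ?T"
      proof (rule A.subspaceI)
        show "0 \<in> ?T" using upd0[OF Suc.prems(3,4) kn] A.subspace_0[OF CS] B.subspace_0[OF S] by simp
      next
        fix x y assume "x \<in> ?T" "y \<in> ?T"
        then show "x + y \<in> ?T"
          using multilinD[OF F Suc.prems(3,4) kn, of x y 1] A.subspace_add[OF CS] B.subspace_add[OF S] by simp
      next
        fix c x assume "x \<in> ?T"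
        then show "s c x \<in> ?T"
          using multilinD[OF F Suc.prems(3,4) kn, of x 0 c] A.subspace_0[OF CS] A.subspace_scale[OF CS]
            B.subspace_scale[OF S] upd0[OF Suc.prems(3,4) kn] by simp
      qed
    qed
    moreover have "xs ! k \<in> C" using Suc.prems kn by (auto simp: subset_iff)
    ultimately show ?case using CH by auto
  qed
  from this[of n xs] xs show ?thesis by simp
qed

text \<open>The tensor product of the functionals without Koszul signs; on a tensor power
  \<open>tpair\<close> differs from evaluation at it by a sign (\<open>tpair_eq\<close>).\<close>

definition pform :: "('a \<Rightarrow> 'k) list \<Rightarrow> 'a list \<Rightarrow> 'k::comm_monoid_mult" where
  "pform fs vs = (\<Prod>i<length fs. (fs ! i) (vs ! i))"

lemma pform_Nil [simp]: "pform [] vs = 1"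
  by (simp add: pform_def)

lemma pform_Cons [simp]: "pform (f # fs) (v # vs) = f v * pform fs vs"
  by (simp add: pform_def prod.lessThan_Suc_shift del: prod.lessThan_Suc)

lemma pform_append: "length fs = length vs \<Longrightarrow> pform (fs @ gs) (vs @ ws) = pform fs vs * pform gs ws"
  by (induction fs vs rule: list_induct2) (auto simp: mult.assoc)

definition lists_of :: "'i set \<Rightarrow> nat \<Rightarrow> 'i list set" where
  "lists_of S p = {xs. set xs \<subseteq> S \<and> length xs = p}"

lemma lists_of_finite: "finite S \<Longrightarrow> finite (lists_of S p)"
  unfolding lists_of_def by (rule finite_lists_length_eq)

lemma lists_of_0: "lists_of S 0 = {[]}"
  by (auto simp: lists_of_def)

lemma lists_of_Suc: "lists_of S (Suc p) = (\<lambda>(x, xs). x # xs) ` (S \<times> lists_of S p)"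
  by (auto simp: lists_of_def length_Suc_conv image_iff)

lemma sum_lists_of_Suc: "(\<Sum>xs\<in>lists_of S (Suc p). f xs) = (\<Sum>x\<in>S. \<Sum>xs\<in>lists_of S p. f (x # xs))"
  unfolding lists_of_Suc by (subst sum.reindex) (auto simp: inj_on_def sum.cartesian_product intro!: sum.cong)

lemma homs_length: "homs G ds xs \<Longrightarrow> length xs = length ds"
  unfolding homs_def by (simp add: list_all2_lengthD)

lemma homs_nth: "homs G ds xs \<Longrightarrow> i < length ds \<Longrightarrow> xs ! i \<in> G (ds ! i)"
  unfolding homs_def by (rule list_all2_nthD)

lemma homs_iff: "homs G ds xs \<longleftrightarrow> length xs = length ds \<and> (\<forall>i<length ds. xs ! i \<in> G (ds ! i))"
  unfolding homs_def list_all2_conv_all_nth by auto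

lemma homs_Cons [simp]: "homs G (d # ds) (x # xs) \<longleftrightarrow> x \<in> G d \<and> homs G ds xs"
  by (simp add: homs_def)

lemma homs_Nil [simp]: "homs G [] xs \<longleftrightarrow> xs = []" "homs G ds [] \<longleftrightarrow> ds = []"
  by (auto simp: homs_def)

lemma homs_append: "length ds = length xs \<Longrightarrow> homs G (ds @ es) (xs @ ys) \<longleftrightarrow> homs G ds xs \<and> homs G es ys"
  by (simp add: homs_def list_all2_append)

lemma homs_exists: "set xs \<subseteq> (\<Union>n. G n) \<Longrightarrow> \<exists>ds. homs G ds xs"
  by (induction xs) (auto simp: homs_def intro: list_all2_Cons[THEN iffD2])

context graded_alg begin

abbreviation mlf :: "nat \<Rightarrow> ('a list \<Rightarrow> 'k) \<Rightarrow> bool" where "mlf p \<phi> \<equiv> multilin s (*) UNIV p \<phi>"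

lemma vs_mult: "vector_space ((*) :: 'k \<Rightarrow> 'k \<Rightarrow> 'k)"
  by unfold_locales (auto simp: algebra_simps)

lemma mlfD: "mlf p \<phi> \<Longrightarrow> length xs = p \<Longrightarrow> i < p \<Longrightarrow>
    \<phi> (xs[i := s c x + y]) = c * \<phi> (xs[i := x]) + \<phi> (xs[i := y])"
  by (erule multilinD) auto

lemma mlfI: "(\<And>xs i c x y. length xs = p \<Longrightarrow> i < p \<Longrightarrow>
    \<phi> (xs[i := s c x + y]) = c * \<phi> (xs[i := x]) + \<phi> (xs[i := y])) \<Longrightarrow> mlf p \<phi>"
  unfolding multilin_def by blast

lemma mlf_linf: "mlf p \<phi> \<Longrightarrow> length xs = p \<Longrightarrow> i < p \<Longrightarrow> linf (\<lambda>x. \<phi> (xs[i := x]))"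
  by (simp add: linf_def mlfD)

lemma mlf_0: "mlf p \<phi> \<Longrightarrow> length xs = p \<Longrightarrow> i < p \<Longrightarrow> \<phi> (xs[i := 0]) = 0"
  using linf_zero[OF mlf_linf] .

lemma mlf_0': "mlf p \<phi> \<Longrightarrow> length xs = p \<Longrightarrow> 0 \<in> set xs \<Longrightarrow> \<phi> xs = 0"
  using mlf_0[of p \<phi> xs] by (metis in_set_conv_nth list_update_id)

lemma mlf_Cons: "mlf (Suc p) \<phi> \<Longrightarrow> mlf p (\<lambda>vs. \<phi> (v # vs))"
  by (rule mlfI) (use mlfD[of "Suc p" \<phi> "v # xs" "Suc i" for xs i] in simp)

lemma mlf_hd: "mlf (Suc p) \<phi> \<Longrightarrow> length vs = p \<Longrightarrow> linf (\<lambda>v. \<phi> (v # vs))"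
  using mlf_linf[of "Suc p" \<phi> "0 # vs" 0] by simp

lemma mlf_cong: "(\<And>vs. length vs = p \<Longrightarrow> \<phi> vs = \<psi> vs) \<Longrightarrow> mlf p \<phi> \<longleftrightarrow> mlf p \<psi>"
  unfolding multilin_def by auto

lemma mlf_comb: "mlf p \<phi> \<Longrightarrow> mlf p \<psi> \<Longrightarrow> mlf p (\<lambda>vs. c * \<phi> vs + \<psi> vs)"
  by (rule mlfI, simp add: mlfD, simp add: algebra_simps)

lemma mlf_const: "mlf p (\<lambda>vs. 0)"
  by (rule mlfI) simp

lemma mlf_scale: "mlf p \<phi> \<Longrightarrow> mlf p (\<lambda>vs. c * \<phi> vs)"
  using mlf_comb[OF _ mlf_const] by simp

lemma mlf_permute:
  assumes "mlf p \<phi>" "\<tau> permutes {..<p}"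
  shows "mlf p (\<lambda>vs. \<phi> (permute_list \<tau> vs))"
proof (rule mlfI)
  fix xs :: "'a list" and i c x y assume a: "length xs = p" "i < p"
  have "permute_list \<tau> (xs[i := z]) = (permute_list \<tau> xs)[inv \<tau> i := z]" for z
    using assms(2) a by (intro nth_equalityI)
      (auto simp: permute_list_nth nth_list_update permutes_inverses permutes_in_image
            permutes_inv_eq[OF assms(2)])
  then show "\<phi> (permute_list \<tau> (xs[i := s c x + y])) = c * \<phi> (permute_list \<tau> (xs[i := x])) + \<phi> (permute_list \<tau> (xs[i := y]))"
    using mlfD[OF assms(1), of "permute_list \<tau> xs" "inv \<tau> i" c x y] a assms(2)
      permutes_in_image[OF permutes_inv[OF assms(2)], of i] by simp
qed

lemma mlf_pform: "\<forall>f\<in>set fs. linf f \<Longrightarrow> length fs = p \<Longrightarrow> mlf p (pform fs)"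
proof (induction fs arbitrary: p)
  case (Cons f fs)
  show ?case
  proof (rule mlfI)
    fix xs :: "'a list" and i c x y assume a: "length xs = p" "i < p"
    obtain v vs where xs: "xs = v # vs" "length vs = length fs" using a Cons.prems by (cases xs) auto
    have m: "mlf (length fs) (pform fs)" using Cons by simp
    show "pform (f # fs) (xs[i := s c x + y]) = c * pform (f # fs) (xs[i := x]) + pform (f # fs) (xs[i := y])"
    proof (cases i)
      case 0
      then show ?thesis using Cons.prems xs by (simp add: linfD distrib_right mult.assoc)
    next
      case (Suc j)
      then show ?thesis using mlfD[OF m xs(2), of j c x y] xs a Cons.prems by (simp add: algebra_simps)
    qed
  qed
qed (simp add: multilin_def)

lemma G_span: "UNIV = span (\<Union>n. G n)"
proof -
  have "v \<in> span (\<Union>n. G n)" for v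
  proof -
    have "(\<Sum>n\<in>{n. hc v n \<noteq> 0}. hc v n) \<in> span (\<Union>n. G n)"
      by (intro span_sum span_base) (auto intro: hc_props)
    then show ?thesis using hc_props(3)[of v] by simp
  qed
  then show ?thesis by auto
qed

lemma mlf_eq_hom:
  assumes "mlf p \<phi>" "mlf p \<psi>" "\<And>ds vs. homs G ds vs \<Longrightarrow> length vs = p \<Longrightarrow> length ds = p \<Longrightarrow> \<phi> vs = \<psi> vs" "length vs = p"
  shows "\<phi> vs = \<psi> vs"
proof -
  have "module.subspace ((*) :: 'k \<Rightarrow> 'k \<Rightarrow> 'k) {0}"
    using vs_mult by (simp add: module.subspace_def module_iff_vector_space)
  then have "(\<lambda>vs. (-1) * \<psi> vs + \<phi> vs) vs \<in> {0}"
  proof (rule multilin_span[OF vector_space_axioms vs_mult mlf_comb[OF assms(2,1)] G_span])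
    fix xs assume "length xs = p" "set xs \<subseteq> (\<Union>n. G n)"
    then show "(-1) * \<psi> xs + \<phi> xs \<in> {0}"
      using assms(3) homs_exists[of xs G] homs_length by fastforce
  qed (use assms(4) in auto)
  then show ?thesis by simp
qed

text \<open>One finite index set S serves all slots, so the expansion is a single sum over lists of
  indices and expansions of different forms can be added.\<close>

lemma mlf_expand:
  assumes "mlf p \<phi>" "length vs = p" "finite S" "\<And>v. v \<in> set vs \<Longrightarrow> {i. co i v \<noteq> 0} \<subseteq> S"
  shows "\<phi> vs = (\<Sum>\<beta>\<in>lists_of S p. \<phi> (map snd \<beta>) * pform (map co \<beta>) vs)"
  using assms(1,2,4)
proof (induction p arbitrary: \<phi> vs)
  case 0
  then show ?case by (simp add: lists_of_0)
next
  case (Suc p)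
  obtain v ws where vs: "vs = v # ws" "length ws = p" using Suc.prems by (cases vs) auto
  have "\<phi> vs = \<phi> ((\<Sum>i\<in>S. s (co i v) (snd i)) # ws)"
    using Suc.prems(3)[of v] by (simp add: vs co_sum assms(3))
  also have "\<dots> = (\<Sum>i\<in>S. co i v * \<phi> (snd i # ws))"
    using mlf_hd[OF Suc.prems(1) vs(2)] by (simp add: linf_sum[where f="\<lambda>v. \<phi> (v # ws)"] linf_scale[where f="\<lambda>v. \<phi> (v # ws)"])
  also have "\<dots> = (\<Sum>i\<in>S. co i v * (\<Sum>\<beta>\<in>lists_of S p. \<phi> (snd i # map snd \<beta>) * pform (map co \<beta>) ws))"
    using Suc.prems by (intro sum.cong refl arg_cong2[of _ _ _ _ "(*)"] Suc.IH mlf_Cons) (auto simp: vs)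
  also have "\<dots> = (\<Sum>\<beta>\<in>lists_of S (Suc p). \<phi> (map snd \<beta>) * pform (map co \<beta>) vs)"
    by (simp add: sum_lists_of_Suc vs sum_distrib_left mult_ac)
  finally show ?case .
qed

section \<open>Tensor powers and their evaluations\<close>

lemma tens_app: "mlf (length vs) \<phi> \<Longrightarrow> tens s vs \<phi> = \<phi> vs"
  by (simp add: tens_def)

lemma tens_app0: "\<not> mlf (length vs) \<phi> \<Longrightarrow> tens s vs \<phi> = 0"
  by (simp add: tens_def)

lemma tens_in: "length vs = p \<Longrightarrow> tens s vs \<in> tpow s p"
  unfolding tpow_def by (rule tsp.span_base) auto

lemma tpow_subspace: "tsp.subspace (tpow s p)"
  unfolding tpow_def by (rule tsp.subspace_span)

lemma tpow_0: "0 \<in> tpow s p" and tpow_add: "t \<in> tpow s p \<Longrightarrow> u \<in> tpow s p \<Longrightarrow> t + u \<in> tpow s p"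
  and tpow_scale: "t \<in> tpow s p \<Longrightarrow> tscale c t \<in> tpow s p"
  using tpow_subspace by (auto simp: tsp.subspace_def)

lemma tpow_sum: "(\<And>i. i \<in> S \<Longrightarrow> t i \<in> tpow s p) \<Longrightarrow> (\<Sum>i\<in>S. t i) \<in> tpow s p"
  by (rule tsp.subspace_sum[OF tpow_subspace])

lemma tspan_induct [consumes 1, case_names zero comb base]:
  assumes t: "t \<in> tsp.span B" and P0: "P 0" and comb: "\<And>c t u. t \<in> tsp.span B \<Longrightarrow> u \<in> tsp.span B \<Longrightarrow> P t \<Longrightarrow> P u \<Longrightarrow> P (tscale c t + u)"
    and base: "\<And>t. t \<in> B \<Longrightarrow> P t"
  shows "P t"
proof -
  let ?Q = "\<lambda>t. t \<in> tsp.span B \<and> P t"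
  have s0: "?Q (tscale c t)" if "?Q t" for c t
    using comb[of t 0 c] that P0 tsp.span_zero[of B] tsp.span_scale[of t B c] by simp
  have "?Q (t + u)" if "?Q t" "?Q u" for t u
    using comb[of t u 1] that tsp.span_add[of t B u] by simp
  with s0 P0 have "tsp.subspace {t. ?Q t}"
    by (auto simp: tsp.subspace_def tsp.span_zero)
  then have "tsp.span B \<subseteq> {t. ?Q t}" using base by (intro tsp.span_minimal) (auto simp: tsp.span_base)
  then show ?thesis using t by auto
qed

lemma tpow_induct [consumes 1, case_names zero comb tens]:
  assumes t: "t \<in> tpow s p" and "P 0" and "\<And>c t u. t \<in> tpow s p \<Longrightarrow> u \<in> tpow s p \<Longrightarrow> P t \<Longrightarrow> P u \<Longrightarrow> P (tscale c t + u)"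
    and "\<And>vs. length vs = p \<Longrightarrow> P (tens s vs)"
  shows "P t"
  using t unfolding tpow_def
proof (rule tspan_induct)
  show "P t" if "t \<in> {tens s vs |vs. length vs = p}" for t using that assms(4) by blast
qed (use assms(2,3) in \<open>unfold tpow_def, blast\<close>)+

lemma tens_multilin: "multilin s tscale UNIV p (tens s)"
  unfolding multilin_def by (auto simp: fun_eq_iff tens_def tscale_def mlfD)

text \<open>Koszul signs are given on homogeneous arguments, so identities between linear maps on a
  tensor power are checked on these generators.\<close>

lemma tpow_hom_induct [consumes 1, case_names zero comb tens]:
  assumes t: "t \<in> tpow s p" and P0: "P 0" and comb: "\<And>c t u. t \<in> tpow s p \<Longrightarrow> u \<in> tpow s p \<Longrightarrow> P t \<Longrightarrow> P u \<Longrightarrow> P (tscale c t + u)"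
    and base: "\<And>ds vs. length vs = p \<Longrightarrow> length ds = p \<Longrightarrow> homs G ds vs \<Longrightarrow> P (tens s vs)"
  shows "P t"
  using t
proof (induction rule: tpow_induct)
  case (tens vs)
  let ?S = "{t \<in> tpow s p. P t}"
  have s0: "tscale c t \<in> ?S" if "t \<in> ?S" for c t
    using comb[of t 0 c] that P0 tpow_0 tpow_scale by simp
  have "t + u \<in> ?S" if "t \<in> ?S" "u \<in> ?S" for t u
    using comb[of t u 1] that tpow_add by simp
  with s0 P0 have "tsp.subspace ?S"
    by (auto simp: tsp.subspace_def tpow_0)
  then have "tens s vs \<in> ?S"
  proof (rule multilin_span[OF vector_space_axioms tsp.vector_space_axioms tens_multilin G_span])
    fix xs assume "length xs = p" "set xs \<subseteq> (\<Union>n. G n)"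
    then show "tens s xs \<in> ?S"
      using base homs_exists[of xs G] homs_length tens_in by fastforce
  qed (use tens in auto)
  then show ?case by simp
qed (use P0 comb in blast)+

text \<open>The convention that \<open>tens\<close> is 0 off the multilinear forms passes to spans,
  so tensors may be compared at every \<phi>.\<close>

lemma tpow_nonml: "t \<in> tpow s p \<Longrightarrow> \<not> mlf p \<phi> \<Longrightarrow> t \<phi> = 0"
  by (induction rule: tpow_induct) (auto simp: tens_app0 tscale_def)

lemma tpow_cong:
  assumes "t \<in> tpow s p" "\<And>vs. length vs = p \<Longrightarrow> \<phi> vs = \<psi> vs" shows "t \<phi> = t \<psi>"
  using assms(1)
  by (induction rule: tpow_induct) (use mlf_cong[OF assms(2)] assms(2) in \<open>auto simp: tens_def tscale_def\<close>)

lemma tpow_lin: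
  assumes "t \<in> tpow s p" "mlf p \<phi>" "mlf p \<psi>" shows "t (\<lambda>vs. c * \<phi> vs + \<psi> vs) = c * t \<phi> + t \<psi>"
  using assms(1)
proof (induction rule: tpow_induct)
  case (comb d t u)
  then show ?case by (simp add: tscale_def) (simp add: algebra_simps)
qed (use assms(2,3) in \<open>auto simp: tens_app mlf_comb\<close>)

lemma tpow_scale_form:
  assumes "t \<in> tpow s p" "mlf p \<phi>" shows "t (\<lambda>vs. c * \<phi> vs) = c * t \<phi>"
  using tpow_lin[OF assms mlf_const, of c] tpow_lin[OF assms(1) mlf_const mlf_const, of 1] by simp

lemma tpow_cong_hom:
  assumes "t \<in> tpow s p" "mlf p \<phi>" "mlf p \<psi>" "\<And>ds vs. homs G ds vs \<Longrightarrow> length vs = p \<Longrightarrow> length ds = p \<Longrightarrow> \<phi> vs = \<psi> vs"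
  shows "t \<phi> = t \<psi>"
  by (rule tpow_cong[OF assms(1)], rule mlf_eq_hom[OF assms(2-4)])

abbreviation coord :: "(int \<times> 'a) list \<Rightarrow> ('k, 'a) tensor \<Rightarrow> 'k" where
  "coord \<beta> t \<equiv> t (pform (map co \<beta>))"

text \<open>The claim for all larger sets S' is what carries the induction: two tensors are expanded
  over the union of their index sets.\<close>

lemma tpow_expand:
  assumes "t \<in> tpow s p"
  shows "\<exists>S. finite S \<and> (\<forall>S'. finite S' \<longrightarrow> S \<subseteq> S' \<longrightarrow> t = (\<Sum>\<beta>\<in>lists_of S' p. tscale (coord \<beta> t) (tens s (map snd \<beta>))))"
  using assms
proof (induction rule: tpow_induct)
  case zero
  show ?case by (intro exI[of _ "{}"]) (simp add: tscale_def fun_eq_iff sum_fun_app)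
next
  case (comb c t u)
  from comb.IH(1) obtain S where S: "finite S" "\<And>S'. finite S' \<Longrightarrow> S \<subseteq> S' \<Longrightarrow> t = (\<Sum>\<beta>\<in>lists_of S' p. tscale (coord \<beta> t) (tens s (map snd \<beta>)))"
    by blast
  from comb.IH(2) obtain T where T: "finite T" "\<And>S'. finite S' \<Longrightarrow> T \<subseteq> S' \<Longrightarrow> u = (\<Sum>\<beta>\<in>lists_of S' p. tscale (coord \<beta> u) (tens s (map snd \<beta>)))"
    by blast
  have "tscale c t + u = (\<Sum>\<beta>\<in>lists_of S' p. tscale (coord \<beta> (tscale c t + u)) (tens s (map snd \<beta>)))"
    if "finite S'" "S \<union> T \<subseteq> S'" for S'
  proof -
    have "tscale c t + u = tscale c (\<Sum>\<beta>\<in>lists_of S' p. tscale (coord \<beta> t) (tens s (map snd \<beta>)))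
       + (\<Sum>\<beta>\<in>lists_of S' p. tscale (coord \<beta> u) (tens s (map snd \<beta>)))"
      using S(2)[of S'] T(2)[of S'] that by simp
    also have "\<dots> = (\<Sum>\<beta>\<in>lists_of S' p. tscale (coord \<beta> (tscale c t + u)) (tens s (map snd \<beta>)))"
      unfolding tsp.scale_sum_right sum.distrib[symmetric] tsp.scale_scale
      by (intro sum.cong refl) (simp add: tsp.scale_left_distrib tscale_def[of c t])
    finally show ?thesis .
  qed
  then show ?case using S(1) T(1) by (intro exI[of _ "S \<union> T"] conjI allI impI) (rule finite_UnI)
next
  case (tens vs)
  let ?S = "\<Union>v\<in>set vs. {i. co i v \<noteq> 0}"
  have "tens s vs = (\<Sum>\<beta>\<in>lists_of S' p. tscale (coord \<beta> (tens s vs)) (tens s (map snd \<beta>)))"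
    if "finite S'" "?S \<subseteq> S'" for S'
  proof
    fix \<phi>
    have ml: "mlf p (pform (map co \<beta>))" if "length \<beta> = p" for \<beta>
      using that co_dual by (intro mlf_pform) (auto intro!: dual_linf)
    show "tens s vs \<phi> = (\<Sum>\<beta>\<in>lists_of S' p. tscale (coord \<beta> (tens s vs)) (tens s (map snd \<beta>))) \<phi>"
    proof (cases "mlf p \<phi>")
      case True
      have "\<phi> vs = (\<Sum>\<beta>\<in>lists_of S' p. \<phi> (map snd \<beta>) * pform (map co \<beta>) vs)"
        using that by (intro mlf_expand True tens) auto
      then show ?thesis
        using True tens ml by (auto simp: sum_fun_app tscale_def tens_app lists_of_def mult.commute intro!: sum.cong)
    qed (use tens in \<open>auto simp: sum_fun_app tscale_def tens_app0 lists_of_def intro!: sum.neutral[symmetric]\<close>)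
  qed
  moreover have "finite ?S" by (simp add: co_fin)
  ultimately show ?case by (intro exI[of _ ?S]) blast
qed

lemma homs_co: "homs dual (map (\<lambda>i. - fst i) \<beta>) (map co \<beta>)"
  by (auto simp: homs_iff) (metis co_dual prod.collapse)

lemma homs_dual_linf: "homs dual es fs \<Longrightarrow> \<forall>f\<in>set fs. linf f"
  by (metis dual_linf homs_iff in_set_conv_nth)

lemma mlf_pform_hom: "homs dual es fs \<Longrightarrow> length fs = p \<Longrightarrow> mlf p (pform fs)"
  by (intro mlf_pform homs_dual_linf)

text \<open>Coordinates are evaluations at products of homogeneous functionals, and
  \<open>tpow_expand\<close> rebuilds the tensor from them.\<close>

lemma tpow_separates:
  assumes t: "t \<in> tpow s p" and 0: "\<And>es fs. homs dual es fs \<Longrightarrow> length fs = p \<Longrightarrow> length es = p \<Longrightarrow> t (pform fs) = 0"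
  shows "t = 0"
proof -
  obtain S where S: "finite S" "t = (\<Sum>\<beta>\<in>lists_of S p. tscale (coord \<beta> t) (tens s (map snd \<beta>)))"
    using tpow_expand[OF t] by blast
  have "tscale (coord \<beta> t) (tens s (map snd \<beta>)) = 0" if "\<beta> \<in> lists_of S p" for \<beta>
    using 0[OF homs_co, of \<beta>] that by (simp add: lists_of_def tscale_def fun_eq_iff)
  then show ?thesis by (subst S(2)) (rule sum.neutral, blast)
qed

lemma tpow_eqI:
  assumes "t \<in> tpow s p" "u \<in> tpow s p" "\<And>es fs. homs dual es fs \<Longrightarrow> length fs = p \<Longrightarrow> length es = p \<Longrightarrow> t (pform fs) = u (pform fs)"
  shows "t = u"
proof -
  have "t + tscale (-1) u = 0"
  proof (rule tpow_separates[of _ p])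
    show "t + tscale (-1) u \<in> tpow s p" using assms by (intro tpow_add tpow_scale)
  qed (use assms(3) in \<open>auto simp: tscale_def\<close>)
  then show ?thesis by (simp add: tscale_def fun_eq_iff)
qed

lemma tpow_deg_sub: "tpow_deg s G p n \<subseteq> tpow s p"
  unfolding tpow_deg_def tpow_def by (rule tsp.span_mono) auto

text \<open>A functional of degree e can be nonzero only in degree -e. This is the exchange rule of
  the whole sign calculus: where an evaluation is nonzero, a sign in the degrees of the vectors
  equals one in the degrees of the functionals.\<close>

lemma pform_vanish:
  assumes "homs dual es fs" "homs G ds vs" "length fs = length vs" "pform fs vs \<noteq> 0"
  shows "es = map uminus ds"
proof (rule nth_equalityI)
  show "length es = length (map uminus ds)" using assms(1-3) by (simp add: homs_length[symmetric])
  fix i assume i: "i < length es"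
  have "(fs ! i) (vs ! i) \<noteq> 0" using assms(4) i homs_length[OF assms(1)] by (auto simp: pform_def)
  then show "es ! i = map uminus ds ! i"
    using i assms(1-3) dual_vanish[OF homs_nth[OF assms(1) i] homs_nth[OF assms(2), of i]]
    by (force simp: homs_length[symmetric] eq_neg_iff_add_eq_0 add.commute)
qed

lemma sum_list_uminus: "sum_list (map uminus ds) = - sum_list (ds :: int list)"
  by (induction ds) auto

lemma tpow_deg_vanish:
  assumes t: "t \<in> tpow_deg s G p n" and fs: "homs dual es fs" "length fs = p" "sum_list es + n \<noteq> 0"
  shows "t (pform fs) = 0"
  using t unfolding tpow_deg_def
proof (induction rule: tspan_induct)
  case (base t)
  then obtain ds vs where b: "t = tens s vs" "length vs = p" "homs G ds vs" "sum_list ds = n" by blast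
  have "pform fs vs = 0"
    by (rule ccontr) (use fs b(2,4) pform_vanish[OF fs(1) b(3)] in \<open>auto simp: sum_list_uminus\<close>)
  then show ?case using b fs(2) mlf_pform_hom[OF fs(1,2)] by (simp add: tens_app)
qed (auto simp: tscale_def)

lemma tpow_deg_detect:
  assumes t: "t \<in> tpow s p" and 0: "\<And>es fs. homs dual es fs \<Longrightarrow> length fs = p \<Longrightarrow> sum_list es + n \<noteq> 0 \<Longrightarrow> t (pform fs) = 0"
  shows "t \<in> tpow_deg s G p n"
proof -
  obtain S where S: "finite S" "t = (\<Sum>\<beta>\<in>lists_of S p. tscale (coord \<beta> t) (tens s (map snd \<beta>)))"
    using tpow_expand[OF t] by blast
  have "tscale (coord \<beta> t) (tens s (map snd \<beta>)) \<in> tpow_deg s G p n" if \<beta>: "\<beta> \<in> lists_of S p" for \<beta>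
  \<comment> \<open>An index outside the chosen bases need not carry a homogeneous vector, but then
    its functional is zero, and so is the coordinate.\<close>
  proof (cases "coord \<beta> t = 0 \<or> (\<exists>i\<in>set \<beta>. co i = 0)")
    case True
    then have "coord \<beta> t = 0"
    proof
      assume "\<exists>i\<in>set \<beta>. co i = 0"
      then obtain j where "j < length \<beta>" "co (\<beta> ! j) = 0" by (auto simp: in_set_conv_nth)
      then have "pform (map co \<beta>) vs = 0" for vs by (auto simp: pform_def intro!: bexI[of _ j])
      then have "coord \<beta> t = t (\<lambda>vs. 0 * 0)" by (intro tpow_cong[OF t]) auto
      then show ?thesis using tpow_scale_form[OF t mlf_const, of 0] by simp
    qed
    then show ?thesis unfolding tpow_deg_def by (simp add: tscale_def tsp.span_zero zero_fun_def[symmetric])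
  next
    case False
    have sm: "sum_list (map (\<lambda>i. - fst i) \<beta>) = - sum_list (map fst \<beta>)"
      by (induction \<beta>) auto
    have "sum_list (map fst \<beta>) = n"
      using False 0[OF homs_co, of \<beta>] \<beta> by (auto simp: lists_of_def sm)
    moreover have "homs G (map fst \<beta>) (map snd \<beta>)"
    proof -
      have "snd i \<in> G (fst i)" if "i \<in> set \<beta>" for i
      proof -
        obtain v where "co i v \<noteq> 0" using False \<open>i \<in> set \<beta>\<close> by (auto simp: fun_eq_iff)
        then show ?thesis by (rule co_nz_G)
      qed
      then show ?thesis by (auto simp: homs_iff)
    qed
    ultimately show ?thesis using \<beta> unfolding tpow_deg_def
      by (intro tsp.span_scale tsp.span_base CollectI exI[of _ "map fst \<beta>"] exI[of _ "map snd \<beta>"])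
        (auto simp: lists_of_def)
  qed
  then show ?thesis by (subst S(2)) (auto simp: tpow_deg_def intro!: tsp.span_sum)
qed

end

section \<open>Koszul signs and maps of tensor powers\<close>

text \<open>The Koszul exponent over the inversions of \<sigma> itself, whereas
  \<open>koszul\<close> runs over those of the inverse. The weights h are free so that blocks of
  letters can be permuted like single letters.\<close>

definition isum :: "nat \<Rightarrow> (nat \<Rightarrow> nat) \<Rightarrow> (nat \<Rightarrow> int) \<Rightarrow> int" where
  "isum p \<sigma> h = (\<Sum>(i, j)\<in>{(i, j). i < j \<and> j < p \<and> \<sigma> i > \<sigma> j}. h (\<sigma> i) * h (\<sigma> j))"

text \<open>The exponent of the Koszul rule for evaluating functionals of degrees es at vectors of
  the opposite degrees.\<close>

definition psum :: "int list \<Rightarrow> int" where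
  "psum es = (\<Sum>(i, j)\<in>{(i, j). i < j \<and> j < length es}. es ! i * es ! j)"

lemma koszul_inv:
  "\<sigma> permutes {..<p} \<Longrightarrow> length ds = p \<Longrightarrow> koszul (inv \<sigma>) ds = isum p \<sigma> (\<lambda>i. ds ! i)"
  by (simp add: koszul_def isum_def permutes_inv_inv)

lemma koszul_eq:
  assumes s: "\<sigma> permutes {..<p}" and "length ds = p" shows "koszul \<sigma> ds = isum p \<sigma> (\<lambda>i. ds ! inv \<sigma> i)"
  unfolding koszul_def isum_def assms(2)
proof (rule sum.reindex_bij_witness[where i="\<lambda>(a, b). (\<sigma> b, \<sigma> a)" and j="\<lambda>(i, j). (inv \<sigma> j, inv \<sigma> i)"])
qed (use permutes_inverses[OF s] permutes_in_image[OF s] permutes_in_image[OF permutes_inv[OF s]] in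
     \<open>auto simp: mult.commute\<close>)

lemma permutes_lt: "\<sigma> permutes {..<p} \<Longrightarrow> i < p \<Longrightarrow> \<sigma> i < p"
  using permutes_in_image[of \<sigma> "{..<p}" i] by simp

lemma homs_permute: "\<sigma> permutes {..<length ds} \<Longrightarrow> homs H ds vs \<Longrightarrow> homs H (permute_list \<sigma> ds) (permute_list \<sigma> vs)"
  by (auto simp: homs_iff permute_list_nth permutes_lt)

context graded_alg begin

text \<open>Multilinearity is tested against the forms on the values; this is what lets
  \<open>tlift F\<close> send \<open>tens s vs\<close> to \<open>F vs\<close>.\<close>

definition tmulti :: "nat \<Rightarrow> nat \<Rightarrow> ('a list \<Rightarrow> ('k, 'a) tensor) \<Rightarrow> bool" where
  "tmulti p q F \<longleftrightarrow> (\<forall>vs. length vs = p \<longrightarrow> F vs \<in> tpow s q) \<and> (\<forall>\<phi>. mlf q \<phi> \<longrightarrow> mlf p (\<lambda>vs. F vs \<phi>))"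

lemma tmulti_mlf: assumes "tmulti p q F" shows "mlf p (\<lambda>vs. F vs \<phi>)"
proof (cases "mlf q \<phi>")
  case False
  have "mlf p (\<lambda>vs. F vs \<phi>) \<longleftrightarrow> mlf p (\<lambda>vs. 0)"
    by (rule mlf_cong) (use False assms tpow_nonml in \<open>auto simp: tmulti_def\<close>)
  then show ?thesis using mlf_const by simp
qed (use assms in \<open>auto simp: tmulti_def\<close>)

lemma tlift_tens: "tmulti p q F \<Longrightarrow> length vs = p \<Longrightarrow> tlift F (tens s vs) = F vs"
  by (simp add: fun_eq_iff tlift_def tens_app tmulti_mlf)

lemma tlift_lin: "tlift F (tscale c t + u) = tscale c (tlift F t) + tlift F u"
  by (simp add: fun_eq_iff tlift_def tscale_def)

lemma tlift_0: "tlift F 0 = 0"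
  by (simp add: fun_eq_iff tlift_def)

lemma tlift_in: "tmulti p q F \<Longrightarrow> t \<in> tpow s p \<Longrightarrow> tlift F t \<in> tpow s q"
  by (rotate_tac, induction rule: tpow_induct)
    (simp_all only: tlift_0 tlift_lin tlift_tens tpow_0 tpow_add tpow_scale, simp add: tmulti_def)

lemma hext_app: "hext G F vs \<phi> = hext G (\<lambda>ds vs. F ds vs \<phi>) vs" for F :: "int list \<Rightarrow> 'a list \<Rightarrow> ('k, 'a) tensor"
  by (simp add: hext_def sum_fun_app)

lemma hext_in:
  assumes "\<And>ds ws. length ws = p \<Longrightarrow> F ds ws \<in> tpow s q" "length vs = p"
  shows "hext G F vs \<in> tpow s q"
  unfolding hext_def by (rule tpow_sum, rule assms(1)) (use assms(2) in auto)

text \<open>A nonzero homogeneous vector has a unique degree, so one term of the sum remains. If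
  some entry is 0 the sum is empty, whence the second hypothesis.\<close>

lemma hext_hom:
  assumes "homs G ds vs" "0 \<in> set vs \<Longrightarrow> F ds vs = 0"
  shows "hext G F vs = F ds vs"
proof (cases "0 \<in> set vs")
  case True
  then obtain i where "i < length vs" "vs ! i = 0" by (auto simp: in_set_conv_nth)
  then have e: "{ds. length ds = length vs \<and> (\<forall>i<length vs. hc (vs ! i) (ds ! i) \<noteq> 0)} = {}"
    by (auto intro!: exI[of _ i])
  show ?thesis unfolding hext_def e using assms(2)[OF True] by simp
next
  case False
  have nz: "vs ! i \<noteq> 0" if "i < length vs" for i using False that by (metis nth_mem)
  note hom = homs_nth[OF assms(1)] homs_length[OF assms(1)]
  have "hc (vs ! i) n \<noteq> 0 \<longleftrightarrow> n = ds ! i" if "i < length ds" for i n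
    using hc_hom[OF hom(1)[OF that], of n] nz[of i] that hom(2) by simp
  then have "{ds. length ds = length vs \<and> (\<forall>i<length vs. hc (vs ! i) (ds ! i) \<noteq> 0)} = {ds}"
    using hom(2) by (auto intro!: nth_equalityI)
  moreover have "map2 hc vs ds = vs"
    using hom by (auto intro!: nth_equalityI simp: hc_hom[OF hom(1)])
  ultimately show ?thesis by (simp add: hext_def)
qed

lemma homs_hc: "length ds = length vs \<Longrightarrow> homs G ds (map2 hc vs ds)"
  by (auto simp: homs_iff hc_props)

lemma hext_superset:
  assumes N: "finite N" "\<And>v. v \<in> set vs \<Longrightarrow> {n. hc v n \<noteq> 0} \<subseteq> N"
    and F: "\<And>ds ws. homs G ds ws \<Longrightarrow> length ds = length vs \<Longrightarrow> 0 \<in> set ws \<Longrightarrow> F ds ws = 0"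
  shows "hext G F vs = (\<Sum>ds\<in>lists_of N (length vs). F ds (map2 hc vs ds))"
  unfolding hext_def
proof (rule sum.mono_neutral_left)
  show "finite (lists_of N (length vs))" by (rule lists_of_finite[OF N(1)])
  show "{ds. length ds = length vs \<and> (\<forall>i<length vs. hc (vs ! i) (ds ! i) \<noteq> 0)} \<subseteq> lists_of N (length vs)"
    using N(2) by (fastforce simp: lists_of_def in_set_conv_nth)
  show "\<forall>ds\<in>lists_of N (length vs) - {ds. length ds = length vs \<and> (\<forall>i<length vs. hc (vs ! i) (ds ! i) \<noteq> 0)}. F ds (map2 hc vs ds) = 0"
  proof
    fix ds assume "ds \<in> lists_of N (length vs) - {ds. length ds = length vs \<and> (\<forall>i<length vs. hc (vs ! i) (ds ! i) \<noteq> 0)}"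
    then obtain i where i: "length ds = length vs" "i < length vs" "hc (vs ! i) (ds ! i) = 0"
      by (auto simp: lists_of_def)
    then have "map2 hc vs ds ! i = 0" "i < length (map2 hc vs ds)" by simp_all
    then have "0 \<in> set (map2 hc vs ds)" by (metis nth_mem)
    then show "F ds (map2 hc vs ds) = 0" using i by (intro F homs_hc)
  qed
qed

text \<open>Linearity in each slot within one homogeneous degree; as the list ds stays fixed, F may
  contain a sign that depends on it.\<close>

definition hml :: "nat \<Rightarrow> (int list \<Rightarrow> 'a list \<Rightarrow> 'k) \<Rightarrow> bool" where
  "hml p F \<longleftrightarrow> (\<forall>ds vs i c x y. homs G ds vs \<and> length ds = p \<and> i < p \<and> x \<in> G (ds ! i) \<and> y \<in> G (ds ! i) \<longrightarrow>
     F ds (vs[i := s c x + y]) = c * F ds (vs[i := x]) + F ds (vs[i := y]))"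

lemma hml_mlf: "mlf p \<psi> \<Longrightarrow> hml p (\<lambda>ds vs. c ds * \<psi> vs)"
  unfolding hml_def by (auto simp: mlfD homs_length distrib_left)

lemma hml_0: assumes F: "hml p F" and "homs G ds ws" "length ds = p" "0 \<in> set ws" shows "F ds ws = 0"
proof -
  obtain i where i: "i < p" "ws ! i = 0" using assms by (auto simp: in_set_conv_nth homs_length)
  have "F ds (ws[i := s 1 0 + 0]) = 1 * F ds (ws[i := 0]) + F ds (ws[i := 0])"
    using F assms(2,3) i unfolding hml_def by (blast intro: G_zero)
  then show ?thesis using i by (metis add_cancel_right_left list_update_id mult_1 scale_one add_0)
qed

text \<open>For x, y and their combination one common finite set of degrees is used; then the three
  sums have the same index set and linearity applies term by term.\<close>

lemma hext_mlf: assumes F: "hml p F" shows "mlf p (hext G F)"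
proof (rule mlfI)
  fix xs :: "'a list" and i c x y assume a: "length xs = p" "i < p"
  define N where "N = (\<Union>v\<in>set xs \<union> {x, y, s c x + y}. {n. hc v n \<noteq> 0})"
  have fN: "finite N" unfolding N_def by (auto simp: hc_props)
  have e: "hext G F (xs[i := z]) = (\<Sum>ds\<in>lists_of N p. F ds ((map2 hc xs ds)[i := hc z (ds ! i)]))"
    if z: "z \<in> {x, y, s c x + y}" for z
  proof -
    have "set (xs[i := z]) \<subseteq> insert z (set xs)" by (rule set_update_subset_insert)
    then have "{n. hc v n \<noteq> 0} \<subseteq> N" if "v \<in> set (xs[i := z])" for v
      using that z unfolding N_def by blast
    then have "hext G F (xs[i := z]) = (\<Sum>ds\<in>lists_of N p. F ds (map2 hc (xs[i := z]) ds))"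
      using hext_superset[OF fN, of "xs[i := z]" F] hml_0[OF F] a by simp
    also have "map2 hc (xs[i := z]) ds = (map2 hc xs ds)[i := hc z (ds ! i)]" if "length ds = p" for ds
      using a that by (intro nth_equalityI) (auto simp: nth_list_update)
    then have "(\<Sum>ds\<in>lists_of N p. F ds (map2 hc (xs[i := z]) ds)) = (\<Sum>ds\<in>lists_of N p. F ds ((map2 hc xs ds)[i := hc z (ds ! i)]))"
      by (intro sum.cong) (auto simp: lists_of_def)
    finally show ?thesis .
  qed
  have "F ds ((map2 hc xs ds)[i := hc (s c x + y) (ds ! i)]) =
      c * F ds ((map2 hc xs ds)[i := hc x (ds ! i)]) + F ds ((map2 hc xs ds)[i := hc y (ds ! i)])"
    if "ds \<in> lists_of N p" for ds
    using that F a homs_hc[of ds xs] unfolding hml_def hc_linear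
    by (auto simp: lists_of_def hc_props)
  then show "hext G F (xs[i := s c x + y]) = c * hext G F (xs[i := x]) + hext G F (xs[i := y])"
    by (simp add: e sum.distrib sum_distrib_left)
qed

lemma hext_scaled:
  assumes "mlf p \<psi>"
  shows "mlf p (hext G (\<lambda>ds vs. c ds * \<psi> vs))"
    and "homs G ds vs \<Longrightarrow> length vs = p \<Longrightarrow> hext G (\<lambda>ds vs. c ds * \<psi> vs) vs = c ds * \<psi> vs"
  using hext_mlf[OF hml_mlf[OF assms]] apply blast
  by (rule hext_hom) (auto simp: mlf_0'[OF assms])

lemma hext_cong_length:
  assumes "\<And>ds ws. length ws = length vs \<Longrightarrow> F ds ws = F' ds ws" shows "hext G F vs = hext G F' vs"
  unfolding hext_def by (intro sum.cong refl assms) auto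

lemma hext_tensor:
  assumes T: "\<And>ws. length ws = p \<Longrightarrow> T ws \<in> tpow s q" "\<And>\<phi>. mlf q \<phi> \<Longrightarrow> mlf p (\<lambda>vs. T vs \<phi>)"
  shows "tmulti p q (hext G (\<lambda>ds vs. tscale (c ds) (T vs)))"
    and "homs G ds vs \<Longrightarrow> length vs = p \<Longrightarrow> hext G (\<lambda>ds vs. tscale (c ds) (T vs)) vs = tscale (c ds) (T vs)"
proof -
  have T': "tmulti p q T" using T by (simp add: tmulti_def)
  show "tmulti p q (hext G (\<lambda>ds vs. tscale (c ds) (T vs)))"
    unfolding tmulti_def
  proof (intro conjI allI impI)
    fix \<phi> assume "mlf q \<phi>"
    then show "mlf p (\<lambda>vs. hext G (\<lambda>ds vs. tscale (c ds) (T vs)) vs \<phi>)"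
      using hext_scaled(1)[OF T(2), of \<phi> c] by (simp add: hext_app tscale_def)
  qed (auto intro!: hext_in tpow_scale T(1))
  assume h: "homs G ds vs" "length vs = p"
  show "hext G (\<lambda>ds vs. tscale (c ds) (T vs)) vs = tscale (c ds) (T vs)"
  proof
    fix \<phi>
    show "hext G (\<lambda>ds vs. tscale (c ds) (T vs)) vs \<phi> = tscale (c ds) (T vs) \<phi>"
      using hext_scaled(2)[OF tmulti_mlf[OF T', of \<phi>] h, of c] by (simp add: hext_app tscale_def)
  qed
qed

section \<open>Permutations and Koszul pairings of tensors\<close>

lemma tperm_multi:
  assumes "\<sigma> permutes {..<p}"
  shows "tmulti p p (hext G (\<lambda>ds vs. tscale (c ds) (tens s (permute_list (inv \<sigma>) vs))))"
    and "homs G ds vs \<Longrightarrow> length vs = p \<Longrightarrow> hext G (\<lambda>ds vs. tscale (c ds) (tens s (permute_list (inv \<sigma>) vs))) vs =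
      tscale (c ds) (tens s (permute_list (inv \<sigma>) vs))"
proof -
  have m: "mlf p (\<lambda>vs. tens s (permute_list (inv \<sigma>) vs) \<phi>)" if "mlf p \<phi>" for \<phi>
    by (subst mlf_cong[OF tens_app]) (use that mlf_permute[OF that permutes_inv[OF assms]] in auto)
  show "tmulti p p (hext G (\<lambda>ds vs. tscale (c ds) (tens s (permute_list (inv \<sigma>) vs))))"
    by (rule hext_tensor(1)[OF _ m]) (auto intro: tens_in)
  show "homs G ds vs \<Longrightarrow> length vs = p \<Longrightarrow> hext G (\<lambda>ds vs. tscale (c ds) (tens s (permute_list (inv \<sigma>) vs))) vs =
      tscale (c ds) (tens s (permute_list (inv \<sigma>) vs))"
    by (rule hext_tensor(2)[OF _ m]) (auto intro: tens_in)
qed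

lemma tperm_in: "\<sigma> permutes {..<p} \<Longrightarrow> t \<in> tpow s p \<Longrightarrow> tperm s G \<sigma> t \<in> tpow s p"
  unfolding tperm_def by (rule tlift_in[OF tperm_multi(1)])

lemma tperm_lin: "tperm s G \<sigma> (tscale c t + u) = tscale c (tperm s G \<sigma> t) + tperm s G \<sigma> u" "tperm s G \<sigma> 0 = 0"
  unfolding tperm_def by (rule tlift_lin tlift_0)+

lemma tperm_inv_tens:
  assumes "\<sigma> permutes {..<p}" "homs G ds vs" "length vs = p"
  shows "tperm s G (inv \<sigma>) (tens s vs) = tscale (sg (isum p \<sigma> (\<lambda>i. ds ! i))) (tens s (permute_list \<sigma> vs))"
  unfolding tperm_def using tlift_tens[OF tperm_multi(1)[OF permutes_inv[OF assms(1)]] assms(3)]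
    tperm_multi(2)[OF permutes_inv[OF assms(1)] assms(2,3), of "\<lambda>ds. sg (koszul (inv \<sigma>) ds)"] assms
  by (simp add: koszul_inv permutes_inv_inv homs_length)

lemma pform_permute:
  assumes s: "\<sigma> permutes {..<p}" "length fs = p" "length vs = p"
  shows "pform fs (permute_list (inv \<sigma>) vs) = pform (permute_list \<sigma> fs) vs"
proof -
  have "pform fs (permute_list (inv \<sigma>) vs) = (\<Prod>i<p. (fs ! i) (vs ! inv \<sigma> i))"
    unfolding pform_def using assms permutes_inv[OF s(1)] by (intro prod.cong) (auto simp: permute_list_nth)
  also have "\<dots> = (\<Prod>i<p. (fs ! \<sigma> i) (vs ! i))"
    by (rule prod.reindex_bij_witness[where i=\<sigma> and j="inv \<sigma>"])
      (use permutes_inverses[OF s(1)] permutes_lt[OF s(1)] permutes_lt[OF permutes_inv[OF s(1)]] in auto)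
  also have "\<dots> = pform (permute_list \<sigma> fs) vs"
    unfolding pform_def using assms by (intro prod.cong) (auto simp: permute_list_nth)
  finally show ?thesis .
qed

text \<open>Evaluation turns the action on tensors into the action on the list of functionals. By
  \<open>pform_vanish\<close> the sign can be written in the degrees of the functionals, where it is
  a constant and leaves the evaluation.\<close>

lemma tperm_pform:
  assumes s: "\<sigma> permutes {..<p}" and t: "t \<in> tpow s p" and fs: "homs dual es fs" "length fs = p"
  shows "tperm s G \<sigma> t (pform fs) = sg (isum p \<sigma> (\<lambda>i. es ! i)) * t (pform (permute_list \<sigma> fs))"
proof -
  have es: "length es = p" using fs by (simp add: homs_length)
  have m: "mlf p (pform fs)" by (rule mlf_pform_hom[OF fs])
  have fs': "homs dual (permute_list \<sigma> es) (permute_list \<sigma> fs)" "length (permute_list \<sigma> fs) = p"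
    using s fs es by (auto simp: homs_permute)
  have m': "mlf p (pform (permute_list \<sigma> fs))"
    by (rule mlf_pform_hom[OF fs'])
  have m'': "mlf p (\<lambda>vs. pform fs (permute_list (inv \<sigma>) vs))"
    by (rule mlf_permute[OF m permutes_inv[OF s]])
  have "tperm s G \<sigma> t (pform fs) = t (hext G (\<lambda>ds vs. sg (koszul \<sigma> ds) * tens s (permute_list (inv \<sigma>) vs) (pform fs)))"
    by (simp add: tperm_def tlift_def hext_app tscale_def)
  also have "\<dots> = t (hext G (\<lambda>ds vs. sg (koszul \<sigma> ds) * pform fs (permute_list (inv \<sigma>) vs)))"
    by (rule tpow_cong[OF t], rule hext_cong_length) (use m in \<open>auto simp: tens_app\<close>)
  also have "\<dots> = t (\<lambda>vs. sg (isum p \<sigma> (\<lambda>i. es ! i)) * pform (permute_list \<sigma> fs) vs)"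
  proof (rule tpow_cong_hom[OF t hext_scaled(1)[OF m''] mlf_scale[OF m']])
    fix ds vs assume h: "homs G ds vs" "length vs = p" "length ds = p"
    have "sg (koszul \<sigma> ds) * pform (permute_list \<sigma> fs) vs = sg (isum p \<sigma> (\<lambda>i. es ! i)) * pform (permute_list \<sigma> fs) vs"
    proof (cases "pform (permute_list \<sigma> fs) vs = 0")
      case False
      have e: "permute_list \<sigma> es = map uminus ds"
        using pform_vanish[OF fs'(1) h(1) _ False] fs'(2) h by simp
      have "ds ! inv \<sigma> i = - (es ! i)" if "i < p" for i
        using arg_cong[OF e, of "\<lambda>l. l ! inv \<sigma> i"] s that es h permutes_lt[OF permutes_inv[OF s], of i]
        by (simp add: permute_list_nth permutes_inverses)
      then have "isum p \<sigma> (\<lambda>i. ds ! inv \<sigma> i) = isum p \<sigma> (\<lambda>i. es ! i)"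
        unfolding isum_def using permutes_lt[OF s] by (intro sum.cong refl) auto
      then show ?thesis by (simp add: koszul_eq[OF s h(3)])
    qed simp
    then show "hext G (\<lambda>ds vs. sg (koszul \<sigma> ds) * pform fs (permute_list (inv \<sigma>) vs)) vs =
      sg (isum p \<sigma> (\<lambda>i. es ! i)) * pform (permute_list \<sigma> fs) vs"
      using hext_scaled(2)[OF m'' h(1,2)] pform_permute[OF s fs(2) h(2)] by simp
  qed
  also have "\<dots> = sg (isum p \<sigma> (\<lambda>i. es ! i)) * t (pform (permute_list \<sigma> fs))"
    by (rule tpow_scale_form[OF t m'])
  finally show ?thesis .
qed

lemma tpair_eq:
  assumes t: "t \<in> tpow s p" and fs: "homs dual es fs" "length fs = p"
  shows "tpair G es fs t = sg (psum es) * t (pform fs)"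
proof -
  have m: "mlf p (pform fs)" by (rule mlf_pform_hom[OF fs])
  let ?e = "\<lambda>ds. \<Sum>(i, j)\<in>{(i, j). i < j \<and> j < length fs}. es ! j * ds ! i"
  have "tpair G es fs t = t (hext G (\<lambda>ds vs. sg (?e ds) * pform fs vs))"
    by (simp add: tpair_def pform_def)
  also have "\<dots> = t (\<lambda>vs. sg (psum es) * pform fs vs)"
  proof (rule tpow_cong_hom[OF t hext_scaled(1)[OF m] mlf_scale[OF m]])
    fix ds vs assume h: "homs G ds vs" "length vs = p" "length ds = p"
    have "sg (?e ds) * pform fs vs = sg (psum es) * pform fs vs"
    proof (cases "pform fs vs = 0")
      case False
      have e: "es = map uminus ds"
        using pform_vanish[OF fs(1) h(1) _ False] fs(2) h by simp
      have "?e ds = - psum es"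
        unfolding psum_def sum_negf[symmetric] by (rule sum.cong) (auto simp: e fs(2) h)
      then have "(sg (?e ds) :: 'k) = sg (psum es)" by (simp add: sg_if)
      then show ?thesis by simp
    qed simp
    then show "hext G (\<lambda>ds vs. sg (?e ds) * pform fs vs) vs = sg (psum es) * pform fs vs"
      using hext_scaled(2)[OF m h(1,2), of "\<lambda>ds. sg (?e ds)"] by simp
  qed
  also have "\<dots> = sg (psum es) * t (pform fs)"
    by (rule tpow_scale_form[OF t m])
  finally show ?thesis .
qed

section \<open>Tensor products of tensors and of endomorphisms\<close>

lemma mlf_append: "mlf (i + j) \<phi> \<Longrightarrow> length vs = i \<Longrightarrow> mlf j (\<lambda>ws. \<phi> (vs @ ws))"
  by (rule mlfI) (use mlfD[of "i + j" \<phi> "vs @ xs" "i + k" for xs k] in \<open>simp add: list_update_append\<close>)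

lemma mlf_append': "mlf (i + j) \<phi> \<Longrightarrow> length ws = j \<Longrightarrow> mlf i (\<lambda>vs. \<phi> (vs @ ws))"
proof (rule mlfI)
  fix xs :: "'a list" and k c x y
  assume "mlf (i + j) \<phi>" "length ws = j" "length xs = i" "k < i"
  then show "\<phi> (xs[k := s c x + y] @ ws) = c * \<phi> (xs[k := x] @ ws) + \<phi> (xs[k := y] @ ws)"
    using mlfD[of "i + j" \<phi> "xs @ ws" k c x y] by (simp add: list_update_append)
qed

lemma mlf_inner:
  assumes u: "u \<in> tpow s j" and \<phi>: "mlf (i + j) \<phi>" shows "mlf i (\<lambda>vs. u (\<lambda>ws. \<phi> (vs @ ws)))"
proof (rule mlfI)
  fix xs :: "'a list" and k c x y assume a: "length xs = i" "k < i"
  have "u (\<lambda>ws. \<phi> (xs[k := s c x + y] @ ws)) = u (\<lambda>ws. c * \<phi> (xs[k := x] @ ws) + \<phi> (xs[k := y] @ ws))"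
    using mlfD[OF mlf_append'[OF \<phi>] a] by (intro tpow_cong[OF u]) simp
  also have "\<dots> = c * u (\<lambda>ws. \<phi> (xs[k := x] @ ws)) + u (\<lambda>ws. \<phi> (xs[k := y] @ ws))"
    using a by (intro tpow_lin[OF u] mlf_append[OF \<phi>]) auto
  finally show "u (\<lambda>ws. \<phi> (xs[k := s c x + y] @ ws)) = c * u (\<lambda>ws. \<phi> (xs[k := x] @ ws)) + u (\<lambda>ws. \<phi> (xs[k := y] @ ws))" .
qed

lemma tprod_app:
  assumes t: "t \<in> tpow s i" and u: "u \<in> tpow s j" and \<phi>: "mlf (i + j) \<phi>"
  shows "tprod s t u \<phi> = t (\<lambda>vs. u (\<lambda>ws. \<phi> (vs @ ws)))"
  unfolding tprod_def tlift_def
  by (rule tpow_cong[OF t], rule tpow_cong[OF u]) (use \<phi> in \<open>simp add: tens_app\<close>)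

lemma tprod_in:
  assumes t: "t \<in> tpow s i" and u: "u \<in> tpow s j" shows "tprod s t u \<in> tpow s (i + j)"
proof -
  have m1: "tmulti j (i + j) (\<lambda>ws. tens s (vs @ ws))" if "length vs = i" for vs
    unfolding tmulti_def
  proof (intro conjI allI impI tens_in)
    fix \<phi> assume \<phi>: "mlf (i + j) \<phi>"
    show "mlf j (\<lambda>ws. tens s (vs @ ws) \<phi>)"
      by (subst mlf_cong[OF tens_app]) (use that \<phi> mlf_append[OF \<phi> that] in auto)
  qed (use that in simp)
  have m2: "tmulti i (i + j) (\<lambda>vs. tlift (\<lambda>ws. tens s (vs @ ws)) u)"
    unfolding tmulti_def
  proof (intro conjI allI impI)
    fix \<phi> assume \<phi>: "mlf (i + j) \<phi>"
    have "mlf i (\<lambda>vs. tlift (\<lambda>ws. tens s (vs @ ws)) u \<phi>) \<longleftrightarrow> mlf i (\<lambda>vs. u (\<lambda>ws. \<phi> (vs @ ws)))"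
      unfolding tlift_def by (rule mlf_cong, rule tpow_cong[OF u]) (use \<phi> in \<open>simp add: tens_app\<close>)
    then show "mlf i (\<lambda>vs. tlift (\<lambda>ws. tens s (vs @ ws)) u \<phi>)" using mlf_inner[OF u \<phi>] by simp
  qed (use tlift_in[OF m1 u] in auto)
  show ?thesis unfolding tprod_def by (rule tlift_in[OF m2 t])
qed

lemma tprod_pform:
  assumes t: "t \<in> tpow s i" and u: "u \<in> tpow s j" and fs: "\<forall>f\<in>set (fs @ gs). linf f" "length fs = i" "length gs = j"
  shows "tprod s t u (pform (fs @ gs)) = t (pform fs) * u (pform gs)"
proof -
  have m: "mlf i (pform fs)" "mlf j (pform gs)" "mlf (i + j) (pform (fs @ gs))"
    using fs by (auto intro!: mlf_pform)
  have "tprod s t u (pform (fs @ gs)) = t (\<lambda>vs. u (\<lambda>ws. pform fs vs * pform gs ws))"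
    unfolding tprod_app[OF t u m(3)]
    by (rule tpow_cong[OF t], rule tpow_cong[OF u]) (use fs in \<open>simp add: pform_append\<close>)
  also have "\<dots> = t (\<lambda>vs. u (pform gs) * pform fs vs)"
    unfolding tpow_scale_form[OF u m(2)] by (simp only: mult.commute)
  finally show ?thesis by (simp add: tpow_scale_form[OF t m(1)])
qed

definition endo :: "nat \<Rightarrow> (('k, 'a) tensor \<Rightarrow> ('k, 'a) tensor) \<Rightarrow> bool" where
  "endo p F \<longleftrightarrow> (\<forall>t\<in>tpow s p. F t \<in> tpow s p) \<and>
     (\<forall>t\<in>tpow s p. \<forall>u\<in>tpow s p. \<forall>c. F (tscale c t + u) = tscale c (F t) + F u)"

lemma endo_id: "endo p id"
  by (simp add: endo_def)

lemma endo_tens_mlf: assumes "endo p F" shows "mlf p (\<lambda>vs. F (tens s vs) \<phi>)"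
proof (rule mlfI)
  fix xs :: "'a list" and k c x y assume a: "length xs = p" "k < p"
  have "tens s (xs[k := s c x + y]) = tscale c (tens s (xs[k := x])) + tens s (xs[k := y])"
    by (rule multilinD[OF tens_multilin]) (use a in auto)
  moreover have "tens s (xs[k := x]) \<in> tpow s p" "tens s (xs[k := y]) \<in> tpow s p" using a by (auto intro: tens_in)
  ultimately have "F (tens s (xs[k := s c x + y])) = tscale c (F (tens s (xs[k := x]))) + F (tens s (xs[k := y]))"
    using assms unfolding endo_def by metis
  then show "F (tens s (xs[k := s c x + y])) \<phi> = c * F (tens s (xs[k := x])) \<phi> + F (tens s (xs[k := y])) \<phi>"
    by (simp add: tscale_def)
qed

lemma endo_in: "endo p F \<Longrightarrow> length vs = p \<Longrightarrow> F (tens s vs) \<in> tpow s p"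
  by (auto simp: endo_def intro: tens_in)

lemma tmap_mlf:
  assumes F: "endo i F" and H: "endo j H" and \<phi>: "mlf (i + j) \<phi>"
  shows "mlf (i + j) (\<lambda>vs. tprod s (F (tens s (take i vs))) (H (tens s (drop i vs))) \<phi>)"
proof -
  \<comment> \<open>The form that remains for the first factor once the second has been evaluated.
    Varying one of the first i slots changes the argument of F; varying a later slot changes this
    form.\<close>
  let ?B = "\<lambda>ws as. H (tens s ws) (\<lambda>ws. \<phi> (as @ ws))"
  have e: "tprod s (F (tens s (take i vs))) (H (tens s (drop i vs))) \<phi> = F (tens s (take i vs)) (?B (drop i vs))"
    if "length vs = i + j" for vs
    by (rule tprod_app[OF endo_in[OF F] endo_in[OF H] \<phi>]) (use that in auto)
  have "mlf (i + j) (\<lambda>vs. F (tens s (take i vs)) (?B (drop i vs)))"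
  proof (rule mlfI)
    fix xs :: "'a list" and k c x y assume a: "length xs = i + j" "k < i + j"
    show "F (tens s (take i (xs[k := s c x + y]))) (?B (drop i (xs[k := s c x + y]))) =
      c * F (tens s (take i (xs[k := x]))) (?B (drop i (xs[k := x]))) + F (tens s (take i (xs[k := y]))) (?B (drop i (xs[k := y])))"
    proof (cases "k < i")
      case True
      then show ?thesis using mlfD[OF endo_tens_mlf[OF F], of "take i xs" k] a
        by (simp add: take_update_swap)
    next
      case False
      have B: "mlf i (?B ws)" if "length ws = j" for ws
        by (rule mlf_inner[OF endo_in[OF H that] \<phi>])
      have l: "length ((drop i xs)[k - i := z]) = j" for z using a by simp
      have "?B ((drop i xs)[k - i := s c x + y]) = (\<lambda>as. c * ?B ((drop i xs)[k - i := x]) as + ?B ((drop i xs)[k - i := y]) as)"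
        using mlfD[OF endo_tens_mlf[OF H], of "drop i xs" "k - i"] a False by (auto simp: fun_eq_iff)
      then have "F (tens s (take i xs)) (?B ((drop i xs)[k - i := s c x + y])) =
         c * F (tens s (take i xs)) (?B ((drop i xs)[k - i := x])) + F (tens s (take i xs)) (?B ((drop i xs)[k - i := y]))"
        using tpow_lin[OF endo_in[OF F] B[OF l] B[OF l], of "take i xs" c x y] a by simp
      then show ?thesis using False a
        by (simp add: drop_update_swap)
    qed
  qed
  then show ?thesis by (subst mlf_cong[OF e])
qed

lemma tmap_multi:
  assumes F: "endo i F" and H: "endo j H"
  shows "tmulti (i + j) (i + j) (hext G (\<lambda>ds vs. tscale (c ds) (tprod s (F (tens s (take i vs))) (H (tens s (drop i vs))))))"
    and "homs G ds vs \<Longrightarrow> length vs = i + j \<Longrightarrow>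
      hext G (\<lambda>ds vs. tscale (c ds) (tprod s (F (tens s (take i vs))) (H (tens s (drop i vs))))) vs =
      tscale (c ds) (tprod s (F (tens s (take i vs))) (H (tens s (drop i vs))))"
proof -
  have i: "tprod s (F (tens s (take i ws))) (H (tens s (drop i ws))) \<in> tpow s (i + j)" if "length ws = i + j" for ws
    by (rule tprod_in[OF endo_in[OF F] endo_in[OF H]]) (use that in auto)
  show "tmulti (i + j) (i + j) (hext G (\<lambda>ds vs. tscale (c ds) (tprod s (F (tens s (take i vs))) (H (tens s (drop i vs))))))"
    by (rule hext_tensor(1)[OF i tmap_mlf[OF F H]])
  show "homs G ds vs \<Longrightarrow> length vs = i + j \<Longrightarrow>
      hext G (\<lambda>ds vs. tscale (c ds) (tprod s (F (tens s (take i vs))) (H (tens s (drop i vs))))) vs =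
      tscale (c ds) (tprod s (F (tens s (take i vs))) (H (tens s (drop i vs))))"
    by (rule hext_tensor(2)[OF i tmap_mlf[OF F H]])
qed

lemma tmap_in: "endo i F \<Longrightarrow> endo j H \<Longrightarrow> t \<in> tpow s (i + j) \<Longrightarrow> tmap s G i F e H t \<in> tpow s (i + j)"
  unfolding tmap_def by (rule tlift_in[OF tmap_multi(1)])

lemma tmap_lin: "tmap s G i F e H (tscale c t + u) = tscale c (tmap s G i F e H t) + tmap s G i F e H u" "tmap s G i F e H 0 = 0"
  unfolding tmap_def by (rule tlift_lin tlift_0)+

lemma tmap_tens:
  assumes "endo i F" "endo j H" "homs G ds vs" "length vs = i + j"
  shows "tmap s G i F e H (tens s vs) =
    tscale (sg (e * sum_list (take i ds))) (tprod s (F (tens s (take i vs))) (H (tens s (drop i vs))))"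
  unfolding tmap_def using tlift_tens[OF tmap_multi(1)[OF assms(1,2)] assms(4)] tmap_multi(2)[OF assms] by simp

text \<open>For degree 0 the Koszul factor is 1 in all degrees, so the homogeneous extension is the
  form itself and t may be any tensor.\<close>

lemma tmap_app:
  assumes F: "endo i F" and H: "endo j H" and t: "t \<in> tpow s (i + j)" and \<phi>: "mlf (i + j) \<phi>"
  shows "tmap s G i F 0 H t \<phi> = t (\<lambda>vs. tprod s (F (tens s (take i vs))) (H (tens s (drop i vs))) \<phi>)"
proof -
  have m: "mlf (i + j) (\<lambda>vs. tprod s (F (tens s (take i vs))) (H (tens s (drop i vs))) \<phi>)"
    by (rule tmap_mlf[OF F H \<phi>])
  have "tmap s G i F 0 H t \<phi> = t (hext G (\<lambda>ds vs. 1 * tprod s (F (tens s (take i vs))) (H (tens s (drop i vs))) \<phi>))"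
    by (simp add: tmap_def tlift_def hext_app tscale_def)
  also have "\<dots> = t (\<lambda>vs. 1 * tprod s (F (tens s (take i vs))) (H (tens s (drop i vs))) \<phi>)"
    by (rule tpow_cong_hom[OF t hext_scaled(1)[OF m, of "\<lambda>_. 1"] mlf_scale[OF m, of 1]])
      (rule hext_scaled(2)[OF m, of _ _ "\<lambda>_. 1"])
  finally show ?thesis by simp
qed

section \<open>Outer multiplications and contraction\<close>

lemma linf_lmult: "linf f \<Longrightarrow> linf (\<lambda>v. f (a * v))" and linf_rmult: "linf f \<Longrightarrow> linf (\<lambda>v. f (v * a))"
  by (simp_all add: linf_def scale_mult_left scale_mult_right distrib_left distrib_right)

lemma lmul_multi: "tmulti (Suc p) (Suc p) (\<lambda>vs. tens s ((a * hd vs) # tl vs))"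
  and rmul_multi: "tmulti (Suc p) (Suc p) (\<lambda>vs. tens s (butlast vs @ [last vs * a]))"
proof -
  have "mlf (Suc p) (\<lambda>vs. tens s ((a * hd vs) # tl vs) \<phi>)" if \<phi>: "mlf (Suc p) \<phi>" for \<phi>
  proof (subst mlf_cong[OF tens_app], use \<phi> in simp, rule mlfI)
    fix xs :: "'a list" and i c x y assume a: "length xs = Suc p" "i < Suc p"
    obtain v vs where xs: "xs = v # vs" "length vs = p" using a by (cases xs) auto
    show "\<phi> (a * hd (xs[i := s c x + y]) # tl (xs[i := s c x + y])) =
       c * \<phi> (a * hd (xs[i := x]) # tl (xs[i := x])) + \<phi> (a * hd (xs[i := y]) # tl (xs[i := y]))"
      using linfD[OF mlf_hd[OF \<phi> xs(2)], of c "a * x" "a * y"] mlfD[OF mlf_Cons[OF \<phi>] xs(2), of "i - 1" "a * v" c x y] a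
      by (cases i) (auto simp: xs distrib_left scale_mult_right)
  qed
  then show "tmulti (Suc p) (Suc p) (\<lambda>vs. tens s ((a * hd vs) # tl vs))"
    by (auto simp: tmulti_def intro: tens_in)
  have "mlf (Suc p) (\<lambda>vs. tens s (butlast vs @ [last vs * a]) \<phi>)" if \<phi>: "mlf (Suc p) \<phi>" for \<phi>
  proof (subst mlf_cong[OF tens_app], use \<phi> in simp, rule mlfI)
    fix xs :: "'a list" and i c x y assume a: "length xs = Suc p" "i < Suc p"
    obtain v vs where xs: "xs = vs @ [v]" "length vs = p" using a by (cases xs rule: rev_cases) auto
    show "\<phi> (butlast (xs[i := s c x + y]) @ [last (xs[i := s c x + y]) * a]) =
       c * \<phi> (butlast (xs[i := x]) @ [last (xs[i := x]) * a]) + \<phi> (butlast (xs[i := y]) @ [last (xs[i := y]) * a])"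
    proof (cases "i = p")
      case True
      then show ?thesis using mlfD[OF \<phi>, of "vs @ [0]" p c "x * a" "y * a"] a xs
        by (simp add: distrib_right scale_mult_left list_update_append)
    next
      case False
      then show ?thesis using mlfD[OF \<phi>, of "vs @ [v * a]" i c x y] a xs
        by (simp add: list_update_append butlast_append)
    qed
  qed
  then show "tmulti (Suc p) (Suc p) (\<lambda>vs. tens s (butlast vs @ [last vs * a]))"
    by (auto simp: tmulti_def intro: tens_in)
qed

lemma lmul_in: "t \<in> tpow s (Suc p) \<Longrightarrow> lmul s a t \<in> tpow s (Suc p)"
  and rmul_in: "t \<in> tpow s (Suc p) \<Longrightarrow> rmul s t a \<in> tpow s (Suc p)"
  unfolding lmul_def rmul_def by (rule tlift_in[OF lmul_multi] tlift_in[OF rmul_multi], assumption)+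

lemma lmul_pform:
  assumes t: "t \<in> tpow s (Suc p)" and fs: "\<forall>f\<in>set (f # fs). linf f" "length fs = p"
  shows "lmul s a t (pform (f # fs)) = t (pform ((\<lambda>v. f (a * v)) # fs))"
  unfolding lmul_def tlift_def
proof (rule tpow_cong[OF t])
  fix vs :: "'a list" assume l: "length vs = Suc p"
  have "mlf (Suc p) (pform (f # fs))" using fs by (intro mlf_pform) auto
  then show "tens s (a * hd vs # tl vs) (pform (f # fs)) = pform ((\<lambda>v. f (a * v)) # fs) vs"
    using l by (cases vs) (simp_all add: tens_app)
qed

lemma rmul_pform:
  assumes t: "t \<in> tpow s (Suc p)" and fs: "\<forall>f\<in>set (fs @ [f]). linf f" "length fs = p"
  shows "rmul s t b (pform (fs @ [f])) = t (pform (fs @ [\<lambda>v. f (v * b)]))"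
  unfolding rmul_def tlift_def
proof (rule tpow_cong[OF t])
  fix vs :: "'a list" assume l: "length vs = Suc p"
  have "mlf (Suc p) (pform (fs @ [f]))" using fs by (intro mlf_pform) auto
  then show "tens s (butlast vs @ [last vs * b]) (pform (fs @ [f])) = pform (fs @ [\<lambda>v. f (v * b)]) vs"
    using l fs(2) by (cases vs rule: rev_cases) (simp_all add: tens_app pform_append)
qed

text \<open>On a pure tensor the vector is the first factor, scaled by the value of
  \<open>fs\<close> at the others. It is independent of g; this later supplies the algebra-valued
  component of the maps.\<close>

lemma contraction:
  assumes "t \<in> tpow s (Suc p)" "\<forall>f\<in>set fs. linf f" "length fs = p"
  shows "\<exists>x. \<forall>g. linf g \<longrightarrow> t (pform (g # fs)) = g x"
  using assms(1)
proof (induction rule: tpow_induct)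
  case zero
  show ?case by (intro exI[of _ 0]) (simp add: linf_zero)
next
  case (comb c t u)
  then obtain x y where "\<forall>g. linf g \<longrightarrow> t (pform (g # fs)) = g x" "\<forall>g. linf g \<longrightarrow> u (pform (g # fs)) = g y" by blast
  then show ?case by (intro exI[of _ "s c x + y"]) (simp add: linfD tscale_def)
next
  case (tens vs)
  then obtain w ws where vs: "vs = w # ws" by (cases vs) auto
  have "mlf (Suc p) (pform (g # fs))" if "linf g" for g using that assms(2,3) by (intro mlf_pform) auto
  then show ?case using tens
    by (intro exI[of _ "s (pform fs ws) w"]) (auto simp: tens_app vs linf_scale mult.commute)
qed

lemma dual_lmult: "f \<in> dual e \<Longrightarrow> a \<in> G d \<Longrightarrow> (\<lambda>v. f (a * v)) \<in> dual (e + d)"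
  and dual_rmult: "f \<in> dual e \<Longrightarrow> a \<in> G d \<Longrightarrow> (\<lambda>v. f (v * a)) \<in> dual (e + d)"
  unfolding dual_iff by (auto simp: linf_lmult linf_rmult add_ac) (metis G_mult add.assoc add.commute)+

end

section \<open>The sign of the bracket formula\<close>

text \<open>
  The sign relating \<open>(f\<^sub>1 \<otimes> \<dots> \<otimes> f\<^sub>p)\<close>, evaluated without Koszul signs, at the bracket of the \<open>a\<^sub>i\<close> to the form on
  \<open>a\<^sub>p, t f\<^sub>p, \<dots>, a\<^sub>1, t f\<^sub>1\<close>. It equals the sign of the theorem because the total degree is even where the form does
  not vanish.
\<close>

fun tsg :: "int list \<Rightarrow> int list \<Rightarrow> int" where
  "tsg (d # ds) (e # es) = int (length ds) * d + sum_list es + d * sum_list ds + e * sum_list ds + e * d + tsg ds es"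
| "tsg _ _ = 0"

text \<open>Cutting a list of pairs in two leaves cross terms in lengths and total degrees only.
  This governs the sign of a composition of brackets, where a block of arguments is replaced by one
  vector.\<close>

lemma tsg_append:
  "length ds = length es \<Longrightarrow> length ds' = length es' \<Longrightarrow>
   tsg (ds @ ds') (es @ es') = tsg ds es + tsg ds' es' + int (length ds') * sum_list ds + int (length ds) * sum_list es'
     + sum_list ds * sum_list ds' + sum_list es * sum_list ds'"
  by (induction ds es rule: list_induct2) (auto simp: algebra_simps)

lemma tsg_hd: "ds \<noteq> [] \<Longrightarrow> tsg ds ((e + c) # es) = tsg ds (e # es) + c * sum_list ds"
  by (cases ds) (auto simp: algebra_simps)

section \<open>Sums over pairs of positions and inversions\<close>

lemma pairs_finite: "finite {(i, j). i < j \<and> j < (n::nat) \<and> Q i j}"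
  by (rule finite_subset[of _ "{..<n} \<times> {..<n}"]) auto

lemma pairs_finite': "finite {(i, j). i < j \<and> j < (n::nat)}"
  by (rule finite_subset[of _ "{..<n} \<times> {..<n}"]) auto

lemma pairs_nested: "(\<Sum>(i, j)\<in>{(i, j). i < j \<and> j < n}. F i j) = (\<Sum>j<n. \<Sum>i<j. F i j)"
  for F :: "nat \<Rightarrow> nat \<Rightarrow> int"
  by (subst sum.Sigma) (auto intro!: sum.reindex_bij_witness[where i="\<lambda>(j, i). (i, j)" and j="\<lambda>(i, j). (j, i)"])

lemma pairs_Suc: "(\<Sum>(i, j)\<in>{(i, j). i < j \<and> j < Suc n}. F i j) =
    (\<Sum>j<n. F 0 (Suc j)) + (\<Sum>(i, j)\<in>{(i, j). i < j \<and> j < n}. F (Suc i) (Suc j))"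
  for F :: "nat \<Rightarrow> nat \<Rightarrow> int"
  unfolding pairs_nested by (simp add: sum.lessThan_Suc_shift sum.distrib del: sum.lessThan_Suc)

lemma sum_list_nth': "sum_list xs = (\<Sum>i<length xs. xs ! i)" for xs :: "int list"
  by (simp add: sum_list_sum_nth atLeast0LessThan)

lemma tsg_index:
  "length ds = p \<Longrightarrow> length es = p \<Longrightarrow> tsg ds es =
    (\<Sum>(i, j)\<in>{(i, j). i < j \<and> j < p}. ds ! i + es ! j + ds ! i * ds ! j + es ! i * ds ! j) + (\<Sum>i<p. es ! i * ds ! i)"
proof (induction ds es arbitrary: p rule: tsg.induct)
  case (1 d ds e es)
  then obtain q where p: "p = Suc q" "length ds = q" "length es = q" by auto
  show ?case unfolding p(1) pairs_Suc
    using 1(1)[OF p(2,3)] p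
    by (simp add: sum.lessThan_Suc_shift sum.distrib sum_list_nth' sum_distrib_left del: sum.lessThan_Suc)
qed auto

text \<open>Reordering by \<sigma> changes the orientation of exactly the inverted pairs, so the
  correction is F on each of them minus F on its reversal.\<close>

lemma pairs_permute:
  fixes F :: "nat \<Rightarrow> nat \<Rightarrow> int"
  assumes s: "\<sigma> permutes {..<p}"
  shows "(\<Sum>(i, j)\<in>{(i, j). i < j \<and> j < p}. F (\<sigma> i) (\<sigma> j)) = (\<Sum>(i, j)\<in>{(i, j). i < j \<and> j < p}. F i j)
    + (\<Sum>(i, j)\<in>{(i, j). i < j \<and> j < p \<and> \<sigma> i > \<sigma> j}. F (\<sigma> i) (\<sigma> j) - F (\<sigma> j) (\<sigma> i))"
proof -
  let ?A = "{(i, j). i < j \<and> j < p \<and> \<sigma> i < \<sigma> j}" and ?B = "{(i, j). i < j \<and> j < p \<and> \<sigma> i > \<sigma> j}"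
  have inj: "\<sigma> i = \<sigma> j \<longleftrightarrow> i = j" for i j using permutes_inj[OF s] by (auto dest: injD)
  have inj': "inv \<sigma> i = inv \<sigma> j \<longleftrightarrow> i = j" for i j using permutes_inj[OF permutes_inv[OF s]] by (auto dest: injD)
  have fin: "finite ?A" "finite ?B" by (rule pairs_finite)+
  have dj: "?A \<inter> ?B = {}" by auto
  have "\<sigma> i < \<sigma> j \<or> \<sigma> j < \<sigma> i" if "i < j" for i j using that inj by (metis less_irrefl linorder_neqE_nat)
  then have un: "{(i, j). i < j \<and> j < p} = ?A \<union> ?B" by blast
  have l: "(\<Sum>(i, j)\<in>{(i, j). i < j \<and> j < p}. F (\<sigma> i) (\<sigma> j)) = (\<Sum>(i, j)\<in>?A. F (\<sigma> i) (\<sigma> j)) + (\<Sum>(i, j)\<in>?B. F (\<sigma> i) (\<sigma> j))"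
    unfolding un by (rule sum.union_disjoint[OF fin dj])
  let ?C = "{(i, j). i < j \<and> j < p \<and> inv \<sigma> i < inv \<sigma> j}" and ?D = "{(i, j). i < j \<and> j < p \<and> inv \<sigma> i > inv \<sigma> j}"
  have fin': "finite ?C" "finite ?D" by (rule pairs_finite)+
  have dj': "?C \<inter> ?D = {}" by auto
  have "inv \<sigma> i < inv \<sigma> j \<or> inv \<sigma> j < inv \<sigma> i" if "i < j" for i j using that inj' by (metis less_irrefl linorder_neqE_nat)
  then have un': "{(i, j). i < j \<and> j < p} = ?C \<union> ?D" by blast
  have r: "(\<Sum>(i, j)\<in>{(i, j). i < j \<and> j < p}. F i j) = (\<Sum>(i, j)\<in>?C. F i j) + (\<Sum>(i, j)\<in>?D. F i j)"
    unfolding un' by (rule sum.union_disjoint[OF fin' dj'])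
  have "(\<Sum>(i, j)\<in>?A. F (\<sigma> i) (\<sigma> j)) = (\<Sum>(i, j)\<in>?C. F i j)"
    by (rule sum.reindex_bij_witness[where i="\<lambda>(i, j). (inv \<sigma> i, inv \<sigma> j)" and j="\<lambda>(i, j). (\<sigma> i, \<sigma> j)"])
      (use permutes_inverses[OF s] permutes_lt[OF s] permutes_lt[OF permutes_inv[OF s]] in auto)
  moreover have "(\<Sum>(i, j)\<in>?B. F (\<sigma> j) (\<sigma> i)) = (\<Sum>(i, j)\<in>?D. F i j)"
    by (rule sum.reindex_bij_witness[where i="\<lambda>(i, j). (inv \<sigma> j, inv \<sigma> i)" and j="\<lambda>(i, j). (\<sigma> j, \<sigma> i)"])
      (use permutes_inverses[OF s] permutes_lt[OF s] permutes_lt[OF permutes_inv[OF s]] in auto)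
  ultimately show ?thesis unfolding l r by (simp add: sum_subtractf case_prod_unfold)
qed

definition ninv :: "nat \<Rightarrow> (nat \<Rightarrow> nat) \<Rightarrow> int" where
  "ninv p \<sigma> = int (card {(i, j). i < j \<and> j < p \<and> \<sigma> i > \<sigma> j})"

lemma ninv_sum: "ninv p \<sigma> = (\<Sum>(i, j)\<in>{(i, j). i < j \<and> j < p}. if \<sigma> i > \<sigma> j then 1 else 0)"
proof -
  have "(\<Sum>(i, j)\<in>{(i, j). i < j \<and> j < p}. if \<sigma> i > \<sigma> j then (1::int) else 0) =
    (\<Sum>(i, j)\<in>{(i, j). i < j \<and> j < p \<and> \<sigma> i > \<sigma> j}. 1)"
    by (rule sum.mono_neutral_cong_right) (auto simp: pairs_finite' split: if_splits)
  then show ?thesis by (simp add: ninv_def case_prod_unfold)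
qed

lemma even_sum: "(\<And>x. x \<in> S \<Longrightarrow> even (f x)) \<Longrightarrow> even (\<Sum>x\<in>S. f x :: int)"
  by (rule dvd_sum)

text \<open>Apply \<open>pairs_permute\<close> to the indicator of the inversions of \<tau>: each
  inversion of \<sigma> contributes 1 or -1, hence 2 or 0 after adding 1.\<close>

lemma ninv_comp:
  assumes s: "\<sigma> permutes {..<p}" and t: "\<tau> permutes {..<p}"
  shows "even (ninv p (\<tau> \<circ> \<sigma>) + ninv p \<tau> + ninv p \<sigma>)"
proof -
  let ?F = "\<lambda>i j. if \<tau> i > \<tau> j then 1 else (0::int)"
  let ?I = "{(i, j). i < j \<and> j < p \<and> \<sigma> i > \<sigma> j}"
  have inj: "\<sigma> i = \<sigma> j \<longleftrightarrow> i = j" "\<tau> i = \<tau> j \<longleftrightarrow> i = j" for i j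
    using permutes_inj[OF s] permutes_inj[OF t] by (auto dest: injD)
  have "ninv p (\<tau> \<circ> \<sigma>) = ninv p \<tau> + (\<Sum>(i, j)\<in>?I. ?F (\<sigma> i) (\<sigma> j) - ?F (\<sigma> j) (\<sigma> i))"
    using pairs_permute[OF s, of ?F] by (simp add: ninv_sum)
  moreover have "ninv p \<sigma> = (\<Sum>(i, j)\<in>?I. 1)" by (simp add: ninv_def case_prod_unfold)
  ultimately have e1: "ninv p (\<tau> \<circ> \<sigma>) + ninv p \<tau> + ninv p \<sigma> =
      2 * ninv p \<tau> + (\<Sum>(i, j)\<in>?I. ?F (\<sigma> i) (\<sigma> j) - ?F (\<sigma> j) (\<sigma> i) + 1)"
    by (simp add: sum.distrib case_prod_unfold)
  have e2: "even (\<Sum>(i, j)\<in>?I. ?F (\<sigma> i) (\<sigma> j) - ?F (\<sigma> j) (\<sigma> i) + 1)"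
    by (rule even_sum) (auto simp: not_less order.order_iff_strict inj)
  show ?thesis unfolding e1 by (rule dvd_add[OF dvd_triv_left e2])
qed

text \<open>For n = b - a there are n inversions starting at a and n - 1 further ones ending at b,
  an odd number in total.\<close>

lemma ninv_transpose:
  assumes "a < b" "b < p" shows "odd (ninv p (transpose a b))"
proof -
  have "{(i, j). i < j \<and> j < p \<and> transpose a b i > transpose a b j} =
      ((\<lambda>j. (a, j)) ` {a<..b}) \<union> ((\<lambda>i. (i, b)) ` {a<..<b})"
    using assms by (auto simp: transpose_def split: if_splits)
  moreover have "card (((\<lambda>j. (a, j)) ` {a<..b}) \<union> ((\<lambda>i. (i, b)) ` {a<..<b})) = (b - a) + (b - a - 1)"
    by (subst card_Un_disjoint) (auto simp: card_image inj_on_def)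
  ultimately show ?thesis using assms unfolding ninv_def by (simp only:) presburger
qed

lemma sign_ninv:
  assumes "\<sigma> permutes {..<p}" shows "(of_int (sign \<sigma>) :: 'k::field) = sg (ninv p \<sigma>)"
proof -
  have fin: "finite {..<p}" by simp
  show ?thesis using assms fin
  proof (induction rule: permutes_induct)
    case id
    have "{(i, j). i < j \<and> j < p \<and> id i > id j} = {}" by auto
    then show ?case unfolding ninv_def by (simp only: card.empty) simp
  next
    case (swap a b \<tau>)
    have pt: "transpose a b permutes {..<p}" using swap by (auto intro: permutes_swap_id)
    show ?case
    proof (cases "a = b")
      case True
      then show ?thesis using swap by simp
    next
      case False
      then have "odd (ninv p (transpose a b))"
        using ninv_transpose[of a b p] ninv_transpose[of b a p] swap by (cases "a < b") (auto simp: transpose_commute)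
      then have "even (ninv p (transpose a b \<circ> \<tau>)) \<longleftrightarrow> odd (ninv p \<tau>)"
        using ninv_comp[OF \<open>\<tau> permutes _\<close> pt] by auto
      moreover have "sign (transpose a b \<circ> \<tau>) = - sign \<tau>"
        using sign_compose[OF permutation_swap_id] \<open>\<tau> permutes _\<close> False permutation_permutes
        by (metis finite_lessThan minus_mult_left mult_1 sign_swap_id)
      moreover have "(of_int (sign \<tau>) :: 'k) = sg (ninv p \<tau>)" using swap by blast
      ultimately show ?thesis unfolding sg_if by (simp del: comp_apply)
    qed
  qed
qed

text \<open>The claim holds for each inverted pair separately. Read as signs: the Koszul signs of
  the vectors and of the functionals, the sign of \<sigma> and the change of \<open>tsg\<close>
  combine to the sign of permuting blocks \<open>a, t f\<close> of degree d + e + 1.\<close>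

lemma tsg_permute:
  assumes s: "\<sigma> permutes {..<p}" and l: "length ds = p" "length es = p"
  shows "even (tsg (permute_list \<sigma> ds) (permute_list \<sigma> es) + tsg ds es + isum p \<sigma> (\<lambda>i. ds ! i) + isum p \<sigma> (\<lambda>i. es ! i)
     + isum p \<sigma> (\<lambda>i. ds ! i + es ! i + 1) + ninv p \<sigma>)"
proof -
  let ?q = "\<lambda>i j. ds ! i + es ! j + ds ! i * ds ! j + es ! i * ds ! j"
  let ?I = "{(i, j). i < j \<and> j < p \<and> \<sigma> i > \<sigma> j}"
  have lp: "length (permute_list \<sigma> ds) = p" "length (permute_list \<sigma> es) = p" using l by auto
  have nth: "permute_list \<sigma> ds ! i = ds ! \<sigma> i" "permute_list \<sigma> es ! i = es ! \<sigma> i" if "i < p" for i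
    using that s l by (auto simp: permute_list_nth)
  have d: "(\<Sum>i<p. es ! \<sigma> i * ds ! \<sigma> i) = (\<Sum>i<p. es ! i * ds ! i)"
    using sum.permute[OF s, of "\<lambda>i. es ! i * ds ! i"] by (simp add: comp_def)
  have "tsg (permute_list \<sigma> ds) (permute_list \<sigma> es) =
     (\<Sum>(i, j)\<in>{(i, j). i < j \<and> j < p}. ?q (\<sigma> i) (\<sigma> j)) + (\<Sum>i<p. es ! \<sigma> i * ds ! \<sigma> i)"
    unfolding tsg_index[OF lp] by (intro arg_cong2[of _ _ _ _ "(+)"] sum.cong) (auto simp: nth)
  also have "\<dots> = tsg ds es + (\<Sum>(i, j)\<in>?I. ?q (\<sigma> i) (\<sigma> j) - ?q (\<sigma> j) (\<sigma> i))"
    unfolding tsg_index[OF l] d pairs_permute[OF s, of ?q] by simp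
  finally have e: "tsg (permute_list \<sigma> ds) (permute_list \<sigma> es) = tsg ds es + (\<Sum>(i, j)\<in>?I. ?q (\<sigma> i) (\<sigma> j) - ?q (\<sigma> j) (\<sigma> i))" .
  have n: "ninv p \<sigma> = (\<Sum>(i, j)\<in>?I. 1)" by (simp add: ninv_def case_prod_unfold)
  have "tsg (permute_list \<sigma> ds) (permute_list \<sigma> es) + tsg ds es + isum p \<sigma> (\<lambda>i. ds ! i) + isum p \<sigma> (\<lambda>i. es ! i)
     + isum p \<sigma> (\<lambda>i. ds ! i + es ! i + 1) + ninv p \<sigma> = 2 * tsg ds es + (\<Sum>(i, j)\<in>?I. (?q (\<sigma> i) (\<sigma> j) - ?q (\<sigma> j) (\<sigma> i))
      + ds ! \<sigma> i * ds ! \<sigma> j + es ! \<sigma> i * es ! \<sigma> j + (ds ! \<sigma> i + es ! \<sigma> i + 1) * (ds ! \<sigma> j + es ! \<sigma> j + 1) + 1)" (is "?lhs = _")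
    unfolding e n isum_def by (simp only: sum.distrib case_prod_unfold)
  note eq = this
  have ev: "even (\<Sum>(i, j)\<in>?I. (?q (\<sigma> i) (\<sigma> j) - ?q (\<sigma> j) (\<sigma> i))
      + ds ! \<sigma> i * ds ! \<sigma> j + es ! \<sigma> i * es ! \<sigma> j + (ds ! \<sigma> i + es ! \<sigma> i + 1) * (ds ! \<sigma> j + es ! \<sigma> j + 1) + 1)"
  proof (rule even_sum, clarify)
    fix i j
    have "even ((a + f + a * b + e * b - (b + e + b * a + f * a)) + a * b + e * f + (a + e + 1) * (b + f + 1) + 1)" for a b e f :: int
    proof -
      have e: "(a + f + a * b + e * b - (b + e + b * a + f * a)) + a * b + e * f + (a + e + 1) * (b + f + 1) + 1 =
        2 * (a * b + e * b + e * f + a + f + 1)" by (simp add: algebra_simps)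
      show ?thesis unfolding e by (rule dvd_triv_left)
    qed
    from this[of "ds ! \<sigma> i" "es ! \<sigma> j" "ds ! \<sigma> j" "es ! \<sigma> i"]
    show "even ((?q (\<sigma> i) (\<sigma> j) - ?q (\<sigma> j) (\<sigma> i))
      + ds ! \<sigma> i * ds ! \<sigma> j + es ! \<sigma> i * es ! \<sigma> j + (ds ! \<sigma> i + es ! \<sigma> i + 1) * (ds ! \<sigma> j + es ! \<sigma> j + 1) + 1)" by simp
  qed
  show ?thesis unfolding eq by (rule dvd_add[OF dvd_triv_left ev])
qed

section \<open>Cyclic permutations\<close>

lemma cycle_pow: "p \<ge> 1 \<Longrightarrow> (cycle_perm p ^^ k) i = (if i < p then (i + k) mod p else i)"
  by (induction k) (auto simp: cycle_perm_def mod_Suc_eq)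

lemma cycle_permutes: assumes "p \<ge> 1" shows "(cycle_perm p ^^ k) permutes {..<p}"
proof -
  have c: "cycle_perm p i = (if i < p then if Suc i = p then 0 else Suc i else i)" for i
    using assms by (auto simp: cycle_perm_def)
  have "inj_on (cycle_perm p) {..<p}" by (auto simp: inj_on_def c split: if_splits)
  moreover have "cycle_perm p ` {..<p} \<subseteq> {..<p}" by (auto simp: c)
  ultimately have "bij_betw (cycle_perm p) {..<p} {..<p}"
    using endo_inj_surj[of "{..<p}" "cycle_perm p"] by (simp add: bij_betw_def)
  then have cp: "cycle_perm p permutes {..<p}" by (intro bij_imp_permutes) (auto simp: c)
  show ?thesis
  proof (induction k)
    case (Suc k)
    show ?case unfolding funpow.simps by (rule permutes_compose[OF Suc cp])
  qed (simp add: permutes_id[unfolded id_def] id_def)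
qed

lemma cyclic_perms_sum: assumes "p \<ge> 1"
  shows "(\<Sum>\<sigma>\<in>cyclic_perms p. f \<sigma>) = (\<Sum>k<p. f (cycle_perm p ^^ k))"
proof -
  have "cyclic_perms p = (\<lambda>k. cycle_perm p ^^ k) ` {..<p}"
  proof -
    have "cycle_perm p ^^ k = cycle_perm p ^^ (k mod p)" for k
      using assms by (auto simp: fun_eq_iff cycle_pow mod_add_right_eq)
    moreover have "k mod p \<in> {..<p}" for k using assms by simp
    ultimately have "range (\<lambda>k. cycle_perm p ^^ k) \<subseteq> (\<lambda>k. cycle_perm p ^^ k) ` {..<p}"
      by (intro image_subsetI) (rule image_eqI)
    then show ?thesis unfolding cyclic_perms_def by (intro equalityI) (simp_all add: image_mono)
  qed
  moreover have "inj_on (\<lambda>k. cycle_perm p ^^ k) {..<p}"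
  proof (rule inj_onI)
    fix x y assume xy: "x \<in> {..<p}" "y \<in> {..<p}" and e: "cycle_perm p ^^ x = cycle_perm p ^^ y"
    show "x = y" using fun_cong[OF e, of 0] assms xy by (simp add: cycle_pow)
  qed
  ultimately show ?thesis by (simp add: sum.reindex)
qed

lemma permute_cycle: "length xs = p \<Longrightarrow> p \<ge> 1 \<Longrightarrow> permute_list (cycle_perm p ^^ k) xs = rotate k xs"
  by (intro nth_equalityI) (auto simp: permute_list_nth[OF cycle_permutes] cycle_pow nth_rotate add.commute)

text \<open>Rotation by k inverts exactly the pairs formed by one of the first k letters and one of
  the others, so the exponent is a product of two block degrees.\<close>

lemma isum_cycle:
  assumes "k < p" shows "isum p (cycle_perm p ^^ k) h = (\<Sum>i<k. h i) * (\<Sum>i\<in>{k..<p}. h i)"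
proof -
  have p: "p \<ge> 1" using assms by simp
  have a: "(i + k) mod p = (if i < p - k then i + k else i + k - p)" if "i < p" for i
    using that assms by (auto simp: mod_if le_mod_geq)
  have set: "{(i, j). i < j \<and> j < p \<and> (cycle_perm p ^^ k) i > (cycle_perm p ^^ k) j} = {..<p - k} \<times> {p - k..<p}"
    using assms by (auto simp: cycle_pow[OF p] a split: if_splits)
  have "isum p (cycle_perm p ^^ k) h = (\<Sum>(i, j)\<in>{..<p - k} \<times> {p - k..<p}. h (i + k) * h (j + k - p))"
    unfolding isum_def set by (rule sum.cong) (auto simp: cycle_pow[OF p] a)
  also have "\<dots> = (\<Sum>i<p - k. h (i + k)) * (\<Sum>j\<in>{p - k..<p}. h (j + k - p))"
    by (simp add: sum_product sum.cartesian_product)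
  also have "(\<Sum>i<p - k. h (i + k)) = (\<Sum>i\<in>{k..<p}. h i)"
    using assms by (intro sum.reindex_bij_witness[where i="\<lambda>i. i - k" and j="\<lambda>i. i + k"]) auto
  also have "(\<Sum>j\<in>{p - k..<p}. h (j + k - p)) = (\<Sum>i<k. h i)"
    using assms by (intro sum.reindex_bij_witness[where i="\<lambda>i. i + p - k" and j="\<lambda>j. j + k - p"]) auto
  finally show ?thesis by (simp add: mult.commute)
qed

text \<open>If the total is odd, one of the two exchanged blocks has even degree.\<close>

lemma isum_cycle_even:
  assumes "k < p" "odd (\<Sum>i<p. h i)" shows "even (isum p (cycle_perm p ^^ k) h)"
proof -
  have "(\<Sum>i<p. h i) = (\<Sum>i<k. h i) + (\<Sum>i\<in>{k..<p}. h i)"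
    using assms(1) by (subst sum.union_disjoint[symmetric]) (auto intro: sum.cong)
  then show ?thesis unfolding isum_cycle[OF assms(1)] using assms(2) by simp
qed

text \<open>Let a be the degree of the last vector, f that of the first functional and D, E the sums
  of the remaining degrees. Modulo 2 everything cancels except (a + f)(D + E + p + 1), and by the
  last hypothesis D + E + p has the parity of a + f.\<close>

lemma bracket_sign_tsg:
  assumes l: "length ds = p" "length es = p" "p \<ge> 1" and c: "even (sum_list ds + sum_list es + int p)"
  shows "even (psum es + bracket_sign p ds es + tsg ds es)"
proof -
  obtain n where p: "p = Suc n" using l by (cases p) auto
  let ?a = "ds ! n" and ?f = "es ! 0" and ?D = "\<Sum>j<n. ds ! j" and ?E = "\<Sum>j<n. es ! Suc j"
  have D: "sum_list ds = ?D + ?a" and E: "sum_list es = ?f + ?E"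
    using l by (simp_all add: sum_list_nth' p sum.lessThan_Suc_shift[of "\<lambda>i. es ! i"] del: sum.lessThan_Suc)
      (simp add: p)
  let ?L1 = "\<Sum>j<p. (int p - int j - 1) * ds ! j" and ?L2 = "\<Sum>j<p. int j * es ! j"
  let ?S1 = "\<Sum>j<n. \<Sum>i<j. ds ! i * ds ! j" and ?S2 = "\<Sum>j<n. \<Sum>i<j. es ! Suc i * es ! Suc j"
  let ?S3 = "\<Sum>j<n. \<Sum>i<j. es ! Suc i * ds ! Suc j" 
  let ?S3' = "\<Sum>(i, j)\<in>{(i, j). 1 < i \<and> i \<le> j \<and> j < p}. es ! (i - 1) * ds ! (j - 1)"
  have 1: "psum es = ?f * ?E + ?S2"
    unfolding psum_def l(2) p pairs_Suc by (simp add: pairs_nested sum_distrib_left)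
  have b1: "(\<Sum>(i, j)\<in>{(i, j). 1 \<le> i \<and> i < j \<and> j < p}. ds ! (i - 1) * ds ! (j - 1)) = ?S1"
    unfolding pairs_nested[symmetric]
    by (rule sum.reindex_bij_witness[where i="\<lambda>(i, j). (Suc i, Suc j)" and j="\<lambda>(i, j). (i - 1, j - 1)"]) (auto simp: p)
  have b2: "(\<Sum>(i, j)\<in>{(i, j). 1 < i \<and> i < j \<and> j \<le> p}. es ! (i - 1) * es ! (j - 1)) = ?S2"
    unfolding pairs_nested[symmetric]
    by (rule sum.reindex_bij_witness[where i="\<lambda>(i, j). (Suc (Suc i), Suc (Suc j))" and j="\<lambda>(i, j). (i - 2, j - 2)"])
      (auto simp: p numeral_2_eq_2 Suc_diff_Suc)
  have b3: "(\<Sum>j = 1..p. (int p - int j) * ds ! (j - 1)) = ?L1"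
    by (rule sum.reindex_bij_witness[where i=Suc and j="\<lambda>j. j - 1"]) auto
  have b4: "(\<Sum>j = 1..p. (int j - 1) * es ! (j - 1)) = ?L2"
    by (rule sum.reindex_bij_witness[where i=Suc and j="\<lambda>j. j - 1"]) auto
  have bs: "bracket_sign p ds es = ?a * ?f + (int p + 1) * (?a + ?f) + ?L1 + ?L2 + ?S1 + ?S2 + ?S3'"
    unfolding bracket_sign_def Let_def b1 b2 b3 b4 by (simp add: p)
  have t1: "(\<Sum>(i, j)\<in>{(i, j). i < j \<and> j < p}. ds ! i) = ?L1"
  proof -
    have "(\<Sum>(i, j)\<in>{(i, j). i < j \<and> j < p}. ds ! i) = (\<Sum>i<p. \<Sum>j\<in>{i<..<p}. ds ! i)"
      by (subst sum.Sigma) (auto intro!: sum.cong)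
    then show ?thesis by (simp add: of_nat_diff) (auto intro!: sum.cong simp: of_nat_diff)
  qed
  have t2: "(\<Sum>(i, j)\<in>{(i, j). i < j \<and> j < p}. es ! j) = ?L2"
    unfolding pairs_nested by simp
  have t3: "(\<Sum>(i, j)\<in>{(i, j). i < j \<and> j < p}. ds ! i * ds ! j) = ?S1 + ?D * ?a"
    unfolding pairs_nested by (simp add: p sum_distrib_right)
  have t4: "(\<Sum>(i, j)\<in>{(i, j). i < j \<and> j < p}. es ! i * ds ! j) + (\<Sum>i<p. es ! i * ds ! i) = ?S3' + ?f * (?D + ?a) + ?E * ?a"
  proof -
    let ?T = "{(i, j). i \<le> j \<and> j < p}"
    have fT: "finite ?T" by (rule finite_subset[of _ "{..<p} \<times> {..<p}"]) auto
    have "(\<Sum>(i, j)\<in>{(i, j). i < j \<and> j < p}. es ! i * ds ! j) + (\<Sum>i<p. es ! i * ds ! i) = (\<Sum>(i, j)\<in>?T. es ! i * ds ! j)"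
    proof -
      have "(\<Sum>i<p. es ! i * ds ! i) = (\<Sum>(i, j)\<in>(\<lambda>i. (i, i)) ` {..<p}. es ! i * ds ! j)"
        by (subst sum.reindex) (auto simp: inj_on_def)
      moreover have "?T = {(i, j). i < j \<and> j < p} \<union> (\<lambda>i. (i, i)) ` {..<p}" by auto
      moreover have "(\<Sum>(i, j)\<in>{(i, j). i < j \<and> j < p} \<union> (\<lambda>i. (i, i)) ` {..<p}. es ! i * ds ! j) =
        (\<Sum>(i, j)\<in>{(i, j). i < j \<and> j < p}. es ! i * ds ! j) + (\<Sum>(i, j)\<in>(\<lambda>i. (i, i)) ` {..<p}. es ! i * ds ! j)"
        by (rule sum.union_disjoint) (auto simp: pairs_finite')
      ultimately show ?thesis by simp
    qed
    \<comment> \<open>The triangle i \<le> j < p is cut into the part that gives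
      \<open>?S3'\<close>, the row i = 0 and the column j = n.\<close>
    also have "\<dots> = (\<Sum>(i, j)\<in>{(i, j). 1 \<le> i \<and> i \<le> j \<and> j < n}. es ! i * ds ! j) +
        ((\<Sum>(i, j)\<in>Pair 0 ` {..<p}. es ! i * ds ! j) + (\<Sum>(i, j)\<in>(\<lambda>i. (i, n)) ` {1..n}. es ! i * ds ! j))"
    proof -
      have T: "?T = {(i, j). 1 \<le> i \<and> i \<le> j \<and> j < n} \<union> (Pair 0 ` {..<p} \<union> (\<lambda>i. (i, n)) ` {1..n})"
        by (auto simp: p image_iff)
      have f1: "finite {(i, j). 1 \<le> i \<and> i \<le> j \<and> j < n}" by (rule finite_subset[OF _ fT]) (auto simp: p)
      show ?thesis unfolding T
        by (subst sum.union_disjoint, use f1 in simp, simp, force, subst sum.union_disjoint) auto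
    qed
    also have "(\<Sum>(i, j)\<in>{(i, j). 1 \<le> i \<and> i \<le> j \<and> j < n}. es ! i * ds ! j) = ?S3'"
      by (rule sum.reindex_bij_witness[where i="\<lambda>(i, j). (i - 1, j - 1)" and j="\<lambda>(i, j). (Suc i, Suc j)"]) (auto simp: p)
    also have "(\<Sum>(i, j)\<in>Pair 0 ` {..<p}. es ! i * ds ! j) = ?f * (?D + ?a)"
      by (subst sum.reindex) (auto simp: inj_on_def sum_distrib_left p distrib_left)
    also have "(\<Sum>(i, j)\<in>(\<lambda>i. (i, n)) ` {1..n}. es ! i * ds ! j) = ?E * ?a"
    proof -
      have "(\<Sum>i\<in>{1..n}. es ! i * ?a) = (\<Sum>i<n. es ! Suc i * ?a)"
        by (rule sum.reindex_bij_witness[where i=Suc and j="\<lambda>j. j - 1"]) auto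
      then show ?thesis by (subst sum.reindex) (auto simp: inj_on_def sum_distrib_right)
    qed
    finally show ?thesis by simp
  qed
  have "tsg ds es = ?L1 + ?L2 + (?S1 + ?D * ?a) + (?S3' + ?f * (?D + ?a) + ?E * ?a)"
    unfolding tsg_index[OF l(1,2)] t1[symmetric] t2[symmetric] t3[symmetric] t4[symmetric]
    by (simp add: sum.distrib case_prod_unfold)
  moreover have "even (?D + ?a + ?f + ?E + int p)" using c D E by (simp add: algebra_simps)
  ultimately show ?thesis unfolding 1 bs by (simp only: even_add even_mult_iff) (auto simp only: even_add even_mult_iff odd_one)
qed

section \<open>The axioms of the brackets on evaluations\<close>

lemma sg_move: "(sg a :: 'k::field) * x = sg b * y \<longleftrightarrow> x = sg (a + b) * y"
  by (cases "even a"; cases "even b") (auto simp: sg_if)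

lemmas parity_simps = even_add even_diff even_mult_iff even_of_nat even_Suc of_nat_Suc even_minus odd_one not_True_eq_False not_False_eq_True

text \<open>The axioms are translated once for an abstract form \<open>Y\<close> and the result is
  used twice: for the form of given maps and for the form built from given brackets.
  \<open>yv\<close> is the vector that represents \<open>Y\<close> in its first functional; it is
  what an inner bracket passes to an outer one.\<close>

locale bracket_form = graded_alg s G
  for s :: "'k::field_char_0 \<Rightarrow> 'a::ring \<Rightarrow> 'a" and G :: "int \<Rightarrow> 'a set" +
  fixes br :: "nat \<Rightarrow> ('k, 'a) tensor \<Rightarrow> ('k, 'a) tensor"
    and Y :: "'a list \<Rightarrow> ('a \<Rightarrow> 'k) list \<Rightarrow> 'k"
    and yv :: "'a list \<Rightarrow> ('a \<Rightarrow> 'k) list \<Rightarrow> 'a"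
  assumes bf: "bracket_family s br"
    and link: "p \<ge> 1 \<Longrightarrow> homs G ds as \<Longrightarrow> length as = p \<Longrightarrow> homs (dual_deg s G) es fs \<Longrightarrow> length fs = p \<Longrightarrow>
      br p (tens s as) (pform fs) = sg (tsg ds es) * Y as fs"
    and Y_deg: "p \<ge> 1 \<Longrightarrow> homs G ds as \<Longrightarrow> length as = p \<Longrightarrow> homs (dual_deg s G) es fs \<Longrightarrow> length fs = p \<Longrightarrow>
      Y as fs \<noteq> 0 \<Longrightarrow> sum_list ds + sum_list es = int p - 2"
    and Y_yv: "homs G ds as \<Longrightarrow> length as = Suc q \<Longrightarrow> homs (dual_deg s G) es fs \<Longrightarrow> length fs = q \<Longrightarrow> f \<in> dual_deg s G e \<Longrightarrow>
      Y as (f # fs) = f (yv as fs)"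
begin

lemma br_endo: "p \<ge> 1 \<Longrightarrow> endo p (br p)"
  using bf by (auto simp: bracket_family_def endo_def)

lemma br_in: "p \<ge> 1 \<Longrightarrow> t \<in> tpow s p \<Longrightarrow> br p t \<in> tpow s p"
  using br_endo by (auto simp: endo_def)

lemma br_lin: "p \<ge> 1 \<Longrightarrow> t \<in> tpow s p \<Longrightarrow> u \<in> tpow s p \<Longrightarrow> br p (tscale c t + u) = tscale c (br p t) + br p u"
  using br_endo by (auto simp: endo_def)

lemma br_0: "p \<ge> 1 \<Longrightarrow> br p 0 = 0"
  using br_lin[of p 0 0 1] tpow_0 by simp

lemma br_scale: "p \<ge> 1 \<Longrightarrow> t \<in> tpow s p \<Longrightarrow> br p (tscale c t) = tscale c (br p t)"
  using br_lin[of p t 0 c] tpow_0 br_0 by simp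

lemma br_deg:
  assumes p: "p \<ge> 1" and t: "t \<in> tpow_deg s G p n" shows "br p t \<in> tpow_deg s G p (n + 2 - int p)"
  using t unfolding tpow_deg_def[of s G p n]
proof (induction rule: tspan_induct)
  case zero
  show ?case unfolding br_0[OF p] tpow_deg_def by (rule tsp.span_zero)
next
  case (comb c t u)
  then have tu: "t \<in> tpow s p" "u \<in> tpow s p" using tpow_deg_sub[of p n] by (auto simp: tpow_deg_def)
  show ?case unfolding br_lin[OF p tu] using comb unfolding tpow_deg_def by (intro tsp.span_add tsp.span_scale)
next
  case (base t)
  then obtain ds vs where b: "t = tens s vs" "length vs = p" "homs G ds vs" "sum_list ds = n" by blast
  show ?case unfolding b(1)
  proof (rule tpow_deg_detect[OF br_in[OF p tens_in[OF b(2)]]])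
    fix es fs assume f: "homs dual es fs" "length fs = p" "sum_list es + (n + 2 - int p) \<noteq> 0"
    have "Y vs fs = 0" using Y_deg[OF p b(3,2) f(1,2)] b(4) f(3) by (cases "Y vs fs = 0") auto
    then show "br p (tens s vs) (pform fs) = 0" using link[OF p b(3,2) f(1,2)] by simp
  qed
qed

text \<open>Each pair \<open>a, t f\<close> moves as one block of degree d + e + 1, as in the
  ultracyclicity identity.\<close>

definition skew_cond :: bool where
  "skew_cond \<longleftrightarrow> (\<forall>p\<ge>1. \<forall>\<sigma> ds as es fs. \<sigma> permutes {..<p} \<and> homs G ds as \<and> length as = p \<and> homs dual es fs \<and> length fs = p \<longrightarrow>
     Y (permute_list \<sigma> as) (permute_list \<sigma> fs) = sg (isum p \<sigma> (\<lambda>i. ds ! i + es ! i + 1)) * Y as fs)"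

lemma skew_eval:
  assumes p: "p \<ge> 1" and s: "\<sigma> permutes {..<p}" and as: "homs G ds as" "length as = p" and fs: "homs dual es fs" "length fs = p"
  shows "tperm s G \<sigma> (br p (tperm s G (inv \<sigma>) (tens s as))) (pform fs) =
     sg (isum p \<sigma> (\<lambda>i. es ! i) + isum p \<sigma> (\<lambda>i. ds ! i) + tsg (permute_list \<sigma> ds) (permute_list \<sigma> es)) *
       Y (permute_list \<sigma> as) (permute_list \<sigma> fs)"
proof -
  have l: "length ds = p" "length es = p" using as fs by (auto simp: homs_length)
  have i: "tens s (permute_list \<sigma> as) \<in> tpow s p" using as by (intro tens_in) simp
  have as': "homs G (permute_list \<sigma> ds) (permute_list \<sigma> as)" "length (permute_list \<sigma> as) = p"
    and fs': "homs dual (permute_list \<sigma> es) (permute_list \<sigma> fs)" "length (permute_list \<sigma> fs) = p"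
    using s as fs l by (auto simp: homs_permute)
  have b: "br p (tens s (permute_list \<sigma> as)) \<in> tpow s p" by (rule br_in[OF p i])
  show ?thesis
    unfolding tperm_inv_tens[OF s as] br_scale[OF p i] tperm_pform[OF s tpow_scale[OF b] fs]
    by (simp add: tscale_def link[OF p as' fs'] sg_add mult.assoc)
qed

lemma skew_iff:
  "(\<forall>p\<ge>1. \<forall>\<sigma>. \<sigma> permutes {..<p} \<longrightarrow>
        (\<forall>t\<in>tpow s p. tperm s G \<sigma> (br p (tperm s G (inv \<sigma>) t)) = tscale (of_int (sign \<sigma>)) (br p t))) \<longleftrightarrow> skew_cond"
proof -
  have key: "tperm s G \<sigma> (br p (tperm s G (inv \<sigma>) (tens s as))) (pform fs) = tscale (of_int (sign \<sigma>)) (br p (tens s as)) (pform fs)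
    \<longleftrightarrow> Y (permute_list \<sigma> as) (permute_list \<sigma> fs) = sg (isum p \<sigma> (\<lambda>i. ds ! i + es ! i + 1)) * Y as fs"
    if "p \<ge> 1" "\<sigma> permutes {..<p}" "homs G ds as" "length as = p" "homs dual es fs" "length fs = p" for p \<sigma> ds as es fs
  proof -
    have l: "length ds = p" "length es = p" using that by (auto simp: homs_length)
    have e: "tscale (of_int (sign \<sigma>)) (br p (tens s as)) (pform fs) = sg (ninv p \<sigma> + tsg ds es) * Y as fs"
      by (simp add: tscale_def sign_ninv[OF that(2)] link[OF that(1,3,4,5,6)] sg_add)
    have c: "(sg (isum p \<sigma> (\<lambda>i. es ! i) + isum p \<sigma> (\<lambda>i. ds ! i) + tsg (permute_list \<sigma> ds) (permute_list \<sigma> es) + (ninv p \<sigma> + tsg ds es)) :: 'k)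
       = sg (isum p \<sigma> (\<lambda>i. ds ! i + es ! i + 1))"
      by (rule sg_cong) (use tsg_permute[OF that(2) l] in \<open>simp add: add_ac\<close>)
    show ?thesis unfolding skew_eval[OF that] e sg_move c ..
  qed
  show ?thesis
  proof (intro iffI)
    assume L: "\<forall>p\<ge>1. \<forall>\<sigma>. \<sigma> permutes {..<p} \<longrightarrow>
        (\<forall>t\<in>tpow s p. tperm s G \<sigma> (br p (tperm s G (inv \<sigma>) t)) = tscale (of_int (sign \<sigma>)) (br p t))"
    show skew_cond unfolding skew_cond_def
    proof (intro allI impI, elim conjE)
      fix p \<sigma> ds as es fs
      assume a: "1 \<le> p" "\<sigma> permutes {..<p}" "homs G ds as" "length as = p" "homs dual es fs" "length fs = p"
      have "tperm s G \<sigma> (br p (tperm s G (inv \<sigma>) (tens s as))) = tscale (of_int (sign \<sigma>)) (br p (tens s as))"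
        by (rule L[rule_format, OF a(1,2) tens_in[OF a(4)]])
      then show "Y (permute_list \<sigma> as) (permute_list \<sigma> fs) = sg (isum p \<sigma> (\<lambda>i. ds ! i + es ! i + 1)) * Y as fs"
        unfolding key[OF a, symmetric] by simp
    qed
  next
    assume C: skew_cond
    show "\<forall>p\<ge>1. \<forall>\<sigma>. \<sigma> permutes {..<p} \<longrightarrow>
        (\<forall>t\<in>tpow s p. tperm s G \<sigma> (br p (tperm s G (inv \<sigma>) t)) = tscale (of_int (sign \<sigma>)) (br p t))"
    proof (intro allI impI ballI)
      fix p \<sigma> t assume p: "1 \<le> p" and s: "\<sigma> permutes {..<p}" and t: "t \<in> tpow s p"
      note si = permutes_inv[OF s]
      show "tperm s G \<sigma> (br p (tperm s G (inv \<sigma>) t)) = tscale (of_int (sign \<sigma>)) (br p t)"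
        using t
      proof (induction rule: tpow_hom_induct)
        case zero
        show ?case by (simp only: tperm_lin br_0[OF p] tsp.scale_zero_right)
      next
        case (comb c t u)
        then show ?case
          by (simp only: tperm_lin br_lin[OF p] tperm_in[OF si] br_in[OF p] tsp.scale_right_distrib tsp.scale_left_commute)
      next
        case (tens ds vs)
        show ?case
        proof (rule tpow_eqI[of _ p])
          show "tperm s G \<sigma> (br p (tperm s G (inv \<sigma>) (tens s vs))) \<in> tpow s p"
            by (intro tperm_in[OF s] br_in[OF p] tperm_in[OF si] tens_in tens)
          show "tscale (of_int (sign \<sigma>)) (br p (tens s vs)) \<in> tpow s p"
            by (intro tpow_scale br_in[OF p] tens_in tens)
          fix es fs assume f: "homs dual es fs" "length fs = p"
          show "tperm s G \<sigma> (br p (tperm s G (inv \<sigma>) (tens s vs))) (pform fs) = tscale (of_int (sign \<sigma>)) (br p (tens s vs)) (pform fs)"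
            unfolding key[OF p s tens(3,1) f]
            by (rule C[unfolded skew_cond_def, rule_format, OF p]) (use s tens f in simp)
        qed
      qed
    qed
  qed
qed

definition leibniz_cond :: bool where
  "leibniz_cond \<longleftrightarrow> (\<forall>q ds as d a d' b es fs. homs G ds as \<and> length as = q \<and> a \<in> G d \<and> b \<in> G d' \<and> homs dual es fs \<and> length fs = Suc q \<longrightarrow>
     Y (as @ [a * b]) fs = Y (as @ [a]) (butlast fs @ [\<lambda>v. last fs (v * b)]) + sg d * Y (as @ [b]) ((\<lambda>v. hd fs (a * v)) # tl fs))"

text \<open>The terms on the right have \<open>tsg\<close> exponents of their own. Each is compared
  with that of the left side under the degree constraint of the term itself; where the constraint
  fails the term is zero.\<close>

lemma leibniz_eval:
  assumes as: "homs G ds as" "length as = q" and ab: "a \<in> G d" "b \<in> G d'" and fs: "homs dual es fs" "length fs = Suc q"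
  shows "(br (Suc q) (tens s (as @ [a * b])) (pform fs) =
      (rmul s (br (Suc q) (tens s (as @ [a]))) b + tscale (sg (d * (int (Suc q) + sum_list ds))) (lmul s a (br (Suc q) (tens s (as @ [b]))))) (pform fs)) \<longleftrightarrow>
    Y (as @ [a * b]) fs = Y (as @ [a]) (butlast fs @ [\<lambda>v. last fs (v * b)]) + sg d * Y (as @ [b]) ((\<lambda>v. hd fs (a * v)) # tl fs)"
proof -
  let ?p = "Suc q"
  have p: "1 \<le> ?p" by simp
  have l: "length ds = q" "length es = Suc q" using as fs by (auto simp: homs_length)
  obtain fs' f where f: "fs = fs' @ [f]" "length fs' = q" using fs(2) by (cases fs rule: rev_cases) auto
  obtain es' e where e: "es = es' @ [e]" "length es' = q" using l(2) by (cases es rule: rev_cases) auto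
  obtain g gs where g: "fs = g # gs" "length gs = q" using fs(2) by (cases fs) auto
  obtain h hs where h: "es = h # hs" "length hs = q" using l(2) by (cases es) auto
  have fs1: "homs dual es' fs'" "f \<in> dual e" using fs(1) unfolding f(1) e(1) by (simp_all add: homs_append e f)
  have fs2: "homs dual hs gs" "g \<in> dual h" using fs(1) unfolding g(1) h(1) by simp_all
  have lin: "\<forall>f\<in>set fs. linf f" by (rule homs_dual_linf[OF fs(1)])
  have asx: "homs G (ds @ [x]) (as @ [c])" "length (as @ [c]) = ?p" if "c \<in> G x" for c x
    using as l that by (auto simp: homs_append)
  have fb: "homs dual (es' @ [e + d']) (fs' @ [\<lambda>v. f (v * b)])" "length (fs' @ [\<lambda>v. f (v * b)]) = ?p"
    using fs1 e f ab by (auto simp: homs_append dual_rmult)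
  have ga: "homs dual ((h + d) # hs) ((\<lambda>v. g (a * v)) # gs)" "length ((\<lambda>v. g (a * v)) # gs) = ?p"
    using fs2 g ab by (auto simp: dual_lmult)
  let ?Y0 = "Y (as @ [a * b]) fs" and ?Y1 = "Y (as @ [a]) (fs' @ [\<lambda>v. f (v * b)])" and ?Y2 = "Y (as @ [b]) ((\<lambda>v. g (a * v)) # gs)"
  have e0: "br ?p (tens s (as @ [a * b])) (pform fs) = sg (tsg (ds @ [d + d']) es) * ?Y0"
    by (rule link[OF p asx[OF G_mult[OF ab]] fs])
  have e1: "rmul s (br ?p (tens s (as @ [a]))) b (pform fs) = sg (tsg (ds @ [d]) (es' @ [e + d'])) * ?Y1"
    using rmul_pform[OF br_in[OF p tens_in[OF asx(2)[OF ab(1)]]], of fs' f b] lin f link[OF p asx[OF ab(1)] fb] by simp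
  have e2: "lmul s a (br ?p (tens s (as @ [b]))) (pform fs) = sg (tsg (ds @ [d']) ((h + d) # hs)) * ?Y2"
    using lmul_pform[OF br_in[OF p tens_in[OF asx(2)[OF ab(2)]]], of g gs a] lin g link[OF p asx[OF ab(2)] ga] by simp
  have sumes: "sum_list es = sum_list es' + e" "sum_list es = h + sum_list hs" by (simp add: e(1), simp add: h(1))
  have T: "tsg (ds @ [x]) (es' @ [z]) = tsg ds es' + sum_list ds + int q * z + x * (sum_list ds + sum_list es' + z)" for x z
    using tsg_append[of ds es' "[x]" "[z]"] l e by (simp add: algebra_simps)
  have T0: "tsg (ds @ [x]) es = tsg ds es' + sum_list ds + int q * e + x * (sum_list ds + sum_list es' + e)" for x
    unfolding e(1) T ..
  have T2: "tsg (ds @ [d']) ((h + d) # hs) = tsg (ds @ [d']) es + d * (sum_list ds + d')"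
    unfolding h(1) by (simp add: tsg_hd)
  let ?S0 = "sg (tsg (ds @ [d + d']) es) :: 'k"
  have s1: "sg (tsg (ds @ [d]) (es' @ [e + d'])) * ?Y1 = ?S0 * ?Y1"
  proof (cases "?Y1 = 0")
    case False
    then have c: "sum_list ds + d + (sum_list es' + e + d') = int ?p - 2"
      using Y_deg[OF p asx[OF ab(1)] fb] by simp
    have "even (tsg (ds @ [d]) (es' @ [e + d']) + tsg (ds @ [d + d']) es)"
    proof -
      have "even (sum_list ds + d + (sum_list es' + e + d') + int ?p)" using c by presburger
      then show ?thesis unfolding T T0 by (simp only: parity_simps) blast
    qed
    then show ?thesis by (simp only: sg_cong)
  qed simp
  have s2: "sg (d * (int ?p + sum_list ds)) * (sg (tsg (ds @ [d']) ((h + d) # hs)) * ?Y2) = ?S0 * (sg d * ?Y2)"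
  proof (cases "?Y2 = 0")
    case False
    then have c: "sum_list ds + d' + (sum_list es + d) = int ?p - 2"
      using Y_deg[OF p asx[OF ab(2)] ga] sumes by simp
    have "even (d * (int ?p + sum_list ds) + tsg (ds @ [d']) ((h + d) # hs) + (tsg (ds @ [d + d']) es + d))"
    proof -
      have "even (sum_list ds + d' + (sum_list es' + e + d) + int ?p)" using c sumes by presburger
      then show ?thesis unfolding T2 T0 by (simp only: parity_simps) blast
    qed
    then have "(sg (d * (int ?p + sum_list ds) + tsg (ds @ [d']) ((h + d) # hs)) :: 'k) = sg (tsg (ds @ [d + d']) es + d)"
      by (rule sg_cong)
    then show ?thesis by (simp only: sg_add mult.assoc[symmetric])
  qed simp
  have "(br (Suc q) (tens s (as @ [a * b])) (pform fs) =
      (rmul s (br (Suc q) (tens s (as @ [a]))) b + tscale (sg (d * (int (Suc q) + sum_list ds))) (lmul s a (br (Suc q) (tens s (as @ [b]))))) (pform fs)) \<longleftrightarrow>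
    ?S0 * ?Y0 = ?S0 * ?Y1 + ?S0 * (sg d * ?Y2)"
    by (simp only: plus_fun_apply tscale_def e0 e1 e2 s1 s2)
  also have "\<dots> \<longleftrightarrow> ?Y0 = ?Y1 + sg d * ?Y2"
    unfolding distrib_left[symmetric] mult_left_cancel[OF sg_neq] ..
  finally show ?thesis using f g by (simp add: butlast_append) (metis last_snoc list.sel(1,3) butlast_snoc)
qed

lemma leibniz_iff:
  "(\<forall>p\<ge>1. \<forall>ds as d a d' b. length as = p - 1 \<and> homs G ds as \<and> a \<in> G d \<and> b \<in> G d' \<longrightarrow>
        br p (tens s (as @ [a * b])) =
          rmul s (br p (tens s (as @ [a]))) b +
          tscale ((-1) powi (d * (int p + sum_list ds))) (lmul s a (br p (tens s (as @ [b]))))) \<longleftrightarrow> leibniz_cond"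
proof
  assume L: "\<forall>p\<ge>1. \<forall>ds as d a d' b. length as = p - 1 \<and> homs G ds as \<and> a \<in> G d \<and> b \<in> G d' \<longrightarrow>
        br p (tens s (as @ [a * b])) =
          rmul s (br p (tens s (as @ [a]))) b +
          tscale ((-1) powi (d * (int p + sum_list ds))) (lmul s a (br p (tens s (as @ [b]))))"
  show leibniz_cond unfolding leibniz_cond_def
  proof (intro allI impI, elim conjE)
    fix q ds as d a d' b es fs
    assume a: "homs G ds as" "length as = q" "a \<in> G d" "b \<in> G d'" "homs dual es fs" "length fs = Suc q"
    have "br (Suc q) (tens s (as @ [a * b])) =
          rmul s (br (Suc q) (tens s (as @ [a]))) b +
          tscale ((-1) powi (d * (int (Suc q) + sum_list ds))) (lmul s a (br (Suc q) (tens s (as @ [b]))))"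
      using L[rule_format, of "Suc q" as ds a d b d'] a by simp
    then show "Y (as @ [a * b]) fs = Y (as @ [a]) (butlast fs @ [\<lambda>v. last fs (v * b)]) + sg d * Y (as @ [b]) ((\<lambda>v. hd fs (a * v)) # tl fs)"
      using leibniz_eval[OF a] by simp
  qed
next
  assume C: leibniz_cond
  show "\<forall>p\<ge>1. \<forall>ds as d a d' b. length as = p - 1 \<and> homs G ds as \<and> a \<in> G d \<and> b \<in> G d' \<longrightarrow>
        br p (tens s (as @ [a * b])) =
          rmul s (br p (tens s (as @ [a]))) b +
          tscale ((-1) powi (d * (int p + sum_list ds))) (lmul s a (br p (tens s (as @ [b]))))"
  proof (intro allI impI, elim conjE)
    fix p ds as d a d' b
    assume p: "1 \<le> p" and a: "length as = p - 1" "homs G ds as" "a \<in> G d" "b \<in> G d'"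
    obtain q where q: "p = Suc q" using p by (cases p) auto
    have lq: "length as = q" using a q by simp
    have i: "br p (tens s (as @ [c])) \<in> tpow s (Suc q)" for c using p a(1) unfolding q[symmetric] by (intro br_in tens_in) auto
    show "br p (tens s (as @ [a * b])) =
          rmul s (br p (tens s (as @ [a]))) b +
          tscale ((-1) powi (d * (int p + sum_list ds))) (lmul s a (br p (tens s (as @ [b]))))"
    proof (rule tpow_eqI[of _ p])
      show "br p (tens s (as @ [a * b])) \<in> tpow s p" "rmul s (br p (tens s (as @ [a]))) b +
          tscale ((-1) powi (d * (int p + sum_list ds))) (lmul s a (br p (tens s (as @ [b])))) \<in> tpow s p"
        using i unfolding q by (auto intro!: tpow_add tpow_scale rmul_in lmul_in)
      fix es fs assume f: "homs dual es fs" "length fs = p"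
      show "br p (tens s (as @ [a * b])) (pform fs) = (rmul s (br p (tens s (as @ [a]))) b +
          tscale ((-1) powi (d * (int p + sum_list ds))) (lmul s a (br p (tens s (as @ [b]))))) (pform fs)"
        unfolding q leibniz_eval[OF a(2) lq a(3,4) f[unfolded q]]
        by (rule C[unfolded leibniz_cond_def, rule_format]) (use a lq f q in auto)
    qed
  qed
qed

end

section \<open>The Jacobi identity on evaluations\<close>

context bracket_form begin

text \<open>Contracting the inner bracket with the functionals that do not reach the outer one
  leaves a vector x, which becomes the last argument of the outer bracket. The sign comes from
  moving the inner bracket past the first i - 1 arguments.\<close>

lemma bracket_comp_eval:
  assumes ij: "i \<ge> 1" "j \<ge> 1" "p = i + j - 1" and as: "homs G ds as" "length as = p" and fs: "homs dual es fs" "length fs = p"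
    and x: "\<And>g. linf g \<Longrightarrow> br j (tens s (drop (i - 1) as)) (pform (g # drop i fs)) = g x"
  shows "bracket_comp s G br i j (tens s as) (pform fs) =
    sg ((2 - int j) * sum_list (take (i - 1) ds)) * br i (tens s (take (i - 1) as @ [x])) (pform (take i fs))"
proof -
  let ?us = "take (i - 1) as" and ?w = "br j (tens s (drop (i - 1) as))"
  let ?c = "sg ((2 - int j) * sum_list (take (i - 1) ds)) :: 'k"
  let ?u = "tprod s (tens s ?us) ?w"
  have p1: "i - 1 + j = p" "i + (j - 1) = p" using ij by auto
  have w: "?w \<in> tpow s j" using ij as(2) by (intro br_in tens_in) auto
  have us: "tens s ?us \<in> tpow s (i - 1)" using ij as(2) by (intro tens_in) auto
  have u: "?u \<in> tpow s p" using tprod_in[OF us w] p1 by simp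
  have lin: "\<forall>f\<in>set fs. linf f" by (rule homs_dual_linf[OF fs(1)])
  have lin': "\<forall>f\<in>set (take i fs). linf f" "\<forall>f\<in>set (drop i fs). linf f"
    using lin by (auto dest: in_set_takeD in_set_dropD)
  have lt: "length (take i fs) = i" "length (drop i fs) = j - 1" using fs(2) ij by auto
  have m: "mlf p (pform fs)" by (rule mlf_pform_hom[OF fs])
  have mt: "mlf i (pform (take i fs))" "mlf (j - 1) (pform (drop i fs))" using lin' lt by (auto intro!: mlf_pform)
  have "tmap s G (i - 1) id (2 - int j) (br j) (tens s as) = tscale ?c ?u"
    using tmap_tens[OF endo_id br_endo[OF ij(2)] as(1), of "i - 1" "2 - int j"] p1 as(2) by simp
  moreover have "tmap s G i (br i) 0 id (tscale ?c ?u) = tscale ?c (tmap s G i (br i) 0 id ?u)"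
    using tmap_lin(1)[of i "br i" 0 id ?c ?u 0] tmap_lin(2)[of i "br i" 0 id] by (simp only: add_0_right)
  ultimately have e1: "bracket_comp s G br i j (tens s as) (pform fs) = ?c * tmap s G i (br i) 0 id ?u (pform fs)"
    by (simp add: bracket_comp_def tscale_def)
  let ?\<phi> = "\<lambda>vs. br i (tens s (take i vs)) (pform (take i fs)) * pform (drop i fs) (drop i vs)"
  have split: "tprod s (br i (tens s (take i vs))) (id (tens s (drop i vs))) (pform fs) = ?\<phi> vs" if "length vs = p" for vs
  proof -
    have "br i (tens s (take i vs)) \<in> tpow s i" "tens s (drop i vs) \<in> tpow s (j - 1)"
      using that ij by (auto intro!: br_in tens_in)
    from tprod_pform[OF this, of "take i fs" "drop i fs"] lin lt
    have "tprod s (br i (tens s (take i vs))) (tens s (drop i vs)) (pform fs) =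
       br i (tens s (take i vs)) (pform (take i fs)) * tens s (drop i vs) (pform (drop i fs))" by simp
    moreover have "tens s (drop i vs) (pform (drop i fs)) = pform (drop i fs) (drop i vs)"
      using mt(2) that ij by (intro tens_app) auto
    ultimately show ?thesis by simp
  qed
  have m\<phi>: "mlf p ?\<phi>"
    using tmap_mlf[OF br_endo[OF ij(1)] endo_id, of "j - 1" "pform fs"] m unfolding p1
    by (subst mlf_cong[OF split[symmetric]]) auto
  have "tmap s G i (br i) 0 id ?u (pform fs) = ?u (\<lambda>vs. tprod s (br i (tens s (take i vs))) (id (tens s (drop i vs))) (pform fs))"
    using tmap_app[OF br_endo[OF ij(1)] endo_id, of ?u "j - 1" "pform fs"] u m unfolding p1 by simp
  also have "\<dots> = ?u ?\<phi>" by (rule tpow_cong[OF u split])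
  also have "\<dots> = tens s ?us (\<lambda>vs. ?w (\<lambda>ws. ?\<phi> (vs @ ws)))"
    using tprod_app[OF us w, of ?\<phi>] m\<phi> p1 by simp
  also have "\<dots> = ?w (\<lambda>ws. ?\<phi> (?us @ ws))"
    using mlf_inner[OF w, of "i - 1" ?\<phi>] m\<phi> p1 as(2) ij by (intro tens_app) simp
  \<comment> \<open>The outer bracket as a function of its last argument is a functional of which
    only linearity is established; therefore x is assumed to represent the contraction for all
    linear g.\<close>
  also have "\<dots> = ?w (pform ((\<lambda>v. br i (tens s (?us @ [v])) (pform (take i fs))) # drop i fs))"
  proof (rule tpow_cong[OF w])
    fix ws :: "'a list" assume "length ws = j"
    then obtain h t where ws: "ws = h # t" using ij by (cases ws) auto
    have "length ?us = i - 1" using as(2) ij by simp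
    then have "take i (?us @ h # t) = ?us @ [h]" "drop i (?us @ h # t) = t" using ij by (auto simp: take_Cons')
    then show "?\<phi> (?us @ ws) = pform ((\<lambda>v. br i (tens s (?us @ [v])) (pform (take i fs))) # drop i fs) ws"
      by (simp add: ws)
  qed
  also have "\<dots> = br i (tens s (?us @ [x])) (pform (take i fs))"
  proof (rule x)
    have l: "length (?us @ [0]) = i" using as(2) ij by simp
    show "linf (\<lambda>v. br i (tens s (?us @ [v])) (pform (take i fs)))"
      using mlf_linf[OF endo_tens_mlf[OF br_endo[OF ij(1)]] l, of "i - 1" "pform (take i fs)"] ij as(2)
      by (simp add: list_update_append)
  qed
  finally show ?thesis unfolding e1 by simp
qed

definition Ycomp :: "nat \<Rightarrow> 'a list \<Rightarrow> ('a \<Rightarrow> 'k) list \<Rightarrow> 'k" where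
  "Ycomp i as fs = Y (take (i - 1) as @ [yv (drop (i - 1) as) (drop i fs)]) (take i fs)"

lemma yv_deg:
  assumes "homs G ds as" "length as = Suc q" "homs dual es fs" "length fs = q"
  shows "yv as fs \<in> G (sum_list ds + sum_list es + 1 - int q)"
proof (rule dual_detects_degree)
  fix e f assume f: "f \<in> dual e" "e \<noteq> - (sum_list ds + sum_list es + 1 - int q)"
  have fs: "homs dual (e # es) (f # fs)" "length (f # fs) = Suc q" using f assms by auto
  have "Y as (f # fs) = 0" using Y_deg[OF _ assms(1,2) fs] f(2) by fastforce
  then show "f (yv as fs) = 0" using Y_yv[OF assms f(1)] by simp
qed

lemma homs_take: "homs H ds xs \<Longrightarrow> homs H (take n ds) (take n xs)"
  and homs_drop: "homs H ds xs \<Longrightarrow> homs H (drop n ds) (drop n xs)"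
  by (simp_all add: homs_def list_all2_takeI list_all2_dropI)

text \<open>The signs of the two evaluations and the Koszul sign recombine by
  \<open>tsg_append\<close> to an exponent that sees the cut i only through i(p + 1), the
  coefficient in the Jacobi identity.\<close>

lemma bracket_comp_Ycomp:
  assumes i: "1 \<le> i" "i \<le> p" and as: "homs G ds as" "length as = p" and fs: "homs dual es fs" "length fs = p"
  shows "bracket_comp s G br i (p - i + 1) (tens s as) (pform fs) =
    sg (tsg ds es + sum_list ds + int p + 1 + int i * (int p + 1)) * Ycomp i as fs"
proof -
  define j where "j = p - i + 1"
  have j: "1 \<le> j" "p = i + j - 1" "j = Suc (j - 1)" "p - i + 1 = j" using i by (auto simp: j_def)
  have l: "length ds = p" "length es = p" using as fs by (auto simp: homs_length)
  let ?us = "take (i - 1) as" and ?as = "drop (i - 1) as" and ?fs = "drop i fs" and ?gs = "take i fs"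
  let ?D1 = "take (i - 1) ds" and ?D2 = "drop (i - 1) ds" and ?E1 = "take i es" and ?E2 = "drop i es"
  let ?y = "yv ?as ?fs"
  let ?ly = "sum_list ?D2 + sum_list ?E2 + 2 - int j"
  have h: "homs G ?D2 ?as" "length ?as = Suc (j - 1)" "homs dual ?E2 ?fs" "length ?fs = j - 1"
    using as fs i j by (auto simp: homs_drop)
  have h': "length ?as = j" using h(2) j by simp
  have y: "?y \<in> G ?ly" using yv_deg[OF h] j by (simp add: of_nat_diff algebra_simps)
  let ?w = "br j (tens s ?as)"
  have w: "?w \<in> tpow s j" using br_in[OF j(1) tens_in[OF h']] .
  \<comment> \<open>Only functionals of degree \<open>- ?ly\<close> can be nonzero at
    \<open>?y\<close>, so the sign can be fixed before the functional is chosen.\<close>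
  let ?c = "sg (tsg ?D2 (- ?ly # ?E2)) :: 'k"
  have hom: "?w (pform (g # ?fs)) = g (s ?c ?y)" if g: "g \<in> dual e" for g e
  proof -
    have gs: "homs dual (e # ?E2) (g # ?fs)" "length (g # ?fs) = j" using g h j by auto
    have "?w (pform (g # ?fs)) = sg (tsg ?D2 (e # ?E2)) * g ?y"
      using link[OF j(1) h(1) h' gs] Y_yv[OF h g] by simp
    also have "\<dots> = ?c * g ?y"
    proof (cases "g ?y = 0")
      case False
      then have "e = - ?ly" using dual_vanish[OF g y] by force
      then show ?thesis by simp
    qed simp
    finally show ?thesis using dual_linf[OF g] by (simp add: linf_scale)
  qed
  have linfs: "\<forall>f\<in>set ?fs. linf f" by (rule homs_dual_linf[OF h(3)])
  \<comment> \<open>\<open>contraction\<close> provides a vector for all linear functionals; the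
    homogeneous ones, which separate vectors, identify it with the scaled \<open>?y\<close>.\<close>
  obtain x where x: "linf g \<Longrightarrow> ?w (pform (g # ?fs)) = g x" for g
    using contraction[of ?w "j - 1" ?fs] w linfs h(4) j(3) by auto
  have "x + s (-1) (s ?c ?y) = 0"
  proof (rule dual_separates)
    fix n f assume f: "f \<in> dual n"
    show "f (x + s (- 1) (s ?c ?y)) = 0"
      unfolding linf_add[OF dual_linf[OF f]] linf_scale[OF dual_linf[OF f], of "-1"]
      using hom[OF f] x[OF dual_linf[OF f]] by simp
  qed
  then have x_eq: "x = s ?c ?y" by (simp del: scale_scale)
  let ?B = "br i (tens s (?us @ [?y])) (pform ?gs)"
  have u: "homs G (?D1 @ [?ly]) (?us @ [?y])" "length (?us @ [?y]) = i"
    using as l y i by (auto simp: homs_append homs_take)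
  have gs: "homs dual ?E1 ?gs" "length ?gs = i" using fs i by (auto simp: homs_take)
  have "br i (tens s (?us @ [x])) (pform ?gs) = ?c * ?B"
  proof -
    have l0: "length (?us @ [0]) = i" using as(2) i by simp
    have "linf (\<lambda>v. br i (tens s (?us @ [v])) (pform ?gs))"
      using mlf_linf[OF endo_tens_mlf[OF br_endo[OF i(1)]] l0, of "i - 1" "pform (take i fs)"] i as(2)
      by (simp add: list_update_append)
    from linf_scale[OF this] show ?thesis unfolding x_eq .
  qed
  then have e: "bracket_comp s G br i j (tens s as) (pform fs) = sg ((2 - int j) * sum_list ?D1) * (?c * ?B)"
    using bracket_comp_eval[OF i(1) j(1,2) as fs x] by simp
  have B: "?B = sg (tsg (?D1 @ [?ly]) ?E1) * Ycomp i as fs"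
    unfolding Ycomp_def by (rule link[OF i(1) u gs])
  show ?thesis
  proof (cases "Ycomp i as fs = 0")
    case False
    then have c: "sum_list ?D1 + ?ly + sum_list ?E1 = int i - 2"
      using Y_deg[OF i(1) u gs] by (simp add: Ycomp_def)
    have "length ?E1 = i" using l i by simp
    then obtain E f where E: "?E1 = E @ [f]" "length E = i - 1" using i by (cases ?E1 rule: rev_cases) auto
    have "length ?D2 = j" using l i j by simp
    then obtain d D where D: "?D2 = d # D" "length D = j - 1"
      using j(3) by (metis length_Suc_conv)
    have es: "es = E @ (f # ?E2)" using append_take_drop_id[of i es] unfolding E(1) by simp
    have ds: "ds = ?D1 @ ?D2" by simp
    have lD1: "length ?D1 = i - 1" using l i by simp
    have lE2: "length ?E2 = j - 1" using l j by simp
    have T: "tsg ds es = tsg ?D1 E + tsg ?D2 (f # ?E2) + int j * sum_list ?D1 + (int i - 1) * (f + sum_list ?E2)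
        + sum_list ?D1 * sum_list ?D2 + sum_list E * sum_list ?D2"
      using tsg_append[of ?D1 E ?D2 "f # ?E2"] lD1 E D lE2 j i es l by (simp add: of_nat_diff)
    have Tj: "tsg ?D2 (- ?ly # ?E2) = tsg ?D2 (f # ?E2) + (- ?ly - f) * sum_list ?D2"
    proof -
      have n: "?D2 \<noteq> []" using D by simp
      have f0: "f + (- ?ly - f) = - ?ly" by simp
      show ?thesis using tsg_hd[OF n, of f "- ?ly - f" ?E2] unfolding f0 .
    qed
    have Ti: "tsg (?D1 @ [?ly]) ?E1 = tsg ?D1 E + f * ?ly + sum_list ?D1 + (int i - 1) * f + sum_list ?D1 * ?ly + sum_list E * ?ly"
      unfolding E(1) using tsg_append[of ?D1 E "[?ly]" "[f]"] lD1 E i by (simp add: of_nat_diff)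
    have sD: "sum_list ds = sum_list ?D1 + sum_list ?D2" by (metis ds sum_list_append)
    have sE: "sum_list ?E1 = sum_list E + f" unfolding E(1) by simp
    have pij: "int p = int i + int j - 1" using j by simp
    define X1 X2 X3 X4 where "X1 = sum_list ?D1" and "X2 = sum_list ?D2" and "X3 = sum_list E" and "X4 = sum_list ?E2"
    have parity_part: "even ((2 - J) * X1 + (t2 + (- (X2 + X4 + 2 - J) - f) * X2) + (t1 + f * (X2 + X4 + 2 - J) + X1 + (I - 1) * f + X1 * (X2 + X4 + 2 - J) + X3 * (X2 + X4 + 2 - J))
       + (t1 + t2 + J * X1 + (I - 1) * (f + X4) + X1 * X2 + X3 * X2 + (X1 + X2) + (I + J - 1) + 1 + I * (I + J - 1 + 1)))"
      if "X1 + (X2 + X4 + 2 - J) + (X3 + f) = I - 2" for I J t1 t2 :: int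
    proof -
      have "even (X1 + (X2 + X4 + J) + (X3 + f) + I)" using that by presburger
      then show ?thesis
        by (cases "even X1"; cases "even X2"; cases "even X3"; cases "even X4"; cases "even f"; cases "even J"; cases "even I") simp_all
    qed
    have "even ((2 - int j) * sum_list ?D1 + tsg ?D2 (- ?ly # ?E2) + tsg (?D1 @ [?ly]) ?E1
      + (tsg ds es + sum_list ds + int p + 1 + int i * (int p + 1)))"
      unfolding T Tj Ti sD pij unfolding X1_def[symmetric] X2_def[symmetric] X3_def[symmetric] X4_def[symmetric]
      by (rule parity_part) (use c sE in \<open>simp add: X1_def X2_def X3_def X4_def\<close>)
    then have "(sg ((2 - int j) * sum_list ?D1 + tsg ?D2 (- ?ly # ?E2) + tsg (?D1 @ [?ly]) ?E1) :: 'k) =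
       sg (tsg ds es + sum_list ds + int p + 1 + int i * (int p + 1))" by (rule sg_cong)
    then show ?thesis unfolding j(4) e B by (simp only: mult.assoc[symmetric] sg_add[symmetric] add.assoc)
  next
    case True
    then show ?thesis unfolding j(4) e B by simp
  qed
qed

text \<open>No signs remain: i(p + 1) cancels against \<open>bracket_comp_Ycomp\<close>, and a
  rotation contributes none because the blocks have odd total degree.\<close>

definition jacobi_cond :: bool where
  "jacobi_cond \<longleftrightarrow> (\<forall>p\<ge>1. \<forall>ds as es fs. homs G ds as \<and> length as = p \<and> homs dual es fs \<and> length fs = p \<longrightarrow>
     (\<Sum>i = 1..p. \<Sum>k<p. Ycomp i (rotate k as) (rotate k fs)) = 0)"

lemma Ycomp_deg:
  assumes i: "1 \<le> i" "i \<le> p" and as: "homs G ds as" "length as = p" and fs: "homs dual es fs" "length fs = p"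
    and nz: "Ycomp i as fs \<noteq> 0"
  shows "sum_list ds + sum_list es = int p - 3"
proof -
  let ?D1 = "take (i - 1) ds" and ?D2 = "drop (i - 1) ds" and ?E1 = "take i es" and ?E2 = "drop i es"
  have l: "length ds = p" "length es = p" using as fs by (auto simp: homs_length)
  have h: "homs G ?D2 (drop (i - 1) as)" "length (drop (i - 1) as) = Suc (p - i)" "homs dual ?E2 (drop i fs)" "length (drop i fs) = p - i"
    using as fs i by (auto simp: homs_drop)
  note y = yv_deg[OF h]
  let ?ly = "sum_list ?D2 + sum_list ?E2 + 1 - int (p - i)"
  have u: "homs G (?D1 @ [?ly]) (take (i - 1) as @ [yv (drop (i - 1) as) (drop i fs)])"
     "length (take (i - 1) as @ [yv (drop (i - 1) as) (drop i fs)]) = i"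
    using as l y i by (auto simp: homs_append homs_take)
  have gs: "homs dual ?E1 (take i fs)" "length (take i fs) = i" using fs i by (auto simp: homs_take)
  have c: "sum_list ?D1 + ?ly + sum_list ?E1 = int i - 2"
    using Y_deg[OF i(1) u gs] nz by (simp add: Ycomp_def)
  have "sum_list ds = sum_list ?D1 + sum_list ?D2" "sum_list es = sum_list ?E1 + sum_list ?E2"
    by (metis append_take_drop_id sum_list_append)+
  then show ?thesis using c i by (simp add: of_nat_diff)
qed

definition jacobi :: "nat \<Rightarrow> ('k, 'a) tensor \<Rightarrow> ('k, 'a) tensor" where
  "jacobi p t = (\<Sum>i = 1..p. tscale ((-1) powi (int i * (int p + 1)))
           (\<Sum>\<sigma>\<in>cyclic_perms p. tscale (of_int (sign \<sigma>))
              (tperm s G \<sigma> (bracket_comp s G br i (p - i + 1) (tperm s G (inv \<sigma>) t)))))"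

lemma bracket_comp_in:
  assumes "1 \<le> i" "i \<le> p" "t \<in> tpow s p" shows "bracket_comp s G br i (p - i + 1) t \<in> tpow s p"
proof -
  have p: "i - 1 + (p - i + 1) = p" "i + (p - i) = p" "1 \<le> p - i + 1" using assms by auto
  have "tmap s G (i - 1) id (2 - int (p - i + 1)) (br (p - i + 1)) t \<in> tpow s p"
    using tmap_in[OF endo_id br_endo[OF p(3)], of t "i - 1"] assms(3) unfolding p by simp
  from tmap_in[OF br_endo[OF assms(1)] endo_id[of "p - i"]] this show ?thesis
    unfolding p bracket_comp_def by simp
qed

lemma bracket_comp_lin:
  "bracket_comp s G br i j (tscale c t + u) = tscale c (bracket_comp s G br i j t) + bracket_comp s G br i j u"
  "bracket_comp s G br i j 0 = 0"
  by (simp_all only: bracket_comp_def comp_apply tmap_lin)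

lemma jacobi_in:
  assumes p: "1 \<le> p" and t: "t \<in> tpow s p" shows "jacobi p t \<in> tpow s p"
  unfolding jacobi_def cyclic_perms_sum[OF p]
proof (intro tpow_sum tpow_scale)
  fix i k assume i: "i \<in> {1..p}"
  show "tperm s G (cycle_perm p ^^ k) (bracket_comp s G br i (p - i + 1) (tperm s G (inv (cycle_perm p ^^ k)) t)) \<in> tpow s p"
    using i by (intro tperm_in bracket_comp_in cycle_permutes[OF p] permutes_inv t) auto
qed

lemma jacobi_lin: "jacobi p (tscale c t + u) = tscale c (jacobi p t) + jacobi p u"
  unfolding jacobi_def
  by (simp only: tperm_lin bracket_comp_lin tsp.scale_right_distrib sum.distrib tsp.scale_sum_right tsp.scale_left_commute[of c])

lemma jacobi_0: "jacobi p 0 = 0"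
  unfolding jacobi_def by (simp only: tperm_lin bracket_comp_lin tsp.scale_zero_right sum.neutral_const)

lemma jacobi_eval:
  assumes p: "1 \<le> p" and as: "homs G ds as" "length as = p" and fs: "homs dual es fs" "length fs = p"
  shows "jacobi p (tens s as) (pform fs) =
    sg (tsg ds es + sum_list ds + int p + 1) * (\<Sum>i = 1..p. \<Sum>k<p. Ycomp i (rotate k as) (rotate k fs))"
proof -
  have l: "length ds = p" "length es = p" using as fs by (auto simp: homs_length)
  have summand: "sg (int i * (int p + 1)) * (of_int (sign \<sigma>) *
       tperm s G \<sigma> (bracket_comp s G br i (p - i + 1) (tperm s G (inv \<sigma>) (tens s as))) (pform fs)) =
     sg (tsg ds es + sum_list ds + int p + 1) * Ycomp i (rotate k as) (rotate k fs)"
    if i: "1 \<le> i" "i \<le> p" and k: "k < p" and \<sigma>: "\<sigma> = cycle_perm p ^^ k" for i k \<sigma>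
  proof -
    have s: "\<sigma> permutes {..<p}" unfolding \<sigma> by (rule cycle_permutes[OF p])
    have rot: "permute_list \<sigma> as = rotate k as" "permute_list \<sigma> fs = rotate k fs"
      using as(2) fs(2) p unfolding \<sigma> by (auto intro: permute_cycle)
    have as': "homs G (permute_list \<sigma> ds) (permute_list \<sigma> as)" "length (permute_list \<sigma> as) = p"
      and fs': "homs dual (permute_list \<sigma> es) (permute_list \<sigma> fs)" "length (permute_list \<sigma> fs) = p"
      using s as fs l by (auto simp: homs_permute)
    have ti: "tens s (permute_list \<sigma> as) \<in> tpow s p" by (rule tens_in[OF as'(2)])
    let ?T = "tens s (permute_list \<sigma> as)" and ?Y = "Ycomp i (permute_list \<sigma> as) (permute_list \<sigma> fs)"
    let ?a = "isum p \<sigma> (\<lambda>i. ds ! i)" and ?b = "isum p \<sigma> (\<lambda>i. es ! i)"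
    have sl: "sum_list (permute_list \<sigma> ds) = sum_list ds" "sum_list (permute_list \<sigma> es) = sum_list es"
      using mset_permute_list s l by (metis sum_mset_sum_list)+
    have bs: "bracket_comp s G br i (p - i + 1) (tscale c ?T) = tscale c (bracket_comp s G br i (p - i + 1) ?T)" for c
      using bracket_comp_lin(1)[of i "p - i + 1" c ?T 0] bracket_comp_lin(2)[of i "p - i + 1"] by (simp only: add_0_right)
    have "tperm s G \<sigma> (bracket_comp s G br i (p - i + 1) (tperm s G (inv \<sigma>) (tens s as))) (pform fs) =
        sg ?b * (sg ?a * (sg (tsg (permute_list \<sigma> ds) (permute_list \<sigma> es) + sum_list ds + int p + 1 + int i * (int p + 1)) * ?Y))"
      unfolding tperm_inv_tens[OF s as] bs tperm_pform[OF s tpow_scale[OF bracket_comp_in[OF i ti]] fs]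
      using bracket_comp_Ycomp[OF i as' fs'] by (simp add: tscale_def sl)
    then have "sg (int i * (int p + 1)) * (of_int (sign \<sigma>) *
       tperm s G \<sigma> (bracket_comp s G br i (p - i + 1) (tperm s G (inv \<sigma>) (tens s as))) (pform fs)) =
       sg (int i * (int p + 1) + ninv p \<sigma> + ?b + ?a + (tsg (permute_list \<sigma> ds) (permute_list \<sigma> es) + sum_list ds + int p + 1 + int i * (int p + 1))) * ?Y"
      by (simp only: sign_ninv[OF s] sg_add mult.assoc)
    also have "\<dots> = sg (tsg ds es + sum_list ds + int p + 1) * ?Y"
    proof (cases "?Y = 0")
      case False
      have c: "sum_list ds + sum_list es = int p - 3"
        using Ycomp_deg[OF i as' fs' False] sl by simp
      have "(\<Sum>i<p. ds ! i + es ! i + 1) = sum_list ds + sum_list es + int p"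
        by (simp add: sum.distrib sum_list_nth' l)
      \<comment> \<open>The total is 2p - 3, so \<open>isum_cycle_even\<close> applies to the
        blocks.\<close>
      then have "odd (\<Sum>i<p. ds ! i + es ! i + 1)" using c by presburger
      then have "even (isum p \<sigma> (\<lambda>i. ds ! i + es ! i + 1))" unfolding \<sigma> by (rule isum_cycle_even[OF k])
      then have "even (tsg (permute_list \<sigma> ds) (permute_list \<sigma> es) + tsg ds es + ?a + ?b + ninv p \<sigma>)"
        using tsg_permute[OF s l] by (simp only: parity_simps) argo
      then have "even (int i * (int p + 1) + ninv p \<sigma> + ?b + ?a + (tsg (permute_list \<sigma> ds) (permute_list \<sigma> es) + sum_list ds + int p + 1 + int i * (int p + 1))
        + (tsg ds es + sum_list ds + int p + 1))" by (simp only: parity_simps) argo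
      then show ?thesis by (simp only: sg_cong)
    qed simp
    finally show ?thesis unfolding rot .
  qed
  have "jacobi p (tens s as) (pform fs) = (\<Sum>i = 1..p. \<Sum>k<p. sg (int i * (int p + 1)) * (of_int (sign (cycle_perm p ^^ k)) *
       tperm s G (cycle_perm p ^^ k) (bracket_comp s G br i (p - i + 1) (tperm s G (inv (cycle_perm p ^^ k)) (tens s as))) (pform fs)))"
    unfolding jacobi_def cyclic_perms_sum[OF p] by (simp only: sum_fun_app tscale_def sum_distrib_left)
  also have "\<dots> = (\<Sum>i = 1..p. \<Sum>k<p. sg (tsg ds es + sum_list ds + int p + 1) * Ycomp i (rotate k as) (rotate k fs))"
    by (intro sum.cong refl, rule summand) auto
  finally show ?thesis by (simp only: sum_distrib_left)
qed

lemma jacobi_iff: "(\<forall>p\<ge>1. \<forall>t\<in>tpow s p. jacobi p t = 0) \<longleftrightarrow> jacobi_cond"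
proof
  assume L: "\<forall>p\<ge>1. \<forall>t\<in>tpow s p. jacobi p t = 0"
  show jacobi_cond unfolding jacobi_cond_def
  proof (intro allI impI, elim conjE)
    fix p ds as es fs
    assume a: "1 \<le> p" "homs G ds as" "length as = p" "homs dual es fs" "length fs = p"
    have "jacobi p (tens s as) (pform fs) = 0" using L a(1) tens_in[OF a(3)] by simp
    then show "(\<Sum>i = 1..p. \<Sum>k<p. Ycomp i (rotate k as) (rotate k fs)) = 0"
      unfolding jacobi_eval[OF a] by (simp add: sg_neq)
  qed
next
  assume C: jacobi_cond
  show "\<forall>p\<ge>1. \<forall>t\<in>tpow s p. jacobi p t = 0"
  proof (intro allI impI ballI)
    fix p t assume p: "1 \<le> p" and "t \<in> tpow s p"
    from this(2) show "jacobi p t = 0"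
    proof (induction rule: tpow_hom_induct)
      case zero
      show ?case by (rule jacobi_0)
    next
      case (comb c t u)
      then show ?case by (simp only: jacobi_lin tsp.scale_zero_right add_0_right)
    next
      case (tens ds vs)
      show ?case
      proof (rule tpow_separates[OF jacobi_in[OF p tens_in[OF tens(1)]]])
        fix es fs assume f: "homs dual es fs" "length fs = p"
        have "(\<Sum>i = 1..p. \<Sum>k<p. Ycomp i (rotate k vs) (rotate k fs)) = 0"
          by (rule C[unfolded jacobi_cond_def, rule_format, OF p]) (use tens f in simp)
        then show "jacobi p (tens s vs) (pform fs) = 0"
          unfolding jacobi_eval[OF p tens(3,1) f] by simp
      qed
    qed
  qed
qed

lemma double_P_inf_iff: "double_P_inf s G br \<longleftrightarrow> skew_cond \<and> leibniz_cond \<and> jacobi_cond"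
  unfolding double_P_inf_def skew_iff[symmetric] leibniz_iff[symmetric] jacobi_iff[symmetric] jacobi_def
  using bf br_deg by simp

end

section \<open>The square-zero extension\<close>

text \<open>The sign of the left action is left out. Its exponent is d + d(e' + k), and where the
  functional is nonzero e' + k = -d, so the exponent is even. The formula thus makes sense without
  homogeneity.\<close>

definition ext_mult :: "'a::ring \<times> ('a \<Rightarrow> 'k::field) \<Rightarrow> 'a \<times> ('a \<Rightarrow> 'k) \<Rightarrow> 'a \<times> ('a \<Rightarrow> 'k)" where
  "ext_mult x y = (fst x * fst y, \<lambda>c. snd x (fst y * c) + snd y (c * fst x))"

lemma nat_form_eq: "nat_form x y = snd x (fst y) + snd y (fst x)"
  by (simp add: nat_form_def case_prod_unfold)

lemma nat_form_commute: "nat_form x y = nat_form y x"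
  by (simp add: nat_form_eq add.commute)

lemma ext_scale_eq: "ext_scale s c x = (s c (fst x), fscale c (snd x))"
  by (simp add: ext_scale_def fscale_def case_prod_unfold)

lemma multilin_compose:
  assumes F: "multilin s s' C (r + 1 + t) F" and H: "multilin s s C q H" and HC: "\<And>ys. length ys = q \<Longrightarrow> set ys \<subseteq> C \<Longrightarrow> H ys \<in> C"
  shows "multilin s s' C (r + q + t) (\<lambda>xs. F (take r xs @ [H (take q (drop r xs))] @ drop (r + q) xs))"
  unfolding multilin_def
proof (intro allI impI, elim conjE)
  fix xs i c x y
  assume a: "length xs = r + q + t" "set xs \<subseteq> C" "i < r + q + t" "x \<in> C" "y \<in> C"
  let ?us = "take r xs" and ?bs = "take q (drop r xs)" and ?vs = "drop (r + q) xs"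
  have C: "set ?us \<subseteq> C" "set ?bs \<subseteq> C" "set ?vs \<subseteq> C"
    using a(2) by (auto dest: in_set_takeD in_set_dropD)
  have l: "length ?us = r" "length ?bs = q" "length ?vs = t" using a(1) by auto
  have upd: "set (?bs[k := z]) \<subseteq> C" if "z \<in> C" for k z
    using C(2) that set_update_subset_insert[of ?bs k z] by auto
  consider "i < r" | "r \<le> i" "i < r + q" | "r + q \<le> i" by linarith
  then show "F (take r (xs[i := s c x + y]) @ [H (take q (drop r (xs[i := s c x + y])))] @ drop (r + q) (xs[i := s c x + y])) =
     s' c (F (take r (xs[i := x]) @ [H (take q (drop r (xs[i := x])))] @ drop (r + q) (xs[i := x]))) +
     F (take r (xs[i := y]) @ [H (take q (drop r (xs[i := y])))] @ drop (r + q) (xs[i := y]))"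
  proof cases
    case 1
    have e: "take r (xs[i := z]) @ [H (take q (drop r (xs[i := z])))] @ drop (r + q) (xs[i := z]) = (?us @ [H ?bs] @ ?vs)[i := z]" for z
      using 1 l by (simp add: take_update_swap list_update_append)
    show ?thesis unfolding e by (rule multilinD[OF F]) (use l C HC a 1 in auto)
  next
    case 2
    \<comment> \<open>A placeholder 0 stands for the image of the block, so that varying a slot
      inside the block becomes a list update at position r.\<close>
    have e: "take r (xs[i := z]) @ [H (take q (drop r (xs[i := z])))] @ drop (r + q) (xs[i := z]) = (?us @ [0] @ ?vs)[r := H (?bs[i - r := z])]" for z
      using 2 l a(1) by (simp add: take_update_swap drop_update_swap list_update_append list_update_beyond)
    have H': "H (?bs[i - r := s c x + y]) = s c (H (?bs[i - r := x])) + H (?bs[i - r := y])"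
      by (rule multilinD[OF H]) (use l C a 2 in auto)
    have e': "(?us @ [0] @ ?vs)[r := z] = (?us @ [H (?bs[i - r := x])] @ ?vs)[r := z]" for z
      using l by (simp add: list_update_append)
    show ?thesis unfolding e H' unfolding e' by (rule multilinD[OF F]) (use l C HC upd a in auto)
  next
    case 3
    then obtain k where k: "i = r + q + k" using le_iff_add by blast
    have e: "take r (xs[i := z]) @ [H (take q (drop r (xs[i := z])))] @ drop (r + q) (xs[i := z]) = (?us @ [H ?bs] @ ?vs)[r + Suc k := z]" for z
      using k l a(1) by (simp add: drop_update_swap list_update_append)
    show ?thesis unfolding e by (rule multilinD[OF F]) (use l C HC a k in auto)
  qed
qed

context graded_alg begin

abbreviation esc :: "'k \<Rightarrow> 'a \<times> ('a \<Rightarrow> 'k) \<Rightarrow> 'a \<times> ('a \<Rightarrow> 'k)" where "esc \<equiv> ext_scale s"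
abbreviation edg :: "int \<Rightarrow> ('a \<times> ('a \<Rightarrow> 'k)) set" where "edg \<equiv> ext_deg s G"
abbreviation esp :: "('a \<times> ('a \<Rightarrow> 'k)) set" where "esp \<equiv> ext_space s G"

end

sublocale graded_alg \<subseteq> E: vector_space "ext_scale s"
  by unfold_locales (auto simp: ext_scale_eq plus_prod_def fsp.scale_right_distrib fsp.scale_left_distrib
      scale_right_distrib scale_left_distrib)

context graded_alg begin

lemma esp_iff: "x \<in> esp \<longleftrightarrow> snd x \<in> gdual s G"
  by (cases x) (simp add: ext_space_def)

lemma edg_iff: "x \<in> edg n \<longleftrightarrow> fst x \<in> G n \<and> snd x \<in> dual (n - 1)"
  by (cases x) (simp add: ext_deg_def)

lemma esp_subspace: "E.subspace esp"
  unfolding E.subspace_def using gdual_subspace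
  by (auto simp: esp_iff ext_scale_eq fsp.subspace_def)

lemma esp_0: "0 \<in> esp" and esp_add: "x \<in> esp \<Longrightarrow> y \<in> esp \<Longrightarrow> x + y \<in> esp" and esp_scale: "x \<in> esp \<Longrightarrow> esc c x \<in> esp"
  using esp_subspace by (auto simp: E.subspace_def)

lemma edg_subspace: "E.subspace (edg n)"
  unfolding E.subspace_def using G_subspace[of n] dual_subspace[of "n - 1"]
  by (auto simp: edg_iff ext_scale_eq fsp.subspace_def subspace_def)

lemma edg_esp: "x \<in> edg n \<Longrightarrow> x \<in> esp"
  by (auto simp: edg_iff esp_iff intro: dual_gdual)

lemma edg_0: "0 \<in> edg n"
  using edg_subspace by (rule E.subspace_0)

lemma edg_base: "(a, 0) \<in> edg n \<longleftrightarrow> a \<in> G n" and edg_dual: "(0, f) \<in> edg n \<longleftrightarrow> f \<in> dual (n - 1)"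
  by (auto simp: edg_iff G_zero dual_zero)

text \<open>A spanning set whose members have both a degree and a type, algebra or dual.\<close>

definition purehom :: "('a \<times> ('a \<Rightarrow> 'k)) set" where
  "purehom = {(a, 0) | a n. a \<in> G n} \<union> {(0, f) | f n. f \<in> dual n}"

lemma purehom_edg: "x \<in> purehom \<Longrightarrow> \<exists>n. x \<in> edg n"
proof -
  have "f \<in> dual n \<Longrightarrow> (0, f) \<in> edg (n + 1)" for f n by (simp add: edg_dual)
  then show "x \<in> purehom \<Longrightarrow> \<exists>n. x \<in> edg n"
    by (auto simp: purehom_def edg_base)
qed

lemma esp_span: "esp = E.span purehom"
proof
  show "E.span purehom \<subseteq> esp"
    by (rule E.span_minimal[OF _ esp_subspace]) (use purehom_edg edg_esp in blast)
  show "esp \<subseteq> E.span purehom"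
  proof
    fix x assume x: "x \<in> esp"
    have 1: "(a, 0) \<in> E.span purehom" for a
    proof -
      have "subspace {a. (a, 0) \<in> E.span purehom}"
      proof (rule subspaceI)
        show "0 \<in> {a. (a, 0) \<in> E.span purehom}" using E.span_zero by (simp add: zero_prod_def)
      next
        fix x y assume "x \<in> {a. (a, 0) \<in> E.span purehom}" "y \<in> {a. (a, 0) \<in> E.span purehom}"
        then have "(x, 0) + (y, 0) \<in> E.span purehom" by (intro E.span_add) auto
        then show "x + y \<in> {a. (a, 0) \<in> E.span purehom}" by simp
      next
        fix c x assume "x \<in> {a. (a, 0) \<in> E.span purehom}"
        then have "esc c (x, 0) \<in> E.span purehom" by (intro E.span_scale) auto
        then show "s c x \<in> {a. (a, 0) \<in> E.span purehom}" by (simp add: ext_scale_eq)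
      qed
      then have "span (\<Union>n. G n) \<subseteq> {a. (a, 0) \<in> E.span purehom}"
        by (intro span_minimal) (auto simp: purehom_def intro!: E.span_base)
      then show ?thesis using G_span by auto
    qed
    have "fsp.subspace {f. (0, f) \<in> E.span purehom}"
    proof (rule fsp.subspaceI)
      show "0 \<in> {f. (0, f) \<in> E.span purehom}" using E.span_zero by (simp add: zero_prod_def)
    next
      fix x y assume "x \<in> {f. (0, f) \<in> E.span purehom}" "y \<in> {f. (0, f) \<in> E.span purehom}"
      then have "(0, x) + (0, y) \<in> E.span purehom" by (intro E.span_add) auto
      then show "x + y \<in> {f. (0, f) \<in> E.span purehom}" by simp
    next
      fix c x assume "x \<in> {f. (0, f) \<in> E.span purehom}"
      then have "esc c (0, x) \<in> E.span purehom" by (intro E.span_scale) auto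
      then show "fscale c x \<in> {f. (0, f) \<in> E.span purehom}" by (simp add: ext_scale_eq)
    qed
    then have "gdual s G \<subseteq> {f. (0, f) \<in> E.span purehom}"
      unfolding gdual_span by (intro fsp.span_minimal) (auto simp: purehom_def intro!: E.span_base)
    then have "(fst x, 0) + (0, snd x) \<in> E.span purehom"
      using 1 x by (intro E.span_add) (auto simp: esp_iff)
    then show "x \<in> E.span purehom" by simp
  qed
qed

lemma nf_lin: "x \<in> esp \<Longrightarrow> y \<in> esp \<Longrightarrow> z \<in> esp \<Longrightarrow> nat_form (esc c x + y) z = c * nat_form x z + nat_form y z"
  using gdual_linf[of "snd z"]
  by (simp add: esp_iff nat_form_eq ext_scale_eq linfD fscale_def, simp add: algebra_simps)

lemma nf_lin': "x \<in> esp \<Longrightarrow> y \<in> esp \<Longrightarrow> z \<in> esp \<Longrightarrow> nat_form z (esc c x + y) = c * nat_form z x + nat_form z y"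
  using nf_lin[of x y z c] by (simp only: nat_form_commute)

lemma nf_0: "x \<in> esp \<Longrightarrow> nat_form 0 x = 0" "x \<in> esp \<Longrightarrow> nat_form x 0 = 0"
  using gdual_linf[of "snd x"] by (auto simp: esp_iff nat_form_eq linf_zero)

lemma nf_scale: "x \<in> esp \<Longrightarrow> z \<in> esp \<Longrightarrow> nat_form (esc c x) z = c * nat_form x z"
  using nf_lin[of x 0 z c] by (simp add: esp_0 nf_0)

lemma nf_sum: "(\<And>i. i \<in> S \<Longrightarrow> f i \<in> esp) \<Longrightarrow> z \<in> esp \<Longrightarrow> nat_form (\<Sum>i\<in>S. f i) z = (\<Sum>i\<in>S. nat_form (f i) z)"
proof (induction S rule: infinite_finite_induct)
  case (insert i S)
  have "(\<Sum>i\<in>S. f i) \<in> esp" using insert by (intro E.subspace_sum[OF esp_subspace]) auto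
  then show ?case using insert nf_lin[of "f i" "\<Sum>i\<in>S. f i" z 1] by simp
qed (simp_all add: nf_0)

lemma nf_deg: "x \<in> edg i \<Longrightarrow> y \<in> edg j \<Longrightarrow> nat_form x y \<noteq> 0 \<Longrightarrow> i + j = 1"
  using dual_vanish[of "snd x" "i - 1" "fst y" j] dual_vanish[of "snd y" "j - 1" "fst x" i]
  by (fastforce simp: edg_iff nat_form_eq)

text \<open>Homogeneous functionals separate the algebra part, and homogeneous vectors determine the
  functional on every component of its argument.\<close>

lemma nf_nondeg: assumes x: "x \<in> esp" and z: "\<And>z. z \<in> purehom \<Longrightarrow> nat_form x z = 0" shows "x = 0"
proof -
  have "fst x = 0"
  proof (rule dual_separates)
    fix n f assume f: "f \<in> dual n"
    then have "nat_form x (0, f) = 0" by (intro z) (auto simp: purehom_def)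
    then show "f (fst x) = 0" using x gdual_linf[of "snd x"] by (simp add: nat_form_eq esp_iff linf_zero)
  qed
  moreover have "snd x a = 0" for a
  proof -
    have l: "linf (snd x)" using x gdual_linf by (simp add: esp_iff)
    have "snd x (hc a n) = 0" for n
      using z[of "(hc a n, 0)"] hc_props(1) by (auto simp: purehom_def nat_form_eq)
    then have "snd x (\<Sum>n\<in>{n. hc a n \<noteq> 0}. hc a n) = 0" using l by (simp add: linf_sum)
    then show ?thesis using hc_props(3)[of a] by simp
  qed
  ultimately show ?thesis by (simp add: prod_eq_iff fun_eq_iff)
qed

lemma nf_nondegenerate: "nondegenerate_form esc edg esp (-1) nat_form"
  unfolding nondegenerate_form_def
proof (intro conjI allI ballI impI)
  fix x assume "x \<in> esp" "x \<noteq> 0"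
  then obtain z where "z \<in> purehom" "nat_form x z \<noteq> 0" using nf_nondeg by blast
  then show "\<exists>y\<in>esp. nat_form x y \<noteq> 0" using purehom_edg edg_esp by blast
next
  fix y assume "y \<in> esp" "y \<noteq> 0"
  then obtain z where "z \<in> purehom" "nat_form y z \<noteq> 0" using nf_nondeg by blast
  then show "\<exists>x\<in>esp. nat_form x y \<noteq> 0" using purehom_edg edg_esp nat_form_commute by metis
next
  fix i j x y assume "x \<in> edg i" "y \<in> edg j" "i + j + - 1 \<noteq> 0"
  then show "nat_form x y = 0" using nf_deg[of x i y j] by auto
qed (simp_all add: nf_lin nf_lin')

text \<open>A nonzero value forces i + j = 1, so one of i, j is even and the sign is 1.\<close>

lemma nf_sym: "x \<in> edg i \<Longrightarrow> y \<in> edg j \<Longrightarrow> (-1) powi (i * j) * nat_form y x = nat_form x y"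
proof -
  assume a: "x \<in> edg i" "y \<in> edg j"
  show ?thesis
  proof (cases "nat_form x y = 0")
    case False
    then have "i + j = 1" by (rule nf_deg[OF a])
    then have "even i \<or> even j" by presburger
    then show ?thesis by (simp add: sg_if nat_form_commute)
  qed (simp add: nat_form_commute)
qed

lemma homs_esp: "homs edg ds xs \<Longrightarrow> set xs \<subseteq> esp"
proof
  fix x assume "homs edg ds xs" "x \<in> set xs"
  then obtain i where "xs ! i = x" "xs ! i \<in> edg (ds ! i)" by (auto simp: in_set_conv_nth homs_iff)
  then show "x \<in> esp" using edg_esp by blast
qed

lemma emul_edg: assumes "x \<in> edg i" "y \<in> edg j" shows "ext_mult x y \<in> edg (i + j)"
proof -
  have "(\<lambda>c. snd x (fst y * c)) \<in> dual (i + j - 1)" "(\<lambda>c. snd y (c * fst x)) \<in> dual (i + j - 1)"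
    using dual_lmult[of "snd x" "i - 1" "fst y" j] dual_rmult[of "snd y" "j - 1" "fst x" i] assms
    by (simp_all add: edg_iff algebra_simps)
  from dual_comb[OF this, of 1] assms show ?thesis
    by (simp add: ext_mult_def edg_iff G_mult plus_fun_def)
qed

section \<open>Words with letters in the two summands\<close>

definition ext_summand :: "bool \<Rightarrow> ('a \<times> ('a \<Rightarrow> 'k)) set" where
  "ext_summand i = (if i then dual_part s G else base_part)"

lemma tB_base: "(a, 0) \<in> ext_summand False" and tB_dual: "f \<in> dual n \<Longrightarrow> (0, f) \<in> ext_summand True"
  by (auto simp: ext_summand_def base_part_def dual_part_def dual_gdual)

abbreviation pw :: "bool list \<Rightarrow> ('a \<times> ('a \<Rightarrow> 'k)) list \<Rightarrow> bool" where
  "pw is w \<equiv> list_all2 (\<lambda>i x. x \<in> ext_summand i) is w"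

lemma tB_esp: "x \<in> ext_summand i \<Longrightarrow> x \<in> esp"
  using zero_in_gdual[of s G] by (auto simp: esp_iff ext_summand_def dual_part_def base_part_def split: if_splits)

lemma pw_esp: "pw is w \<Longrightarrow> set w \<subseteq> esp"
  by (induction rule: list_all2_induct) (auto intro: tB_esp)

lemma purehom_tB: "x \<in> purehom \<Longrightarrow> \<exists>i. x \<in> ext_summand i"
  unfolding purehom_def using tB_base tB_dual by blast

text \<open>\<open>multilin_span\<close> would lose the degree list ds, on which F may depend
  through signs. Instead each entry is split into its algebra part and its functional, which have
  the same degree; k counts the entries not yet split.\<close>

lemma pure_reduce:
  assumes F: "multilin esc s' esp n F" and s': "vector_space s'"
    and van: "\<And>is ys. homs edg ds ys \<Longrightarrow> pw is ys \<Longrightarrow> length ys = n \<Longrightarrow> F ys = 0"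
    and xs: "homs edg ds xs" "length xs = n"
  shows "F xs = 0"
proof -
  interpret S: vector_space s' by (rule s')
  have "F xs = 0" if "k \<le> n" "\<exists>is. pw is (drop k xs)" "homs edg ds xs" "length xs = n" for k xs
    using that
  proof (induction k arbitrary: xs)
    case 0
    then show ?case using van by auto
  next
    case (Suc k)
    have kn: "k < n" using Suc by simp
    obtain "is" where is': "pw is (drop (Suc k) xs)" using Suc by blast
    let ?x = "xs ! k"
    have l: "length ds = n" using Suc homs_length by fastforce
    have x: "?x \<in> edg (ds ! k)" using homs_nth[OF Suc.prems(3)] l kn by simp
    have up: "F (xs[k := z]) = 0" if z: "z \<in> edg (ds ! k)" "z \<in> ext_summand i" for z i
    proof (rule Suc.IH)
      have "drop k (xs[k := z]) = z # drop (Suc k) xs"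
        using kn Suc.prems(4) by (metis Cons_nth_drop_Suc drop_update_cancel length_list_update lessI nth_list_update_eq)
      then show "\<exists>is. pw is (drop k (xs[k := z]))" using is' z(2) by (intro exI[of _ "i # is"]) simp
      show "homs edg ds (xs[k := z])" using Suc.prems(3,4) z(1) kn by (auto simp: homs_iff nth_list_update)
    qed (use kn Suc.prems in auto)
    have a: "(fst ?x, 0) \<in> edg (ds ! k)" "(0, snd ?x) \<in> edg (ds ! k)"
      using x by (auto simp: edg_iff G_zero dual_zero)
    have b: "(fst ?x, 0) \<in> ext_summand False" "(0, snd ?x) \<in> ext_summand True"
      using a(2) by (auto simp: edg_dual intro: tB_base tB_dual)
    have "F (xs[k := esc 1 (fst ?x, 0) + (0, snd ?x)]) = s' 1 (F (xs[k := (fst ?x, 0)])) + F (xs[k := (0, snd ?x)])"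
      by (rule multilinD[OF F Suc.prems(4) homs_esp[OF Suc.prems(3)] kn]) (use a edg_esp in auto)
    moreover have "xs[k := esc 1 (fst ?x, 0) + (0, snd ?x)] = xs"
      by (simp add: E.scale_one)
    ultimately show ?case using up[OF a(1) b(1)] up[OF a(2) b(2)] by simp
  qed
  from this[of n xs] xs show ?thesis by simp
qed

end

section \<open>Cyclic maps and the Stasheff identities\<close>

text \<open>
  All conditions on a good manageable special pre-Calabi-Yau structure except the Stasheff identities and
  ultracyclicity.
\<close>

locale cyclic_maps = graded_alg s G
  for s :: "'k::field_char_0 \<Rightarrow> 'a::ring \<Rightarrow> 'a" and G :: "int \<Rightarrow> 'a set" +
  fixes m :: "nat \<Rightarrow> ('a \<times> ('a \<Rightarrow> 'k)) list \<Rightarrow> 'a \<times> ('a \<Rightarrow> 'k)"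
  assumes m_off: "\<not> (n \<ge> 1 \<and> length xs = n \<and> set xs \<subseteq> ext_space s G) \<Longrightarrow> m n xs = 0"
    and m_ml: "n \<ge> 1 \<Longrightarrow> multilin (ext_scale s) (ext_scale s) (ext_space s G) n (m n)"
    and m_deg: "n \<ge> 1 \<Longrightarrow> length xs = n \<Longrightarrow> homs (ext_deg s G) ds xs \<Longrightarrow> m n xs \<in> ext_deg s G (sum_list ds + 2 - int n)"
    and m_cyc: "n \<ge> 1 \<Longrightarrow> length as = n \<Longrightarrow> a \<in> ext_deg s G d \<Longrightarrow> homs (ext_deg s G) ds as \<Longrightarrow>
      nat_form (m n as) a = (-1) powi (int n + d * sum_list ds) * nat_form (m n (a # butlast as)) (last as)"
    and m_odd: "essentially_odd m"
    and m_man: "manageable s G m"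
    and m_good: "good s G m"
begin

lemma m_esp: "m n xs \<in> esp"
proof (cases "n \<ge> 1 \<and> length xs = n \<and> set xs \<subseteq> esp")
  case True
  then have n: "n \<ge> 1" by simp
  show ?thesis
  proof (rule multilin_span[OF E.vector_space_axioms E.vector_space_axioms m_ml[OF n] esp_span esp_subspace])
    fix ys assume y: "length ys = n" "set ys \<subseteq> purehom"
    then have "set ys \<subseteq> (\<Union>d. edg d)" using purehom_edg by blast
    then obtain ds where "homs edg ds ys" using homs_exists by blast
    then show "m n ys \<in> esp" using m_deg[OF n y(1)] edg_esp by blast
  qed (use True in auto)
qed (simp add: m_off esp_0)

lemma m_zero: assumes "0 \<in> set xs" shows "m n xs = 0"
proof (cases "n \<ge> 1 \<and> length xs = n \<and> set xs \<subseteq> esp")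
  case True
  obtain i where i: "i < n" "xs ! i = 0" using assms True by (auto simp: in_set_conv_nth)
  have "m n (xs[i := esc 1 0 + 0]) = esc 1 (m n (xs[i := 0])) + m n (xs[i := 0])"
    by (rule multilinD[OF m_ml]) (use True i esp_0 in auto)
  then show ?thesis using i(2) by (metis E.scale_one add_0 add_cancel_right_left list_update_id)
qed (use m_off in blast)

lemma m_even: "even n \<Longrightarrow> n \<noteq> 2 \<Longrightarrow> m n xs = 0"
proof -
  assume "even n" "n \<noteq> 2"
  then obtain i where i: "n = 2 * i" "i \<noteq> 1" by (auto elim: evenE)
  then show ?thesis using m_odd m_off[of n xs] by (cases "i = 0") (auto simp: essentially_odd_def)
qed

lemma m_2_hom:
  assumes "x \<in> edg i" "y \<in> edg j" shows "m 2 [x, y] = ext_mult x y"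
proof -
  obtain a f where x: "x = (a, f)" by (cases x)
  obtain b g where y: "y = (b, g)" by (cases y)
  have a: "a \<in> G i" "f \<in> dual (i - 1)" "b \<in> G j" "g \<in> dual (j - 1)" using assms x y by (auto simp: edg_iff)
  note M = m_man[unfolded manageable_def, rule_format, OF a]
  have mm: "m 2 [x, y] \<in> edg (i + j)"
    using m_deg[of 2 "[x, y]" "[i, j]"] assms by (simp add: homs_def)
  have "snd (m 2 [x, y]) c = snd (ext_mult x y) c" for c
  proof -
    have l: "linf (snd (m 2 [x, y]))" "linf (snd (ext_mult x y))"
      using mm emul_edg[OF assms] by (auto simp: edg_iff dual_linf)
    have "snd (m 2 [x, y]) (hc c k) = snd (ext_mult x y) (hc c k)" for k
    proof -
      have "sg i * sg (i * (j - 1 + k)) * g (hc c k * a) = g (hc c k * a)"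
      proof (cases "g (hc c k * a) = 0")
        case False
        then have "k + i + (j - 1) = 0"
          using dual_vanish[OF a(4) G_mult[OF hc_props(1) a(1)]] by blast
        then have "j - 1 + k = - i" by simp
        then have "even (i + i * (j - 1 + k))" by simp
        then show ?thesis by (simp add: sg_add[symmetric] sg_if)
      qed simp
      then show ?thesis using M hc_props(1)[of c k] by (simp add: x y ext_mult_def)
    qed
    then have "snd (m 2 [x, y]) (\<Sum>k\<in>{k. hc c k \<noteq> 0}. hc c k) = snd (ext_mult x y) (\<Sum>k\<in>{k. hc c k \<noteq> 0}. hc c k)"
      by (simp add: linf_sum l)
    then show ?thesis using hc_props(3)[of c] by simp
  qed
  moreover have "fst (m 2 [x, y]) = fst (ext_mult x y)" using M by (simp add: x y ext_mult_def)
  ultimately show ?thesis by (simp add: prod_eq_iff fun_eq_iff)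
qed

definition W :: "('a \<times> ('a \<Rightarrow> 'k)) list \<Rightarrow> 'k" where
  "W w = nat_form (m (length w - 1) (butlast w)) (last w)"

lemma W_snoc: "W (xs @ [x]) = nat_form (m (length xs) xs) x"
  by (simp add: W_def)

text \<open>The map of arity n has degree 2 - n and the form pairs degrees with sum 1, so n + 1
  letters must have total degree n - 1.\<close>

lemma W_deg:
  assumes "homs edg ds w" "length w \<ge> 2" "W w \<noteq> 0" shows "sum_list ds = int (length w) - 2"
proof -
  have l: "length ds = length w" using assms(1) by (simp add: homs_length)
  obtain xs x where w: "w = xs @ [x]" using assms(2) by (cases w rule: rev_cases) auto
  obtain es e where d: "ds = es @ [e]" using l w by (cases ds rule: rev_cases) auto
  have le: "length es = length xs" using l w d by simp
  have h: "homs edg es xs" "x \<in> edg e" using assms(1) unfolding w d by (simp_all add: homs_append le)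
  have "m (length xs) xs \<in> edg (sum_list es + 2 - int (length xs))"
    by (rule m_deg) (use h assms w in auto)
  from nf_deg[OF this h(2)] assms(3) show ?thesis by (simp add: w d W_snoc)
qed

lemma W_zero: "0 \<in> set w \<Longrightarrow> set w \<subseteq> esp \<Longrightarrow> W w = 0"
proof -
  assume a: "0 \<in> set w" "set w \<subseteq> esp"
  then obtain xs x where w: "w = xs @ [x]" by (cases w rule: rev_cases) auto
  show "W w = 0"
  proof (cases "x = 0")
    case True
    then show ?thesis by (simp add: w W_snoc nf_0 m_esp)
  next
    case False
    then have "m (length xs) xs = 0" using a w by (intro m_zero) auto
    then show ?thesis using a by (simp add: w W_snoc nf_0)
  qed
qed

text \<open>Inserting the constraint of \<open>W_deg\<close> in the cyclicity sign leaves the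
  exponent n(1 + d), which involves only the letter that moves.\<close>

lemma W_rot1:
  assumes "homs edg ds as" "as \<noteq> []" "a \<in> edg d"
  shows "W (as @ [a]) = sg (int (length as) * (1 + d)) * W (a # as)"
proof -
  have l: "length ds = length as" using assms(1) by (simp add: homs_length)
  have e: "W (as @ [a]) = sg (int (length as) + d * sum_list ds) * W (a # as)"
    using m_cyc[of "length as" as a d ds] assms by (cases as) (auto simp: W_snoc W_def Suc_le_eq)
  show ?thesis
  proof (cases "W (a # as) = 0")
    case False
    have "sum_list (d # ds) = int (length (a # as)) - 2"
      by (rule W_deg[OF _ _ False]) (use assms in \<open>auto simp: Suc_le_eq\<close>)
    then have "sum_list ds = int (length as) - 1 - d" by simp
    then have "even (int (length as) + d * sum_list ds + int (length as) * (1 + d))"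
      by (simp only: parity_simps) argo
    then have "(sg (int (length as) + d * sum_list ds) :: 'k) = sg (int (length as) * (1 + d))" by (rule sg_cong)
    then show ?thesis using e by simp
  qed (use e in simp)
qed

lemma W_rot:
  assumes "homs edg ds us" "homs edg es vs" "length us + length vs \<ge> 2"
  shows "W (vs @ us) = sg ((int (length us + length vs) - 1) * (int (length us) + sum_list ds)) * W (us @ vs)"
  using assms
proof (induction us arbitrary: ds es vs rule: rev_induct)
  case Nil
  then show ?case by simp
next
  case (snoc u us)
  then have "length ds = Suc (length us)" by (simp add: homs_length[symmetric])
  then obtain ds' d where ds: "ds = ds' @ [d]" "length ds' = length us" by (cases ds rule: rev_cases) auto
  have h: "homs edg ds' us" "u \<in> edg d" using snoc.prems(1) unfolding ds(1) by (simp_all add: homs_append ds(2))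
  have "length es = length vs" using snoc.prems(2) by (simp add: homs_length)
  then have h': "homs edg (es @ ds') (vs @ us)" using h snoc.prems by (simp add: homs_append)
  let ?n = "int (length us + length vs)"
  have "W (vs @ us @ [u]) = sg (?n * (1 + d)) * W (u # vs @ us)"
  proof -
    have "vs @ us \<noteq> []" using snoc.prems(3) by auto
    from W_rot1[OF h' this h(2)] show ?thesis by (simp add: add.commute)
  qed
  also have "W (u # vs @ us) = sg (?n * (int (length us) + sum_list ds')) * W (us @ u # vs)"
    using snoc.IH[OF h(1), of "d # es" "u # vs"] snoc.prems h by simp
  also have "sg (?n * (1 + d)) * (sg (?n * (int (length us) + sum_list ds')) * W (us @ u # vs)) =
      sg (?n * (1 + d) + ?n * (int (length us) + sum_list ds')) * W (us @ u # vs)"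
    by (simp only: sg_add mult.assoc)
  also have "?n * (1 + d) + ?n * (int (length us) + sum_list ds') = (int (length (us @ [u]) + length vs) - 1) * (int (length (us @ [u])) + sum_list ds)"
    by (simp add: ds algebra_simps)
  finally show ?case by simp
qed

text \<open>Up to rotation every insertion of one map in another has this shape, with the inner map
  at the front.\<close>

definition compose_W :: "nat \<Rightarrow> ('a \<times> ('a \<Rightarrow> 'k)) list \<Rightarrow> 'k" where
  "compose_W q w = W (m q (take q w) # drop q w)"

text \<open>After rotation both sides are the form on the two vectors
  \<open>m (length bs) bs\<close> and \<open>m (length cs) cs\<close>. The form is symmetric, so
  inner and outer map exchange roles; the degree constraint eliminates the degrees of cs from the
  sign.\<close>

lemma C0_swap:
  assumes "homs edg ds bs" "homs edg es cs" "bs \<noteq> []" "cs \<noteq> []"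
  shows "compose_W (length bs) (bs @ cs) =
    sg (int (length cs) * (1 + sum_list ds + int (length bs)) + int (length bs) * (sum_list ds + int (length bs))) * compose_W (length cs) (cs @ bs)"
proof -
  let ?q = "length bs" and ?n = "length cs"
  let ?y = "m ?q bs" and ?z = "m ?n cs"
  let ?dy = "sum_list ds + 2 - int ?q" and ?dz = "sum_list es + 2 - int ?n"
  have y: "?y \<in> edg ?dy" by (rule m_deg) (use assms in \<open>auto simp: Suc_le_eq\<close>)
  have z: "?z \<in> edg ?dz" by (rule m_deg) (use assms in \<open>auto simp: Suc_le_eq\<close>)
  have s2: "sg a * (sg a * x) = x" for a and x :: 'k by (simp add: mult.assoc[symmetric] sg_sq del: power_int_eq_0_iff)
  have "compose_W ?q (bs @ cs) = W (?y # cs)" by (simp add: compose_W_def)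
  also have "\<dots> = sg (int ?n * (1 + ?dy)) * W (cs @ [?y])"
    unfolding W_rot1[OF assms(2,4) y] s2 ..
  also have "W (cs @ [?y]) = W (bs @ [?z])" by (simp add: W_snoc nat_form_commute)
  also have "W (bs @ [?z]) = sg (int ?q * (1 + ?dz)) * W (?z # bs)" by (rule W_rot1[OF assms(1,3) z])
  also have "W (?z # bs) = compose_W ?n (cs @ bs)" by (simp add: compose_W_def)
  finally have e: "compose_W ?q (bs @ cs) = sg (int ?n * (1 + ?dy) + int ?q * (1 + ?dz)) * compose_W ?n (cs @ bs)"
    by (simp only: sg_add mult.assoc)
  show ?thesis
  proof (cases "compose_W ?n (cs @ bs) = 0")
    case False
    then have "W (?z # bs) \<noteq> 0" by (simp add: compose_W_def)
    then have "sum_list (?dz # ds) = int (length (?z # bs)) - 2"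
      by (rule W_deg[rotated 2]) (use z assms in \<open>auto simp: Suc_le_eq\<close>)
    then have dz: "?dz = int ?q - 1 - sum_list ds" by simp
    have "even (int ?n * (1 + ?dy) + int ?q * (1 + ?dz) + (int ?n * (1 + sum_list ds + int ?q) + int ?q * (sum_list ds + int ?q)))"
      unfolding dz by (simp only: parity_simps even_numeral) argo
    then show ?thesis unfolding e by (simp only: sg_cong)
  qed (simp add: e)
qed

definition stasheff_sum :: "int list \<Rightarrow> nat \<Rightarrow> ('a \<times> ('a \<Rightarrow> 'k)) list \<Rightarrow> 'a \<times> ('a \<Rightarrow> 'k)" where
  "stasheff_sum ds n xs = (\<Sum>(r, q, t)\<in>{(r, q, t). r + q + t = n \<and> q \<ge> 1}.
           esc ((-1) powi (int r + int q * int t + (2 - int q) * sum_list (take r ds)))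
             (m (r + 1 + t) (take r xs @ [m q (take q (drop r xs))] @ drop (r + q) xs)))"

definition stasheff :: "nat \<Rightarrow> bool" where
  "stasheff n \<longleftrightarrow> (\<forall>ds xs. length xs = n \<and> homs edg ds xs \<longrightarrow> stasheff_sum ds n xs = 0)"

text \<open>
  The Stasheff sum paired with the last letter of \<open>w\<close>; cyclicity moves the inner map to the front of a rotated word.
\<close>

definition stasheff_form :: "int list \<Rightarrow> ('a \<times> ('a \<Rightarrow> 'k)) list \<Rightarrow> 'k" where
  "stasheff_form ds w = (let n = length w - 1 in \<Sum>q = 1..n. \<Sum>r\<le>n - q.
     sg (int q * (int n + 1) + int r + (int n + 1) * (int r + sum_list (take r ds))) * compose_W q (rotate r w))"

lemma C0_rotate:
  assumes h: "homs edg ds xs" "z \<in> edg dz" and l: "length xs = n" "r + q \<le> n" "q \<ge> 1"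
  shows "W (take r xs @ [m q (take q (drop r xs))] @ drop (r + q) xs @ [z]) =
    sg ((int n - int q + 1) * (int r + sum_list (take r ds))) * compose_W q (rotate r (xs @ [z]))"
proof -
  let ?us = "take r xs" and ?y = "m q (take q (drop r xs))" and ?vs = "drop (r + q) xs @ [z]"
  have ld: "length ds = n" using h l by (simp add: homs_length[symmetric])
  have y: "?y \<in> edg (sum_list (take q (drop r ds)) + 2 - int q)"
    by (rule m_deg) (use l h in \<open>auto simp: homs_def intro!: list_all2_takeI list_all2_dropI\<close>)
  have us: "homs edg (take r ds) ?us" using h(1) by (simp add: homs_def list_all2_takeI)
  have vs: "homs edg ((sum_list (take q (drop r ds)) + 2 - int q) # drop (r + q) ds @ [dz]) (?y # ?vs)"
    using h y l ld by (simp add: homs_append) (simp add: homs_def list_all2_dropI)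
  have rot: "rotate r (xs @ [z]) = take q (drop r xs) @ ?vs @ ?us"
  proof -
    have "r mod length (xs @ [z]) = r" using l by simp
    then have "rotate r (xs @ [z]) = drop r xs @ [z] @ ?us" using l by (simp add: rotate_drop_take)
    also have "drop r xs = take q (drop r xs) @ drop (r + q) xs"
      by (metis append_take_drop_id drop_drop add.commute)
    finally show ?thesis by simp
  qed
  have s2: "sg a * (sg a * x) = x" for a and x :: 'k by (simp add: mult.assoc[symmetric] sg_sq del: power_int_eq_0_iff)
  have C: "compose_W q (rotate r (xs @ [z])) = W ((?y # ?vs) @ ?us)"
    unfolding compose_W_def rot using l by simp
  have ln: "int (length ?us + length (?y # ?vs)) - 1 = int n - int q + 1" "length ?us = r"
    using l by (auto simp: of_nat_diff)
  have "W ((?y # ?vs) @ ?us) = sg ((int n - int q + 1) * (int r + sum_list (take r ds))) * W (?us @ ?y # ?vs)"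
  proof -
    have "2 \<le> length ?us + length (?y # ?vs)" by simp
    from W_rot[OF us vs this] show ?thesis unfolding ln(1) unfolding ln(2) .
  qed
  then show ?thesis unfolding C by (simp add: s2)
qed

lemma stash_paired:
  assumes h: "homs edg ds xs" "z \<in> edg dz" "length xs = n"
  shows "nat_form (stasheff_sum ds n xs) z = stasheff_form (ds @ [dz]) (xs @ [z])"
proof -
  have ld: "length ds = n" using h by (simp add: homs_length[symmetric])
  let ?t = "\<lambda>r q t. esc ((-1) powi (int r + int q * int t + (2 - int q) * sum_list (take r ds)))
             (m (r + 1 + t) (take r xs @ [m q (take q (drop r xs))] @ drop (r + q) xs))"
  have t: "nat_form (?t r q t) z = sg (int q * (int n + 1) + int r + (int n + 1) * (int r + sum_list (take r ds))) * compose_W q (rotate r (xs @ [z]))"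
    if rqt: "r + q + t = n" "q \<ge> 1" for r q t
  proof -
    let ?U = "sum_list (take r ds)"
    let ?l = "take r xs @ [m q (take q (drop r xs))] @ drop (r + q) xs"
    have ll: "length ?l = r + 1 + t" using rqt h(3) by simp
    have "nat_form (?t r q t) z = sg (int r + int q * int t + (2 - int q) * ?U) * nat_form (m (length ?l) ?l) z"
      unfolding ll using h(2) by (intro nf_scale m_esp edg_esp)
    also have "nat_form (m (length ?l) ?l) z = W (?l @ [z])" unfolding W_snoc ..
    also have "W (?l @ [z]) = sg ((int n - int q + 1) * (int r + ?U)) * compose_W q (rotate r (xs @ [z]))"
      using C0_rotate[OF h(1,2,3), of r q] rqt by simp
    finally have e: "nat_form (?t r q t) z = sg (int r + int q * int t + (2 - int q) * ?U + (int n - int q + 1) * (int r + ?U)) * compose_W q (rotate r (xs @ [z]))"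
      by (simp only: sg_add mult.assoc)
    have n: "int n = int r + int q + int t" using rqt by simp
    have "even (int r + int q * int t + (2 - int q) * ?U + (int n - int q + 1) * (int r + ?U) +
       (int q * (int n + 1) + int r + (int n + 1) * (int r + ?U)))"
      unfolding n by (simp only: parity_simps even_numeral) argo
    then show ?thesis unfolding e by (simp only: sg_cong)
  qed
  have n: "length (xs @ [z]) - 1 = n" using h by simp
  have fin: "finite {(r, q, t). r + q + t = n \<and> q \<ge> 1}"
    by (rule finite_subset[of _ "{..n} \<times> {..n} \<times> {..n}"]) auto
  have "nat_form (stasheff_sum ds n xs) z = (\<Sum>(r, q, t)\<in>{(r, q, t). r + q + t = n \<and> q \<ge> 1}. nat_form (?t r q t) z)"
    unfolding stasheff_sum_def by (subst nf_sum) (use h(2) in \<open>auto intro: esp_scale m_esp edg_esp simp: case_prod_unfold\<close>)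
  also have "\<dots> = (\<Sum>(r, q, t)\<in>{(r, q, t). r + q + t = n \<and> q \<ge> 1}.
      sg (int q * (int n + 1) + int r + (int n + 1) * (int r + sum_list (take r ds))) * compose_W q (rotate r (xs @ [z])))"
  proof (rule sum.cong[OF refl])
    fix p assume "p \<in> {(r, q, t). r + q + t = n \<and> q \<ge> 1}"
    then obtain r q t' where p: "p = (r, q, t')" "r + q + t' = n" "q \<ge> 1" by (cases p) auto
    show "(case p of (r, q, t) \<Rightarrow> nat_form (?t r q t) z) = (case p of (r, q, t) \<Rightarrow>
      sg (int q * (int n + 1) + int r + (int n + 1) * (int r + sum_list (take r ds))) * compose_W q (rotate r (xs @ [z])))"
      unfolding p(1) prod.case by (rule t[OF p(2,3)])
  qed
  also have "\<dots> = (\<Sum>(q, r)\<in>(SIGMA q:{1..n}. {..n - q}).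
      sg (int q * (int n + 1) + int r + (int n + 1) * (int r + sum_list (take r ds))) * compose_W q (rotate r (xs @ [z])))"
    by (rule sum.reindex_bij_witness[where i="\<lambda>(q, r). (r, q, n - r - q)" and j="\<lambda>(r, q, t). (q, r)"]) auto
  also have "\<dots> = stasheff_form (ds @ [dz]) (xs @ [z])"
    unfolding stasheff_form_def n Let_def using ld by (subst sum.Sigma) (auto intro!: sum.cong)
  finally show ?thesis .
qed

lemma stash_multilin: "n \<ge> 1 \<Longrightarrow> multilin esc esc esp n (stasheff_sum ds n)"
  unfolding multilin_def
proof (intro allI impI, elim conjE)
  fix xs i c x y assume n: "n \<ge> 1" and a: "length xs = n" "set xs \<subseteq> esp" "i < n" "x \<in> esp" "y \<in> esp"
  have fin: "finite {(r, q, t). r + q + t = n \<and> q \<ge> 1}"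
    by (rule finite_subset[of _ "{..n} \<times> {..n} \<times> {..n}"]) auto
  let ?g = "\<lambda>(r, q, t) xs. esc ((-1) powi (int r + int q * int t + (2 - int q) * sum_list (take r ds)))
             (m (r + 1 + t) (take r xs @ [m q (take q (drop r xs))] @ drop (r + q) xs))"
  have g: "?g p (xs[i := esc c x + y]) = esc c (?g p (xs[i := x])) + ?g p (xs[i := y])"
    if pm: "p \<in> {(r, q, t). r + q + t = n \<and> q \<ge> 1}" for p
  proof -
    obtain r q t where p: "p = (r, q, t)" "r + q + t = n" "q \<ge> 1" using pm by (cases p) auto
    have ml: "multilin esc esc esp (r + q + t) (\<lambda>xs. m (r + 1 + t) (take r xs @ [m q (take q (drop r xs))] @ drop (r + q) xs))"
      by (rule multilin_compose[OF m_ml m_ml]) (use p m_esp in auto)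
    show ?thesis unfolding p(1) prod.case
      by (subst multilinD[OF ml]) (use a p in \<open>auto simp: E.scale_right_distrib E.scale_left_commute\<close>)
  qed
  have s: "stasheff_sum ds n = (\<lambda>xs. \<Sum>p\<in>{(r, q, t). r + q + t = n \<and> q \<ge> 1}. ?g p xs)"
    unfolding stasheff_sum_def by (simp add: case_prod_unfold)
  show "stasheff_sum ds n (xs[i := esc c x + y]) = esc c (stasheff_sum ds n (xs[i := x])) + stasheff_sum ds n (xs[i := y])"
    unfolding s using g by (simp only: sum.cong[OF refl g] sum.distrib E.scale_sum_right)
qed

text \<open>Nondegeneracy tests the identity against one more letter, and multilinearity lets every
  letter lie in one summand, so that goodness can be applied to the pattern of types.\<close>

lemma stasheff_iff:
  assumes n: "n \<ge> 1"
  shows "stasheff n \<longleftrightarrow> (\<forall>ds is w. length w = Suc n \<and> homs edg ds w \<and> pw is w \<longrightarrow> stasheff_form ds w = 0)"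
proof
  assume S: "stasheff n"
  show "\<forall>ds is w. length w = Suc n \<and> homs edg ds w \<and> pw is w \<longrightarrow> stasheff_form ds w = 0"
  proof (intro allI impI, elim conjE)
    fix ds "is" w assume w: "length w = Suc n" "homs edg ds w" "pw is w"
    obtain xs z where x: "w = xs @ [z]" "length xs = n" using w by (cases w rule: rev_cases) auto
    have "length ds = Suc n" using w by (simp add: homs_length[symmetric])
    then obtain ds' d where d: "ds = ds' @ [d]" "length ds' = n" by (cases ds rule: rev_cases) auto
    have h: "homs edg ds' xs" "z \<in> edg d" using w(2) by (auto simp: x d homs_append)
    have "stasheff_sum ds' n xs = 0" using S x h by (auto simp: stasheff_def)
    then show "stasheff_form ds w = 0" using stash_paired[OF h x(2)] h(2) by (simp add: x d nf_0 edg_esp)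
  qed
next
  assume E: "\<forall>ds is w. length w = Suc n \<and> homs edg ds w \<and> pw is w \<longrightarrow> stasheff_form ds w = 0"
  show "stasheff n" unfolding stasheff_def
  proof (intro allI impI, elim conjE)
    fix ds xs assume xs: "length xs = n" "homs edg ds xs"
    show "stasheff_sum ds n xs = 0"
    proof (rule pure_reduce[OF stash_multilin[OF n] E.vector_space_axioms _ xs(2,1)])
      fix "is" ys assume y: "homs edg ds ys" "pw is ys" "length ys = n"
      have esp: "stasheff_sum ds n ys \<in> esp"
        unfolding stasheff_sum_def by (intro E.subspace_sum[OF esp_subspace]) (auto intro: esp_scale m_esp)
      show "stasheff_sum ds n ys = 0"
      proof (rule nf_nondeg[OF esp])
        fix z assume z: "z \<in> purehom"
        obtain d where d: "z \<in> edg d" using purehom_edg[OF z] by blast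
        obtain i where i: "z \<in> ext_summand i" using purehom_tB[OF z] by blast
        have "stasheff_form (ds @ [d]) (ys @ [z]) = 0"
          by (rule E[rule_format, of _ _ "is @ [i]"])
            (use y d i in \<open>simp add: homs_append homs_length list_all2_append list_all2_lengthD\<close>)
        then show "nat_form (stasheff_sum ds n ys) z = 0" using stash_paired[OF y(1) d y(3)] by simp
      qed
    qed
  qed
qed

text \<open>The inner map has arity q and the outer one arity \<open>length w - q\<close>; maps of
  even arity other than 2 vanish.\<close>

lemma C0_even_zero:
  assumes "set w \<subseteq> esp" "1 \<le> q" "q < length w" "even q \<and> q \<noteq> 2 \<or> even (length w - q) \<and> length w - q \<noteq> 2"
  shows "compose_W q w = 0"
proof (cases "even q \<and> q \<noteq> 2")
  case True
  then show ?thesis unfolding compose_W_def using assms m_even[of q] by (intro W_zero) (auto simp: esp_0 dest: in_set_dropD)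
next
  case False
  let ?w = "m q (take q w) # drop q w"
  have l: "length ?w - 1 = length w - q" using assms by simp
  have "m (length w - q) (butlast ?w) = 0" using False assms(4) by (intro m_even) auto
  moreover have "last w \<in> esp" using assms(1,3) by (cases w rule: rev_cases) auto
  then have "last ?w \<in> esp" using assms m_esp by (auto simp: last_drop)
  ultimately show ?thesis unfolding compose_W_def W_def l by (simp add: nf_0)
qed

definition stasheff_form_2 :: "int list \<Rightarrow> ('a \<times> ('a \<Rightarrow> 'k)) list \<Rightarrow> 'k" where
  "stasheff_form_2 ds w = (\<Sum>r<length w. sg (sum_list (take r ds)) * compose_W 2 (rotate r w))"

lemma homs_rotate: "homs H ds xs \<Longrightarrow> homs H (rotate r ds) (rotate r xs)"
proof -
  assume h: "homs H ds xs"
  have "(r + i) mod length ds < length ds" if "i < length ds" for i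
    using that by (intro mod_less_divisor) linarith
  then show ?thesis using h by (auto simp: homs_iff nth_rotate)
qed

text \<open>For even n the arities q and n + 1 - q have opposite parity, so one of the two maps is
  the product: q = 2 or q = n - 1. \<open>C0_swap\<close> turns the two terms with q = n - 1 into
  the rotations n - 1 and n missing from the terms with q = 2.\<close>

lemma SE_even:
  assumes w: "homs edg ds w" and l: "length w = Suc n" and n: "even n" "n \<ge> 2"
  shows "stasheff_form ds w = stasheff_form_2 ds w"
proof -
  have ld: "length ds = Suc n" using w l by (simp add: homs_length[symmetric])
  have esp: "set (rotate r w) \<subseteq> esp" for r using homs_esp[OF w] by simp
  let ?f = "\<lambda>q r. sg (int q * (int n + 1) + int r + (int n + 1) * (int r + sum_list (take r ds))) * compose_W q (rotate r w)"
  have z: "?f q r = 0" if "q \<in> {1..n}" "q \<noteq> 2" "q \<noteq> n - 1" for q r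
  proof -
    have "even q \<and> q \<noteq> 2 \<or> even (Suc n - q) \<and> Suc n - q \<noteq> 2"
      using that n by (cases "even q") auto
    then have "compose_W q (rotate r w) = 0" using that esp l by (intro C0_even_zero) auto
    then show ?thesis by simp
  qed
  have "stasheff_form ds w = (\<Sum>q\<in>{1..n}. \<Sum>r\<le>n - q. ?f q r)" by (simp add: stasheff_form_def l)
  also have "\<dots> = (\<Sum>q\<in>{2, n - 1}. \<Sum>r\<le>n - q. ?f q r)"
    by (rule sum.mono_neutral_right) (use n z in \<open>auto intro!: sum.neutral\<close>)
  also have "\<dots> = (\<Sum>r\<le>n - 2. ?f 2 r) + (\<Sum>r\<le>1. ?f (n - 1) r)"
  proof -
    have "n - 1 \<noteq> 2" using n by presburger
    then show ?thesis using n by (subst sum.insert) auto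
  qed
  also have "(\<Sum>r\<le>n - 2. ?f 2 r) = (\<Sum>r<n - 1. sg (sum_list (take r ds)) * compose_W 2 (rotate r w))"
  proof (rule sum.cong)
    fix r
    have "even (int 2 * (int n + 1) + int r + (int n + 1) * (int r + sum_list (take r ds)) + sum_list (take r ds))"
      using n by (simp, argo)
    then show "?f 2 r = sg (sum_list (take r ds)) * compose_W 2 (rotate r w)" by (simp only: sg_cong)
  qed (use n in auto)
  also have "(\<Sum>r\<le>1. ?f (n - 1) r) = (\<Sum>r\<in>{n - 1, n}. sg (sum_list (take r ds)) * compose_W 2 (rotate r w))"
  proof -
    have key: "?f (n - 1) r = sg (sum_list (take (r + n - 1) ds)) * compose_W 2 (rotate (r + n - 1) w)" if r: "r \<le> 1" for r
    proof -
      let ?b = "take (n - 1) (rotate r w)" and ?c = "drop (n - 1) (rotate r w)"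
      let ?db = "take (n - 1) (rotate r ds)" and ?dc = "drop (n - 1) (rotate r ds)"
      have lb: "length ?b = n - 1" "length ?c = 2" using l n by auto
      have hb: "homs edg ?db ?b" "homs edg ?dc ?c"
        using homs_rotate[OF w, of r] by (simp_all add: homs_def list_all2_takeI list_all2_dropI)
      have "?b \<noteq> []" "?c \<noteq> []" using lb n by (auto simp del: length_drop length_take)
      from C0_swap[OF hb this] have e: "compose_W (n - 1) (rotate r w) =
        sg (int 2 * (1 + sum_list ?db + int (n - 1)) + int (n - 1) * (sum_list ?db + int (n - 1))) * compose_W 2 (?c @ ?b)"
        unfolding lb by simp
      have "?c @ ?b = rotate (n - 1) (rotate r w)"
        using l n by (simp add: rotate_drop_take)
      also have "\<dots> = rotate (r + n - 1) w" using n by (simp add: rotate_rotate add.commute)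
      finally have rot: "?c @ ?b = rotate (r + n - 1) w" .
      have sdb: "sum_list ?db = sum_list (take (r + n - 1) ds) - sum_list (take r ds)"
      proof -
        have "rotate r ds = drop r ds @ take r ds" using ld r n by (simp add: rotate_drop_take)
        then have "?db = take (n - 1) (drop r ds)" using ld r n by simp
        moreover have "take (r + n - 1) ds = take r ds @ take (n - 1) (drop r ds)"
          using n by (simp add: take_add[symmetric])
        ultimately show ?thesis by simp
      qed
      define A B where "A = sum_list (take (r + n - 1) ds)" and "B = sum_list (take r ds)"
      have "odd (int (n - 1))" using n by simp
      then have "even (int (n - 1) * (int n + 1) + int r + (int n + 1) * (int r + B) + (int 2 * (1 + (A - B) + int (n - 1)) + int (n - 1) * (A - B + int (n - 1))) + A)"
        using n(1) by (cases "even A"; cases "even B"; cases "even r") simp_all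
      then have "(sg (int (n - 1) * (int n + 1) + int r + (int n + 1) * (int r + B) + (int 2 * (1 + (A - B) + int (n - 1)) + int (n - 1) * (A - B + int (n - 1)))) :: 'k) = sg A"
        by (rule sg_cong)
      then show ?thesis unfolding e rot sdb A_def[symmetric] B_def[symmetric]
        by (simp only: mult.assoc[symmetric] sg_add[symmetric])
    qed
    have "(\<Sum>r\<le>1. ?f (n - 1) r) = ?f (n - 1) 0 + ?f (n - 1) 1" by (simp only: One_nat_def sum.atMost_Suc atMost_0) simp
    also have "\<dots> = (\<Sum>r\<in>{n - 1, n}. sg (sum_list (take r ds)) * compose_W 2 (rotate r w))"
      using key[of 0] key[of 1] n by simp
    finally show ?thesis .
  qed
  also have "(\<Sum>r<n - 1. sg (sum_list (take r ds)) * compose_W 2 (rotate r w)) + (\<Sum>r\<in>{n - 1, n}. sg (sum_list (take r ds)) * compose_W 2 (rotate r w))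
    = (\<Sum>r<Suc n. sg (sum_list (take r ds)) * compose_W 2 (rotate r w))"
  proof -
    obtain k where k: "n = Suc k" using n by (cases n) auto
    show ?thesis by (simp add: k)
  qed
  finally show ?thesis by (simp add: stasheff_form_2_def l)
qed

text \<open>Rotation shifts the summation index by one. The new term at r = n + 1 equals the lost
  one at r = 0, since a nonzero term forces the total degree n - 2, which is even.\<close>

lemma SE2_rotate1:
  assumes w: "homs edg ds w" and l: "length w = Suc n" "even n" "n \<ge> 2"
  shows "stasheff_form_2 (rotate1 ds) (rotate1 w) = sg (hd ds) * stasheff_form_2 ds w"
proof -
  have ld: "length ds = Suc n" using w l by (simp add: homs_length[symmetric])
  then obtain d ds' where d: "ds = d # ds'" "length ds' = n" by (cases ds) auto
  let ?f = "\<lambda>r. sg (sum_list (take r ds)) * compose_W 2 (rotate r w)"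
  have "stasheff_form_2 (rotate1 ds) (rotate1 w) = (\<Sum>r<Suc n. sg d * ?f (Suc r))"
    unfolding stasheff_form_2_def
  proof (rule sum.cong)
    fix r assume r: "r \<in> {..<Suc n}"
    have "sum_list (take (Suc r) ds) = d + sum_list (take r (rotate1 ds))" using r d by simp
    then have "even (sum_list (take r (rotate1 ds)) + (d + sum_list (take (Suc r) ds)))" by simp
    then have "(sg (sum_list (take r (rotate1 ds))) :: 'k) = sg (d + sum_list (take (Suc r) ds))" by (rule sg_cong)
    moreover have "rotate r (rotate1 w) = rotate (Suc r) w" by (simp add: rotate1_rotate_swap)
    ultimately show "sg (sum_list (take r (rotate1 ds))) * compose_W 2 (rotate r (rotate1 w)) = sg d * ?f (Suc r)"
      by (simp only: sg_add mult.assoc)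
  qed (use l in simp)
  also have "\<dots> = sg d * (\<Sum>r<Suc n. ?f (Suc r))" by (simp only: sum_distrib_left)
  also have "(\<Sum>r<Suc n. ?f (Suc r)) = (\<Sum>r<Suc n. ?f r) + ?f (Suc n) - ?f 0"
  proof -
    have "(\<Sum>r<Suc (Suc n). ?f r) = ?f 0 + (\<Sum>r<Suc n. ?f (Suc r))" by (rule sum.lessThan_Suc_shift)
    moreover have "(\<Sum>r<Suc (Suc n). ?f r) = (\<Sum>r<Suc n. ?f r) + ?f (Suc n)" by (rule sum.lessThan_Suc)
    ultimately show ?thesis by simp
  qed
  also have "?f (Suc n) = ?f 0"
    unfolding rotate_id[of "Suc n" w, unfolded l(1) mod_self, OF refl]
  proof (cases "compose_W 2 w = 0")
    case False
    obtain x1 x2 ws where ws: "w = x1 # x2 # ws" "length ws = n - 1" using l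
      by (cases w; cases "tl w") auto
    obtain d2 ds'' where d2: "ds' = d2 # ds''" using d(2) l by (cases ds') auto
    have h: "x1 \<in> edg d" "x2 \<in> edg d2" "homs edg ds'' ws" using w by (simp_all add: ws d d2)
    have m2: "m 2 [x1, x2] \<in> edg (d + d2)" using m_deg[of 2 "[x1, x2]" "[d, d2]"] h by simp
    have "W (m 2 [x1, x2] # ws) \<noteq> 0" using False by (simp add: compose_W_def ws numeral_2_eq_2)
    then have "sum_list ((d + d2) # ds'') = int (length (m 2 [x1, x2] # ws)) - 2"
      by (rule W_deg[rotated 2]) (use h m2 ws l in auto)
    then have "sum_list ds = int n - 2" using ws l by (simp add: d d2 of_nat_diff)
    then have "even (sum_list ds)" using l(2) by simp
    then show "sg (sum_list (take (Suc n) ds)) * compose_W 2 w = sg (sum_list (take 0 ds)) * compose_W 2 (rotate 0 w)"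
      using ld by (simp add: sg_if)
  qed simp
  finally show ?thesis by (simp add: stasheff_form_2_def l d)
qed

lemma SE2_rotate:
  assumes w: "homs edg ds w" and l: "length w = Suc n" "even n" "n \<ge> 2" and 0: "stasheff_form_2 (rotate k ds) (rotate k w) = 0"
  shows "stasheff_form_2 ds w = 0"
  using 0
proof (induction k)
  case (Suc k)
  have "stasheff_form_2 (rotate (Suc k) ds) (rotate (Suc k) w) = sg (hd (rotate k ds)) * stasheff_form_2 (rotate k ds) (rotate k w)"
    using SE2_rotate1[OF homs_rotate[OF w]] l by simp
  then show ?case using Suc by (simp add: sg_neq)
qed simp

end

section \<open>Alternating words\<close>

lemma alt_last: "distinct_adj (is :: bool list) \<Longrightarrow> is \<noteq> [] \<Longrightarrow> last is = (hd is = odd (length is))"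
  by (induction "is") (auto simp: distinct_adj_Cons)

text \<open>In an alternating word of even length the last letter differs from the first, so
  alternation passes the seam.\<close>

lemma alt_rotate1: "distinct_adj (is :: bool list) \<Longrightarrow> even (length is) \<Longrightarrow> distinct_adj (rotate1 is)"
proof (cases "is")
  case (Cons i js)
  assume a: "distinct_adj is" "even (length is)"
  show ?thesis
  proof (cases "js = []")
    case False
    have "last is \<noteq> hd is" using alt_last[OF a(1)] a(2) Cons by auto
    then have "last js \<noteq> i" using Cons False by simp
    then show ?thesis using a(1) False by (simp add: Cons distinct_adj_append_iff distinct_adj_Cons)
  qed (simp add: Cons)
qed simp

lemma alt_rotate: "even (length (is :: bool list)) \<Longrightarrow> distinct_adj (rotate r is) \<longleftrightarrow> distinct_adj is"
proof -
  assume e: "even (length is)"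
  have f: "distinct_adj js \<Longrightarrow> even (length js) \<Longrightarrow> distinct_adj (rotate k js)" for k and js :: "bool list"
    by (induction k) (auto intro: alt_rotate1)
  let ?k = "length is - r mod length is"
  have "rotate ?k (rotate r is) = is"
  proof (cases "is = []")
    case False
    then have "(?k + r) mod length is = 0"
      by (metis length_greater_0_conv less_imp_le_nat le_add_diff_inverse2 mod_add_right_eq mod_less_divisor mod_self)
    then show ?thesis by (simp add: rotate_rotate rotate_id)
  qed simp
  then show ?thesis using f[of "is" r] f[of "rotate r is" ?k] e by auto
qed

text \<open>Either two neighbours agree, or the word alternates and its odd length makes the first
  and the last letter agree.\<close>

lemma odd_cycle_repeats:
  assumes "odd (length (is :: bool list))" "length is \<ge> 3"
  shows "\<exists>k i js. rotate k is = i # i # js"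
proof (cases "distinct_adj is")
  case True
  obtain js i where s: "is = js @ [i]" using assms by (cases "is" rule: rev_cases) auto
  have "js \<noteq> []" using assms s by auto
  have "hd js = i" using alt_last[OF True] assms(1) s \<open>js \<noteq> []\<close> by auto
  then have "rotate (length js) is = i # i # tl js" using \<open>js \<noteq> []\<close>
    unfolding s rotate_append by (cases js) simp_all
  then show ?thesis by blast
next
  case False
  then obtain j where j: "Suc j < length is" "is ! j = is ! Suc j" by (auto simp: distinct_adj_conv_nth)
  then have "drop j is = is ! j # is ! Suc j # drop (Suc (Suc j)) is"
    by (metis Cons_nth_drop_Suc Suc_lessD)
  then have "rotate j is = is ! j # is ! j # (drop (Suc (Suc j)) is @ take j is)"
    using j by (simp add: rotate_drop_take)
  then show ?thesis by blast
qed

section \<open>Interleaved lists and standard words\<close>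

lemma interleave_Nil [simp]: "interleave [] bs = []" "interleave as [] = []"
  by (simp_all add: interleave_def)

lemma interleave_Cons [simp]: "interleave (a # as) (b # bs) = a # b # interleave as bs"
  by (simp add: interleave_def)

lemma interleave_append: "length as = length bs \<Longrightarrow> interleave (as @ as') (bs @ bs') = interleave as bs @ interleave as' bs'"
  by (induction as bs rule: list_induct2) auto

lemma interleave_length: "length as = length bs \<Longrightarrow> length (interleave as bs) = 2 * length as"
  by (induction as bs rule: list_induct2) auto

lemma interleave_rotate1: "length as = length bs \<Longrightarrow> interleave (rotate1 as) (rotate1 bs) = rotate 2 (interleave as bs)"
  by (cases as; cases bs) (auto simp: numeral_2_eq_2 interleave_append)

lemma interleave_rotate: "length as = length bs \<Longrightarrow> interleave (rotate k as) (rotate k bs) = rotate (2 * k) (interleave as bs)"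
proof (induction k)
  case (Suc k)
  have "interleave (rotate (Suc k) as) (rotate (Suc k) bs) = rotate 2 (rotate (2 * k) (interleave as bs))"
    using interleave_rotate1[of "rotate k as" "rotate k bs"] Suc by simp
  then show ?case by (simp only: rotate_rotate) simp
qed simp

text \<open>
  The word \<open>a\<^sub>p, t f\<^sub>p, \<dots>, a\<^sub>1, t f\<^sub>1\<close>.
\<close>

definition word :: "'a list \<Rightarrow> ('a \<Rightarrow> 'k) list \<Rightarrow> ('a::zero \<times> ('a \<Rightarrow> 'k::zero)) list" where
  "word as fs = interleave (map (\<lambda>a. (a, 0)) (rev as)) (map (\<lambda>f. (0, f)) (rev fs))"

lemma word_length: "length as = length fs \<Longrightarrow> length (word as fs) = 2 * length as"
  by (simp add: word_def interleave_length)

lemma word_snoc: "word (as @ [a]) (fs @ [f]) = (a, 0) # (0, f) # word as fs"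
  by (simp add: word_def)

lemma word_Nil: "word [] [] = []"
  by (simp add: word_def)

lemma word_append: "length as = length fs \<Longrightarrow> length as' = length fs' \<Longrightarrow> word (as @ as') (fs @ fs') = word as' fs' @ word as fs"
  by (simp add: word_def interleave_append)

lemma word_Cons: "length as = length fs \<Longrightarrow> word (a # as) (f # fs) = word as fs @ [(a, 0), (0, f)]"
  using word_append[of "[a]" "[f]" as fs] by (simp add: word_def)

lemma word_bracket_args:
  "length as = length fs \<Longrightarrow> as \<noteq> [] \<Longrightarrow> word as fs = bracket_args as fs @ [(0, fs ! 0)]"
proof -
  assume l: "length as = length fs" "as \<noteq> []"
  have "concat (map (\<lambda>i. [(as ! i, 0), (0, fs ! i)]) (rev [n..<length as])) = word (drop n as) (drop n fs)" if "n \<le> length as" for n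
    using that
  proof (induction "length as - n" arbitrary: n)
    case 0
    then show ?case using l by (simp add: word_Nil)
  next
    case (Suc k)
    then have n: "n < length as" by simp
    have u: "[n..<length as] = n # [Suc n..<length as]" using n by (simp add: upt_conv_Cons)
    have d: "drop n as = as ! n # drop (Suc n) as" "drop n fs = fs ! n # drop (Suc n) fs"
      using n l by (simp_all add: Cons_nth_drop_Suc)
    have IH: "concat (map (\<lambda>i. [(as ! i, 0), (0, fs ! i)]) (rev [Suc n..<length as])) = word (drop (Suc n) as) (drop (Suc n) fs)"
      using Suc n by (intro Suc.hyps(1)) auto
    show ?case unfolding u d using IH l by (subst word_Cons) auto
  qed
  moreover have "1 \<le> length as" using l by (cases as) auto
  ultimately have "concat (map (\<lambda>i. [(as ! i, 0), (0, fs ! i)]) (rev [1..<length as])) = word (drop 1 as) (drop 1 fs)"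
    by blast
  then have 1: "concat (map (\<lambda>i. [(as ! i, 0), (0, fs ! i)]) (rev [1..<length as])) = word (tl as) (tl fs)"
    by (simp only: One_nat_def drop_Suc drop_0)
  obtain a as' where a: "as = a # as'" using l by (cases as) auto
  obtain f fs' where f: "fs = f # fs'" using l a by (cases fs) auto
  show ?thesis unfolding bracket_args_def 1 using l by (simp add: a f word_Cons)
qed

text \<open>Two letters make one pair, and the word lists the pairs from the last to the first,
  which reverses the direction of rotation.\<close>

lemma rotate_word:
  assumes "length as = length fs" "k < length as"
  shows "rotate (2 * k) (word as fs) = word (rotate (length as - k) as) (rotate (length as - k) fs)"
  unfolding word_def using assms
  by (simp add: interleave_rotate[symmetric] rotate_map rotate_rev)

text \<open>The values p - k run over 1, ..., p, and equality of h at p and 0 closes the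
  cycle.\<close>

lemma sum_rotations: "(\<Sum>k<p. h (p - k)) = (\<Sum>k<p. h k)" if "h p = h 0" for h :: "nat \<Rightarrow> 'b::ab_group_add"
proof -
  have "(\<Sum>k<p. h (p - k)) = (\<Sum>k<p. h (Suc k))"
    using sum.nat_diff_reindex[of "\<lambda>i. h (Suc i)" p] by (simp add: Suc_diff_Suc)
  also have "\<dots> = (\<Sum>k<p. h k) + h p - h 0"
    by (induction p) auto
  finally show ?thesis using that by simp
qed

text \<open>Cutting a cycle of \<open>2p\<close> letters in two odd arcs counts every cut twice; the swap identity keeps one
  of the two counts.\<close>

lemma arc_sum_even:
  fixes f :: "nat \<Rightarrow> nat \<Rightarrow> 'k::field"
  assumes swap: "\<And>j r. j < p \<Longrightarrow> f (2 * j + 1) r = - f (2 * (p - 1 - j) + 1) (r + (2 * j + 1))"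
  shows "(\<Sum>j<p. \<Sum>r\<le>2 * (p - 1 - j). sg (int r) * f (2 * j + 1) r) = (\<Sum>j<p. \<Sum>k<p. f (2 * j + 1) (2 * k))"
    and "(\<Sum>j<p. \<Sum>r\<le>2 * (p - 1 - j). sg (int r) * f (2 * j + 1) r) = - (\<Sum>j<p. \<Sum>k<p. f (2 * j + 1) (2 * k + 1))"
proof -
  have split: "(\<Sum>r\<le>2 * n. sg (int r) * g r) = (\<Sum>k\<le>n. g (2 * k)) - (\<Sum>k<n. g (2 * k + 1))" for n and g :: "nat \<Rightarrow> 'k"
  proof (induction n)
    case (Suc n)
    have "2 * Suc n = Suc (Suc (2 * n))" by simp
    then have "(\<Sum>r\<le>2 * Suc n. sg (int r) * g r) = (\<Sum>r\<le>2 * n. sg (int r) * g r) - g (2 * n + 1) + g (2 * Suc n)"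
      by (simp only: sum.atMost_Suc) (simp add: sg_if)
    then show ?case using Suc by simp
  qed simp
  let ?q = "\<lambda>j. p - 1 - j"
  \<comment> \<open>Split by the parity of r. For the first claim the odd rotations are carried by
    \<open>swap\<close> to the complementary arcs, where they become even and fill up the missing
    rotations.\<close>
  have L: "(\<Sum>j<p. \<Sum>r\<le>2 * ?q j. sg (int r) * f (2 * j + 1) r) =
     (\<Sum>j<p. \<Sum>k\<le>?q j. f (2 * j + 1) (2 * k)) - (\<Sum>j<p. \<Sum>k<?q j. f (2 * j + 1) (2 * k + 1))"
    unfolding split sum_subtractf ..
  have refl': "(\<Sum>j<p. g (?q j)) = (\<Sum>j<p. g j)" for g :: "nat \<Rightarrow> 'k"
    using sum.nat_diff_reindex[of g p] by simp
  have "(\<Sum>j<p. \<Sum>k<?q j. f (2 * j + 1) (2 * k + 1)) = (\<Sum>j<p. \<Sum>k<?q j. - f (2 * ?q j + 1) (2 * (k + j + 1)))"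
  proof (intro sum.cong refl)
    fix j k assume "j \<in> {..<p}"
    then show "f (2 * j + 1) (2 * k + 1) = - f (2 * ?q j + 1) (2 * (k + j + 1))"
      using swap[of j "2 * k + 1"] by (simp add: algebra_simps)
  qed
  also have "\<dots> = - (\<Sum>j<p. \<Sum>k<?q j. f (2 * ?q j + 1) (2 * (k + (j + 1))))"
    by (simp only: sum_negf add.assoc)
  also have "(\<Sum>j<p. \<Sum>k<?q j. f (2 * ?q j + 1) (2 * (k + (j + 1)))) = (\<Sum>j<p. \<Sum>k\<in>{j + 1..<p}. f (2 * ?q j + 1) (2 * k))"
  proof (rule sum.cong[OF refl])
    fix j assume "j \<in> {..<p}"
    then show "(\<Sum>k<?q j. f (2 * ?q j + 1) (2 * (k + (j + 1)))) = (\<Sum>k\<in>{j + 1..<p}. f (2 * ?q j + 1) (2 * k))"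
      by (intro sum.reindex_bij_witness[where i="\<lambda>k. k - (j + 1)" and j="\<lambda>k. k + (j + 1)"]) auto
  qed
  also have "\<dots> = (\<Sum>j<p. \<Sum>k\<in>{?q (?q j) + 1..<p}. f (2 * ?q j + 1) (2 * k))"
    by (intro sum.cong) auto
  also have "\<dots> = (\<Sum>j<p. \<Sum>k\<in>{?q j + 1..<p}. f (2 * j + 1) (2 * k))"
    by (rule refl'[of "\<lambda>j. \<Sum>k\<in>{?q j + 1..<p}. f (2 * j + 1) (2 * k)"])
  finally have B: "(\<Sum>j<p. \<Sum>k<?q j. f (2 * j + 1) (2 * k + 1)) = - (\<Sum>j<p. \<Sum>k\<in>{?q j + 1..<p}. f (2 * j + 1) (2 * k))" .
  have "(\<Sum>k\<le>?q j. g k) + (\<Sum>k\<in>{?q j + 1..<p}. g k) = (\<Sum>k<p. g k)" if "j < p" for j and g :: "nat \<Rightarrow> 'k"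
  proof -
    have "{..<p} = {..?q j} \<union> {?q j + 1..<p}" using that by auto
    moreover have "sum g ({..?q j} \<union> {?q j + 1..<p}) = sum g {..?q j} + sum g {?q j + 1..<p}"
      by (rule sum.union_disjoint) auto
    ultimately show ?thesis by simp
  qed
  then show "(\<Sum>j<p. \<Sum>r\<le>2 * ?q j. sg (int r) * f (2 * j + 1) r) = (\<Sum>j<p. \<Sum>k<p. f (2 * j + 1) (2 * k))"
    unfolding L B by (simp add: sum.distrib[symmetric])
  \<comment> \<open>For the second claim the even rotations are moved instead.\<close>
  have "(\<Sum>j<p. \<Sum>k\<le>?q j. f (2 * j + 1) (2 * k)) = (\<Sum>j<p. \<Sum>k\<le>?q j. - f (2 * ?q j + 1) (2 * (k + j) + 1))"
  proof (intro sum.cong refl)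
    fix j k assume "j \<in> {..<p}"
    then show "f (2 * j + 1) (2 * k) = - f (2 * ?q j + 1) (2 * (k + j) + 1)"
      using swap[of j "2 * k"] by (simp add: algebra_simps)
  qed
  also have "\<dots> = - (\<Sum>j<p. \<Sum>k\<le>?q j. f (2 * ?q j + 1) (2 * (k + j) + 1))"
    by (simp only: sum_negf)
  also have "(\<Sum>j<p. \<Sum>k\<le>?q j. f (2 * ?q j + 1) (2 * (k + j) + 1)) = (\<Sum>j<p. \<Sum>k\<in>{j..<p}. f (2 * ?q j + 1) (2 * k + 1))"
  proof (rule sum.cong[OF refl])
    fix j assume "j \<in> {..<p}"
    then show "(\<Sum>k\<le>?q j. f (2 * ?q j + 1) (2 * (k + j) + 1)) = (\<Sum>k\<in>{j..<p}. f (2 * ?q j + 1) (2 * k + 1))"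
      by (intro sum.reindex_bij_witness[where i="\<lambda>k. k - j" and j="\<lambda>k. k + j"]) auto
  qed
  also have "\<dots> = (\<Sum>j<p. \<Sum>k\<in>{?q (?q j)..<p}. f (2 * ?q j + 1) (2 * k + 1))"
    by (intro sum.cong) auto
  also have "\<dots> = (\<Sum>j<p. \<Sum>k\<in>{?q j..<p}. f (2 * j + 1) (2 * k + 1))"
    by (rule refl'[of "\<lambda>j. \<Sum>k\<in>{?q j..<p}. f (2 * j + 1) (2 * k + 1)"])
  finally have A: "(\<Sum>j<p. \<Sum>k\<le>?q j. f (2 * j + 1) (2 * k)) = - (\<Sum>j<p. \<Sum>k\<in>{?q j..<p}. f (2 * j + 1) (2 * k + 1))" .
  have "(\<Sum>k\<in>{?q j..<p}. g k) + (\<Sum>k<?q j. g k) = (\<Sum>k<p. g k)" if "j < p" for j and g :: "nat \<Rightarrow> 'k"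
  proof -
    have "{..<p} = {?q j..<p} \<union> {..<?q j}" using that by auto
    moreover have "sum g ({?q j..<p} \<union> {..<?q j}) = sum g {?q j..<p} + sum g {..<?q j}"
      by (rule sum.union_disjoint) auto
    ultimately show ?thesis by simp
  qed
  then have "(\<Sum>j<p. \<Sum>k\<in>{?q j..<p}. f (2 * j + 1) (2 * k + 1)) + (\<Sum>j<p. \<Sum>k<?q j. f (2 * j + 1) (2 * k + 1)) = (\<Sum>j<p. \<Sum>k<p. f (2 * j + 1) (2 * k + 1))"
    by (simp add: sum.distrib[symmetric])
  then show "(\<Sum>j<p. \<Sum>r\<le>2 * ?q j. sg (int r) * f (2 * j + 1) r) = - (\<Sum>j<p. \<Sum>k<p. f (2 * j + 1) (2 * k + 1))"
    unfolding L A by (simp add: algebra_simps)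
qed

context graded_alg begin

lemma pw_length: "pw is w \<Longrightarrow> length is = length w"
  by (simp add: list_all2_lengthD)

lemma pw_rotate: "pw is w \<Longrightarrow> pw (rotate r is) (rotate r w)"
proof -
  assume h: "pw is w"
  have "(r + i) mod length w < length w" if "i < length w" for i
    using that by (intro mod_less_divisor) linarith
  then show ?thesis using h pw_length[OF h] by (auto simp: list_all2_conv_all_nth nth_rotate)
qed

lemma tB_iff: "x \<in> ext_summand i \<longleftrightarrow> (if i then fst x = 0 \<and> snd x \<in> gdual s G else snd x = 0)"
  by (cases x) (auto simp: ext_summand_def dual_part_def base_part_def)

text \<open>A product with a functional factor has no algebra part, and a product of two algebra
  letters has no functional part; hence the disjunction of types.\<close>

lemma emul_tB: "x \<in> ext_summand i \<Longrightarrow> y \<in> ext_summand j \<Longrightarrow> x \<in> edg a \<Longrightarrow> y \<in> edg b \<Longrightarrow> ext_mult x y \<in> ext_summand (i \<or> j)"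
proof -
  assume a: "x \<in> ext_summand i" "y \<in> ext_summand j" "x \<in> edg a" "y \<in> edg b"
  have "snd (ext_mult x y) \<in> gdual s G" using edg_esp[OF emul_edg[OF a(3,4)]] by (simp add: esp_iff)
  moreover have "linf (snd x)" "linf (snd y)" using a(3,4) edg_esp gdual_linf by (auto simp: esp_iff)
  ultimately show ?thesis using a(1,2)
    by (cases i; cases j) (simp_all add: tB_iff ext_mult_def fun_eq_iff linf_zero)
qed

lemma emul_dual: "x \<in> ext_summand True \<Longrightarrow> y \<in> ext_summand True \<Longrightarrow> ext_mult x y = 0"
  using gdual_linf[of "snd x"] gdual_linf[of "snd y"]
  by (simp add: tB_iff ext_mult_def prod_eq_iff fun_eq_iff linf_zero)

lemma word_pw: "homs G ds as \<Longrightarrow> homs dual es fs \<Longrightarrow> length as = length fs \<Longrightarrow> pw (word' as fs) (word as fs)"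
  if "\<And>as fs. word' as fs = concat (replicate (length as) [False, True])" for word' :: "'a list \<Rightarrow> ('a \<Rightarrow> 'k) list \<Rightarrow> bool list"
proof (induction as arbitrary: ds es fs rule: rev_induct)
  case Nil
  then show ?case by (simp add: that word_Nil)
next
  case (snoc a as)
  then obtain fs' f where f: "fs = fs' @ [f]" "length as = length fs'" by (cases fs rule: rev_cases) auto
  have "length ds = Suc (length as)" "length es = Suc (length as)" using snoc.prems by (simp_all add: homs_length[symmetric])
  then obtain ds' d es' e where d: "ds = ds' @ [d]" "length ds' = length as" "es = es' @ [e]" "length es' = length as"
    by (cases ds rule: rev_cases; cases es rule: rev_cases) auto
  have h: "homs G ds' as" "homs dual es' fs'" "f \<in> dual e" using snoc.prems d f by (auto simp: homs_append)
  show ?case using snoc.IH[OF h(1,2) f(2)] tB_base tB_dual[OF h(3)] by (simp add: that f word_snoc)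
qed

definition wdeg :: "int list \<Rightarrow> int list \<Rightarrow> int list" where
  "wdeg ds es = interleave (rev ds) (map (\<lambda>e. e + 1) (rev es))"

lemma wdeg_snoc: "wdeg (ds @ [d]) (es @ [e]) = d # (e + 1) # wdeg ds es"
  by (simp add: wdeg_def)

lemma word_hom:
  "homs G ds as \<Longrightarrow> homs dual es fs \<Longrightarrow> length as = length fs \<Longrightarrow> homs edg (wdeg ds es) (word as fs)"
proof (induction as arbitrary: ds es fs rule: rev_induct)
  case Nil
  then show ?case by (simp add: word_Nil wdeg_def)
next
  case (snoc a as)
  then obtain fs' f where f: "fs = fs' @ [f]" "length as = length fs'" by (cases fs rule: rev_cases) auto
  have "length ds = Suc (length as)" "length es = Suc (length as)" using snoc.prems by (simp_all add: homs_length[symmetric])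
  then obtain ds' d es' e where d: "ds = ds' @ [d]" "length ds' = length as" "es = es' @ [e]" "length es' = length as"
    by (cases ds rule: rev_cases; cases es rule: rev_cases) auto
  have h: "homs G ds' as" "homs dual es' fs'" "f \<in> dual e" "a \<in> G d" using snoc.prems d f by (auto simp: homs_append)
  show ?case using snoc.IH[OF h(1,2) f(2)] h(3,4) by (simp add: f d word_snoc wdeg_snoc edg_base edg_dual)
qed

text \<open>Pairs are peeled off the front: an algebra letter and a functional, which are the last
  entries of the two lists.\<close>

lemma word_exists:
  assumes "homs edg ds w" "pw is w" "distinct_adj is" "is = [] \<or> \<not> hd is" "even (length w)"
  shows "\<exists>as fs es gs. w = word as fs \<and> ds = wdeg es gs \<and> length as = length fs \<and> homs G es as \<and> homs dual gs fs"
  using assms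
proof (induction "length w" arbitrary: w ds "is" rule: less_induct)
  case less
  show ?case
  proof (cases w)
    case Nil
    then show ?thesis using less.prems(1) by (intro exI[of _ "[]"]) (simp add: word_Nil wdeg_def)
  next
    case (Cons x w1)
    obtain y w' where w: "w = x # y # w'" using Cons less.prems(5) by (cases w1) auto
    obtain i j js where is': "is = i # j # js" using pw_length[OF less.prems(2)] w
      by (cases "is"; cases "tl is") auto
    obtain d e ds' where ds: "ds = d # e # ds'" using homs_length[OF less.prems(1)] w
      by (cases ds; cases "tl ds") auto
    have ij: "\<not> i" "j" using less.prems(3,4) by (auto simp: is')
    have h: "x \<in> edg d" "y \<in> edg e" "homs edg ds' w'" using less.prems(1) by (simp_all add: w ds)
    have p: "x \<in> ext_summand i" "y \<in> ext_summand j" "pw js w'" using less.prems(2) by (simp_all add: w is')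
    have a: "distinct_adj js" "js = [] \<or> \<not> hd js" using less.prems(3) ij by (auto simp: is' distinct_adj_Cons)
    obtain as fs es gs where IH: "w' = word as fs" "length as = length fs" "homs G es as" "homs dual gs fs" "ds' = wdeg es gs"
      using less.hyps[OF _ h(3) p(3) a] less.prems(5) w by auto
    have x: "x = (fst x, 0)" "fst x \<in> G d" using p(1) ij h(1) by (auto simp: ext_summand_def base_part_def edg_iff)
    have y: "y = (0, snd y)" "snd y \<in> dual (e - 1)" using p(2) ij h(2) by (auto simp: ext_summand_def dual_part_def edg_iff)
    have l: "length es = length as" "length gs = length fs" using IH by (simp_all add: homs_length[symmetric])
    have "w = word (as @ [fst x]) (fs @ [snd y])" using x(1) y(1) IH by (simp add: w word_snoc)
    moreover have "homs G (es @ [d]) (as @ [fst x])" "homs dual (gs @ [e - 1]) (fs @ [snd y])"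
      using IH x y l by (simp_all add: homs_append)
    moreover have "ds = wdeg (es @ [d]) (gs @ [e - 1])" by (simp add: wdeg_snoc ds IH)
    ultimately show ?thesis using IH(2) by (metis length_append_singleton)
  qed
qed

lemma wdeg_sum: "length ds = length es \<Longrightarrow> sum_list (wdeg ds es) = sum_list ds + sum_list es + int (length ds)"
proof -
  assume l: "length ds = length es"
  have i: "length as = length bs \<Longrightarrow> sum_list (interleave as bs) = sum_list as + sum_list bs" for as bs :: "int list"
    by (induction as bs rule: list_induct2) auto
  have "sum_list (map (\<lambda>e. e + 1) es) = sum_list es + int (length es)" by (induction es) auto
  then show ?thesis using l by (simp add: wdeg_def i sum_list_rev rev_map[symmetric])
qed

end

section \<open>Even Stasheff identities and the Leibniz rule\<close>

context cyclic_maps begin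

lemma m_good_alt:
  assumes "odd n" "length w = n" "pw is w"
  shows "if distinct_adj is then m n w \<in> ext_summand (hd is) else m n w = 0"
proof -
  have l: "length is = n" using pw_length[OF assms(3)] assms(2) by simp
  have "list_all2 (\<lambda>i x. x \<in> (if i then dual_part s G else base_part)) is w"
    using assms(3) by (simp add: ext_summand_def)
  then show ?thesis
    using m_good assms(1) l unfolding good_def Let_def ext_summand_def distinct_adj_conv_nth by blast
qed

text \<open>A good map takes values in the summand of its first argument, which for an odd
  alternating list is also the type of its last argument. The form pairs only opposite summands, so
  the final letter continues the alternation.\<close>

lemma W_alt:
  assumes pw: "pw is w" and l: "even (length w)" "length w \<ge> 2" and nz: "W w \<noteq> 0"
  shows "distinct_adj is"
proof -
  obtain xs x where w: "w = xs @ [x]" using l by (cases w rule: rev_cases) auto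
  have li: "length is = length w" using pw by (rule pw_length)
  obtain js i where is': "is = js @ [i]" using l li by (cases "is" rule: rev_cases) auto
  have lj: "length js = length xs" using li w is' by simp
  have h: "pw js xs" "x \<in> ext_summand i" using pw by (simp_all add: w is' list_all2_append lj)
  have o: "odd (length xs)" "xs \<noteq> []" using l w by auto
  have m0: "m (length xs) xs \<noteq> 0"
    using nz tB_esp[OF h(2)] by (auto simp: w W_snoc nf_0)
  note g = m_good_alt[OF o(1) refl h(1)]
  have a: "distinct_adj js" using g m0 by (auto split: if_splits)
  have t: "m (length xs) xs \<in> ext_summand (hd js)" using g a by simp
  have "hd js \<noteq> i"
  proof
    assume "hd js = i"
    then have "nat_form (m (length xs) xs) x = 0"
      using t h(2) by (cases i) (auto simp: nat_form_eq ext_summand_def base_part_def dual_part_def linf_zero gdual_linf)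
    then show False using nz by (simp add: w W_snoc)
  qed
  moreover have "js \<noteq> []" using lj o by auto
  then have "last js = hd js" using alt_last[OF a] lj o(1) by auto
  ultimately show ?thesis using a by (simp add: is' distinct_adj_append_iff)
qed

lemma W_adj:
  assumes "pw is w" "even (length w)" "length w \<ge> 2" "\<not> distinct_adj is" shows "W w = 0"
  using W_alt[OF assms(1-3)] assms(4) by blast

text \<open>An alternating block of odd length has the same type at both ends, and its image has
  this type too. So alternation of the contracted word lifts to the whole word.\<close>

lemma C0_alt:
  assumes pw: "pw is w" and l: "even (length w)" and q: "odd q" "q < length w" and nz: "compose_W q w \<noteq> 0"
  shows "distinct_adj is"
proof -
  let ?b = "take q w" and ?c = "drop q w" and ?i = "take q is" and ?j = "drop q is"
  have li: "length is = length w" using pw by (rule pw_length)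
  have h: "pw ?i ?b" "pw ?j ?c" using pw by (simp_all add: list_all2_takeI list_all2_dropI)
  have lb: "length ?b = q" "length ?i = q" "length ?c = length w - q" using q li by auto
  have m0: "m q ?b \<noteq> 0"
  proof
    assume "m q ?b = 0"
    then have "compose_W q w = 0" unfolding compose_W_def using pw_esp[OF h(2)] by (intro W_zero) (auto simp: esp_0)
    then show False using nz by simp
  qed
  note g = m_good_alt[OF q(1) lb(1) h(1)]
  have a: "distinct_adj ?i" "m q ?b \<in> ext_summand (hd ?i)" using g m0 by (auto split: if_splits)
  have ne: "?i \<noteq> []" using q(1) lb(2) by (metis even_zero list.size(3))
  have "pw (hd ?i # ?j) (m q ?b # ?c)" using a h by simp
  then have "distinct_adj (hd ?i # ?j)"
    using nz q l li lb by (intro W_alt[of _ "m q ?b # ?c"]) (auto simp: compose_W_def)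
  have "last ?i = hd ?i" using alt_last[OF a(1) ne] lb q by simp
  have "distinct_adj (?i @ ?j)"
  proof -
    have "?j \<noteq> []" using q li by simp
    then show ?thesis unfolding distinct_adj_append_iff
      using a ne \<open>distinct_adj (hd ?i # ?j)\<close> \<open>last ?i = hd ?i\<close> by (simp add: distinct_adj_Cons)
  qed
  then show ?thesis by simp
qed

definition leibniz_W :: bool where
  "leibniz_W \<longleftrightarrow> (\<forall>q ds as d a d' b es fs. homs G ds as \<and> length as = q \<and> a \<in> G d \<and> b \<in> G d' \<and> homs dual es fs \<and> length fs = Suc q \<longrightarrow>
     W (word (as @ [a * b]) fs) = W (word (as @ [a]) (butlast fs @ [\<lambda>v. last fs (v * b)])) + sg d * W (word (as @ [b]) ((\<lambda>v. hd fs (a * v)) # tl fs)))"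

lemma C0_2: "x \<in> edg i \<Longrightarrow> y \<in> edg j \<Longrightarrow> compose_W 2 (x # y # w) = W (ext_mult x y # w)"
  by (simp add: compose_W_def numeral_2_eq_2[symmetric] m_2_hom)

text \<open>For these r the product touches neither of the two equal letters; they stay neighbours
  in the contracted word, whose value is therefore zero.\<close>

lemma C0_2_middle:
  assumes h: "homs edg ds w" "pw is w" "length w = Suc n" "even n" and i: "is = i # i # js" and r: "2 \<le> r" "r < n"
  shows "compose_W 2 (rotate r w) = 0"
proof -
  have l: "length (rotate r w) = Suc n" "length is = Suc n" "length ds = Suc n"
    using h pw_length[OF h(2)] by (simp_all add: homs_length[symmetric])
  have flip: "pw (rotate r is) (rotate r w)" by (rule pw_rotate[OF h(2)])
  have rh: "homs edg (rotate r ds) (rotate r w)" by (rule homs_rotate[OF h(1)])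
  have rot: "rotate r is = drop r is @ take r is" using l r by (simp add: rotate_drop_take)
  obtain k1 k2 ks where k: "drop r is = k1 # k2 # ks"
    using l r by (cases "drop r is"; cases "tl (drop r is)") (auto dest: arg_cong[of _ _ length])
  have t: "take r is = i # i # take (r - 2) js" using r i by (cases r; cases "r - 1") auto
  have ri: "rotate r is = k1 # k2 # ks @ i # i # take (r - 2) js" unfolding rot k t by simp
  obtain u1 u2 us where u: "rotate r w = u1 # u2 # us" using l(1) r by (cases "rotate r w"; cases "tl (rotate r w)") auto
  obtain e1 e2 e3 where e: "rotate r ds = e1 # e2 # e3" using l(3) r by (cases "rotate r ds"; cases "tl (rotate r ds)") (auto dest: arg_cong[of _ _ length])
  have hu: "u1 \<in> edg e1" "u2 \<in> edg e2" "u1 \<in> ext_summand k1" "u2 \<in> ext_summand k2" using rh flip by (simp_all add: u e ri)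
  have pw: "pw ((k1 \<or> k2) # ks @ i # i # take (r - 2) js) (ext_mult u1 u2 # us)"
    using flip emul_tB[OF hu(3,4,1,2)] by (simp add: u ri)
  have nd: "\<not> distinct_adj ((k1 \<or> k2) # ks @ i # i # take (r - 2) js)"
    by (simp add: distinct_adj_append_iff distinct_adj_Cons)
  have "length us = n - 1" using l(1) by (simp add: u)
  then have "even (length (ext_mult u1 u2 # us))" "length (ext_mult u1 u2 # us) \<ge> 2" using h(4) r by simp_all
  from W_adj[OF pw this nd] show ?thesis unfolding u C0_2[OF hu(1,2)] .
qed

lemma SE2_three:
  assumes h: "homs edg ds w" "pw is w" "length w = Suc n" "even n" "n \<ge> 2" and i: "is = i # i # js"
  shows "stasheff_form_2 ds w = compose_W 2 w + sg (hd ds) * compose_W 2 (rotate 1 w) + sg (sum_list (butlast ds)) * compose_W 2 (rotate n w)"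
proof -
  have l: "length ds = Suc n" using h by (simp add: homs_length[symmetric])
  let ?f = "\<lambda>r. sg (sum_list (take r ds)) * compose_W 2 (rotate r w)"
  have "stasheff_form_2 ds w = (\<Sum>r\<in>{..<Suc n}. ?f r)" by (simp add: stasheff_form_2_def h(3))
  also have "\<dots> = (\<Sum>r\<in>{0, 1, n}. ?f r)"
    using h(5) C0_2_middle[OF h(1-4) i] by (intro sum.mono_neutral_right) auto
  also have "\<dots> = ?f 0 + ?f 1 + ?f n" using h(5) by simp
  also have "sum_list (take 1 ds) = hd ds" using l by (cases ds) auto
  also have "take n ds = butlast ds" using l by (simp add: butlast_conv_take)
  finally show ?thesis by simp
qed

text \<open>In the word a, b, t f, ..., t g the three remaining products are that of a and b, the
  action of b on f and the action of a on g. Rotating the last two contracted words to standard form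
  produces the signs of the Leibniz rule.\<close>

lemma SE2_word:
  assumes as: "homs G ds as" "length as = q" and ab: "a \<in> G d" "b \<in> G d'" and fs: "homs dual es fs" "length fs = Suc q"
  shows "stasheff_form_2 (d # wdeg (ds @ [d']) es) ((a, 0) # word (as @ [b]) fs) =
    W (word (as @ [a * b]) fs) - W (word (as @ [a]) (butlast fs @ [\<lambda>v. last fs (v * b)])) - sg d * W (word (as @ [b]) ((\<lambda>v. hd fs (a * v)) # tl fs))"
    (is "stasheff_form_2 ?D ?w = ?Y0 - ?Y1 - sg d * ?Y2")
proof -
  have l: "length ds = q" "length es = Suc q" using as fs by (simp_all add: homs_length[symmetric])
  obtain fs' f where f: "fs = fs' @ [f]" "length fs' = q" using fs(2) by (cases fs rule: rev_cases) auto
  obtain es' e where e: "es = es' @ [e]" "length es' = q" using l(2) by (cases es rule: rev_cases) auto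
  obtain g gs where g: "fs = g # gs" "length gs = q" using fs(2) by (cases fs) auto
  obtain h hs where h: "es = h # hs" "length hs = q" using l(2) by (cases es) auto
  have fh: "homs dual es' fs'" "f \<in> dual e" using fs(1) e f by (simp_all add: homs_append)
  have gh: "g \<in> dual h" "homs dual hs gs" using fs(1) unfolding g(1) h(1) by simp_all
  have asb: "homs G (ds @ [d']) (as @ [b])" "length (as @ [b]) = length fs" using as l ab fs by (auto simp: homs_append)
  have hw: "homs edg (wdeg (ds @ [d']) es) (word (as @ [b]) fs)" by (rule word_hom[OF asb(1) fs(1) asb(2)])
  let ?is = "\<lambda>n. concat (replicate n [False, True])"
  have pwd: "pw (?is (length (as @ [b]))) (word (as @ [b]) fs)" by (rule word_pw[OF _ asb(1) fs(1) asb(2)]) simp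
  have A: "(a, 0) \<in> edg d" "(b, 0) \<in> edg d'" "(0, f) \<in> edg (e + 1)" "(0, g) \<in> edg (h + 1)"
    using ab fh gh by (simp_all add: edg_base edg_dual)
  have hw': "homs edg ?D ?w" using hw A by simp
  have pw': "pw (False # False # True # ?is q) ?w" using pwd as(2) tB_base by simp
  have lw: "length ?w = Suc (2 * Suc q)" using word_length[OF asb(2)] as(2) by simp
  have fv: "(\<lambda>v. f (v * b)) \<in> dual (e + d')" "(\<lambda>v. g (a * v)) \<in> dual (h + d)"
    using dual_rmult[OF fh(2) ab(2)] dual_lmult[OF gh(1) ab(1)] .
  have three: "stasheff_form_2 ?D ?w = compose_W 2 ?w + sg d * compose_W 2 (rotate 1 ?w) + sg (sum_list (butlast ?D)) * compose_W 2 (rotate (2 * Suc q) ?w)"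
  proof -
    have "even (2 * Suc q)" "2 * Suc q \<ge> 2" by simp_all
    from SE2_three[OF hw' pw' lw this refl] show ?thesis unfolding list.sel .
  qed
  have w1: "?w = (a, 0) # (b, 0) # (0, f) # word as fs'" by (simp add: f word_snoc)
  have t0: "compose_W 2 ?w = ?Y0"
    using C0_2[OF A(1,2)] by (simp add: w1 f word_snoc ext_mult_def zero_fun_def[symmetric])
  have em1: "ext_mult (b, 0) (0, f) = (0, \<lambda>v. f (v * b))" by (simp add: ext_mult_def)
  have t1: "sg d * compose_W 2 (rotate 1 ?w) = - ?Y1"
  proof -
    have "compose_W 2 (rotate 1 ?w) = W (((0, \<lambda>v. f (v * b)) # word as fs') @ [(a, 0)])"
      using C0_2[OF A(2,3)] by (simp add: w1 em1)
    also have "\<dots> = sg (int (length ((0, \<lambda>v. f (v * b)) # word as fs')) * (1 + d)) * W ((a, 0) # (0, \<lambda>v. f (v * b)) # word as fs')"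
    proof (rule W_rot1)
      show "homs edg ((e + d' + 1) # wdeg ds es') ((0, \<lambda>v. f (v * b)) # word as fs')"
        using fv word_hom[OF as(1) fh(1)] as f by (simp add: edg_dual)
    qed (use A in auto)
    also have "W ((a, 0) # (0, \<lambda>v. f (v * b)) # word as fs') = ?Y1" using f by (simp add: word_snoc)
    also have "length ((0, \<lambda>v. f (v * b)) # word as fs') = 2 * q + 1" using word_length[of as fs'] as f by simp
    finally have "sg d * compose_W 2 (rotate 1 ?w) = sg (d + int (2 * q + 1) * (1 + d)) * ?Y1" by (simp only: sg_add mult.assoc)
    moreover have "odd (d + int (2 * q + 1) * (1 + d))" by simp
    ultimately show ?thesis by (simp add: sg_if)
  qed
  have t2: "sg (sum_list (butlast ?D)) * compose_W 2 (rotate (2 * Suc q) ?w) = - (sg d * ?Y2)"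
  proof -
    obtain v where v: "word (as @ [b]) fs = v @ [(0, g)]" "length v = 2 * q + 1"
      and v': "word (as @ [b]) ((\<lambda>v. g (a * v)) # gs) = v @ [(0, \<lambda>v. g (a * v))]"
    proof -
      obtain c cs where c: "as @ [b] = c # cs" "length cs = q" using as(2) by (cases as) auto
      have "word (c # cs) (g' # gs) = (word cs gs @ [(c, 0)]) @ [(0, g')]" for g'
        using c g by (subst word_Cons) auto
      then show ?thesis using that[of "word cs gs @ [(c, 0)]"] word_length[of cs gs] c g by simp
    qed
    obtain dv dz where dv: "wdeg (ds @ [d']) es = dv @ [dz]" "length dv = length v"
      using homs_length[OF hw] v by (cases "wdeg (ds @ [d']) es" rule: rev_cases) auto
    have hv: "homs edg dv v" "(0, g) \<in> edg dz" using hw by (simp_all add: v dv homs_append)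
    have "rotate (length ((a, 0) # v)) (((a, 0) # v) @ [(0, g)]) = [(0, g)] @ ((a, 0) # v)" by (rule rotate_append)
    then have rot: "rotate (2 * Suc q) ?w = (0, g) # (a, 0) # v" using v by simp
    have em: "ext_mult (0, g) (a, 0) = (0, \<lambda>v. g (a * v))" by (simp add: ext_mult_def)
    have "ext_mult (0, g) (a, 0) \<in> edg (dz + d)" by (rule emul_edg[OF hv(2) A(1)])
    then have ga: "(0, \<lambda>v. g (a * v)) \<in> edg (dz + d)" unfolding em .
    have "v \<noteq> []" using v by auto
    from W_rot1[OF hv(1) this ga]
    have y2: "?Y2 = sg (int (2 * q + 1) * (1 + (dz + d))) * compose_W 2 (rotate (2 * Suc q) ?w)"
      unfolding rot C0_2[OF hv(2) A(1)] em using v v' g by simp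
    have s2: "sg a * (sg a * x) = x" for a and x :: 'k by (simp add: mult.assoc[symmetric] sg_sq del: power_int_eq_0_iff)
    have c: "compose_W 2 (rotate (2 * Suc q) ?w) = sg (int (2 * q + 1) * (1 + (dz + d))) * ?Y2"
      unfolding y2 s2 ..
    show ?thesis
    proof (cases "?Y2 = 0")
      case False
      then have nz: "W (v @ [(0, \<lambda>v. g (a * v))]) \<noteq> 0" using v' g by simp
      have "sum_list (dv @ [dz + d]) = int (length (v @ [(0, \<lambda>v. g (a * v))])) - 2"
        by (rule W_deg[OF _ _ nz]) (use hv ga v dv in \<open>auto simp: homs_append\<close>)
      then have su: "sum_list dv + dz + d = 2 * int q" using v by simp
      have "butlast ?D = d # dv" using dv by simp
      then have sb: "sum_list (butlast ?D) = d + sum_list dv" by simp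
      have "even (sum_list dv + dz + d)" using su by presburger
      then have "even (sum_list (butlast ?D) + int (2 * q + 1) * (1 + (dz + d)) + (1 + d))" unfolding sb by (simp, argo)
      then have "(sg (sum_list (butlast ?D) + int (2 * q + 1) * (1 + (dz + d))) :: 'k) = sg (1 + d)" by (rule sg_cong)
      then show ?thesis unfolding c by (simp only: mult.assoc[symmetric] sg_add[symmetric]) (simp add: sg_if)
    next
      case True
      show ?thesis unfolding c True by simp
    qed
  qed
  show ?thesis unfolding three t0 t1 t2 by simp
qed

end

context cyclic_maps begin

text \<open>If the repeated letter is a functional, all three terms vanish. If it is an algebra
  letter, a nonzero term forces the letters after the two to alternate beginning with a functional,
  and then the word is the one of \<open>SE2_word\<close>.\<close>

lemma SE2_repeat:
  assumes h: "homs edg ds w" "pw is w" "length w = Suc n" "even n" "n \<ge> 2" and i: "is = i # i # js" and C: leibniz_W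
  shows "stasheff_form_2 ds w = 0"
proof -
  have l: "length is = Suc n" "length ds = Suc n" using h pw_length[OF h(2)] by (simp_all add: homs_length[symmetric])
  obtain x1 x2 ws where w: "w = x1 # x2 # ws" using h(3,5) by (cases w; cases "tl w") auto
  obtain d1 d2 dws where d: "ds = d1 # d2 # dws" using l h(5) by (cases ds; cases "tl ds") auto
  have lw: "length ws = n - 1" "length js = n - 1" "length dws = n - 1" using h(3) l w i d by simp_all
  obtain y ys where y: "ws = y # ys" using lw h(5) by (cases ws) auto
  obtain jy jys where jy: "js = jy # jys" using lw h(5) by (cases js) auto
  obtain dy dys where dy: "dws = dy # dys" using lw h(5) by (cases dws) auto
  obtain zs z where z: "ws = zs @ [z]" using y rev_exhaust[of ws] by blast
  obtain jzs jz where jz: "js = jzs @ [jz]" using jy rev_exhaust[of js] by blast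
  obtain dzs dz where dz: "dws = dzs @ [dz]" using dy rev_exhaust[of dws] by blast
  have lz: "length zs = length jzs" "length dzs = length zs" using lw z jz dz by simp_all
  have hx: "x1 \<in> edg d1" "x2 \<in> edg d2" "homs edg dws ws" using h(1) by (simp_all add: w d)
  have px: "x1 \<in> ext_summand i" "x2 \<in> ext_summand i" "pw js ws" using h(2) by (simp_all add: w i)
  have hy: "y \<in> edg dy" "homs edg dys ys" using hx(3) by (simp_all add: y dy)
  have py: "y \<in> ext_summand jy" "pw jys ys" using px(3) by (simp_all add: y jy)
  have hz: "z \<in> edg dz" using hx(3) lz by (simp add: z dz homs_append)
  have pz: "z \<in> ext_summand jz" "pw jzs zs" using px(3) lz by (simp_all add: z jz list_all2_append)
  have T0: "compose_W 2 w = W (ext_mult x1 x2 # ws)" unfolding w by (rule C0_2[OF hx(1,2)])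
  have T1: "compose_W 2 (rotate 1 w) = W (ext_mult x2 y # ys @ [x1])" using C0_2[OF hx(2) hy(1)] by (simp add: w y)
  have TN: "compose_W 2 (rotate n w) = W (ext_mult z x1 # x2 # zs)"
  proof -
    have n: "length (x1 # x2 # zs) = n" using lw z h(5) by simp
    have "rotate n ((x1 # x2 # zs) @ [z]) = [z] @ x1 # x2 # zs" unfolding n[symmetric] by (rule rotate_append)
    then show ?thesis using C0_2[OF hz hx(1)] by (simp add: w z)
  qed
  have p0: "pw ((i \<or> i) # js) (ext_mult x1 x2 # ws)" using emul_tB[OF px(1,2) hx(1,2)] px(3) by simp
  have p1: "pw ((i \<or> jy) # jys @ [i]) (ext_mult x2 y # ys @ [x1])"
    using emul_tB[OF px(2) py(1) hx(2) hy(1)] py(2) px(1) by (simp add: list_all2_append list_all2_lengthD)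
  have pN: "pw ((jz \<or> i) # i # jzs) (ext_mult z x1 # x2 # zs)"
    using emul_tB[OF pz(1) px(1) hz hx(1)] pz(2) px(2) by simp
  have len: "even (length (ext_mult x1 x2 # ws))" "length (ext_mult x1 x2 # ws) \<ge> 2"
     "even (length (ext_mult x2 y # ys @ [x1]))" "length (ext_mult x2 y # ys @ [x1]) \<ge> 2"
     "even (length (ext_mult z x1 # x2 # zs))" "length (ext_mult z x1 # x2 # zs) \<ge> 2"
  proof -
    have "length ys = n - 2" using lw(1) unfolding y by simp
    moreover have "length zs = n - 2" using lw(1) unfolding z by simp
    moreover note lw(1) h(4,5)
    ultimately
    show "even (length (ext_mult x1 x2 # ws))" "length (ext_mult x1 x2 # ws) \<ge> 2"
     "even (length (ext_mult x2 y # ys @ [x1]))" "length (ext_mult x2 y # ys @ [x1]) \<ge> 2"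
     "even (length (ext_mult z x1 # x2 # zs))" "length (ext_mult z x1 # x2 # zs) \<ge> 2"
      by simp_all
  qed
  have lj: "even (length ((i \<or> jy) # jys @ [i]))" "even (length ((jz \<or> i) # i # jzs))"
    using len(3,5) pw_length[OF p1] pw_length[OF pN] by simp_all
  \<comment> \<open>The contracted word has even length, so if it alternates its ends
    differ.\<close>
  have d1: "(i \<or> jy) \<noteq> i" if "distinct_adj ((i \<or> jy) # jys @ [i])"
    using alt_last[OF that] lj(1) by auto
  show ?thesis
  proof (cases i)
    case True
    have "W (ext_mult x1 x2 # ws) = 0"
      using emul_dual px(1,2) True pw_esp[OF px(3)] by (intro W_zero) (auto simp: esp_0)
    moreover have "W (ext_mult x2 y # ys @ [x1]) = 0"
      using d1 True by (intro W_adj[OF p1 len(3,4)]) auto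
    moreover have "W (ext_mult z x1 # x2 # zs) = 0"
      using True by (intro W_adj[OF pN len(5,6)]) simp
    ultimately show ?thesis unfolding SE2_three[OF h i] T0 T1 TN by simp
  next
    case False
    show ?thesis
    proof (cases "distinct_adj js \<and> hd js")
      case True
      have "homs edg (d2 # dws) (x2 # ws)" "pw (False # js) (x2 # ws)" "distinct_adj (False # js)" "even (length (x2 # ws))"
        using hx px True False lw h(4,5) by (auto simp: distinct_adj_Cons)
      then obtain as fs es gs where word: "x2 # ws = word as fs" "d2 # dws = wdeg es gs" "length as = length fs" "homs G es as" "homs dual gs fs"
        using word_exists[of "d2 # dws" "x2 # ws" "False # js"] by auto
      have "as \<noteq> []" using word by (auto simp: word_Nil)
      then obtain as' b where as: "as = as' @ [b]" by (cases as rule: rev_cases) auto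
      have "length es = Suc (length as')" using word(4) as by (simp add: homs_length[symmetric])
      then obtain es' e where es: "es = es' @ [e]" "length es' = length as'" by (cases es rule: rev_cases) auto
      have h': "homs G es' as'" "b \<in> G e" using word(4) by (simp_all add: as es homs_append)
      obtain a where a: "x1 = (a, 0)" using px(1) False by (cases x1) (auto simp: tB_iff)
      have a': "a \<in> G d1" using hx(1) by (simp add: a edg_base)
      have fl: "length fs = Suc (length as')" using word(3) as by simp
      have "stasheff_form_2 ds w = stasheff_form_2 (d1 # wdeg (es' @ [e]) gs) ((a, 0) # word (as' @ [b]) fs)"
        using word(1,2) by (simp add: w d a as es)
      also have "\<dots> = 0"
        unfolding SE2_word[OF h'(1) refl a' h'(2) word(5) fl]
        using C[unfolded leibniz_W_def, rule_format, of es' as' "length as'" a d1 b e gs fs] h' a' word(5) fl by simp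
      finally show ?thesis .
    next
      case nd: False
      have "W (ext_mult x1 x2 # ws) = 0"
        using nd False jy by (intro W_adj[OF p0 len(1,2)]) (auto simp: distinct_adj_Cons)
      moreover have "W (ext_mult x2 y # ys @ [x1]) = 0"
      proof (rule W_adj[OF p1 len(3,4)])
        show "\<not> distinct_adj ((i \<or> jy) # jys @ [i])"
        proof
          assume a: "distinct_adj ((i \<or> jy) # jys @ [i])"
          then have jy': "jy" using d1 False by blast
          have "distinct_adj ((jy # jys) @ [i])" using a jy' by simp
          then have "distinct_adj (jy # jys)" by blast
          then show False using nd jy jy' by simp
        qed
      qed
      moreover have "W (ext_mult z x1 # x2 # zs) = 0"
      proof (rule W_adj[OF pN len(5,6)])
        show "\<not> distinct_adj ((jz \<or> i) # i # jzs)"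
        proof
          assume a: "distinct_adj ((jz \<or> i) # i # jzs)"
          then have jz': jz and a': "distinct_adj (i # jzs)" using False by auto
          have "last (i # jzs) \<noteq> jz" using alt_last[OF a] lj(2) jz' by auto
          then have "distinct_adj js \<and> hd js"
            using a' jz' False
            by (cases jzs; cases "tl jzs") (auto simp: jz distinct_adj_append_iff distinct_adj_Cons split: if_splits)
          then show False using nd by simp
        qed
      qed
      ultimately show ?thesis unfolding SE2_three[OF h i] T0 T1 TN by simp
    qed
  qed
qed

text \<open>The word has one letter more than there are inputs, hence odd length, and some rotation
  begins with two letters of equal type; vanishing at that rotation gives vanishing at the
  word.\<close>

lemma stasheff_even_iff: "(\<forall>p\<ge>1. stasheff (2 * p)) \<longleftrightarrow> leibniz_W"
proof
  assume S: "\<forall>p\<ge>1. stasheff (2 * p)"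
  show leibniz_W unfolding leibniz_W_def
  proof (intro allI impI, elim conjE)
    fix q ds as d a d' b es fs
    assume a: "homs G ds as" "length as = q" "a \<in> G d" "b \<in> G d'" "homs dual es fs" "length fs = Suc q"
    let ?w = "(a, 0) # word (as @ [b]) fs" and ?D = "d # wdeg (ds @ [d']) es"
    have lds: "length ds = q" using a by (simp add: homs_length[symmetric])
    have asb: "homs G (ds @ [d']) (as @ [b])" "length (as @ [b]) = length fs" using a lds by (auto simp: homs_append)
    have hw: "homs edg ?D ?w" using word_hom[OF asb(1) a(5) asb(2)] a(3) by (simp add: edg_base)
    let ?is = "\<lambda>n. concat (replicate n [False, True])"
    have pwd: "pw (?is (length (as @ [b]))) (word (as @ [b]) fs)" by (rule word_pw[OF _ asb(1) a(5) asb(2)]) simp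
    have pw: "pw (False # ?is (length (as @ [b]))) ?w" using pwd tB_base by simp
    have lw: "length ?w = Suc (2 * Suc q)" using word_length[OF asb(2)] a(2) by simp
    have n: "even (2 * Suc q)" "2 * Suc q \<ge> 2" "1 \<le> 2 * Suc q" "1 \<le> Suc q" by simp_all
    have "stasheff_form ?D ?w = 0"
      using S[rule_format, OF n(4)] unfolding stasheff_iff[OF n(3)] using lw hw pw by blast
    then have "stasheff_form_2 ?D ?w = 0" unfolding SE_even[OF hw lw n(1,2)] .
    then show "W (word (as @ [a * b]) fs) = W (word (as @ [a]) (butlast fs @ [\<lambda>v. last fs (v * b)])) + sg d * W (word (as @ [b]) ((\<lambda>v. hd fs (a * v)) # tl fs))"
      unfolding SE2_word[OF a] by (simp add: algebra_simps)
  qed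
next
  assume C: leibniz_W
  show "\<forall>p\<ge>1. stasheff (2 * p)"
  proof (intro allI impI)
    fix p :: nat assume p: "1 \<le> p"
    have n: "even (2 * p)" "2 * p \<ge> 2" "1 \<le> 2 * p" using p by auto
    show "stasheff (2 * p)" unfolding stasheff_iff[OF n(3)]
    proof (intro allI impI, elim conjE)
      fix ds "is" w assume w: "length w = Suc (2 * p)" "homs edg ds w" "pw is w"
      have li: "length is = Suc (2 * p)" using w pw_length by simp
      obtain k i js where k: "rotate k is = i # i # js"
        using odd_cycle_repeats[of "is"] li p by auto
      have "stasheff_form_2 (rotate k ds) (rotate k w) = 0"
        by (rule SE2_repeat[OF homs_rotate[OF w(2)] pw_rotate[OF w(3)] _ n(1,2) k C]) (use w in simp)
      then have "stasheff_form_2 ds w = 0" by (rule SE2_rotate[OF w(2,1) n(1,2)])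
      then show "stasheff_form ds w = 0" unfolding SE_even[OF w(2,1) n(1,2)] .
    qed
  qed
qed

section \<open>Odd Stasheff identities and the Jacobi identity\<close>

lemma C0_swap_odd:
  assumes w: "homs edg ds w" "length w = 2 * p" and j: "j < p"
  shows "compose_W (2 * j + 1) (rotate r w) = - compose_W (2 * (p - 1 - j) + 1) (rotate (r + (2 * j + 1)) w)"
proof -
  let ?q = "2 * j + 1" and ?w = "rotate r w" and ?d = "rotate r ds"
  have h: "homs edg (take ?q ?d) (take ?q ?w)" "homs edg (drop ?q ?d) (drop ?q ?w)"
    using homs_rotate[OF w(1), of r] by (simp_all add: homs_def list_all2_takeI list_all2_dropI)
  have l: "length (take ?q ?w) = ?q" "length (drop ?q ?w) = 2 * (p - 1 - j) + 1"
    using w(2) j by auto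
  have ne: "take ?q ?w \<noteq> []" "drop ?q ?w \<noteq> []" using l w(2) j by auto
  have rot: "drop ?q ?w @ take ?q ?w = rotate (r + ?q) w"
  proof -
    have "rotate ?q ?w = drop ?q ?w @ take ?q ?w" using w(2) j by (simp add: rotate_drop_take)
    then show ?thesis by (simp only: rotate_rotate add.commute)
  qed
  let ?S = "sum_list (take ?q ?d)"
  \<comment> \<open>With both arcs odd the exponent of \<open>C0_swap\<close> is 2S + 3 modulo 2, so
    the degree S of the first arc drops out.\<close>
  have "odd (int (2 * (p - 1 - j) + 1) * (1 + ?S + int ?q) + int ?q * (?S + int ?q))"
    by simp
  then have "(sg (int (2 * (p - 1 - j) + 1) * (1 + ?S + int ?q) + int ?q * (?S + int ?q)) :: 'k) = -1"
    by (simp only: sg_if if_False)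
  then show ?thesis
    using C0_swap[OF h ne] unfolding l rot append_take_drop_id by simp
qed

text \<open>If q is even, so is the outer arity, and a map vanishes unless both arities are 2. In
  that case there are three inputs, and the two terms cancel by associativity of the square-zero
  product.\<close>

lemma SE_odd:
  assumes w: "homs edg ds w" "length w = 2 * p" and p: "p \<ge> 1"
  shows "stasheff_form ds w = (\<Sum>j<p. \<Sum>r\<le>2 * (p - 1 - j). sg (int r) * compose_W (2 * j + 1) (rotate r w))"
proof -
  let ?n = "2 * p - 1"
  let ?f = "\<lambda>q r. sg (int q * (int ?n + 1) + int r + (int ?n + 1) * (int r + sum_list (take r ds))) * compose_W q (rotate r w)"
  have esp: "set (rotate r w) \<subseteq> esp" for r using homs_esp[OF w(1)] by simp
  have n1: "int ?n + 1 = 2 * int p" using p by simp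
  have f: "?f q r = sg (int r) * compose_W q (rotate r w)" for q r
  proof -
    have "even (int q * (int ?n + 1) + int r + (int ?n + 1) * (int r + sum_list (take r ds)) + int r)"
      unfolding n1 by simp
    then show ?thesis by (simp only: sg_cong)
  qed
  have ev: "(\<Sum>r\<le>?n - q. ?f q r) = 0" if q: "q \<in> {1..?n}" "even q" for q
  proof (cases "q = 2 \<and> p = 2")
    case False
    have "even q \<and> q \<noteq> 2 \<or> even (2 * p - q) \<and> 2 * p - q \<noteq> 2"
    proof (cases "q = 2")
      case True
      then have "p \<noteq> 2" "p \<ge> 2" using False q by auto
      then show ?thesis using True by auto
    qed (use q in simp)
    then have "compose_W q (rotate r w) = 0" for r
      using q esp[of r] w(2) p by (intro C0_even_zero) auto
    then show ?thesis by simp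
  next
    case True
    obtain x1 x2 x3 z where x: "w = [x1, x2, x3, z]" using w(2) True
      by (auto simp: numeral_eq_Suc length_Suc_conv)
    have "length ds = 4" using x homs_length[OF w(1)] by simp
    then obtain d1 d2 d3 dz where d: "ds = [d1, d2, d3, dz]"
      by (auto simp: numeral_eq_Suc length_Suc_conv)
    have h: "x1 \<in> edg d1" "x2 \<in> edg d2" "x3 \<in> edg d3" "z \<in> edg dz" using w(1) by (simp_all add: x d)
    have 1: "compose_W 2 w = nat_form (ext_mult (ext_mult x1 x2) x3) z"
      using C0_2[OF h(1,2)] m_2_hom[OF emul_edg[OF h(1,2)] h(3)] by (simp add: x W_def numeral_2_eq_2)
    have 2: "compose_W 2 (rotate 1 w) = nat_form (ext_mult (ext_mult x2 x3) z) x1"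
      using C0_2[OF h(2,3)] m_2_hom[OF emul_edg[OF h(2,3)] h(4)] by (simp add: x W_def numeral_2_eq_2)
    have "nat_form (ext_mult (ext_mult x1 x2) x3) z = nat_form (ext_mult (ext_mult x2 x3) z) x1"
      by (simp add: nat_form_eq ext_mult_def mult.assoc)
    then have e: "compose_W 2 w = compose_W 2 (rotate 1 w)" unfolding 1 2 .
    have "?n - q = Suc 0" using True by simp
    then have "(\<Sum>r\<le>?n - q. ?f q r) = ?f q 0 + ?f q 1" by simp
    also have "\<dots> = 0" unfolding f using True e by (simp add: sg_if)
    finally show ?thesis .
  qed
  have "stasheff_form ds w = (\<Sum>q\<in>{1..?n}. \<Sum>r\<le>?n - q. ?f q r)" by (simp add: stasheff_form_def w(2) Let_def)
  also have "\<dots> = (\<Sum>q\<in>{q\<in>{1..?n}. odd q}. \<Sum>r\<le>?n - q. ?f q r)"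
    by (rule sum.mono_neutral_right) (use ev in auto)
  also have "\<dots> = (\<Sum>j<p. \<Sum>r\<le>2 * (p - 1 - j). sg (int r) * compose_W (2 * j + 1) (rotate r w))"
    unfolding f
  proof (rule sum.reindex_bij_witness[where i="\<lambda>j. 2 * j + 1" and j="\<lambda>q. q div 2"])
    fix q assume "q \<in> {q \<in> {1..?n}. odd q}"
    then show "2 * (q div 2) + 1 = q" "q div 2 \<in> {..<p}" by (auto elim!: oddE)
    then have "?n - q = 2 * (p - 1 - q div 2)" by auto
    then show "(\<Sum>r\<le>2 * (p - 1 - q div 2). sg (int r) * compose_W (2 * (q div 2) + 1) (rotate r w)) = (\<Sum>r\<le>?n - q. sg (int r) * compose_W q (rotate r w))"
      using \<open>2 * (q div 2) + 1 = q\<close> by simp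
  qed auto
  finally show ?thesis .
qed

definition jacobi_W :: bool where
  "jacobi_W \<longleftrightarrow> (\<forall>p\<ge>1. \<forall>ds as es fs. homs G ds as \<and> length as = p \<and> homs dual es fs \<and> length fs = p \<longrightarrow>
     (\<Sum>j<p. \<Sum>k<p. compose_W (2 * j + 1) (rotate (2 * k) (word as fs))) = 0)"

text \<open>Of the two expressions in \<open>arc_sum_even\<close> the one with even rotations serves
  words that begin with an algebra letter; the one with odd rotations is the same sum for the word
  rotated by one letter and serves those that begin with a functional. Words that do not alternate
  have only zero terms.\<close>

lemma stasheff_odd_iff: "(\<forall>p\<ge>1. stasheff (2 * p - 1)) \<longleftrightarrow> jacobi_W"
proof -
  have A: "stasheff_form ds w = (\<Sum>j<p. \<Sum>k<p. compose_W (2 * j + 1) (rotate (2 * k) w))"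
    and B: "stasheff_form ds w = - (\<Sum>j<p. \<Sum>k<p. compose_W (2 * j + 1) (rotate (2 * k + 1) w))"
    if "homs edg ds w" "length w = 2 * p" "p \<ge> 1" for ds w p
    unfolding SE_odd[OF that] using that
    by (intro arc_sum_even[of p "\<lambda>q r. compose_W q (rotate r w)"] C0_swap_odd; simp)+
  show ?thesis
  proof
    assume S: "\<forall>p\<ge>1. stasheff (2 * p - 1)"
    show jacobi_W unfolding jacobi_W_def
    proof (intro allI impI, elim conjE)
      fix p ds as es fs
      assume a: "1 \<le> p" "homs G ds as" "length as = p" "homs dual es fs" "length fs = p"
      have hw: "homs edg (wdeg ds es) (word as fs)" by (rule word_hom) (use a in simp_all)
      have pw: "pw (concat (replicate (length as) [False, True])) (word as fs)" by (rule word_pw[OF _ a(2,4)]) (use a in simp_all)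
      have lw: "length (word as fs) = 2 * p" using a by (simp add: word_length)
      have n: "1 \<le> 2 * p - 1" "length (word as fs) = Suc (2 * p - 1)" using a lw by auto
      have "stasheff_form (wdeg ds es) (word as fs) = 0"
        using S[rule_format, OF a(1)] unfolding stasheff_iff[OF n(1)] using n(2) hw pw by blast
      then show "(\<Sum>j<p. \<Sum>k<p. compose_W (2 * j + 1) (rotate (2 * k) (word as fs))) = 0"
        unfolding A[OF hw lw a(1)] .
    qed
  next
    assume C: jacobi_W
    show "\<forall>p\<ge>1. stasheff (2 * p - 1)"
    proof (intro allI impI)
      fix p :: nat assume p: "1 \<le> p"
      have n: "1 \<le> 2 * p - 1" "Suc (2 * p - 1) = 2 * p" using p by auto
      have Cw: "(\<Sum>j<p. \<Sum>k<p. compose_W (2 * j + 1) (rotate (2 * k) w)) = 0"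
        if w: "length w = 2 * p" "homs edg ds w" "pw is w" "distinct_adj is" "\<not> hd is" for ds "is" w
      proof -
        obtain as fs es gs where word: "w = word as fs" "length as = length fs" "homs G es as" "homs dual gs fs"
          using word_exists[OF w(2,3,4)] w(1,5) by auto
        have l: "length as = p" using word_length[OF word(2)] w(1) word(1) by simp
        show ?thesis unfolding word(1)
          using C[unfolded jacobi_W_def, rule_format, OF p, of es as gs fs] word l by simp
      qed
      show "stasheff (2 * p - 1)" unfolding stasheff_iff[OF n(1)]
      proof (intro allI impI, elim conjE)
        fix ds "is" w assume "length w = Suc (2 * p - 1)" and w: "homs edg ds w" "pw is w"
        then have lw: "length w = 2 * p" using n by simp
        have li: "length is = 2 * p" using lw pw_length[OF w(2)] by simp
        show "stasheff_form ds w = 0"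
        proof (cases "distinct_adj is")
          case False
          have "compose_W (2 * j + 1) (rotate (2 * k) w) = 0" if j: "j < p" for j k
          proof (rule ccontr)
            assume "compose_W (2 * j + 1) (rotate (2 * k) w) \<noteq> 0"
            then have "distinct_adj (rotate (2 * k) is)"
              by (rule C0_alt[rotated 4]) (use j lw pw_rotate[OF w(2)] in auto)
            then show False using False alt_rotate[of "is" "2 * k"] li by simp
          qed
          then show ?thesis unfolding A[OF w(1) lw p] by simp
        next
          case True
          show ?thesis
          proof (cases "hd is")
            case False
            show ?thesis unfolding A[OF w(1) lw p] by (rule Cw[OF lw w True False])
          next
            case hd: True
            obtain i j js where is': "is = i # j # js" using li p by (cases "is"; cases "tl is") auto
            have d: "distinct_adj (rotate 1 is)" using alt_rotate[of "is" 1] True li by simp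
            have "\<not> hd (rotate 1 is)" using True hd by (simp add: is')
            from Cw[OF _ homs_rotate[OF w(1)] pw_rotate[OF w(2)] d this] lw
            have "(\<Sum>j<p. \<Sum>k<p. compose_W (2 * j + 1) (rotate (2 * k) (rotate 1 w))) = 0" by simp
            then show ?thesis unfolding B[OF w(1) lw p] by (simp only: rotate_rotate minus_zero)
          qed
        qed
      qed
    qed
  qed
qed

lemma stasheff_iff_W: "(\<forall>n\<ge>1. stasheff n) \<longleftrightarrow> leibniz_W \<and> jacobi_W"
proof -
  have "(\<forall>n\<ge>1. stasheff n) \<longleftrightarrow> (\<forall>p\<ge>1. stasheff (2 * p)) \<and> (\<forall>p\<ge>1. stasheff (2 * p - 1))"
  proof (intro iffI conjI allI impI)
    fix n :: nat assume a: "(\<forall>p\<ge>1. stasheff (2 * p)) \<and> (\<forall>p\<ge>1. stasheff (2 * p - 1))" "1 \<le> n"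
    show "stasheff n"
    proof (cases "even n")
      case True
      then obtain k where "n = 2 * k" by (elim evenE)
      then show ?thesis using a by auto
    next
      case False
      then obtain k where "n = 2 * k + 1" by (elim oddE)
      then show ?thesis using a(1)[THEN conjunct2, rule_format, of "Suc k"] by simp
    qed
  qed auto
  then show ?thesis unfolding stasheff_even_iff stasheff_odd_iff .
qed

end

section \<open>Reversal of positions and block permutations\<close>

definition flip :: "nat \<Rightarrow> nat \<Rightarrow> nat" where
  "flip n i = (if i < n then n - 1 - i else i)"

lemma rp_rp: "flip n (flip n i) = i"
  by (auto simp: flip_def)

lemma rp_permutes: "flip n permutes {..<n}"
proof -
  have "\<exists>!x. flip n x = y" for y
    by (rule ex1I[of _ "flip n y"]) (auto simp: rp_rp)
  then show ?thesis by (auto simp: permutes_def flip_def)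
qed

text \<open>Conjugation by the reversal of positions: the ultracyclicity identity lists the pairs
  forwards, \<open>word\<close> lists them backwards.\<close>

definition rev_perm :: "nat \<Rightarrow> (nat \<Rightarrow> nat) \<Rightarrow> nat \<Rightarrow> nat" where
  "rev_perm n \<sigma> = (\<lambda>i. flip n (\<sigma> (flip n i)))"

lemma rev_perm_permutes: "\<sigma> permutes {..<n} \<Longrightarrow> rev_perm n \<sigma> permutes {..<n}"
  using permutes_compose[OF permutes_compose[OF rp_permutes[of n], of \<sigma>] rp_permutes[of n]]
  by (simp add: rev_perm_def comp_def)

lemma rev_perm_invol: "rev_perm n (rev_perm n \<sigma>) = \<sigma>"
  by (simp add: rev_perm_def rp_rp fun_eq_iff)

lemma rev_nth': "i < n \<Longrightarrow> length xs = n \<Longrightarrow> rev xs ! i = xs ! flip n i"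
  by (simp add: rev_nth flip_def)

lemma rev_rp_nth: "i < n \<Longrightarrow> length xs = n \<Longrightarrow> rev xs ! flip n i = xs ! i"
  by (simp add: rev_nth flip_def)

lemma permute_list_rev:
  assumes s: "\<sigma> permutes {..<n}" and l: "length xs = n"
  shows "permute_list (rev_perm n \<sigma>) (rev xs) = rev (permute_list \<sigma> xs)"
proof (rule nth_equalityI)
  fix i assume "i < length (permute_list (rev_perm n \<sigma>) (rev xs))"
  then have i: "i < n" using l by simp
  have r: "flip n i < n" using i by (auto simp: flip_def)
  have "rev_perm n \<sigma> i < n" by (rule permutes_lt[OF rev_perm_permutes[OF s] i])
  then have "permute_list (rev_perm n \<sigma>) (rev xs) ! i = xs ! \<sigma> (flip n i)"
    using l i rev_perm_permutes[OF s] by (simp add: permute_list_nth rev_nth' rev_perm_def rp_rp)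
  then show "permute_list (rev_perm n \<sigma>) (rev xs) ! i = rev (permute_list \<sigma> xs) ! i"
    using l i r s by (simp add: permute_list_nth rev_nth')
qed (use l in simp)

lemma isum_rev:
  assumes s: "\<sigma> permutes {..<n}"
  shows "isum n (rev_perm n \<sigma>) h = isum n \<sigma> (\<lambda>i. h (flip n i))"
  unfolding isum_def
proof (rule sum.reindex_bij_witness[where i="\<lambda>(i, j). (flip n j, flip n i)" and j="\<lambda>(i, j). (flip n j, flip n i)"])
  have lt: "\<sigma> i < n \<longleftrightarrow> i < n" for i using permutes_in_image[OF s, of i] by simp
  have mono: "flip n i < flip n j \<longleftrightarrow> j < i" if "i < n" "j < n" for i j using that by (auto simp: flip_def)
  have rl: "flip n i < n \<longleftrightarrow> i < n" for i by (auto simp: flip_def)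
  fix p
  { assume "p \<in> {(i, j). i < j \<and> j < n \<and> rev_perm n \<sigma> j < rev_perm n \<sigma> i}"
    then obtain i j where p: "p = (i, j)" "i < j" "j < n" "flip n (\<sigma> (flip n j)) < flip n (\<sigma> (flip n i))"
      by (auto simp: rev_perm_def)
    then have "\<sigma> (flip n i) < \<sigma> (flip n j)" using mono[of "\<sigma> (flip n j)" "\<sigma> (flip n i)"] by (simp add: lt rl)
    then show "(case p of (i, j) \<Rightarrow> (flip n j, flip n i)) \<in> {(i, j). i < j \<and> j < n \<and> \<sigma> j < \<sigma> i}"
      using p mono[of j i] by (simp add: rl) }
  { assume "p \<in> {(i, j). i < j \<and> j < n \<and> \<sigma> j < \<sigma> i}"
    then obtain i j where p: "p = (i, j)" "i < j" "j < n" "\<sigma> j < \<sigma> i" by auto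
    then have "flip n (\<sigma> i) < flip n (\<sigma> j)" using mono[of "\<sigma> i" "\<sigma> j"] by (simp add: lt)
    then show "(case p of (i, j) \<Rightarrow> (flip n j, flip n i)) \<in> {(i, j). i < j \<and> j < n \<and> rev_perm n \<sigma> j < rev_perm n \<sigma> i}"
      using p mono[of j i] by (simp add: rl rev_perm_def rp_rp) }
qed (auto simp: rp_rp rev_perm_def mult.commute)

lemma interleave_nth:
  "length as = length bs \<Longrightarrow> k < 2 * length as \<Longrightarrow> interleave as bs ! k = (if even k then as ! (k div 2) else bs ! (k div 2))"
proof (induction as bs arbitrary: k rule: list_induct2)
  case (Cons a as b bs)
  show ?case
  proof (cases k)
    case (Suc k')
    then show ?thesis
    proof (cases k')
      case (Suc k'')
      then show ?thesis using \<open>k = Suc k'\<close> Cons.IH[of k''] Cons.prems by simp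
    qed simp
  qed simp
qed simp

lemma inv_theta: "\<sigma> permutes S \<Longrightarrow> inv (theta (inv \<sigma>)) = theta \<sigma>"
  by (rule inv_unique_comp) (auto simp: fun_eq_iff theta_def permutes_inverses)

text \<open>The block permutation keeps the order inside a pair and, for each inversion of \<sigma>,
  inverts all four combinations of letters of the two pairs; their degree products add up to the
  product of the pair degrees.\<close>

lemma koszul_theta:
  assumes s: "\<sigma> permutes {..<n}" and l: "length ds = n" "length es = n"
  shows "koszul (theta (inv \<sigma>)) (interleave ds es) = isum n \<sigma> (\<lambda>i. ds ! i + es ! i)"
proof -
  let ?x = "interleave ds es" and ?B = "{..<2::nat}" and ?I = "{(i, j). i < j \<and> j < n \<and> \<sigma> i > \<sigma> j}"
  let ?i = "\<lambda>((k, l), (u, v)). (2 * k + u, 2 * l + v :: nat)"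
    and ?j = "\<lambda>(i, j). ((i div 2, j div 2), (i mod 2, j mod 2 :: nat))"
  have lx: "length ?x = 2 * n" using l by (simp add: interleave_length)
  have x: "?x ! (2 * k + u) = (if u = 0 then ds ! k else es ! k)" if "k < n" "u < 2" for k u
    using that l by (auto simp: interleave_nth less_2_cases_iff)
  have th: "theta \<sigma> (2 * k + u) = 2 * \<sigma> k + u" if "u < 2" for k u
    using that by (auto simp: theta_def less_2_cases_iff)
  have "koszul (theta (inv \<sigma>)) ?x = (\<Sum>(i, j)\<in>{(i, j). i < j \<and> j < 2 * n \<and> theta \<sigma> i > theta \<sigma> j}. ?x ! theta \<sigma> i * ?x ! theta \<sigma> j)"
    unfolding koszul_def inv_theta[OF s] lx ..
  also have "\<dots> = (\<Sum>((k, l), (u, v))\<in>?I \<times> (?B \<times> ?B). ?x ! (2 * \<sigma> k + u) * ?x ! (2 * \<sigma> l + v))"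
  proof (rule sum.reindex_bij_witness[where i="?i" and j="?j"])
    fix p assume "p \<in> {(i, j). i < j \<and> j < 2 * n \<and> theta \<sigma> i > theta \<sigma> j}"
    then obtain i j where p: "p = (i, j)" "i < j" "j < 2 * n" "2 * \<sigma> (j div 2) + j mod 2 < 2 * \<sigma> (i div 2) + i mod 2"
      by (auto simp: theta_def)
    have ne: "i div 2 \<noteq> j div 2"
    proof
      assume e: "i div 2 = j div 2"
      then have "j mod 2 < i mod 2" using p(4) by simp
      moreover have "i mod 2 < j mod 2"
        using e p(2) div_mult_mod_eq[of i 2] div_mult_mod_eq[of j 2] by linarith
      ultimately show False by simp
    qed
    then have lt: "i div 2 < j div 2" using p(2) by presburger
    have "\<sigma> (i div 2) \<noteq> \<sigma> (j div 2)" using ne permutes_inj[OF s] by (auto dest: injD)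
    then have "\<sigma> (j div 2) < \<sigma> (i div 2)" using p(4) by presburger
    then show "?j p \<in> ?I \<times> (?B \<times> ?B)"
      using p lt by auto
    show "?i (?j p) = p"
      using p by simp
    show "(\<lambda>((k, l), (u, v)). ?x ! (2 * \<sigma> k + u) * ?x ! (2 * \<sigma> l + v)) (?j p) =
        (case p of (i, j) \<Rightarrow> ?x ! theta \<sigma> i * ?x ! theta \<sigma> j)"
      using p by (simp add: theta_def)
  next
    fix p assume "p \<in> ?I \<times> (?B \<times> ?B)"
    then obtain k l u v where p: "p = ((k, l), (u, v))" "k < l" "l < n" "\<sigma> k > \<sigma> l" "u < 2" "v < 2" by auto
    show "?j (?i p) = p"
      using p by (auto simp: less_2_cases_iff)
    show "?i p \<in> {(i, j). i < j \<and> j < 2 * n \<and> theta \<sigma> i > theta \<sigma> j}"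
      using p th by auto
  qed
  also have "\<dots> = (\<Sum>(k, l)\<in>?I. \<Sum>(u, v)\<in>?B \<times> ?B. ?x ! (2 * \<sigma> k + u) * ?x ! (2 * \<sigma> l + v))"
    by (simp add: sum.cartesian_product case_prod_unfold)
  also have "\<dots> = isum n \<sigma> (\<lambda>i. ds ! i + es ! i)"
  proof -
    have blk: "(\<Sum>(u, v)\<in>?B \<times> ?B. ?x ! (2 * k + u) * ?x ! (2 * l + v)) = (ds ! k + es ! k) * (ds ! l + es ! l)"
      if p: "k < n" "l < n" for k l
    proof -
      have "(\<Sum>(u, v)\<in>?B \<times> ?B. ?x ! (2 * k + u) * ?x ! (2 * l + v)) = (\<Sum>u<2. ?x ! (2 * k + u)) * (\<Sum>v<2. ?x ! (2 * l + v))"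
        by (simp add: sum_product sum.cartesian_product)
      also have "\<dots> = (ds ! k + es ! k) * (ds ! l + es ! l)"
      proof -
        have s2: "(\<Sum>u<2. h u) = h 0 + h 1" for h :: "nat \<Rightarrow> int" by (simp add: numeral_2_eq_2)
        show ?thesis unfolding s2 using x[OF p(1), of 0] x[OF p(1), of 1] x[OF p(2), of 0] x[OF p(2), of 1] by simp
      qed
      finally show ?thesis .
    qed
    show ?thesis unfolding isum_def
      by (rule sum.cong[OF refl], clarify, rule blk) (auto intro: permutes_lt[OF s])
  qed
  finally show ?thesis .
qed

lemma multilin_subset: "multilin s s' C n F \<Longrightarrow> C' \<subseteq> C \<Longrightarrow> multilin s s' C' n F"
proof -
  assume F: "multilin s s' C n F" and "C' \<subseteq> C"
  then have sub: "x \<in> C' \<Longrightarrow> x \<in> C" "set xs \<subseteq> C' \<Longrightarrow> set xs \<subseteq> C" for x xs by auto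
  show ?thesis unfolding multilin_def
    by (intro allI impI, elim conjE, rule multilinD[OF F]) (auto dest: sub)
qed

section \<open>Ultracyclicity as skew-symmetry of words\<close>

context cyclic_maps begin

definition skew_W :: bool where
  "skew_W \<longleftrightarrow> (\<forall>p\<ge>1. \<forall>\<sigma> ds as es fs. \<sigma> permutes {..<p} \<and> homs G ds as \<and> length as = p \<and> homs dual es fs \<and> length fs = p \<longrightarrow>
     W (word (permute_list \<sigma> as) (permute_list \<sigma> fs)) = sg (isum p \<sigma> (\<lambda>i. ds ! i + es ! i + 1)) * W (word as fs))"

lemma W_interleave:
  assumes "length as = n" "length bs = n" "n \<ge> 1"
  shows "nat_form (m (2 * n - 1) (butlast (interleave as bs))) (last bs) = W (interleave as bs)"
proof -
  obtain as' a where a: "as = as' @ [a]" using assms by (cases as rule: rev_cases) auto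
  obtain bs' b where b: "bs = bs' @ [b]" using assms by (cases bs rule: rev_cases) auto
  obtain k where k: "n = Suc k" using assms by (cases n) auto
  have l: "length as' = k" "length bs' = k" using assms a b k by simp_all
  have "interleave as bs = interleave as' bs' @ [a, b]" using l by (simp add: a b interleave_append)
  then show ?thesis using l by (simp add: W_def b k interleave_length)
qed

text \<open>The degree of \<open>t f\<close> is e + 1, so d + e + 1 is the degree of a pair of
  letters and \<open>koszul_theta\<close> gives the sign; \<open>rev_perm\<close> accounts for the
  reversed order.\<close>

lemma ultracyclic_iff: "ultracyclic_on edg base_part (dual_part s G) nat_form m \<longleftrightarrow> skew_W"
proof -
  have key: "(\<sigma> permutes {..<n} \<and> length as = n \<and> length bs = n \<and> homs edg ds as \<and> homs edg es bs \<and>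
        set as \<subseteq> base_part \<and> set bs \<subseteq> dual_part s G) \<longleftrightarrow>
      (\<exists>as' fs'. as = map (\<lambda>a. (a, 0)) as' \<and> bs = map (\<lambda>f. (0, f)) fs' \<and>
        \<sigma> permutes {..<n} \<and> homs G ds as' \<and> length as' = n \<and> homs dual (map (\<lambda>e. e - 1) es) fs' \<and> length fs' = n)"
    for \<sigma> n ds as es bs
  proof
    assume a: "\<sigma> permutes {..<n} \<and> length as = n \<and> length bs = n \<and> homs edg ds as \<and> homs edg es bs \<and>
        set as \<subseteq> base_part \<and> set bs \<subseteq> dual_part s G"
    have "(fst x, 0) = x" if "x \<in> set as" for x
      using that a by (cases x) (auto simp: base_part_def)
    then have "map (\<lambda>x. (fst x, 0)) as = as" by (rule map_idI)
    then have 1: "as = map (\<lambda>a. (a, 0)) (map fst as)" by (simp add: comp_def)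
    have "(0, snd x) = x" if "x \<in> set bs" for x
      using that a by (cases x) (auto simp: dual_part_def)
    then have "map (\<lambda>x. (0, snd x)) bs = bs" by (rule map_idI)
    then have 2: "bs = map (\<lambda>f. (0, f)) (map snd bs)" by (simp add: comp_def)
    have 3: "homs G ds (map fst as)" using a by (auto simp: homs_iff edg_iff)
    have 4: "homs dual (map (\<lambda>e. e - 1) es) (map snd bs)" using a by (auto simp: homs_iff edg_iff)
    show "\<exists>as' fs'. as = map (\<lambda>a. (a, 0)) as' \<and> bs = map (\<lambda>f. (0, f)) fs' \<and>
        \<sigma> permutes {..<n} \<and> homs G ds as' \<and> length as' = n \<and> homs dual (map (\<lambda>e. e - 1) es) fs' \<and> length fs' = n"
      by (rule exI[of _ "map fst as"], rule exI[of _ "map snd bs"]) (use 1 2 3 4 a in simp)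
  next
    assume "\<exists>as' fs'. as = map (\<lambda>a. (a, 0)) as' \<and> bs = map (\<lambda>f. (0, f)) fs' \<and>
        \<sigma> permutes {..<n} \<and> homs G ds as' \<and> length as' = n \<and> homs dual (map (\<lambda>e. e - 1) es) fs' \<and> length fs' = n"
    then obtain as' fs' where a: "as = map (\<lambda>a. (a, 0)) as'" "bs = map (\<lambda>f. (0, f)) fs'"
        "\<sigma> permutes {..<n}" "homs G ds as'" "length as' = n" "homs dual (map (\<lambda>e. e - 1) es) fs'" "length fs' = n" by blast
    have "f \<in> gdual s G" if "f \<in> set fs'" for f
      using a(6) that by (auto simp: homs_iff in_set_conv_nth intro: dual_gdual)
    then show "\<sigma> permutes {..<n} \<and> length as = n \<and> length bs = n \<and> homs edg ds as \<and> homs edg es bs \<and>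
        set as \<subseteq> base_part \<and> set bs \<subseteq> dual_part s G"
      using a by (auto simp: homs_iff edg_base edg_dual base_part_def dual_part_def)
  qed
  have eq: "(let as' = permute_list \<sigma> as; bs' = permute_list \<sigma> bs in
          nat_form (m (2 * n - 1) (butlast (interleave as' bs'))) (last bs') =
            (-1) powi koszul (theta (inv \<sigma>)) (interleave ds es) *
            nat_form (m (2 * n - 1) (butlast (interleave as bs))) (last bs)) \<longleftrightarrow>
      W (word (permute_list (rev_perm n \<sigma>) (rev as')) (permute_list (rev_perm n \<sigma>) (rev fs'))) =
        sg (isum n (rev_perm n \<sigma>) (\<lambda>i. rev ds ! i + rev (map (\<lambda>e. e - 1) es) ! i + 1)) * W (word (rev as') (rev fs'))"
    if n: "n \<ge> 1" and a: "as = map (\<lambda>a. (a, 0)) as'" "bs = map (\<lambda>f. (0, f)) fs'"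
        "\<sigma> permutes {..<n}" "homs G ds as'" "length as' = n" "homs dual (map (\<lambda>e. e - 1) es) fs'" "length fs' = n"
    for \<sigma> n ds as es bs as' fs'
  proof -
    have l: "length ds = n" "length es = n" using a homs_length by fastforce+
    have s: "\<sigma> permutes {..<length as'}" "\<sigma> permutes {..<length fs'}" using a by simp_all
    have "isum n (rev_perm n \<sigma>) (\<lambda>i. rev ds ! i + rev (map (\<lambda>e. e - 1) es) ! i + 1) = isum n \<sigma> (\<lambda>i. ds ! i + es ! i)"
      unfolding isum_rev[OF a(3)] unfolding isum_def using permutes_lt[OF a(3)]
      by (intro sum.cong refl) (auto simp: rev_rp_nth l)
    then have k: "koszul (theta (inv \<sigma>)) (interleave ds es) = isum n (rev_perm n \<sigma>) (\<lambda>i. rev ds ! i + rev (map (\<lambda>e. e - 1) es) ! i + 1)"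
      using koszul_theta[OF a(3) l] by simp
    have w: "interleave (permute_list \<sigma> as) (permute_list \<sigma> bs) = word (permute_list (rev_perm n \<sigma>) (rev as')) (permute_list (rev_perm n \<sigma>) (rev fs'))"
      unfolding permute_list_rev[OF a(3,5)] permute_list_rev[OF a(3,7)] using s
      by (simp add: a(1,2) word_def permute_list_map)
    have w': "interleave as bs = word (rev as') (rev fs')" by (simp add: a(1,2) word_def)
    have la: "length as = n" "length bs = n" "length (permute_list \<sigma> as) = n" "length (permute_list \<sigma> bs) = n" using a by simp_all
    show ?thesis unfolding Let_def W_interleave[OF la(3,4) n] W_interleave[OF la(1,2) n] unfolding w w' k ..
  qed
  show ?thesis
  proof
    assume U: "ultracyclic_on edg base_part (dual_part s G) nat_form m"
    show skew_W unfolding skew_W_def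
    proof (intro allI impI, elim conjE)
      fix p \<sigma> ds as es fs
      assume p: "1 \<le> p" and a: "\<sigma> permutes {..<p}" "homs G ds as" "length as = p" "homs dual es fs" "length fs = p"
      let ?s = "rev_perm p \<sigma>" and ?as = "map (\<lambda>a. (a, 0)) (rev as)" and ?bs = "map (\<lambda>f. (0, f)) (rev fs)"
      have l: "length ds = p" "length es = p" using a by (simp_all add: homs_length[symmetric])
      have b: "?s permutes {..<p}" "homs G (rev ds) (rev as)" "length (rev as) = p"
         "homs dual (map (\<lambda>e. e - 1) (rev (map (\<lambda>e. e + 1) es))) (rev fs)" "length (rev fs) = p"
        using a rev_perm_permutes[OF a(1)] by (simp_all add: homs_def list_all2_rev rev_map comp_def)
      have "let as' = permute_list ?s ?as; bs' = permute_list ?s ?bs in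
          nat_form (m (2 * p - 1) (butlast (interleave as' bs'))) (last bs') =
            (-1) powi koszul (theta (inv ?s)) (interleave (rev ds) (rev (map (\<lambda>e. e + 1) es))) *
            nat_form (m (2 * p - 1) (butlast (interleave ?as ?bs))) (last ?bs)"
        using U[unfolded ultracyclic_on_def, rule_format, OF p] key[THEN iffD2, of ?as ?bs ?s p "rev ds" "rev (map (\<lambda>e. e + 1) es)"] b by blast
      from eq[OF p refl refl b, THEN iffD1, OF this]
      show "W (word (permute_list \<sigma> as) (permute_list \<sigma> fs)) = sg (isum p \<sigma> (\<lambda>i. ds ! i + es ! i + 1)) * W (word as fs)"
        unfolding rev_perm_invol rev_rev_ident rev_map[symmetric] by (simp add: comp_def)
    qed
  next
    assume C: skew_W
    show "ultracyclic_on edg base_part (dual_part s G) nat_form m"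
      unfolding ultracyclic_on_def
    proof (intro allI impI)
      fix n \<sigma> ds as es bs assume n: "1 \<le> n" and "\<sigma> permutes {..<n} \<and> length as = n \<and> length bs = n \<and> homs edg ds as \<and> homs edg es bs \<and>
        set as \<subseteq> base_part \<and> set bs \<subseteq> dual_part s G"
      then obtain as' fs' where a: "as = map (\<lambda>a. (a, 0)) as'" "bs = map (\<lambda>f. (0, f)) fs'"
        "\<sigma> permutes {..<n}" "homs G ds as'" "length as' = n" "homs dual (map (\<lambda>e. e - 1) es) fs'" "length fs' = n"
        unfolding key by blast
      show "let as' = permute_list \<sigma> as; bs' = permute_list \<sigma> bs in
          nat_form (m (2 * n - 1) (butlast (interleave as' bs'))) (last bs') =
            (-1) powi koszul (theta (inv \<sigma>)) (interleave ds es) *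
            nat_form (m (2 * n - 1) (butlast (interleave as bs))) (last bs)"
        unfolding eq[OF n a]
        by (rule C[unfolded skew_W_def, rule_format, OF n])
          (use a rev_perm_permutes[OF a(3)] in \<open>simp add: homs_def list_all2_rev\<close>)
    qed
  qed
qed

text \<open>Algebra letters alternate only if there is one of them, so goodness settles the odd
  arities. Arity 2 is the square-zero product, known on homogeneous elements, which span.\<close>

lemma m_base:
  assumes n: "n \<ge> 1" "length xs = n" "set xs \<subseteq> base_part" shows "m n xs \<in> base_part"
proof -
  have B: "base_part = ext_summand False" by (auto simp: ext_summand_def)
  consider "odd n" | "even n" "n \<noteq> 2" | "n = 2" by blast
  then show ?thesis
  proof cases
    case 1
    have "pw (replicate n False) xs" using n B by (auto simp: list_all2_conv_all_nth)
    from m_good_alt[OF 1 n(2) this] n(1) show ?thesis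
      by (cases n) (auto simp: B tB_iff split: if_splits)
  next
    case 2
    then show ?thesis by (simp add: m_even B tB_iff)
  next
    case 3
    let ?H = "{(a, 0) | a n. a \<in> G n} :: ('a \<times> ('a \<Rightarrow> 'k)) set"
    have sub: "E.subspace base_part" unfolding B E.subspace_def
      by (auto simp: tB_iff ext_scale_eq)
    have span: "base_part = E.span ?H"
    proof
      show "E.span ?H \<subseteq> base_part" by (rule E.span_minimal[OF _ sub]) (auto simp: base_part_def)
      have "subspace {a. (a, 0) \<in> E.span ?H}"
      proof (rule subspaceI)
        show "0 \<in> {a. (a, 0) \<in> E.span ?H}" using E.span_zero by (simp add: zero_prod_def)
      next
        fix x y assume "x \<in> {a. (a, 0) \<in> E.span ?H}" "y \<in> {a. (a, 0) \<in> E.span ?H}"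
        then have "(x, 0) + (y, 0) \<in> E.span ?H" by (intro E.span_add) auto
        then show "x + y \<in> {a. (a, 0) \<in> E.span ?H}" by simp
      next
        fix c x assume "x \<in> {a. (a, 0) \<in> E.span ?H}"
        then have "esc c (x, 0) \<in> E.span ?H" by (intro E.span_scale) auto
        then show "s c x \<in> {a. (a, 0) \<in> E.span ?H}" by (simp add: ext_scale_eq)
      qed
      then have "span (\<Union>n. G n) \<subseteq> {a. (a, 0) \<in> E.span ?H}"
        by (intro span_minimal) (auto intro!: E.span_base)
      then show "base_part \<subseteq> E.span ?H" using G_span by (auto simp: base_part_def)
    qed
    have "base_part \<subseteq> esp" using B tB_esp by blast
    then have ml: "multilin esc esc base_part n (m n)"
      by (rule multilin_subset[OF m_ml[OF n(1)]])
    show ?thesis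
    proof (rule multilin_span[OF E.vector_space_axioms E.vector_space_axioms ml span sub _ n(2,3)])
      fix xs assume x: "length xs = n" "set xs \<subseteq> ?H"
      then obtain x y where xy: "xs = [x, y]" using 3 by (auto simp: numeral_2_eq_2 length_Suc_conv)
      then obtain a b i j where ab: "x = (a, 0)" "y = (b, 0)" "a \<in> G i" "b \<in> G j" using x(2) by auto
      have "m 2 [x, y] = ext_mult x y" using ab by (intro m_2_hom) (auto simp: edg_base)
      then show "m n xs \<in> base_part" using 3 by (simp add: xy ab ext_mult_def B tB_iff zero_fun_def)
    qed
  qed
qed

lemma GMS_iff: "m \<in> good_manageable_special_pre_CY s G \<longleftrightarrow> skew_W \<and> leibniz_W \<and> jacobi_W"
proof -
  have A: "A_infinity esc edg esp m \<longleftrightarrow> (\<forall>n\<ge>1. stasheff n)"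
    unfolding A_infinity_def stasheff_def stasheff_sum_def using m_off m_ml m_deg by (auto 4 3)
  have B: "cyclic_form esc edg esp (-1) nat_form m"
    unfolding cyclic_form_def using nf_nondegenerate nf_sym m_cyc by blast
  show ?thesis
    unfolding good_manageable_special_pre_CY_def mem_Collect_eq pre_CY_def special_def A stasheff_iff_W ultracyclic_iff
    using B m_base m_man m_odd m_good by blast
qed

end

section \<open>The bracket formula in terms of words\<close>

context cyclic_maps begin

lemma W_word_deg:
  assumes "p \<ge> 1" "homs G ds as" "length as = p" "homs dual es fs" "length fs = p" "W (word as fs) \<noteq> 0"
  shows "sum_list ds + sum_list es = int p - 2"
proof -
  have l: "length ds = length es" "length ds = p" using assms by (simp_all add: homs_length[symmetric])
  have "sum_list (wdeg ds es) = int (length (word as fs)) - 2"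
    by (rule W_deg[OF word_hom]) (use assms in \<open>simp_all add: word_length\<close>)
  then show ?thesis using assms l by (simp add: wdeg_sum word_length)
qed

text \<open>Where the form is nonzero, its degree constraint supplies the parity hypothesis of
  \<open>bracket_sign_tsg\<close>; \<open>psum\<close> is the sign by which the Koszul pairing
  differs from plain evaluation.\<close>

lemma bracket_sign_link:
  assumes a: "p \<ge> 1" "homs G ds as" "length as = p" "homs dual es fs" "length fs = p"
  shows "sg (bracket_sign p ds es) * nat_form (m (2 * p - 1) (bracket_args as fs)) (0, fs ! 0) =
    sg (psum es) * (sg (tsg ds es) * W (word as fs))"
proof -
  have ne: "as \<noteq> []" using a by auto
  have w: "word as fs = bracket_args as fs @ [(0, fs ! 0)]" using a ne by (intro word_bracket_args) auto
  have "length (word as fs) = 2 * p" using a by (simp add: word_length)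
  then have "length (bracket_args as fs) = 2 * p - 1" using w by simp
  then have e: "nat_form (m (2 * p - 1) (bracket_args as fs)) (0, fs ! 0) = W (word as fs)"
    unfolding w W_snoc by simp
  show ?thesis
  proof (cases "W (word as fs) = 0")
    case False
    have l: "length ds = p" "length es = p" using a by (simp_all add: homs_length[symmetric])
    have "even (sum_list ds + sum_list es + int p)" using W_word_deg[OF a False] by simp
    from bracket_sign_tsg[OF l a(1) this] have "even (bracket_sign p ds es + (psum es + tsg ds es))" by (simp, argo)
    then have "(sg (bracket_sign p ds es) :: 'k) = sg (psum es + tsg ds es)" by (rule sg_cong)
    then show ?thesis unfolding e by (simp only: sg_add mult.assoc)
  next
    case True
    show ?thesis unfolding e True by simp
  qed
qed

lemma brackets_of_iff:
  "brackets_of s G m br \<longleftrightarrow> bracket_family s br \<and> (\<forall>p\<ge>1. \<forall>ds as es fs.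
      homs G ds as \<and> length as = p \<and> homs dual es fs \<and> length fs = p \<longrightarrow>
      br p (tens s as) (pform fs) = sg (tsg ds es) * W (word as fs))"
proof -
  have "tpair G es fs (br p (tens s as)) =
          (-1) powi bracket_sign p ds es * nat_form (m (2 * p - 1) (bracket_args as fs)) (0, fs ! 0) \<longleftrightarrow>
      br p (tens s as) (pform fs) = sg (tsg ds es) * W (word as fs)"
    if bf: "bracket_family s br" and a: "p \<ge> 1" "homs G ds as" "length as = p" "homs dual es fs" "length fs = p" for p ds as es fs
  proof -
    have "br p (tens s as) \<in> tpow s p" using bf tens_in[OF a(3)] a(1) by (auto simp: bracket_family_def)
    from tpair_eq[OF this a(4,5)] show ?thesis
      unfolding bracket_sign_link[OF a] by (simp add: mult_left_cancel[OF sg_neq])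
  qed
  then show ?thesis unfolding brackets_of_def by blast
qed

end

locale linked = cyclic_maps s G m
  for s :: "'k::field_char_0 \<Rightarrow> 'a::ring \<Rightarrow> 'a" and G :: "int \<Rightarrow> 'a set" and m +
  fixes br :: "nat \<Rightarrow> ('k, 'a) tensor \<Rightarrow> ('k, 'a) tensor"
  assumes bo: "brackets_of s G m br"

text \<open>The representing vector is the algebra part of the map on the word without its last
  letter; the functional 0 only fills the place that \<open>butlast\<close> removes.\<close>

sublocale linked \<subseteq> bracket_form s G br "\<lambda>as fs. W (word as fs)" "\<lambda>as fs. fst (m (2 * length as - 1) (butlast (word as (0 # fs))))"
proof
  show "bracket_family s br" using bo unfolding brackets_of_iff by blast
  show "br p (tens s as) (pform fs) = sg (tsg ds es) * W (word as fs)"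
    if "p \<ge> 1" "homs G ds as" "length as = p" "homs dual es fs" "length fs = p" for p ds as es fs
    using bo that unfolding brackets_of_iff by blast
  show "sum_list ds + sum_list es = int p - 2"
    if "p \<ge> 1" "homs G ds as" "length as = p" "homs dual es fs" "length fs = p" "W (word as fs) \<noteq> 0" for p ds as es fs
    by (rule W_word_deg[OF that])
  show "W (word as (f # fs)) = f (fst (m (2 * length as - 1) (butlast (word as (0 # fs)))))"
    if a: "homs G ds as" "length as = Suc q" "homs dual es fs" "length fs = q" "f \<in> dual e" for ds as q es fs f e
  proof -
    obtain a as' where as: "as = a # as'" using a(2) by (cases as) auto
    have l: "length as' = length fs" using a as by simp
    let ?X = "word as' fs @ [(a, 0)]"
    have w: "word as (g # fs) = ?X @ [(0, g)]" for g using l by (simp add: as word_Cons)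
    have lX: "length ?X = 2 * length as - 1" using l by (simp add: as word_length)
    have "linf (snd (m (length ?X) ?X))" using m_esp[of "length ?X" ?X] gdual_linf by (simp add: esp_iff)
    then have "W (word as (f # fs)) = f (fst (m (length ?X) ?X))"
      unfolding w W_snoc by (simp add: nat_form_eq linf_zero)
    moreover have "butlast (word as (0 # fs)) = ?X" unfolding w by (rule butlast_snoc)
    ultimately show ?thesis unfolding lX by simp
  qed
qed

lemma list_all2_butlast_snoc: "list_all2 P xs (ys @ [y]) \<Longrightarrow> list_all2 P (butlast xs) ys"
proof -
  assume a: "list_all2 P xs (ys @ [y])"
  then have "xs \<noteq> []" by auto
  then obtain xs' x where x: "xs = xs' @ [x]" using rev_exhaust by blast
  then have "length xs' = length ys" using list_all2_lengthD[OF a] by simp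
  then show ?thesis using a by (simp add: x list_all2_append)
qed

context linked begin

text \<open>The contracted inner bracket is the algebra part of the map on an odd alternating block
  that begins with an algebra letter. By goodness the image of this block lies in the algebra, so
  its algebra part is all of it.\<close>

lemma Ycomp_compose_W:
  assumes i: "1 \<le> i" "i \<le> p" and as: "homs G ds as" "length as = p" and fs: "homs dual es fs" "length fs = p"
  shows "Ycomp i as fs = compose_W (2 * (p - i) + 1) (word as fs)"
proof -
  define us as2 where "us = take (i - 1) as" and "as2 = drop (i - 1) as"
  define gs fs1 where "gs = take (i - 1) fs" and "fs1 = drop (i - 1) fs"
  have l: "length us = i - 1" "length gs = i - 1" "length as2 = Suc (p - i)" "length fs1 = Suc (p - i)"
    using as fs i by (auto simp: us_def as2_def gs_def fs1_def)
  obtain a as2' where as2: "as2 = a # as2'" using l by (cases as2) auto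
  obtain f fs2 where fs1: "fs1 = f # fs2" using l by (cases fs1) auto
  have asE: "as = us @ as2" and fsE: "fs = gs @ f # fs2" unfolding us_def as2_def gs_def fs1[symmetric] fs1_def by simp_all
  have l2: "length as2' = p - i" "length fs2 = p - i" using l as2 fs1 by simp_all
  have tk: "take i fs = gs @ [f]" "drop i fs = fs2" using fsE l(2) i by (simp_all add: take_Cons' drop_Cons')
  let ?X = "word as2' fs2 @ [(a, 0)]"
  have lX: "length ?X = 2 * (p - i) + 1" using l2 by (simp add: word_length)
  have w2: "word as2 (g # fs2) = ?X @ [(0, g)]" for g using l2 by (simp add: as2 word_Cons)
  have w: "word as fs = ?X @ (0, f) # word us gs"
    unfolding asE fsE using l l2 w2[of f] by (subst word_append) (auto simp: as2)
  have yv: "fst (m (2 * length as2 - 1) (butlast (word as2 (0 # fs2)))) = fst (m (length ?X) ?X)"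
  proof -
    have "butlast (word as2 (0 # fs2)) = ?X" unfolding w2 by (rule butlast_snoc)
    moreover have "2 * length as2 - 1 = length ?X" unfolding lX using l by simp
    ultimately show ?thesis by simp
  qed
  have "pw (concat (replicate (length as2) [False, True])) (word as2 (f # fs2))"
  proof (rule word_pw)
    show "homs G (drop (i - 1) ds) as2" using as(1) by (simp add: as2_def homs_def list_all2_dropI)
    show "homs dual (drop (i - 1) es) (f # fs2)" using fs(1) by (simp add: fs1[symmetric] fs1_def homs_def list_all2_dropI)
  qed (use l2 as2 in auto)
  then have pw: "pw (butlast (concat (replicate (length as2) [False, True]))) ?X"
    unfolding w2 by (rule list_all2_butlast_snoc)
  have FT: "distinct_adj (concat (replicate n [False, True])) \<and> (n > 0 \<longrightarrow> hd (concat (replicate n [False, True])) = False \<and> last (concat (replicate n [False, True])) = True)" for n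
    by (induction n) (auto simp: distinct_adj_Cons)
  have "concat (replicate (length as2) [False, True]) = butlast (concat (replicate (length as2) [False, True])) @ [last (concat (replicate (length as2) [False, True]))]"
    using as2 by (intro append_butlast_last_id[symmetric]) simp
  then have da: "distinct_adj (butlast (concat (replicate (length as2) [False, True])))"
    using FT[of "length as2"] by (metis distinct_adj_appendD1)
  have hdF: "hd (butlast (concat (replicate (length as2) [False, True]))) = False" by (simp add: as2)
  have "m (length ?X) ?X \<in> ext_summand False"
    using m_good_alt[OF _ refl pw] da hdF lX by simp
  then have mX: "m (length ?X) ?X = (fst (m (length ?X) ?X), 0)" by (simp add: tB_iff prod_eq_iff)
  have "compose_W (2 * (p - i) + 1) (word as fs) = W (m (length ?X) ?X # (0, f) # word us gs)"
    unfolding compose_W_def w lX[symmetric] by simp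
  also have "\<dots> = W (word (us @ [fst (m (length ?X) ?X)]) (gs @ [f]))"
    by (subst mX) (simp only: word_snoc)
  also have "\<dots> = Ycomp i as fs"
    unfolding Ycomp_def us_def[symmetric] as2_def[symmetric] tk yv ..
  finally show ?thesis ..
qed

text \<open>The outer arity i corresponds to the inner arity 2j + 1 with j = p - i; the reversed
  direction of rotation disappears in the sum over all rotations.\<close>

lemma jacobi_cond_iff_W: "jacobi_cond \<longleftrightarrow> jacobi_W"
proof -
  have "(\<Sum>i = 1..p. \<Sum>k<p. Ycomp i (rotate k as) (rotate k fs)) = (\<Sum>j<p. \<Sum>k<p. compose_W (2 * j + 1) (rotate (2 * k) (word as fs)))"
    if a: "1 \<le> p" "homs G ds as" "length as = p" "homs dual es fs" "length fs = p" for p ds as es fs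
  proof -
    have "(\<Sum>i = 1..p. \<Sum>k<p. Ycomp i (rotate k as) (rotate k fs)) =
        (\<Sum>i = 1..p. \<Sum>k<p. compose_W (2 * (p - i) + 1) (word (rotate k as) (rotate k fs)))"
      by (intro sum.cong refl Ycomp_compose_W[OF _ _ homs_rotate[OF a(2)] _ homs_rotate[OF a(4)]]) (use a in auto)
    also have "\<dots> = (\<Sum>j<p. \<Sum>k<p. compose_W (2 * j + 1) (word (rotate k as) (rotate k fs)))"
      by (rule sum.reindex_bij_witness[where i="\<lambda>j. p - j" and j="\<lambda>i. p - i"]) auto
    also have "\<dots> = (\<Sum>j<p. \<Sum>k<p. compose_W (2 * j + 1) (word (rotate (p - k) as) (rotate (p - k) fs)))"
      by (rule sum.cong[OF refl], rule sum_rotations[symmetric]) (use a in \<open>simp add: rotate_id\<close>)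
    also have "\<dots> = (\<Sum>j<p. \<Sum>k<p. compose_W (2 * j + 1) (rotate (2 * k) (word as fs)))"
      using a by (intro sum.cong refl) (simp add: rotate_word)
    finally show ?thesis .
  qed
  note key = this
  show ?thesis unfolding jacobi_cond_def jacobi_W_def
    by (intro iff_allI imp_cong refl, elim conjE) (simp only: key)
qed

lemma double_P_inf_iff_GMS: "double_P_inf s G br \<longleftrightarrow> m \<in> good_manageable_special_pre_CY s G"
  unfolding double_P_inf_iff GMS_iff jacobi_cond_iff_W skew_cond_def skew_W_def leibniz_cond_def leibniz_W_def ..

end

lemma cyclic_maps_GMS:
  assumes "graded_algebra s G" "m \<in> good_manageable_special_pre_CY s G"
  shows "cyclic_maps s G m"
proof -
  have pre: "pre_CY s G m" "manageable s G m" "special s G m" "good s G m" using assms(2) by (auto simp: good_manageable_special_pre_CY_def)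
  have A: "A_infinity (ext_scale s) (ext_deg s G) (ext_space s G) m" and C: "cyclic_form (ext_scale s) (ext_deg s G) (ext_space s G) (-1) nat_form m"
    using pre(1) by (auto simp: pre_CY_def)
  show ?thesis
  proof
    show "m n xs = 0" if "\<not> (n \<ge> 1 \<and> length xs = n \<and> set xs \<subseteq> ext_space s G)" for n xs
      using A that unfolding A_infinity_def by blast
    show "multilin (ext_scale s) (ext_scale s) (ext_space s G) n (m n)" if "n \<ge> 1" for n
      using A that unfolding A_infinity_def by blast
    show "m n xs \<in> ext_deg s G (sum_list ds + 2 - int n)" if "n \<ge> 1" "length xs = n" "homs (ext_deg s G) ds xs" for n xs ds
      using A that unfolding A_infinity_def by blast
    show "nat_form (m n as) a = (-1) powi (int n + d * sum_list ds) * nat_form (m n (a # butlast as)) (last as)"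
      if "n \<ge> 1" "length as = n" "a \<in> ext_deg s G d" "homs (ext_deg s G) ds as" for n as a d ds
      using C that unfolding cyclic_form_def by blast
    show "essentially_odd m" using pre(3) by (simp add: special_def)
  qed (use assms(1) pre in auto)
qed

section \<open>The structure determined by the brackets\<close>

text \<open>Positions are counted from 0, so in a standard word these are the algebra letters and
  the functionals, both in reverse order.\<close>

fun evens :: "'b list \<Rightarrow> 'b list" and odds :: "'b list \<Rightarrow> 'b list" where
  "evens [] = []" | "evens (x # xs) = x # odds xs"
| "odds [] = []" | "odds (x # xs) = evens xs"

lemma evens_odds_update:
  "evens (w[i := x]) = (if even i then (evens w)[i div 2 := x] else evens w)"
  "odds (w[i := x]) = (if even i then odds w else (odds w)[i div 2 := x])"
proof (induction w arbitrary: i)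
  case (Cons a w)
  { case 1 then show ?case using Cons.IH(2) by (cases i) auto }
  { case 2 then show ?case using Cons.IH(1) by (cases i) auto }
qed auto

lemma evens_odds_length: "length (evens w) = (length w + 1) div 2" "length (odds w) = length w div 2"
  by (induction w) auto

lemma evens_odds_set: "set (evens w) \<subseteq> set w" "set (odds w) \<subseteq> set w"
  by (induction w) auto

lemma evens_odds_snoc:
  "evens (xs @ [z]) = (if even (length xs) then evens xs @ [z] else evens xs)"
  "odds (xs @ [z]) = (if even (length xs) then odds xs else odds xs @ [z])"
  by (induction xs) auto

lemma evens_odds_interleave:
  "length as = length bs \<Longrightarrow> evens (interleave as bs) = as" "length as = length bs \<Longrightarrow> odds (interleave as bs) = bs"
  by (induction as bs rule: list_induct2) auto

lemma evens_odds_homs: "homs H ds w \<Longrightarrow> homs H (evens ds) (evens w)" "homs H ds w \<Longrightarrow> homs H (odds ds) (odds w)"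
proof (induction ds arbitrary: w)
  case (Cons d ds)
  { case 1 then show ?case using Cons.IH(2) by (cases w) auto }
  { case 2 then show ?case using Cons.IH(1) by (cases w) auto }
qed auto

lemma evens_odds_sum: "sum_list (evens ds) + sum_list (odds ds) = sum_list (ds :: int list)"
  by (induction ds) auto

text \<open>For lists of fixed length \<open>tsg\<close> is a polynomial in the degrees with integer
  coefficients, so its parity depends only on their parities.\<close>

lemma tsg_parity:
  assumes "list_all2 (\<lambda>x y. even (x + y)) ds ds'" "list_all2 (\<lambda>x y. even (x + y)) es es'"
  shows "even (tsg ds es + tsg ds' es')"
proof -
  have sum: "list_all2 (\<lambda>x y. even (x + y)) as bs \<Longrightarrow> even (sum_list as + sum_list bs)" for as bs :: "int list"
    by (induction rule: list_all2_induct) auto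
  show ?thesis using assms
  proof (induction arbitrary: es es' rule: list_all2_induct)
    case (Cons d ds d' ds')
    show ?case
    proof (cases es)
      case Nil
      then show ?thesis using Cons.prems by simp
    next
      case (Cons e es1)
      then obtain e' es1' where e: "es' = e' # es1'" "even (e + e')" "list_all2 (\<lambda>x y. even (x + y)) es1 es1'"
        using Cons.prems by (cases es') auto
      have a: "even (tsg ds es1 + tsg ds' es1')" using Cons.IH[OF e(3)] .
      have b: "even (sum_list ds + sum_list ds')" "even (sum_list es1 + sum_list es1')" using sum Cons.hyps(2) e(3) by blast+
      have c: "length ds = length ds'" using Cons.hyps(2) by (rule list_all2_lengthD)
      show ?thesis using a b c e(2) Cons.hyps(1) unfolding local.Cons e(1) tsg.simps
        by (simp only: parity_simps)
    qed
  qed simp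
qed

lemma list_all2_evens_odds: "list_all2 P xs ys \<Longrightarrow> list_all2 P (evens xs) (evens ys)" "list_all2 P xs ys \<Longrightarrow> list_all2 P (odds xs) (odds ys)"
proof (induction xs arbitrary: ys)
  case (Cons d ds)
  { case 1 then show ?case using Cons.IH(2) by (cases ys) auto }
  { case 2 then show ?case using Cons.IH(1) by (cases ys) auto }
qed auto

context graded_alg begin

text \<open>
  The sign in the bracket formula makes sense for homogeneous arguments only, but depends only on the parities of
  their degrees. Projecting to the even and odd parts therefore extends it multilinearly by a finite sum.
\<close>

definition parity_part :: "int \<Rightarrow> 'a \<Rightarrow> 'a" where
  "parity_part \<pi> a = (\<Sum>n\<in>{n. hc a n \<noteq> 0}. if even (n + \<pi>) then hc a n else 0)"

lemma par_superset:
  "finite N \<Longrightarrow> {n. hc a n \<noteq> 0} \<subseteq> N \<Longrightarrow> parity_part \<pi> a = (\<Sum>n\<in>N. if even (n + \<pi>) then hc a n else 0)"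
  unfolding parity_part_def by (rule sum.mono_neutral_left) auto

lemma par_lin: "parity_part \<pi> (s c x + y) = s c (parity_part \<pi> x) + parity_part \<pi> y"
proof -
  let ?N = "{n. hc x n \<noteq> 0} \<union> {n. hc y n \<noteq> 0} \<union> {n. hc (s c x + y) n \<noteq> 0}"
  have N: "finite ?N" by (simp add: hc_props)
  have p: "parity_part \<pi> z = (\<Sum>n\<in>?N. if even (n + \<pi>) then hc z n else 0)" if "z \<in> {x, y, s c x + y}" for z
    by (rule par_superset[OF N]) (use that in auto)
  have px: "parity_part \<pi> x = (\<Sum>n\<in>?N. if even (n + \<pi>) then hc x n else 0)"
    and py: "parity_part \<pi> y = (\<Sum>n\<in>?N. if even (n + \<pi>) then hc y n else 0)"
    and pc: "parity_part \<pi> (s c x + y) = (\<Sum>n\<in>?N. if even (n + \<pi>) then hc (s c x + y) n else 0)"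
    by (rule p, simp)+
  show ?thesis unfolding px py pc scale_sum_right sum.distrib[symmetric]
    by (rule sum.cong) (auto simp: hc_linear)
qed

lemma par_hom: "a \<in> G d \<Longrightarrow> parity_part \<pi> a = (if even (d + \<pi>) then a else 0)"
  by (subst par_superset[of "{d}"]) (auto simp: hc_hom)

lemma linf_eq_hom:
  assumes "linf f" "linf g" "\<And>n a. a \<in> G n \<Longrightarrow> f a = g a" shows "f = g"
proof
  fix a
  have "f (\<Sum>n\<in>{n. hc a n \<noteq> 0}. hc a n) = g (\<Sum>n\<in>{n. hc a n \<noteq> 0}. hc a n)"
    unfolding linf_sum[OF assms(1)] linf_sum[OF assms(2)] by (intro sum.cong refl assms(3)[OF hc_props(1)])
  then show "f a = g a" using hc_props(3)[of a] by simp
qed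

lemma linf_par: "linf f \<Longrightarrow> linf (\<lambda>c. f (parity_part \<pi> c))"
  by (simp add: linf_def par_lin)

lemma par_dual: "f \<in> dual e \<Longrightarrow> (\<lambda>c. f (parity_part \<pi> c)) = (if even (e + \<pi>) then f else 0)"
proof (rule linf_eq_hom)
  assume f: "f \<in> dual e"
  show "linf (\<lambda>c. f (parity_part \<pi> c))" by (rule linf_par[OF dual_linf[OF f]])
  show "linf (if even (e + \<pi>) then f else 0)" using dual_linf[OF f] dual_linf[OF dual_zero] by simp
  fix n a assume a: "a \<in> G n"
  show "f (parity_part \<pi> a) = (if even (e + \<pi>) then f else 0) a"
  proof (cases "n + e = 0")
    case True
    then have "n = - e" by simp
    then show ?thesis using dual_linf[OF f] by (simp add: par_hom[OF a] linf_zero)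
  next
    case False
    then show ?thesis using dual_vanish[OF f a False] dual_linf[OF f] by (simp add: par_hom[OF a] linf_zero)
  qed
qed

lemma par_gdual: "f \<in> gdual s G \<Longrightarrow> (\<lambda>c. f (parity_part \<pi> c)) \<in> gdual s G"
proof -
  assume f: "f \<in> gdual s G"
  have "fsp.subspace {f. (\<lambda>c. f (parity_part \<pi> c)) \<in> gdual s G}"
  proof (rule fsp.subspaceI)
    show "0 \<in> {f. (\<lambda>c. f (parity_part \<pi> c)) \<in> gdual s G}"
      using zero_in_gdual[of s G] by (simp add: zero_fun_def)
  next
    fix f g assume "f \<in> {f. (\<lambda>c. f (parity_part \<pi> c)) \<in> gdual s G}" "g \<in> {f. (\<lambda>c. f (parity_part \<pi> c)) \<in> gdual s G}"
    then have "(\<lambda>c. f (parity_part \<pi> c)) + (\<lambda>c. g (parity_part \<pi> c)) \<in> gdual s G"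
      by (intro fsp.subspace_add[OF gdual_subspace]) auto
    then show "f + g \<in> {f. (\<lambda>c. f (parity_part \<pi> c)) \<in> gdual s G}" by (simp add: plus_fun_def)
  next
    fix c f assume "f \<in> {f. (\<lambda>c. f (parity_part \<pi> c)) \<in> gdual s G}"
    then have "fscale c (\<lambda>c. f (parity_part \<pi> c)) \<in> gdual s G"
      by (intro fsp.subspace_scale[OF gdual_subspace]) auto
    then show "fscale c f \<in> {f. (\<lambda>c. f (parity_part \<pi> c)) \<in> gdual s G}" by (simp add: fscale_def)
  qed
  moreover have "(\<lambda>c. f (parity_part \<pi> c)) \<in> gdual s G" if "f \<in> dual n" for f n
    unfolding par_dual[OF that] using that zero_in_gdual[of s G] by (auto intro: dual_gdual)
  ultimately have "fsp.span (\<Union>n. dual n) \<subseteq> {f. (\<lambda>c. f (parity_part \<pi> c)) \<in> gdual s G}"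
    by (intro fsp.span_minimal) auto
  then show ?thesis using f by (auto simp: gdual_span)
qed

text \<open>The functional part uses \<pi> + 1 because the shift t changes the parity of the
  degree.\<close>

definition ext_parity_part :: "int \<Rightarrow> 'a \<times> ('a \<Rightarrow> 'k) \<Rightarrow> 'a \<times> ('a \<Rightarrow> 'k)" where
  "ext_parity_part \<pi> x = (parity_part \<pi> (fst x), \<lambda>c. snd x (parity_part (\<pi> + 1) c))"

lemma epar_lin: "ext_parity_part \<pi> (esc c x + y) = esc c (ext_parity_part \<pi> x) + ext_parity_part \<pi> y"
  by (simp add: ext_parity_part_def ext_scale_eq par_lin fscale_def plus_prod_def plus_fun_def)

lemma epar_esp: "x \<in> esp \<Longrightarrow> ext_parity_part \<pi> x \<in> esp"
  by (simp add: esp_iff ext_parity_part_def par_gdual)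

lemma epar_hom: "x \<in> edg n \<Longrightarrow> ext_parity_part \<pi> x = (if even (n + \<pi>) then x else 0)"
proof -
  assume x: "x \<in> edg n"
  then have "(\<lambda>c. snd x (parity_part (\<pi> + 1) c)) = (if even (n + \<pi>) then snd x else 0)"
    using par_dual[of "snd x" "n - 1" "\<pi> + 1"] by (simp add: edg_iff)
  then show ?thesis using x by (auto simp: ext_parity_part_def edg_iff par_hom zero_prod_def)
qed

lemma pform_update:
  assumes "i < length fs"
  shows "pform (fs[i := fscale c f + g]) vs = c * pform (fs[i := f]) vs + pform (fs[i := g]) vs"
proof -
  let ?P = "\<Prod>j\<in>{..<length fs} - {i}. (fs ! j) (vs ! j)"
  have "pform (fs[i := h]) vs = h (vs ! i) * ?P" for h
    unfolding pform_def length_list_update using assms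
    by (subst prod.remove[of _ i]) (auto intro!: prod.cong)
  then show ?thesis by (simp add: fscale_def algebra_simps)
qed

end

section \<open>The form on words determined by given brackets\<close>

locale from_bracket = graded_alg s G
  for s :: "'k::field_char_0 \<Rightarrow> 'a::ring \<Rightarrow> 'a" and G :: "int \<Rightarrow> 'a set" +
  fixes br :: "nat \<Rightarrow> ('k, 'a) tensor \<Rightarrow> ('k, 'a) tensor"
  assumes double_P: "double_P_inf s G br"
begin

lemma bfam: "bracket_family s br"
  using double_P by (simp add: double_P_inf_def)

lemma b_endo: "p \<ge> 1 \<Longrightarrow> endo p (br p)"
  using bfam by (auto simp: bracket_family_def endo_def)

text \<open>The bracket evaluated without signs. Reading only the algebra part of letters in even
  positions and the functional of those in odd positions extends it by zero to letters of the wrong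
  type.\<close>

definition V0 :: "nat \<Rightarrow> ('a \<times> ('a \<Rightarrow> 'k)) list \<Rightarrow> 'k" where
  "V0 p w = br p (tens s (rev (map fst (evens w)))) (pform (rev (map snd (odds w))))"

lemma V0_lin:
  assumes p: "p \<ge> 1" and w: "length w = 2 * p" "set w \<subseteq> esp" and i: "i < 2 * p" and xy: "x \<in> esp" "y \<in> esp"
  shows "V0 p (w[i := esc c x + y]) = c * V0 p (w[i := x]) + V0 p (w[i := y])"
proof (cases "even i")
  case True
  let ?as = "rev (map fst (evens w))" and ?k = "p - 1 - i div 2"
  have l: "length (evens w) = p" using w evens_odds_length(1)[of w] by simp
  have k: "?k < p" "i div 2 < p" using p i by auto
  have e: "rev (map fst (evens (w[i := z]))) = ?as[?k := fst z]" for z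
    using True l k by (simp add: evens_odds_update map_update rev_update)
  have "odds (w[i := z]) = odds w" for z using True by (simp add: evens_odds_update)
  then show ?thesis
    unfolding V0_def e using mlfD[OF endo_tens_mlf[OF b_endo[OF p]], of ?as ?k] l k
    by (simp add: ext_scale_eq)
next
  case False
  let ?fs = "rev (map snd (odds w))" and ?k = "p - 1 - i div 2"
  have l: "length (odds w) = p" "length (evens w) = p" using w evens_odds_length[of w] by simp_all
  have k: "?k < p" "i div 2 < p" using p i by auto
  have e: "rev (map snd (odds (w[i := z]))) = ?fs[?k := snd z]" for z
    using False l k by (simp add: evens_odds_update map_update rev_update)
  have ev: "evens (w[i := z]) = evens w" for z using False by (simp add: evens_odds_update)
  have lin: "\<forall>f\<in>set ?fs. linf f" using w(2) evens_odds_set(2)[of w] gdual_linf by (auto simp: esp_iff)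
  have lin': "mlf p (pform (?fs[?k := f]))" if "linf f" for f
  proof (rule mlf_pform)
    show "\<forall>f\<in>set (?fs[?k := f]). linf f" using lin that set_update_subset_insert[of ?fs ?k f] by blast
  qed (use l in simp)
  have t: "br p (tens s (rev (map fst (evens w)))) \<in> tpow s p"
    using l(2) by (intro endo_in[OF b_endo[OF p]]) simp
  have "snd (esc c x + y) = fscale c (snd x) + snd y" by (simp add: ext_scale_eq)
  then have "pform (?fs[?k := snd (esc c x + y)]) = (\<lambda>vs. c * pform (?fs[?k := snd x]) vs + pform (?fs[?k := snd y]) vs)"
    using l k by (intro ext) (simp add: pform_update)
  then show ?thesis
    unfolding V0_def e ev using tpow_lin[OF t lin' lin', of "snd x" "snd y" c] xy gdual_linf by (simp add: esp_iff)
qed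

lemma V0_multilin: "p \<ge> 1 \<Longrightarrow> multilin esc (*) esp (2 * p) (V0 p)"
  unfolding multilin_def using V0_lin by blast

lemma multilin_entry_0:
  assumes "multilin esc (*) esp n F" "length w = n" "set w \<subseteq> esp" "0 \<in> set w" shows "F w = (0 :: 'k)"
proof -
  obtain i where i: "i < n" "w ! i = 0" using assms(2,4) by (auto simp: in_set_conv_nth)
  have "F (w[i := esc 1 0 + 0]) = 1 * F (w[i := 0]) + F (w[i := 0])"
    by (rule multilinD[OF assms(1-3) i(1)]) (simp_all add: esp_0)
  then show ?thesis using i(2) by (metis E.scale_one add_0 add_cancel_right_left list_update_id mult_1)
qed

definition word_sign :: "int list \<Rightarrow> int" where
  "word_sign \<pi> = tsg (rev (evens \<pi>)) (rev (map (\<lambda>e. e - 1) (odds \<pi>)))"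

definition V :: "nat \<Rightarrow> ('a \<times> ('a \<Rightarrow> 'k)) list \<Rightarrow> 'k" where
  "V p w = (\<Sum>\<pi>\<in>lists_of {0, 1} (2 * p). sg (word_sign \<pi>) * V0 p (map2 ext_parity_part \<pi> w))"

lemma map2_epar_esp: "set w \<subseteq> esp \<Longrightarrow> set (map2 ext_parity_part \<pi> w) \<subseteq> esp"
proof
  fix x assume w: "set w \<subseteq> esp" and "x \<in> set (map2 ext_parity_part \<pi> w)"
  then obtain a b where "(a, b) \<in> set (zip \<pi> w)" and x: "x = ext_parity_part a b" by (auto simp del: split_paired_Ex)
  then have "b \<in> esp" using set_zip_rightD w by fast
  then show "x \<in> esp" unfolding x by (rule epar_esp)
qed

lemma V_multilin: assumes p: "p \<ge> 1" shows "multilin esc (*) esp (2 * p) (V p)"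
  unfolding multilin_def
proof (intro allI impI, elim conjE)
  fix w i c x y assume a: "length w = 2 * p" "set w \<subseteq> esp" "i < 2 * p" "x \<in> esp" "y \<in> esp"
  have t: "V0 p (map2 ext_parity_part \<pi> (w[i := esc c x + y])) = c * V0 p (map2 ext_parity_part \<pi> (w[i := x])) + V0 p (map2 ext_parity_part \<pi> (w[i := y]))"
    if "\<pi> \<in> lists_of {0, 1} (2 * p)" for \<pi>
  proof -
    have l: "length \<pi> = 2 * p" using that by (simp add: lists_of_def)
    have u: "map2 ext_parity_part \<pi> (w[i := z]) = (map2 ext_parity_part \<pi> w)[i := ext_parity_part (\<pi> ! i) z]" for z
      using l a by (intro nth_equalityI) (auto simp: nth_list_update)
    show ?thesis unfolding u epar_lin
      by (rule V0_lin[OF p]) (use l a map2_epar_esp epar_esp in auto)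
  qed
  have "V p (w[i := esc c x + y]) = (\<Sum>\<pi>\<in>lists_of {0, 1} (2 * p).
      c * (sg (word_sign \<pi>) * V0 p (map2 ext_parity_part \<pi> (w[i := x]))) + sg (word_sign \<pi>) * V0 p (map2 ext_parity_part \<pi> (w[i := y])))"
    unfolding V_def by (rule sum.cong[OF refl]) (simp add: t distrib_left mult.left_commute)
  then show "V p (w[i := esc c x + y]) = c * V p (w[i := x]) + V p (w[i := y])"
    by (simp add: V_def sum.distrib sum_distrib_left)
qed

lemma V_lin:
  "p \<ge> 1 \<Longrightarrow> length w = 2 * p \<Longrightarrow> set w \<subseteq> esp \<Longrightarrow> i < 2 * p \<Longrightarrow> x \<in> esp \<Longrightarrow> y \<in> esp \<Longrightarrow>
    V p (w[i := esc c x + y]) = c * V p (w[i := x]) + V p (w[i := y])"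
  by (rule multilinD[OF V_multilin])

text \<open>Of all parity patterns only the one of ds survives the projections, and
  \<open>tsg_parity\<close> replaces it by ds in the sign.\<close>

lemma V_hom:
  assumes p: "p \<ge> 1" and w: "homs edg ds w" "length w = 2 * p"
  shows "V p w = sg (word_sign ds) * V0 p w"
proof -
  have l: "length ds = 2 * p" using w by (simp add: homs_length[symmetric])
  let ?\<pi> = "map (\<lambda>d. d mod 2) ds"
  have esp: "set w \<subseteq> esp" by (rule homs_esp[OF w(1)])
  have e: "ext_parity_part \<pi> (w ! i) = (if even (ds ! i + \<pi>) then w ! i else 0)" if "i < 2 * p" for i \<pi>
    using homs_nth[OF w(1)] that l by (intro epar_hom) simp
  have z: "V0 p (map2 ext_parity_part \<pi> w) = 0" if \<pi>: "\<pi> \<in> lists_of {0, 1} (2 * p)" "\<pi> \<noteq> ?\<pi>" for \<pi>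
  proof -
    have lp: "length \<pi> = 2 * p" using \<pi> by (simp add: lists_of_def)
    obtain i where i: "i < 2 * p" "\<pi> ! i \<noteq> ds ! i mod 2"
      using \<pi>(2) lp l nth_equalityI[of \<pi> ?\<pi>] by auto
    have "\<pi> ! i \<in> {0, 1}" using \<pi>(1) i(1) by (auto simp: lists_of_def subset_iff)
    moreover have "odd (b + a)" if "a = 0 \<or> a = 1" "a \<noteq> b mod 2" for a b :: int using that by presburger
    ultimately have "odd (ds ! i + \<pi> ! i)" using i(2) by blast
    then have "map2 ext_parity_part \<pi> w ! i = 0" "i < length (map2 ext_parity_part \<pi> w)" using i(1) lp w(2) e by auto
    then have "0 \<in> set (map2 ext_parity_part \<pi> w)" by (metis nth_mem)
    then show ?thesis by (intro multilin_entry_0[OF V0_multilin[OF p]] map2_epar_esp esp) (use lp w(2) in simp_all)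
  qed
  have "?\<pi> \<in> lists_of {0, 1} (2 * p)" using l by (auto simp: lists_of_def)
  then have "V p w = sg (word_sign ?\<pi>) * V0 p (map2 ext_parity_part ?\<pi> w)"
    unfolding V_def by (subst sum.remove[of _ ?\<pi>]) (auto simp: lists_of_finite z intro!: sum.neutral)
  also have "map2 ext_parity_part ?\<pi> w = w"
    using l w(2) e by (intro nth_equalityI) auto
  also have "even (word_sign ?\<pi> + word_sign ds)"
  proof -
    have r: "list_all2 (\<lambda>x y. even (x + y)) ?\<pi> ds" by (auto simp: list_all2_conv_all_nth)
    show ?thesis unfolding word_sign_def
      using list_all2_evens_odds[OF r] by (intro tsg_parity) (auto simp: list_all2_rev list.rel_map elim: list_all2_mono)
  qed
  then have "(sg (word_sign ?\<pi>) :: 'k) = sg (word_sign ds)" by (rule sg_cong)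
  finally show ?thesis .
qed

lemma evens_odds_word:
  assumes "length as = length fs"
  shows "rev (map fst (evens (word as fs))) = as" "rev (map snd (odds (word as fs))) = fs"
proof -
  have "length (map (\<lambda>a. (a, 0)) (rev as)) = length (map (\<lambda>f. (0, f)) (rev fs))" using assms by simp
  from evens_odds_interleave[OF this] show "rev (map fst (evens (word as fs))) = as" "rev (map snd (odds (word as fs))) = fs"
    unfolding word_def by (simp_all add: comp_def rev_map[symmetric])
qed

lemma evens_odds_wdeg:
  assumes "length ds = length es"
  shows "rev (evens (wdeg ds es)) = ds" "rev (map (\<lambda>e. e - 1) (odds (wdeg ds es))) = es"
  using assms evens_odds_interleave[of "rev ds" "map (\<lambda>e. e + 1) (rev es)"]
  by (simp_all add: wdeg_def comp_def)

lemma V_word: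
  assumes "p \<ge> 1" "homs G ds as" "length as = p" "homs dual es fs" "length fs = p"
  shows "br p (tens s as) (pform fs) = sg (tsg ds es) * V p (word as fs)"
proof -
  have l: "length ds = length es" using assms by (simp add: homs_length[symmetric])
  have h: "homs edg (wdeg ds es) (word as fs)" by (rule word_hom) (use assms in simp_all)
  have v: "V0 p (word as fs) = br p (tens s as) (pform fs)"
    unfolding V0_def using assms by (simp add: evens_odds_word)
  have t: "word_sign (wdeg ds es) = tsg ds es"
    unfolding word_sign_def evens_odds_wdeg[OF l] ..
  have "V p (word as fs) = sg (tsg ds es) * br p (tens s as) (pform fs)"
    using V_hom[OF assms(1) h] assms by (simp add: word_length v t)
  then show ?thesis by (simp add: mult.assoc[symmetric] sg_sq)
qed

lemma homs_evens_odds: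
  assumes "homs edg ds w"
  shows "homs G (rev (evens ds)) (rev (map fst (evens w)))"
    "homs dual (rev (map (\<lambda>d. d - 1) (odds ds))) (rev (map snd (odds w)))"
  using evens_odds_homs[OF assms] unfolding homs_def
  by (auto simp: list_all2_rev list.rel_map edg_iff elim!: list_all2_mono)

text \<open>Components of the wrong type are invisible to the form, so a homogeneous word may be
  replaced by the standard word of its relevant components.\<close>

lemma V_as_word:
  assumes p: "p \<ge> 1" and w: "homs edg ds w" "length w = 2 * p"
  shows "V p w = V p (word (rev (map fst (evens w))) (rev (map snd (odds w))))"
proof -
  let ?as = "rev (map fst (evens w))" and ?fs = "rev (map snd (odds w))"
  have l: "length ?as = p" "length ?fs = p" using w(2) by (simp_all add: evens_odds_length)
  from V_word[OF p homs_evens_odds(1)[OF w(1)] l(1) homs_evens_odds(2)[OF w(1)] l(2)]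
  have "V0 p w = sg (word_sign ds) * V p (word ?as ?fs)" unfolding V0_def word_sign_def .
  then show ?thesis unfolding V_hom[OF p w] by (simp add: mult.assoc[symmetric] sg_sq)
qed

lemma V_deg:
  assumes p: "p \<ge> 1" and w: "homs edg ds w" "length w = 2 * p" and nz: "V p w \<noteq> 0"
  shows "sum_list ds = 2 * int p - 2"
proof -
  let ?as = "rev (map fst (evens w))" and ?fs = "rev (map snd (odds w))"
    and ?ds = "rev (evens ds)" and ?es = "rev (map (\<lambda>d. d - 1) (odds ds))"
  have l: "length ?as = p" "length ?fs = p" using w(2) by (simp_all add: evens_odds_length)
  have ld: "length (odds ds) = p" using w by (simp add: evens_odds_length homs_length[symmetric])
  note h = homs_evens_odds[OF w(1)]
  have "tens s ?as \<in> tpow_deg s G p (sum_list ?ds)"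
    unfolding tpow_deg_def by (rule tsp.span_base) (use h(1) l(1) in blast)
  then have b: "br p (tens s ?as) \<in> tpow_deg s G p (sum_list ?ds + 2 - int p)"
    using double_P p by (auto simp: double_P_inf_def)
  have "V0 p w \<noteq> 0" using nz V_hom[OF p w] by auto
  then have "br p (tens s ?as) (pform ?fs) \<noteq> 0" by (simp add: V0_def)
  then have "sum_list ?es + (sum_list ?ds + 2 - int p) = 0"
    using tpow_deg_vanish[OF b h(2) l(2)] by blast
  moreover have "sum_list (map (\<lambda>d. d - 1) xs) = sum_list xs - int (length xs)" for xs :: "int list"
    by (induction xs) auto
  ultimately show ?thesis using evens_odds_sum[of ds] ld by (simp add: sum_list_rev)
qed

lemma V_update:
  assumes w: "length w = 2 * p" "i < 2 * p" and xy: "if even i then fst x = fst y else snd x = snd y"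
  shows "V p (w[i := x]) = V p (w[i := y])"
  unfolding V_def
proof (rule sum.cong[OF refl])
  fix \<pi> :: "int list" assume "\<pi> \<in> lists_of {0, 1} (2 * p)"
  then have l: "length \<pi> = 2 * p" by (simp add: lists_of_def)
  have u: "map2 ext_parity_part \<pi> (w[i := z]) = (map2 ext_parity_part \<pi> w)[i := ext_parity_part (\<pi> ! i) z]" for z
    using l w by (intro nth_equalityI) (auto simp: nth_list_update)
  have "if even i then fst (ext_parity_part (\<pi> ! i) x) = fst (ext_parity_part (\<pi> ! i) y) else snd (ext_parity_part (\<pi> ! i) x) = snd (ext_parity_part (\<pi> ! i) y)"
    using xy by (auto simp: ext_parity_part_def)
  then show "sg (word_sign \<pi>) * V0 p (map2 ext_parity_part \<pi> (w[i := x])) = sg (word_sign \<pi>) * V0 p (map2 ext_parity_part \<pi> (w[i := y]))"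
    unfolding u V0_def by (cases "even i") (simp_all add: evens_odds_update map_update)
qed

lemma V_zero:
  assumes p: "p \<ge> 1" and w: "length w = 2 * p" "set w \<subseteq> esp" and i: "i < 2 * p"
    and z: "if even i then fst (w ! i) = 0 else snd (w ! i) = 0"
  shows "V p w = 0"
proof -
  have "V p (w[i := w ! i]) = V p (w[i := 0])" by (rule V_update[OF w(1) i]) (use z in auto)
  moreover have "V p (w[i := 0]) = 0"
  proof (rule multilin_entry_0[OF V_multilin[OF p]])
    show "set (w[i := 0]) \<subseteq> esp" using w(2) set_update_subset_insert[of w i 0] esp_0 by blast
    show "0 \<in> set (w[i := 0])" using i w(1) by (intro set_update_memI) simp
  qed (use w in simp)
  ultimately show ?thesis by simp
qed

lemma V_last: "length xs = 2 * p - 1 \<Longrightarrow> p \<ge> 1 \<Longrightarrow> snd x = snd y \<Longrightarrow> V p (xs @ [x]) = V p (xs @ [y])"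
  using V_update[of "xs @ [y]" p "2 * p - 1" x y] by (auto simp: list_update_append)

lemma V_first: "length xs = 2 * p - 1 \<Longrightarrow> p \<ge> 1 \<Longrightarrow> fst x = fst y \<Longrightarrow> V p (x # xs) = V p (y # xs)"
  using V_update[of "y # xs" p 0 x y] by auto

text \<open>\<open>contraction\<close> gives a vector for each parity pattern. The projection
  attached to the last letter is moved from the functional to this vector, and the vectors are added
  with the signs of their patterns.\<close>

lemma alpha_exists:
  assumes p: "p \<ge> 1" and xs: "length xs = 2 * p - 1" "set xs \<subseteq> esp"
  shows "\<exists>\<alpha>. \<forall>g\<in>gdual s G. V p (xs @ [(0, g)]) = g \<alpha>"
proof -
  have "\<exists>x. \<forall>g\<in>gdual s G. V0 p (map2 ext_parity_part \<pi> (xs @ [(0, g)])) = g x" if \<pi>: "\<pi> \<in> lists_of {0, 1} (2 * p)" for \<pi>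
  proof -
    have lp: "length \<pi> = 2 * p" using \<pi> by (simp add: lists_of_def)
    then obtain \<pi>' e where pi': "\<pi> = \<pi>' @ [e]" using p by (cases \<pi> rule: rev_cases) auto
    have l': "length \<pi>' = 2 * p - 1" using lp pi' by simp
    let ?ys = "map2 ext_parity_part \<pi>' xs"
    have m: "map2 ext_parity_part \<pi> (xs @ [(0, g)]) = ?ys @ [ext_parity_part e (0, g)]" for g
      using l' xs(1) by (simp add: pi')
    have ly: "length ?ys = 2 * p - 1" "odd (length ?ys)" using l' xs(1) p by auto
    let ?fs = "rev (map snd (odds ?ys))"
    have le: "length (rev (map fst (evens ?ys))) = p" using ly(1) p by (simp add: evens_odds_length)
    have lo: "length ?fs = p - 1" using ly(1) p by (simp add: evens_odds_length)
    have t: "br p (tens s (rev (map fst (evens ?ys)))) \<in> tpow s (Suc (p - 1))"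
      using endo_in[OF b_endo[OF p] le] p by simp
    have "set (odds ?ys) \<subseteq> esp" using evens_odds_set(2)[of ?ys] map2_epar_esp[OF xs(2), of \<pi>'] by blast
    then have "\<forall>f\<in>set ?fs. linf f" using gdual_linf by (auto simp: esp_iff)
    from contraction[OF t this lo] obtain x where
      x: "linf g \<Longrightarrow> br p (tens s (rev (map fst (evens ?ys)))) (pform (g # ?fs)) = g x" for g by blast
    have "V0 p (map2 ext_parity_part \<pi> (xs @ [(0, g)])) = g (parity_part (e + 1) x)" if "g \<in> gdual s G" for g
    proof -
      have "snd (ext_parity_part e (0, g)) = (\<lambda>c. g (parity_part (e + 1) c))" by (simp add: ext_parity_part_def)
      then show ?thesis
        unfolding m V0_def using ly(2) x[OF linf_par[OF gdual_linf[OF that]], of "e + 1"]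
        by (simp only: evens_odds_snoc if_False list.map map_append rev_append rev.simps append.simps)
    qed
    then show ?thesis by blast
  qed
  then obtain x where x: "V0 p (map2 ext_parity_part \<pi> (xs @ [(0, g)])) = g (x \<pi>)"
    if "\<pi> \<in> lists_of {0, 1} (2 * p)" "g \<in> gdual s G" for \<pi> g by metis
  have "V p (xs @ [(0, g)]) = g (\<Sum>\<pi>\<in>lists_of {0, 1} (2 * p). s (sg (word_sign \<pi>)) (x \<pi>))" if "g \<in> gdual s G" for g
    unfolding V_def using that by (simp add: x linf_sum linf_scale gdual_linf)
  then show ?thesis by blast
qed

definition alpha :: "nat \<Rightarrow> ('a \<times> ('a \<Rightarrow> 'k)) list \<Rightarrow> 'a" where
  "alpha p xs = (SOME \<alpha>. \<forall>g\<in>gdual s G. V p (xs @ [(0, g)]) = g \<alpha>)"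

lemma alpha_eval:
  "p \<ge> 1 \<Longrightarrow> length xs = 2 * p - 1 \<Longrightarrow> set xs \<subseteq> esp \<Longrightarrow> g \<in> gdual s G \<Longrightarrow> g (alpha p xs) = V p (xs @ [(0, g)])"
  using someI_ex[OF alpha_exists[of p xs]] unfolding alpha_def by simp

lemma alpha_eqI: "(\<And>g. g \<in> gdual s G \<Longrightarrow> g a = g b) \<Longrightarrow> a = b"
proof -
  assume e: "\<And>g. g \<in> gdual s G \<Longrightarrow> g a = g b"
  have "g (s (-1) b + a) = 0" if "g \<in> dual n" for g n
    unfolding linfD[OF dual_linf[OF that]] using e[OF dual_gdual[OF that]] by simp
  then have "s (-1) b + a = 0" by (rule dual_separates)
  then show ?thesis by simp
qed

text \<open>Multiplication by (-1)^d in degree d, expressed by the parity projections so that it is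
  linear on the whole algebra. It supplies in \<open>beta\<close> the sign that depends on the
  degree of its argument.\<close>

definition grading_invol :: "'a \<Rightarrow> 'a" where
  "grading_invol c = parity_part 0 c - parity_part 1 c"

lemma kap_lin: "grading_invol (s c x + y) = s c (grading_invol x) + grading_invol y"
  by (simp add: grading_invol_def par_lin scale_right_diff_distrib)

lemma kap_hom: "c \<in> G d \<Longrightarrow> grading_invol c = s (sg d) c"
  by (simp add: grading_invol_def par_hom sg_if)

text \<open>
  Cyclicity forces \<open>\<gamma>(m xs, z) = V (xs @ [z]) \<mp> V (z # xs)\<close>, the first summand seeing only the functional of \<open>z\<close> and the
  second only its algebra part; \<open>alpha\<close> and \<open>beta\<close> represent the two summands.
\<close>

definition beta :: "nat \<Rightarrow> ('a \<times> ('a \<Rightarrow> 'k)) list \<Rightarrow> 'a \<Rightarrow> 'k" where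
  "beta p xs = (\<lambda>c. - V p ((grading_invol c, 0) # xs))"

end

context graded_alg begin

lemma multilin_esp:
  assumes F: "multilin esc esc esp n F" and "\<And>ds ys. homs edg ds ys \<Longrightarrow> length ys = n \<Longrightarrow> F ys \<in> esp"
    and xs: "length xs = n" "set xs \<subseteq> esp"
  shows "F xs \<in> esp"
proof (rule multilin_span[OF E.vector_space_axioms E.vector_space_axioms F esp_span esp_subspace _ xs])
  fix ys assume y: "length ys = n" "set ys \<subseteq> purehom"
  then have "set ys \<subseteq> (\<Union>d. edg d)" using purehom_edg by blast
  then obtain ds where "homs edg ds ys" using homs_exists by blast
  then show "F ys \<in> esp" using assms(2) y(1) by blast
qed

lemma emul_lin:
  assumes "x \<in> esp" "y \<in> esp" "z \<in> esp"
  shows "ext_mult (esc c x + y) z = esc c (ext_mult x z) + ext_mult y z" "ext_mult z (esc c x + y) = esc c (ext_mult z x) + ext_mult z y"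
  using assms gdual_linf[of "snd x"] gdual_linf[of "snd y"] gdual_linf[of "snd z"]
  by (simp_all add: ext_mult_def ext_scale_eq esp_iff prod_eq_iff fscale_def fun_eq_iff linf_add linf_scale
      scale_mult_left scale_mult_right distrib_left distrib_right add_ac)

end

context from_bracket begin

text \<open>Through this instance the axioms of the brackets become identities for \<open>V\<close>
  before any maps exist; skew-symmetry is then available to prove their cyclicity.\<close>

sublocale Vform: bracket_form s G br "\<lambda>as fs. V (length as) (word as fs)"
  "\<lambda>as fs. alpha (length as) (butlast (word as (0 # fs)))"
proof
  show "bracket_family s br" by (rule bfam)
  show "br p (tens s as) (pform fs) = sg (tsg ds es) * V (length as) (word as fs)"
    if "p \<ge> 1" "homs G ds as" "length as = p" "homs dual es fs" "length fs = p" for p ds as es fs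
    using V_word[OF that] that(3) by simp
  show "sum_list ds + sum_list es = int p - 2"
    if a: "p \<ge> 1" "homs G ds as" "length as = p" "homs dual es fs" "length fs = p" "V (length as) (word as fs) \<noteq> 0" for p ds as es fs
  proof -
    have l: "length ds = length es" "length ds = p" using a by (simp_all add: homs_length[symmetric])
    have "sum_list (wdeg ds es) = 2 * int p - 2"
      by (rule V_deg[OF a(1) word_hom]) (use a in \<open>simp_all add: word_length\<close>)
    then show ?thesis using l by (simp add: wdeg_sum)
  qed
  show "V (length as) (word as (f # fs)) = f (alpha (length as) (butlast (word as (0 # fs))))"
    if a: "homs G ds as" "length as = Suc q" "homs dual es fs" "length fs = q" "f \<in> dual e" for ds as q es fs f e
  proof -
    obtain a as' where as: "as = a # as'" using a(2) by (cases as) auto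
    have l: "length as' = length fs" using a as by simp
    let ?X = "word as' fs @ [(a, 0)]"
    have w: "word as (g # fs) = ?X @ [(0, g)]" for g using l by (simp add: as word_Cons)
    obtain d ds' where ds: "ds = d # ds'" "homs G ds' as'" using a(1) as by (cases ds) auto
    have "homs edg (wdeg ds' es) (word as' fs)" by (rule word_hom[OF ds(2) a(3) l])
    then have "set ?X \<subseteq> esp" using homs_esp zero_in_gdual[of s G] by (auto simp: esp_iff)
    moreover have "length ?X = 2 * length as - 1" using l by (simp add: as word_length)
    ultimately have "f (alpha (length as) ?X) = V (length as) (?X @ [(0, f)])"
      using dual_gdual[OF a(5)] a(2) by (intro alpha_eval) auto
    moreover have "butlast (word as (0 # fs)) = ?X" unfolding w by (rule butlast_snoc)
    ultimately show ?thesis unfolding w by simp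
  qed
qed

lemma V_skew:
  "p \<ge> 1 \<Longrightarrow> \<sigma> permutes {..<p} \<Longrightarrow> homs G ds as \<Longrightarrow> length as = p \<Longrightarrow> homs dual es fs \<Longrightarrow> length fs = p \<Longrightarrow>
     V p (word (permute_list \<sigma> as) (permute_list \<sigma> fs)) = sg (isum p \<sigma> (\<lambda>i. ds ! i + es ! i + 1)) * V p (word as fs)"
  using double_P unfolding Vform.double_P_inf_iff Vform.skew_cond_def by (auto simp: length_permute_list)

text \<open>Moving the last two letters to the front is the p-cycle on pairs. With x = dy + dz its
  exponent is x times the degree of the other pairs; the total degree is even, so the exponent has
  the parity of x times x, that is of x. For a single pair x is 0.\<close>

lemma V_cyc:
  assumes p: "p \<ge> 1" and ys: "homs edg ds ys" "length ys = 2 * p - 2" and yz: "y \<in> edg dy" "z \<in> edg dz"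
  shows "V p (ys @ [y, z]) = sg (dy + dz) * V p (y # z # ys)"
proof -
  let ?w = "ys @ [y, z]" and ?w' = "y # z # ys"
  let ?ds = "ds @ [dy, dz]" and ?ds' = "dy # dz # ds"
  have ld: "length ds = 2 * p - 2" using ys by (simp add: homs_length[symmetric])
  have ev: "even (length ys)" "even (length ds)" using ys(2) ld by simp_all
  have h: "homs edg ?ds ?w" "homs edg ?ds' ?w'" using ys yz ld by (simp_all add: homs_append)
  have l: "length ?w = 2 * p" "length ?w' = 2 * p" using ys(2) p by simp_all
  let ?as = "rev (map fst (evens ?w))" and ?fs = "rev (map snd (odds ?w))"
  let ?D = "rev (evens ?ds)" and ?E = "rev (map (\<lambda>d. d - 1) (odds ?ds))"
  have eo: "evens ?w = evens ys @ [y]" "odds ?w = odds ys @ [z]" "evens ?ds = evens ds @ [dy]" "odds ?ds = odds ds @ [dz]"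
    using ev evens_odds_snoc[of ys y] evens_odds_snoc[of "ys @ [y]" z] evens_odds_snoc[of ds dy] evens_odds_snoc[of "ds @ [dy]" dz]
    by simp_all
  have la: "length ?as = p" "length ?fs = p" using l(1) by (simp_all only: evens_odds_length length_rev length_map)
  have r: "rev (map fst (evens ?w')) = rotate 1 ?as" "rev (map snd (odds ?w')) = rotate 1 ?fs"
    by (simp_all add: eo)
  have pr: "permute_list (cycle_perm p) xs = rotate 1 xs" if "length xs = p" for xs :: "'b list"
    using permute_cycle[of xs p 1] that p by simp
  have cp: "cycle_perm p permutes {..<p}" using cycle_permutes[OF p, of 1] by simp
  let ?h = "\<lambda>i. ?D ! i + ?E ! i + 1"
  have "V p (word (rotate 1 ?as) (rotate 1 ?fs)) = sg (isum p (cycle_perm p) ?h) * V p (word ?as ?fs)"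
    using V_skew[OF p cp homs_evens_odds(1)[OF h(1)] la(1) homs_evens_odds(2)[OF h(1)] la(2)]
    unfolding pr[OF la(1)] pr[OF la(2)] .
  then have e: "V p ?w' = sg (isum p (cycle_perm p) ?h) * V p ?w"
    using V_as_word[OF p h(1) l(1)] V_as_word[OF p h(2) l(2)] unfolding r by simp
  show ?thesis
  proof (cases "V p ?w = 0")
    case False
    have sd: "sum_list ?ds = 2 * int p - 2" by (rule V_deg[OF p h(1) l(1) False])
    have lo: "length (evens ds) = p - 1" "length (odds ds) = p - 1" using ld by (simp_all add: evens_odds_length)
    have h0: "?h 0 = dy + dz" by (simp add: eo)
    have s1: "sum_list (map (\<lambda>d. d - 1) xs) = sum_list xs - int (length xs)" for xs :: "int list"
      by (induction xs) auto
    have "(\<Sum>i<p. ?h i) = sum_list ?D + sum_list ?E + int p"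
    proof -
      have lD: "length ?D = p" "length ?E = p" using lo p by (simp_all add: eo)
      show ?thesis unfolding sum_list_nth'[of ?D] sum_list_nth'[of ?E] lD
        by (simp only: sum.distrib) simp
    qed
    also have "\<dots> = sum_list ?ds"
      using evens_odds_sum[of ?ds] lo p by (simp add: sum_list_rev s1 eo)
    finally have tot: "(\<Sum>i<p. ?h i) = 2 * int p - 2" using sd by simp
    have "even (isum p (cycle_perm p) ?h + (dy + dz))"
    proof (cases "p = 1")
      case True
      then have "dy + dz = 0" using tot h0 by simp
      moreover have "isum p (cycle_perm p) ?h = 0"
        unfolding isum_def True by (rule sum.neutral) auto
      ultimately show ?thesis by simp
    next
      case False
      then have p1: "1 < p" using p by simp
      have "(\<Sum>i<p. ?h i) = ?h 0 + (\<Sum>i\<in>{1..<p}. ?h i)"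
        using p by (simp add: lessThan_atLeast0 sum.atLeast_Suc_lessThan)
      then have "(\<Sum>i\<in>{1..<p}. ?h i) = 2 * int p - 2 - (dy + dz)" using tot h0 by simp
      moreover have "isum p (cycle_perm p) ?h = ?h 0 * (\<Sum>i\<in>{1..<p}. ?h i)"
        using isum_cycle[OF p1, of ?h] by simp
      ultimately show ?thesis unfolding h0 by simp
    qed
    then have "even (isum p (cycle_perm p) ?h + (dy + dz))" .
    then have "(sg (isum p (cycle_perm p) ?h) :: 'k) = sg (dy + dz)" by (rule sg_cong)
    then show ?thesis unfolding e by (simp add: mult.assoc[symmetric] sg_sq)
  next
    case True
    then show ?thesis using e by simp
  qed
qed

section \<open>The maps recovered from the form\<close>

definition CY_maps :: "nat \<Rightarrow> ('a \<times> ('a \<Rightarrow> 'k)) list \<Rightarrow> 'a \<times> ('a \<Rightarrow> 'k)" where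
  "CY_maps n xs = (if n \<ge> 1 \<and> length xs = n \<and> set xs \<subseteq> esp then
     if n = 2 then ext_mult (xs ! 0) (xs ! 1)
     else if even n then 0
     else (alpha ((n + 1) div 2) xs, beta ((n + 1) div 2) xs) else 0)"

lemma m_of_odd: "p \<ge> 1 \<Longrightarrow> length xs = 2 * p - 1 \<Longrightarrow> set xs \<subseteq> esp \<Longrightarrow> CY_maps (2 * p - 1) xs = (alpha p xs, beta p xs)"
  by (cases p) (auto simp: CY_maps_def)

lemma m_of_even: "even n \<Longrightarrow> n \<noteq> 2 \<Longrightarrow> CY_maps n xs = 0"
  by (simp add: CY_maps_def)

lemma m_of_2: "x \<in> esp \<Longrightarrow> y \<in> esp \<Longrightarrow> CY_maps 2 [x, y] = ext_mult x y"
  by (simp add: CY_maps_def)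

lemma odd_arity: "odd n \<Longrightarrow> \<exists>p\<ge>1. n = 2 * p - (1 :: nat)"
  by (rule exI[of _ "(n + 1) div 2"]) (auto elim!: oddE)

lemma base_esp: "(a, 0) \<in> esp" using zero_in_gdual[of s G] by (simp add: esp_iff)

lemma m_of_multilin: assumes n: "n \<ge> 1" shows "multilin esc esc esp n (CY_maps n)"
  unfolding multilin_def
proof (intro allI impI, elim conjE)
  fix xs i c x y assume a: "length xs = n" "set xs \<subseteq> esp" "i < n" "x \<in> esp" "y \<in> esp"
  have in_esp: "set (xs[i := z]) \<subseteq> esp" if "z \<in> esp" for z using set_update_subset_insert[of xs i z] a that by blast
  have xy: "esc c x + y \<in> esp" using a by (intro esp_add esp_scale)
  consider p where "p \<ge> 1" "n = 2 * p - 1" | "n = 2" | "even n" "n \<noteq> 2" using odd_arity by blast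
  then show "CY_maps n (xs[i := esc c x + y]) = esc c (CY_maps n (xs[i := x])) + CY_maps n (xs[i := y])"
  proof cases
    case 1
    let ?L = "\<lambda>z. xs[i := z]"
    have l: "length (?L z) = 2 * p - 1" for z using a 1 by simp
    have "alpha p (?L (esc c x + y)) = s c (alpha p (?L x)) + alpha p (?L y)"
    proof (rule alpha_eqI)
      fix g assume g: "g \<in> gdual s G"
      have ev: "g (alpha p (?L z)) = V p ((xs @ [(0, g)])[i := z])" if "z \<in> esp" for z
        using alpha_eval[OF 1(1) l in_esp[OF that] g] a by (simp add: list_update_append)
      have "V p ((xs @ [(0, g)])[i := esc c x + y]) = c * V p ((xs @ [(0, g)])[i := x]) + V p ((xs @ [(0, g)])[i := y])"
        by (rule V_lin[OF 1(1)]) (use a 1 g in \<open>auto simp: esp_iff\<close>)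
      then show "g (alpha p (?L (esc c x + y))) = g (s c (alpha p (?L x)) + alpha p (?L y))"
        unfolding linfD[OF gdual_linf[OF g]] using ev xy a by simp
    qed
    moreover have "beta p (?L (esc c x + y)) = fscale c (beta p (?L x)) + beta p (?L y)"
    proof
      fix v
      have "V p (((grading_invol v, 0) # xs)[Suc i := esc c x + y]) = c * V p (((grading_invol v, 0) # xs)[Suc i := x]) + V p (((grading_invol v, 0) # xs)[Suc i := y])"
        by (rule V_lin[OF 1(1)]) (use a 1 base_esp in auto)
      then show "beta p (?L (esc c x + y)) v = (fscale c (beta p (?L x)) + beta p (?L y)) v"
        by (simp add: beta_def fscale_def)
    qed
    ultimately show ?thesis
      unfolding 1(2) m_of_odd[OF 1(1) l in_esp[OF xy]] m_of_odd[OF 1(1) l in_esp[OF a(4)]] m_of_odd[OF 1(1) l in_esp[OF a(5)]]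
      by (simp add: ext_scale_eq)
  next
    case 2
    then obtain u v where xs: "xs = [u, v]" using a(1) by (auto simp: length_Suc_conv numeral_2_eq_2)
    have uv: "u \<in> esp" "v \<in> esp" using a xs by auto
    consider "i = 0" | "i = 1" using a 2 by linarith
    then show ?thesis
      by cases (use xy a uv emul_lin in \<open>simp_all add: xs 2 m_of_2\<close>)
  next
    case 3
    then show ?thesis by (simp add: m_of_even)
  qed
qed

text \<open>The letter put in front of xs shifts all positions by one, so the parity condition is
  opposite to that of \<open>alpha_zero\<close>.\<close>

lemma beta_zero: "p \<ge> 1 \<Longrightarrow> length xs = 2 * p - 1 \<Longrightarrow> set xs \<subseteq> esp \<Longrightarrow>
    i < 2 * p - 1 \<Longrightarrow> (if odd i then fst (xs ! i) = 0 else snd (xs ! i) = 0) \<Longrightarrow> beta p xs = 0"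
  unfolding beta_def by (rule ext) (use base_esp V_zero[of p "(grading_invol _, 0) # xs" "Suc i"] in auto)

lemma alpha_zero: "p \<ge> 1 \<Longrightarrow> length xs = 2 * p - 1 \<Longrightarrow> set xs \<subseteq> esp \<Longrightarrow>
    i < 2 * p - 1 \<Longrightarrow> (if even i then fst (xs ! i) = 0 else snd (xs ! i) = 0) \<Longrightarrow> alpha p xs = 0"
proof (rule alpha_eqI)
  fix g assume g: "g \<in> gdual s G"
    and a: "p \<ge> 1" "length xs = 2 * p - 1" "set xs \<subseteq> esp" "i < 2 * p - 1" "if even i then fst (xs ! i) = 0 else snd (xs ! i) = 0"
  have "V p (xs @ [(0, g)]) = 0"
    by (rule V_zero[of _ _ i]) (use a g in \<open>auto simp: esp_iff nth_append\<close>)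
  then show "g (alpha p xs) = g 0" using alpha_eval[OF a(1-3) g] gdual_linf[OF g] by (simp add: linf_zero)
qed

lemma m_of_deg:
  assumes n: "n \<ge> 1" and xs: "length xs = n" "homs edg ds xs"
  shows "CY_maps n xs \<in> edg (sum_list ds + 2 - int n)"
proof -
  note esp = homs_esp[OF xs(2)]
  consider p where "p \<ge> 1" "n = 2 * p - 1" | "n = 2" | "even n" "n \<noteq> 2" using odd_arity by blast
  then show ?thesis
  proof cases
    case 1
    have l: "length xs = 2 * p - 1" using xs 1 by simp
    have ld: "length ds = length xs" using homs_length[OF xs(2)] by simp
    have "alpha p xs \<in> G (sum_list ds + 2 - int n)"
    proof (rule dual_detects_degree)
      fix e f assume f: "f \<in> dual e" "e \<noteq> - (sum_list ds + 2 - int n)"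
      have "homs edg (ds @ [e + 1]) (xs @ [(0, f)])" using xs f ld by (simp add: homs_append edg_dual)
      from V_deg[OF 1(1) this] have "V p (xs @ [(0, f)]) = 0" using f(2) 1 l by (cases "V p (xs @ [(0, f)]) = 0") auto
      then show "f (alpha p xs) = 0" using alpha_eval[OF 1(1) l esp dual_gdual[OF f(1)]] by simp
    qed
    moreover have "beta p xs \<in> dual (sum_list ds + 2 - int n - 1)"
      unfolding dual_iff
    proof (intro conjI allI impI)
      have "V p (((0, 0) # xs)[0 := esc c (grading_invol x, 0) + (grading_invol y, 0)]) = c * V p (((0, 0) # xs)[0 := (grading_invol x, 0)]) + V p (((0, 0) # xs)[0 := (grading_invol y, 0)])" for c x y
        by (rule V_lin[OF 1(1)]) (use esp l 1 base_esp in auto)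
      moreover have "esc c (grading_invol x, 0) + (grading_invol y, 0) = (grading_invol (s c x + y), 0)" for c x y
        by (simp add: ext_scale_eq kap_lin fscale_def fun_eq_iff)
      ultimately show "linf (beta p xs)" by (simp add: linf_def beta_def)
      fix k c assume c: "k + (sum_list ds + 2 - int n - 1) \<noteq> 0" "c \<in> G k"
      have "homs edg (k # ds) ((grading_invol c, 0) # xs)" using xs c by (simp add: edg_base kap_hom G_scale)
      from V_deg[OF 1(1) this] have "V p ((grading_invol c, 0) # xs) = 0" using c(1) 1 l by (cases "V p ((grading_invol c, 0) # xs) = 0") auto
      then show "beta p xs c = 0" by (simp add: beta_def)
    qed
    ultimately show ?thesis using m_of_odd[OF 1(1) l esp] by (simp add: edg_iff 1(2))
  next
    case 2
    then obtain u v where u: "xs = [u, v]" using xs(1) by (auto simp: length_Suc_conv numeral_2_eq_2)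
    obtain i j where "ds = [i, j]" "u \<in> edg i" "v \<in> edg j" using xs(2) unfolding u by (cases ds; cases "tl ds") auto
    then show ?thesis using esp emul_edg[of u i v j] by (simp add: u 2 m_of_2)
  next
    case 3
    then show ?thesis by (simp add: m_of_even edg_0)
  qed
qed

lemma m_of_form:
  assumes p: "p \<ge> 1" and xs: "length xs = 2 * p - 1" "homs edg ds xs" and z: "z \<in> edg d"
  shows "nat_form (CY_maps (2 * p - 1) xs) z = V p (xs @ [z]) - sg d * V p (z # xs)"
proof -
  note esp = homs_esp[OF xs(2)]
  have z': "fst z \<in> G d" "snd z \<in> gdual s G" using z by (auto simp: edg_iff dual_gdual)
  have "V p (((0, 0) # xs)[0 := esc (sg d) (fst z, 0) + 0]) = sg d * V p (((0, 0) # xs)[0 := (fst z, 0)]) + V p (((0, 0) # xs)[0 := 0])"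
    by (rule V_lin[OF p]) (use esp xs p base_esp esp_0 in auto)
  moreover have "V p (0 # xs) = 0" by (rule V_zero[OF p, of _ 0]) (use esp xs p esp_0 in auto)
  moreover have "esc (sg d) (fst z, 0) + 0 = (grading_invol (fst z), 0)"
    by (simp add: ext_scale_eq kap_hom[OF z'(1)] fscale_def fun_eq_iff zero_prod_def)
  ultimately have "beta p xs (fst z) = - (sg d * V p ((fst z, 0) # xs))" by (simp add: beta_def)
  also have "V p ((fst z, 0) # xs) = V p (z # xs)" by (rule V_first[OF xs(1) p]) simp
  finally have b: "beta p xs (fst z) = - (sg d * V p (z # xs))" .
  have "snd z (alpha p xs) = V p (xs @ [(0, snd z)])" by (rule alpha_eval[OF p xs(1) esp z'(2)])
  also have "\<dots> = V p (xs @ [z])" by (rule V_last[OF xs(1) p]) simp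
  finally show ?thesis using m_of_odd[OF p xs(1) esp] b by (simp add: nat_form_eq)
qed

end

context from_bracket begin

lemma m_of_off: "\<not> (n \<ge> 1 \<and> length xs = n \<and> set xs \<subseteq> esp) \<Longrightarrow> CY_maps n xs = 0"
  by (auto simp: CY_maps_def)

lemma m_of_esp: "CY_maps n xs \<in> esp"
proof (cases "n \<ge> 1 \<and> length xs = n \<and> set xs \<subseteq> esp")
  case True
  then have n: "n \<ge> 1" by simp
  show ?thesis
    by (rule multilin_esp[OF m_of_multilin[OF n]]) (use True m_of_deg[OF n] edg_esp in blast)+
qed (simp add: m_of_off esp_0)

text \<open>In odd arity both sides combine the values of \<open>V\<close> on y, a, ys and on a, ys,
  y, and \<open>V_cyc\<close> makes them agree up to -(-1)^d; the degree of a nonzero word turns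
  this into the required sign. In arity 2 the triple form is cyclic by associativity.\<close>

lemma m_of_cyc:
  assumes n: "n \<ge> 1" and as: "length as = n" "homs edg ds as" and a: "a \<in> edg d"
  shows "nat_form (CY_maps n as) a = sg (int n + d * sum_list ds) * nat_form (CY_maps n (a # butlast as)) (last as)"
proof -
  have "as \<noteq> []" "ds \<noteq> []" using as n homs_length[OF as(2)] by auto
  then obtain ys y ds' dy where y: "as = ys @ [y]" and d: "ds = ds' @ [dy]" using rev_exhaust[of as] rev_exhaust[of ds] by metis
  have l: "length ds' = length ys" using homs_length[OF as(2)] by (simp add: y d)
  have h: "homs edg ds' ys" "y \<in> edg dy" using as(2) l by (simp_all add: y d homs_append)
  note esp = homs_esp[OF h(1)] edg_esp[OF h(2)] edg_esp[OF a]
  consider p where "p \<ge> 1" "n = 2 * p - 1" | "n = 2" | "even n" "n \<noteq> 2" using odd_arity by blast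
  then show ?thesis
  proof cases
    case 1
    have ly: "length ys = 2 * p - 2" using as(1) 1 by (simp add: y)
    let ?A = "V p (y # a # ys)" and ?B = "V p (a # ys @ [y])"
    have L: "nat_form (CY_maps n as) a = sg (dy + d) * ?A - sg d * ?B"
      using m_of_form[OF 1(1) _ as(2) a] V_cyc[OF 1(1) h(1) ly h(2) a] as(1) 1 by (simp add: y)
    have "homs edg (d # ds') (a # ys)" using h a by simp
    from m_of_form[OF 1(1) _ this h(2)]
    have R: "nat_form (CY_maps n (a # ys)) y = ?B - sg dy * ?A" using 1 ly by (simp add: y)
    have e: "nat_form (CY_maps n as) a = - sg d * nat_form (CY_maps n (a # ys)) y"
      unfolding L R sg_add by (simp add: algebra_simps)
    show ?thesis
    proof (cases "?A = 0 \<and> ?B = 0")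
      case True
      then show ?thesis using e R by (simp add: y)
    next
      case False
      have p2: "2 * int p - 2 = int n - 1" using 1 by auto
      have "dy + d + sum_list ds' = int n - 1"
      proof (cases "?A = 0")
        case True
        then have "?B \<noteq> 0" using False by simp
        moreover have "homs edg (d # ds' @ [dy]) (a # ys @ [y])" using a h l by (simp add: homs_append)
        moreover have "length (a # ys @ [y]) = 2 * p" using ly 1(1) by simp
        ultimately have "sum_list (d # ds' @ [dy]) = 2 * int p - 2" using V_deg[OF 1(1)] by blast
        then show ?thesis using p2 by simp
      next
        case False
        moreover have "homs edg (dy # d # ds') (y # a # ys)" using a h by simp
        moreover have "length (y # a # ys) = 2 * p" using ly 1(1) by simp
        ultimately have "sum_list (dy # d # ds') = 2 * int p - 2" using V_deg[OF 1(1)] by blast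
        then show ?thesis using p2 by simp
      qed
      then have sd: "sum_list ds = int n - 1 - d" by (simp add: d)
      have "odd n" using 1 by auto
      then have "even (1 + d + (int n + d * sum_list ds))"
        unfolding sd by (cases "even d") simp_all
      then have "(sg (1 + d) :: 'k) = sg (int n + d * sum_list ds)" by (rule sg_cong)
      then have "- (sg d :: 'k) = sg (int n + d * sum_list ds)" by (simp add: sg_add)
      then show ?thesis using e by (simp add: y)
    qed
  next
    case 2
    then obtain x where x: "ys = [x]" using as(1) y by (auto simp: length_Suc_conv)
    obtain dx where dx: "ds' = [dx]" "x \<in> edg dx" using h(1) by (cases ds'; cases "tl ds'") (auto simp: x)
    have ex: "x \<in> esp" using esp x by simp
    have e: "nat_form (ext_mult x y) a = nat_form (ext_mult a x) y"
      by (simp add: nat_form_eq ext_mult_def mult.assoc)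
    show ?thesis
    proof (cases "nat_form (ext_mult x y) a = 0")
      case True
      then show ?thesis using e esp ex by (simp add: y x 2 m_of_2)
    next
      case False
      have "dx + dy + d = 1" by (rule nf_deg[OF emul_edg[OF dx(2) h(2)] a False])
      then have s: "sum_list ds = 1 - d" by (simp add: d dx)
      have "even (int n + d * sum_list ds)" unfolding s by (simp add: 2)
      then show ?thesis using e esp ex by (simp add: y x 2 m_of_2 sg_if)
    qed
  next
    case 3
    then show ?thesis using esp by (simp add: m_of_even nf_0 y)
  qed
qed

lemma m_of_manageable: "manageable s G CY_maps"
  unfolding manageable_def
proof (intro allI ballI conjI)
  fix d e d' e' a f a' f' assume h: "a \<in> G d" "f \<in> dual e" "a' \<in> G d'" "f' \<in> dual e'"
  have m: "CY_maps 2 [(a, f), (a', f')] = ext_mult (a, f) (a', f')"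
    by (rule m_of_2) (use h dual_gdual in \<open>auto simp: esp_iff\<close>)
  show "fst (CY_maps 2 [(a, f), (a', f')]) = a * a'" unfolding m by (simp add: ext_mult_def)
  fix k c assume c: "c \<in> G k"
  have "sg d * sg (d * (e' + k)) * f' (c * a) = f' (c * a)"
  proof (cases "f' (c * a) = 0")
    case False
    then have "k + d + e' = 0" using dual_vanish[OF h(4) G_mult[OF c h(1)]] by blast
    then have "e' + k = - d" by simp
    then have "even (d + d * (e' + k))" by simp
    then show ?thesis by (simp add: sg_add[symmetric] sg_if)
  qed simp
  then show "snd (CY_maps 2 [(a, f), (a', f')]) c = f (a' * c) + sg d * sg (d * (e' + k)) * f' (c * a)"
    unfolding m by (simp add: ext_mult_def)
qed

text \<open>\<open>alpha\<close> survives only on words that alternate from an algebra letter,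
  \<open>beta\<close> only on those that alternate from a functional. Two equal neighbours kill
  both; otherwise the first letter decides which one can remain.\<close>

lemma m_of_good: "good s G CY_maps"
  unfolding good_def Let_def
proof (intro conjI allI impI; (elim conjE)?)
  show "essentially_odd CY_maps" by (auto simp: essentially_odd_def m_of_even)
  fix n "is" xs assume n: "odd n" and l: "length is = n"
    and pw': "list_all2 (\<lambda>i x. x \<in> (if i then dual_part s G else base_part)) is xs"
  have pw: "pw is xs" using pw' by (simp add: ext_summand_def)
  obtain p where p: "p \<ge> 1" "n = 2 * p - 1" using odd_arity[OF n] by blast
  have lx: "length xs = 2 * p - 1" using pw l p by (simp add: list_all2_lengthD[symmetric])
  note esp = pw_esp[OF pw]
  have m: "CY_maps n xs = (alpha p xs, beta p xs)" unfolding p(2) by (rule m_of_odd[OF p(1) lx esp])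
  have x: "if is ! i then fst (xs ! i) = 0 else snd (xs ! i) = 0" if "i < n" for i
    using list_all2_nthD[OF pw, of i] that l by (auto simp: tB_iff split: if_splits)
  have a0: "alpha p xs = 0" if "i < n" "is ! i = even i" for i
    by (rule alpha_zero[OF p(1) lx esp, of i]) (use x[OF that(1)] that p in \<open>auto split: if_splits\<close>)
  have b0: "beta p xs = 0" if "i < n" "is ! i = odd i" for i
    by (rule beta_zero[OF p(1) lx esp, of i]) (use x[OF that(1)] that p in \<open>auto split: if_splits\<close>)
  have B: "(if hd is then dual_part s G else base_part) = ext_summand (hd is)" by (simp add: ext_summand_def)
  have n0: "0 < n" using p by simp
  then have hd: "hd is = is ! 0" using l by (cases "is") auto
  show "if \<forall>j. Suc j < n \<longrightarrow> is ! j \<noteq> is ! Suc j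
      then CY_maps n xs \<in> (if hd is then dual_part s G else base_part) else CY_maps n xs = 0"
  proof (cases "\<forall>j. Suc j < n \<longrightarrow> is ! j \<noteq> is ! Suc j")
    case True
    have "CY_maps n xs \<in> ext_summand (hd is)"
      using a0[OF n0] b0[OF n0] m_of_esp[of n xs] by (auto simp: tB_iff m hd esp_iff)
    then show ?thesis unfolding B using True by simp
  next
    case False
    then obtain j where j: "Suc j < n" "is ! j = is ! Suc j" by blast
    have "alpha p xs = 0" using a0[of j] a0[of "Suc j"] j by (cases "is ! j = even j") auto
    moreover have "beta p xs = 0" using b0[of j] b0[of "Suc j"] j by (cases "is ! j = odd j") auto
    ultimately have "CY_maps n xs = 0" by (simp add: m zero_prod_def)
    then show ?thesis using False by (simp only: if_False)
  qed
qed

sublocale M: cyclic_maps s G CY_maps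
proof
  show "CY_maps n xs = 0" if "\<not> (n \<ge> 1 \<and> length xs = n \<and> set xs \<subseteq> esp)" for n xs by (rule m_of_off[OF that])
  show "multilin esc esc esp n (CY_maps n)" if "n \<ge> 1" for n by (rule m_of_multilin[OF that])
  show "CY_maps n xs \<in> edg (sum_list ds + 2 - int n)" if "n \<ge> 1" "length xs = n" "homs edg ds xs" for n xs ds
    by (rule m_of_deg[OF that])
  show "nat_form (CY_maps n as) a = sg (int n + d * sum_list ds) * nat_form (CY_maps n (a # butlast as)) (last as)"
    if "n \<ge> 1" "length as = n" "a \<in> edg d" "homs edg ds as" for n as a d ds
    by (rule m_of_cyc[OF that(1,2,4,3)])
  show "essentially_odd CY_maps" by (auto simp: essentially_odd_def m_of_even)
qed (rule m_of_manageable m_of_good)+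

text \<open>Of the two summands of the form the one with the functional in front vanishes, since
  position 0 reads only the algebra part.\<close>

lemma M_W_word:
  assumes p: "p \<ge> 1" and as: "homs G ds as" "length as = p" and fs: "homs dual es fs" "length fs = p"
  shows "M.W (word as fs) = V p (word as fs)"
proof -
  obtain a as' where a: "as = a # as'" using as p by (cases as) auto
  obtain f fs' where f: "fs = f # fs'" using fs p by (cases fs) auto
  obtain d ds' where d: "ds = d # ds'" "homs G ds' as'" "a \<in> G d" using as(1) a by (cases ds) auto
  obtain e es' where e: "es = e # es'" "homs dual es' fs'" "f \<in> dual e" using fs(1) f by (cases es) auto
  have l: "length as' = length fs'" "length fs' = p - 1" using as fs a f by simp_all
  have hw: "homs edg (wdeg ds' es') (word as' fs')" by (rule word_hom[OF d(2) e(2) l(1)])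
  have "length (wdeg ds' es') = length (word as' fs')" using homs_length[OF hw] by simp
  then have hX: "homs edg (wdeg ds' es' @ [d]) (word as' fs' @ [(a, 0)])"
    using hw d(3) by (simp add: homs_append edg_base)
  have w: "word as fs = (word as' fs' @ [(a, 0)]) @ [(0, f)]" using l by (simp add: a f word_Cons)
  have lX: "length (word as' fs' @ [(a, 0)]) = 2 * p - 1" using l p by (simp add: word_length)
  have z: "V p ((0, f) # word as' fs' @ [(a, 0)]) = 0"
    by (rule V_zero[OF p, of _ 0]) (use lX p homs_esp[OF hX] dual_gdual[OF e(3)] in \<open>auto simp: esp_iff\<close>)
  have "(0, f) \<in> edg (e + 1)" using e by (simp add: edg_dual)
  from m_of_form[OF p lX hX this] show ?thesis
    unfolding w M.W_snoc lX z by simp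
qed

lemma m_of_brackets: "brackets_of s G CY_maps br"
  unfolding M.brackets_of_iff
proof (intro conjI allI impI; (elim conjE)?)
  show "bracket_family s br" by (rule bfam)
  fix p ds as es fs assume a: "1 \<le> p" "homs G ds as" "length as = p" "homs dual es fs" "length fs = p"
  show "br p (tens s as) (pform fs) = sg (tsg ds es) * M.W (word as fs)"
    unfolding M_W_word[OF a] by (rule V_word[OF a])
qed

sublocale L: linked s G CY_maps br
  by unfold_locales (rule m_of_brackets)

lemma m_of_GMS: "CY_maps \<in> good_manageable_special_pre_CY s G"
  using double_P unfolding L.double_P_inf_iff_GMS .

end

section \<open>Existence of the brackets\<close>

lemma word_split:
  assumes "length as1 = length fs1" "length as2 = length fs2"
  shows "word (as1 @ a # as2) (fs1 @ f # fs2) = word as2 fs2 @ (a, 0) # (0, f) # word as1 fs1"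
  using assms by (simp add: word_append word_Cons)

lemma word_update:
  assumes l: "length as = p" "length fs = p" and i: "i < p"
  shows "word (as[i := a]) fs = (word as fs)[2 * (p - 1 - i) := (a, 0)]"
    and "word as (fs[i := f]) = (word as fs)[2 * (p - 1 - i) + 1 := (0, f)]"
proof -
  let ?as1 = "take i as" and ?as2 = "drop (Suc i) as" and ?fs1 = "take i fs" and ?fs2 = "drop (Suc i) fs"
  have as: "as = ?as1 @ as ! i # ?as2" "as[i := a] = ?as1 @ a # ?as2"
    using l i by (simp_all add: id_take_nth_drop upd_conv_take_nth_drop)
  have fs: "fs = ?fs1 @ fs ! i # ?fs2" "fs[i := f] = ?fs1 @ f # ?fs2"
    using l i by (simp_all add: id_take_nth_drop upd_conv_take_nth_drop)
  have ll: "length ?as1 = length ?fs1" "length ?as2 = length ?fs2" using l by simp_all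
  note w = word_split[OF ll]
  have n: "length (word ?as2 ?fs2) = 2 * (p - 1 - i)" using l by (simp add: word_length)
  have W: "word as fs = word ?as2 ?fs2 @ (as ! i, 0) # (0, fs ! i) # word ?as1 ?fs1"
    using w[of "as ! i" "fs ! i"] as(1) fs(1) by simp
  show "word (as[i := a]) fs = (word as fs)[2 * (p - 1 - i) := (a, 0)]"
    unfolding W n[symmetric] using w[of a "fs ! i"] as(2) fs(1) by simp
  show "word as (fs[i := f]) = (word as fs)[2 * (p - 1 - i) + 1 := (0, f)]"
    unfolding W n[symmetric] using w[of "as ! i" f] as(1) fs(2) by (simp add: list_update_append)
qed

context graded_alg begin

text \<open>A functional equal to 1 on a maximal independent subfamily B is nonzero on all of B, so
  B is finite; the finitely many functionals dual to B then detect every nonzero member.\<close>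

lemma finite_family:
  assumes w: "\<And>j. w j \<in> G n" and f: "\<And>f. f \<in> dual (- n) \<Longrightarrow> finite {j. f (w j) \<noteq> 0}"
  shows "finite {j. w j \<noteq> 0}"
proof -
  obtain B where B: "B \<subseteq> range w" "independent B" "range w \<subseteq> span B"
    using maximal_independent_subset by metis
  have BG: "B \<subseteq> G n" using B(1) w by auto
  obtain f where f1: "f \<in> dual (- n)" "\<forall>b\<in>B. f b = 1" using dual_extend[OF B(2) BG, of "\<lambda>_. 1"] by blast
  have "B \<subseteq> w ` {j. f (w j) \<noteq> 0}"
  proof
    fix b assume b: "b \<in> B"
    then obtain j where "b = w j" using B(1) by blast
    then show "b \<in> w ` {j. f (w j) \<noteq> 0}" using f1(2) b by auto
  qed
  then have finB: "finite B" using f[OF f1(1)] finite_surj by blast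
  have "\<exists>h\<in>dual (- n). \<forall>b\<in>B. h b = (if b = c then 1 else 0)" for c
    by (rule dual_extend[OF B(2) BG])
  then obtain h where h: "h c \<in> dual (- n)" "\<And>b. b \<in> B \<Longrightarrow> h c b = (if b = c then 1 else 0)" for c by metis
  have z: "v = 0" if v: "v \<in> span B" "\<And>b. b \<in> B \<Longrightarrow> h b v = 0" for v
  proof -
    obtain u where u: "v = (\<Sum>b\<in>B. s (u b) b)" using v(1) span_finite[OF finB] by auto
    have "u c = 0" if c: "c \<in> B" for c
    proof -
      have "h c v = (\<Sum>b\<in>B. u b * h c b)"
        unfolding u linf_sum[OF dual_linf[OF h(1)]] by (simp add: linf_scale[OF dual_linf[OF h(1)]])
      also have "\<dots> = (\<Sum>b\<in>B. if b = c then u b else 0)" by (rule sum.cong) (simp_all add: h(2))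
      also have "\<dots> = u c" using finB c by simp
      finally show ?thesis using v(2)[OF c] by simp
    qed
    then show ?thesis unfolding u by simp
  qed
  have "{j. w j \<noteq> 0} \<subseteq> (\<Union>b\<in>B. {j. h b (w j) \<noteq> 0})" using z B(3) by blast
  moreover have "finite (\<Union>b\<in>B. {j. h b (w j) \<noteq> 0})" using finB f[OF h(1)] by blast
  ultimately show ?thesis by (rule finite_subset)
qed

text \<open>The representing vector may depend on the other functionals. That such a form
  nevertheless has finite rank is the content of \<open>rep_fit\<close>.\<close>

definition slot_representable :: "int list \<Rightarrow> (('a \<Rightarrow> 'k) list \<Rightarrow> 'k) \<Rightarrow> bool" where
  "slot_representable es Y \<longleftrightarrow> (\<forall>fs i. homs dual es fs \<and> i < length es \<longrightarrow>
     (\<exists>x\<in>G (- (es ! i)). \<forall>f\<in>dual (es ! i). Y (fs[i := f]) = f x))"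

lemma rep_zero: "slot_representable es (\<lambda>_. 0)"
  unfolding slot_representable_def by (auto intro!: bexI[of _ 0] simp: G_zero linf_zero dual_linf)

lemma rep_Cons: assumes "slot_representable (e # es) Y" "f \<in> dual e" shows "slot_representable es (\<lambda>gs. Y (f # gs))"
  unfolding slot_representable_def
proof (intro allI impI, elim conjE)
  fix gs i assume a: "homs dual es gs" "i < length es"
  then show "\<exists>x\<in>G (- (es ! i)). \<forall>g\<in>dual (es ! i). Y (f # gs[i := g]) = g x"
    using assms(1)[unfolded slot_representable_def, rule_format, of "f # gs" "Suc i"] assms(2) by simp
qed

lemma rep_hd: assumes "slot_representable (e # es) Y" "homs dual es gs" shows "\<exists>x\<in>G (- e). \<forall>f\<in>dual e. Y (f # gs) = f x"
  using assms(1)[unfolded slot_representable_def, rule_format, of "0 # gs" 0] assms(2) dual_zero by simp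

lemma co_degree: "x \<in> G n \<Longrightarrow> co c x \<noteq> 0 \<Longrightarrow> fst c = n"
  using dual_vanish[OF co_dual, of x n "fst c" "snd c"] by auto

lemma co_dual': "fst c = - e \<Longrightarrow> co c \<in> dual e"
  by (cases c) (use co_dual[of "fst c" "snd c"] in simp)

lemma co_nonzero: "x \<noteq> 0 \<Longrightarrow> \<exists>c. co c x \<noteq> 0"
  using co_sum[of "{}" x] by auto

text \<open>
  Expanding the first slot in coordinates trades a slot for a larger index set; lists as indices allow this to be
  iterated in an induction.
\<close>

lemma finite_forms:
  fixes Y :: "(int \<times> 'a) list \<Rightarrow> ('a \<Rightarrow> 'k) list \<Rightarrow> 'k"
  assumes "\<And>j. slot_representable es (Y j)" "\<And>fs. homs dual es fs \<Longrightarrow> finite {j. Y j fs \<noteq> 0}"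
  shows "finite {j. \<exists>fs. homs dual es fs \<and> Y j fs \<noteq> 0}"
  using assms
proof (induction es arbitrary: Y)
  case Nil
  then show ?case by simp
next
  case (Cons e es)
  define w where "w j gs = (SOME x. x \<in> G (- e) \<and> (\<forall>f\<in>dual e. Y j (f # gs) = f x))" for j gs
  have w: "w j gs \<in> G (- e)" "\<And>f. f \<in> dual e \<Longrightarrow> Y j (f # gs) = f (w j gs)" if "homs dual es gs" for j gs
  proof -
    have "\<exists>x. x \<in> G (- e) \<and> (\<forall>f\<in>dual e. Y j (f # gs) = f x)"
      using rep_hd[OF Cons.prems(1) that] by blast
    from someI_ex[OF this] show "w j gs \<in> G (- e)" "\<And>f. f \<in> dual e \<Longrightarrow> Y j (f # gs) = f (w j gs)"
      unfolding w_def by blast+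
  qed
  \<comment> \<open>The index c # j selects coordinate c of the first slot of the form with index j;
    all other lists give the zero form.\<close>
  define Z where "Z l = (if l \<noteq> [] \<and> fst (hd l) = - e then (\<lambda>gs. Y (tl l) (co (hd l) # gs)) else (\<lambda>_. 0))" for l
  have "finite {l. \<exists>gs. homs dual es gs \<and> Z l gs \<noteq> 0}"
  proof (rule Cons.IH)
    show "slot_representable es (Z l)" for l
      using rep_Cons[OF Cons.prems(1) co_dual'] by (simp add: Z_def rep_zero)
    fix gs assume gs: "homs dual es gs"
    let ?J = "{j. w j gs \<noteq> 0}"
    have fin: "finite ?J"
    proof (rule finite_family[of _ "- e"])
      show "w j gs \<in> G (- e)" for j by (rule w(1)[OF gs])
      fix f assume f: "f \<in> dual (- (- e))"
      then have "{j. f (w j gs) \<noteq> 0} = {j. Y j (f # gs) \<noteq> 0}" using w(2)[OF gs] by simp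
      then show "finite {j. f (w j gs) \<noteq> 0}" using Cons.prems(2)[of "f # gs"] gs f by simp
    qed
    have "{l. Z l gs \<noteq> 0} \<subseteq> (\<Union>j\<in>?J. (\<lambda>c. c # j) ` {c. co c (w j gs) \<noteq> 0})"
    proof
      fix l assume "l \<in> {l. Z l gs \<noteq> 0}"
      then obtain c j where l: "l = c # j" "fst c = - e" "Y j (co c # gs) \<noteq> 0"
        by (cases l) (auto simp: Z_def split: if_splits)
      then have c: "co c (w j gs) \<noteq> 0" using w(2)[OF gs co_dual'] by simp
      then have "w j gs \<noteq> 0" using linf_zero[OF dual_linf[OF co_dual'[OF l(2)]]] by metis
      then show "l \<in> (\<Union>j\<in>?J. (\<lambda>c. c # j) ` {c. co c (w j gs) \<noteq> 0})" using c l(1) by auto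
    qed
    moreover have "finite (\<Union>j\<in>?J. (\<lambda>c. c # j) ` {c. co c (w j gs) \<noteq> 0})" using fin co_fin by blast
    ultimately show "finite {l. Z l gs \<noteq> 0}" by (rule finite_subset)
  qed
  moreover have "{j. \<exists>fs. homs dual (e # es) fs \<and> Y j fs \<noteq> 0} \<subseteq> tl ` {l. \<exists>gs. homs dual es gs \<and> Z l gs \<noteq> 0}"
  proof
    fix j assume "j \<in> {j. \<exists>fs. homs dual (e # es) fs \<and> Y j fs \<noteq> 0}"
    then obtain fs where "homs dual (e # es) fs" "Y j fs \<noteq> 0" by blast
    then obtain f gs where f: "f \<in> dual e" "homs dual es gs" "Y j (f # gs) \<noteq> 0" by (cases fs) auto
    then have "w j gs \<noteq> 0" using w(2)[OF f(2,1)] linf_zero[OF dual_linf[OF f(1)]] by metis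
    then obtain c where c: "co c (w j gs) \<noteq> 0" using co_nonzero by blast
    have c': "fst c = - e" by (rule co_degree[OF w(1)[OF f(2)] c])
    have "Z (c # j) gs \<noteq> 0" using c c' w(2)[OF f(2) co_dual'[OF c']] by (simp add: Z_def)
    then show "j \<in> tl ` {l. \<exists>gs. homs dual es gs \<and> Z l gs \<noteq> 0}" using f(2) by (intro image_eqI[of _ _ "c # j"]) auto
  qed
  ultimately show ?case by (rule finite_surj)
qed

text \<open>An element of the algebraic tensor product as a list of scaled pure tensors; it has to
  reproduce Y on functionals of degrees es only.\<close>

definition finite_rank :: "int list \<Rightarrow> (('a \<Rightarrow> 'k) list \<Rightarrow> 'k) \<Rightarrow> bool" where
  "finite_rank es Y \<longleftrightarrow> (\<exists>L. (\<forall>(k, vs)\<in>set L. homs G (map uminus es) vs) \<and>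
     (\<forall>fs. homs dual es fs \<longrightarrow> Y fs = (\<Sum>(k, vs)\<leftarrow>L. k * pform fs vs)))"

lemma fit_sum: "finite C \<Longrightarrow> (\<And>c. c \<in> C \<Longrightarrow> finite_rank es (Y c)) \<Longrightarrow> finite_rank es (\<lambda>fs. \<Sum>c\<in>C. Y c fs)"
proof (induction rule: finite_induct)
  case empty
  show ?case unfolding finite_rank_def by (intro exI[of _ "[]"]) simp
next
  case (insert c C)
  obtain L where L: "\<forall>(k, vs)\<in>set L. homs G (map uminus es) vs"
      "\<forall>fs. homs dual es fs \<longrightarrow> Y c fs = (\<Sum>(k, vs)\<leftarrow>L. k * pform fs vs)"
    using insert.prems[of c] unfolding finite_rank_def by auto
  obtain L' where L': "\<forall>(k, vs)\<in>set L'. homs G (map uminus es) vs"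
      "\<forall>fs. homs dual es fs \<longrightarrow> (\<Sum>c\<in>C. Y c fs) = (\<Sum>(k, vs)\<leftarrow>L'. k * pform fs vs)"
    using insert.IH insert.prems unfolding finite_rank_def by auto
  show ?case unfolding finite_rank_def using L L' insert.hyps by (intro exI[of _ "L @ L'"]) auto
qed

lemma fit_Cons: assumes "finite_rank es Y" "b \<in> G (- e)" shows "finite_rank (e # es) (\<lambda>fs. hd fs b * Y (tl fs))"
proof -
  obtain L where L: "\<forall>(k, vs)\<in>set L. homs G (map uminus es) vs"
      "\<forall>fs. homs dual es fs \<longrightarrow> Y fs = (\<Sum>(k, vs)\<leftarrow>L. k * pform fs vs)"
    using assms unfolding finite_rank_def by auto
  have "(\<Sum>(k, vs)\<leftarrow>map (\<lambda>(k, vs). (k, b # vs)) L. k * pform (f # gs) vs) = f b * (\<Sum>(k, vs)\<leftarrow>L. k * pform gs vs)" for f gs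
    by (induction L) (auto simp: algebra_simps)
  note sum = this
  have "\<forall>fs. homs dual (e # es) fs \<longrightarrow> hd fs b * Y (tl fs) = (\<Sum>(k, vs)\<leftarrow>map (\<lambda>(k, vs). (k, b # vs)) L. k * pform fs vs)"
  proof (intro allI impI)
    fix fs assume "homs dual (e # es) fs"
    then obtain f gs where f: "fs = f # gs" "homs dual es gs" by (cases fs) auto
    show "hd fs b * Y (tl fs) = (\<Sum>(k, vs)\<leftarrow>map (\<lambda>(k, vs). (k, b # vs)) L. k * pform fs vs)"
      unfolding f(1) sum using L(2) f(2) by simp
  qed
  moreover have "\<forall>(k, vs)\<in>set (map (\<lambda>(k, vs). (k, b # vs)) L). homs G (map uminus (e # es)) vs"
    using L(1) assms(2) by auto
  ultimately show ?thesis unfolding finite_rank_def by blast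
qed

lemma fit_cong: "finite_rank es Y \<Longrightarrow> (\<And>fs. homs dual es fs \<Longrightarrow> Z fs = Y fs) \<Longrightarrow> finite_rank es Z"
  unfolding finite_rank_def by metis

text \<open>By \<open>finite_forms\<close> only a finite set of coordinates of the first slot
  occurs, uniformly in the other functionals. The first slot therefore splits off as one finite sum,
  and the induction hypothesis applies to each coefficient.\<close>

lemma rep_fit: "slot_representable es Y \<Longrightarrow> finite_rank es Y"
proof (induction es arbitrary: Y)
  case Nil
  show ?case unfolding finite_rank_def by (rule exI[of _ "[(Y [], [])]"]) simp
next
  case (Cons e es)
  \<comment> \<open>Coordinates are encoded as lists of length 1 to fit the index type of
    \<open>finite_forms\<close>.\<close>
  define Z where "Z l = (if length l = 1 \<and> fst (hd l) = - e then (\<lambda>gs. Y (co (hd l) # gs)) else (\<lambda>_. 0))" for l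
  have head: "\<exists>x\<in>G (- e). \<forall>f\<in>dual e. Y (f # gs) = f x" if "homs dual es gs" for gs
    by (rule rep_hd[OF Cons.prems that])
  have finZ: "finite {l. \<exists>gs. homs dual es gs \<and> Z l gs \<noteq> 0}"
  proof (rule finite_forms)
    show "slot_representable es (Z l)" for l
      using rep_Cons[OF Cons.prems co_dual'] by (simp add: Z_def rep_zero)
    fix gs assume gs: "homs dual es gs"
    obtain x where x: "x \<in> G (- e)" "\<forall>f\<in>dual e. Y (f # gs) = f x" using head[OF gs] by blast
    have "{l. Z l gs \<noteq> 0} \<subseteq> (\<lambda>c. [c]) ` {c. co c x \<noteq> 0}"
    proof
      fix l assume l: "l \<in> {l. Z l gs \<noteq> 0}"
      then obtain c where c: "l = [c]" "fst c = - e" by (cases l) (auto simp: Z_def split: if_splits)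
      then show "l \<in> (\<lambda>c. [c]) ` {c. co c x \<noteq> 0}" using l x(2) co_dual'[OF c(2)] by (auto simp: Z_def)
    qed
    then show "finite {l. Z l gs \<noteq> 0}" using finite_surj[OF co_fin] by blast
  qed
  define C where "C = {c. \<exists>gs. homs dual es gs \<and> Z [c] gs \<noteq> 0 \<and> snd c \<in> G (- e)}"
  have finC: "finite C"
    by (rule finite_surj[OF finZ, of _ hd]) (auto simp: C_def intro!: image_eqI[of _ hd "[_]"])
  have C: "fst c = - e" "snd c \<in> G (- e)" if "c \<in> C" for c
    using that by (auto simp: C_def Z_def split: if_splits)
  have "finite_rank (e # es) (\<lambda>fs. hd fs (snd c) * Y (co c # tl fs))" if "c \<in> C" for c
    by (rule fit_Cons[OF Cons.IH[OF rep_Cons[OF Cons.prems co_dual'[OF C(1)[OF that]]]] C(2)[OF that]])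
  then have "finite_rank (e # es) (\<lambda>fs. \<Sum>c\<in>C. hd fs (snd c) * Y (co c # tl fs))" by (rule fit_sum[OF finC])
  then show ?case
  proof (rule fit_cong)
    fix fs assume "homs dual (e # es) fs"
    then obtain f gs where f: "fs = f # gs" "f \<in> dual e" "homs dual es gs" by (cases fs) auto
    obtain x where x: "x \<in> G (- e)" "\<forall>f\<in>dual e. Y (f # gs) = f x" using head[OF f(3)] by blast
    have "{c. co c x \<noteq> 0} \<subseteq> C"
    proof
      fix c assume "c \<in> {c. co c x \<noteq> 0}"
      then have c: "co c x \<noteq> 0" by simp
      have e: "fst c = - e" by (rule co_degree[OF x(1) c])
      then have "Z [c] gs \<noteq> 0" using c x(2) co_dual'[OF e] by (simp add: Z_def)
      then show "c \<in> C" using f(3) co_nz_G[OF c] e by (auto simp: C_def)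
    qed
    then have sx: "(\<Sum>c\<in>C. s (co c x) (snd c)) = x" by (rule co_sum[OF finC])
    have "Y fs = f (\<Sum>c\<in>C. s (co c x) (snd c))" unfolding sx f(1) using x(2) f(2) by simp
    also have "\<dots> = (\<Sum>c\<in>C. co c x * f (snd c))" using dual_linf[OF f(2)] by (simp add: linf_sum linf_scale)
    also have "\<dots> = (\<Sum>c\<in>C. hd fs (snd c) * Y (co c # tl fs))"
      by (rule sum.cong) (use x(2) co_dual'[OF C(1)] in \<open>simp_all add: f(1)\<close>)
    finally show "Y fs = (\<Sum>c\<in>C. hd fs (snd c) * Y (co c # tl fs))" .
  qed
qed

text \<open>Pure tensors of degrees opposite to es are annihilated by functionals of other degrees;
  so the tensors for different degree lists can be added without interfering.\<close>

lemma rep_tensor: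
  assumes "slot_representable es Y" "length es = p"
  shows "\<exists>t\<in>tpow s p. (\<forall>fs. homs dual es fs \<longrightarrow> t (pform fs) = Y fs) \<and>
    (\<forall>es' fs. es' \<noteq> es \<and> homs dual es' fs \<and> length fs = p \<longrightarrow> t (pform fs) = 0)"
proof -
  obtain L where L: "\<forall>(k, vs)\<in>set L. homs G (map uminus es) vs"
      "\<forall>fs. homs dual es fs \<longrightarrow> Y fs = (\<Sum>(k, vs)\<leftarrow>L. k * pform fs vs)"
    using rep_fit[OF assms(1)] unfolding finite_rank_def by auto
  let ?t = "\<Sum>(k, vs)\<leftarrow>L. tscale k (tens s vs)"
  have lv: "\<forall>(k, vs)\<in>set L. length vs = p" using L(1) homs_length[of G "map uminus es"] assms(2) by auto
  have t: "(\<Sum>(k, vs)\<leftarrow>M. tscale k (tens s vs)) (pform fs) = (\<Sum>(k, vs)\<leftarrow>M. k * pform fs vs)"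
    if "homs dual es' fs" "length fs = p" "\<forall>(k, vs)\<in>set M. length vs = p" for es' fs M
    using that(3) that(2)[symmetric] mlf_pform_hom[OF that(1,2)]
    by (induction M) (auto simp: tscale_def tens_app)
  have "?t \<in> tpow s p" using lv by (induction L) (auto intro!: tpow_add tpow_scale tens_in tpow_0)
  moreover have "?t (pform fs) = Y fs" if f: "homs dual es fs" for fs
    using t[OF f _ lv] L(2) f homs_length[OF f] assms(2) by simp
  moreover have "?t (pform fs) = 0" if "es' \<noteq> es" "homs dual es' fs" "length fs = p" for es' fs
  proof -
    have "pform fs vs = 0" if "(k, vs) \<in> set L" for k vs
    proof (rule ccontr)
      assume "pform fs vs \<noteq> 0"
      moreover have "homs G (map uminus es) vs" "length vs = p" using L(1) lv that by auto
      ultimately have "es' = map uminus (map uminus es)"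
        using pform_vanish[OF \<open>homs dual es' fs\<close>, of "map uminus es" vs] \<open>length fs = p\<close> by simp
      then show False using \<open>es' \<noteq> es\<close> by (simp add: comp_def)
    qed
    then have "(\<Sum>(k, vs)\<leftarrow>L. k * pform fs vs) = (\<Sum>(k, vs)\<leftarrow>L. 0)"
      by (intro arg_cong[of _ _ sum_list] map_cong) auto
    then show ?thesis unfolding t[OF that(2,3) lv] by (simp add: case_prod_unfold)
  qed
  ultimately show ?thesis by blast
qed

end

section \<open>The bijection\<close>

context graded_alg begin

text \<open>Evaluations determine the values on homogeneous pure tensors, linearity those on the
  tensor power, and \<open>bracket_family\<close> prescribes 0 elsewhere.\<close>

lemma brackets_of_unique:
  assumes "brackets_of s G m br" "brackets_of s G m br'" shows "br = br'"
proof (rule ext, rule ext)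
  fix p t
  have bf: "bracket_family s br" "bracket_family s br'" using assms by (auto simp: brackets_of_def)
  show "br p t = br' p t"
  proof (cases "p \<ge> 1 \<and> t \<in> tpow s p")
    case True
    then have p: "p \<ge> 1" by simp
    have B: "b p u \<in> tpow s p" "b p (tscale c u + v) = tscale c (b p u) + b p v"
      if "b \<in> {br, br'}" "u \<in> tpow s p" "v \<in> tpow s p" for b u v c
      using that bf p by (auto simp: bracket_family_def)
    have "t \<in> tpow s p" using True by simp
    then show ?thesis
    proof (induction rule: tpow_hom_induct)
      case zero
      have z: "b p 0 = 0" if "b \<in> {br, br'}" for b using B(2)[OF that tpow_0 tpow_0, of 1] by simp
      show ?case by (rule trans[OF z[of br] z[of br', symmetric]]) simp_all
    next
      case (comb c t u)
      have e: "b p (tscale c t + u) = tscale c (b p t) + b p u" if "b \<in> {br, br'}" for b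
        by (rule B(2)[OF that comb(1,2)])
      have "br p (tscale c t + u) = tscale c (br p t) + br p u" by (rule e) simp
      also have "\<dots> = br' p (tscale c t + u)" unfolding comb(3,4) by (rule e[symmetric]) simp
      finally show ?case .
    next
      case (tens ds vs)
      note i = tens_in[OF tens(1)]
      show ?case
      proof (rule tpow_eqI)
        show "br p (tens s vs) \<in> tpow s p" "br' p (tens s vs) \<in> tpow s p" using B(1) i by auto
        fix es fs assume f: "homs dual es fs" "length fs = p"
        have "tpair G es fs (br p (tens s vs)) = tpair G es fs (br' p (tens s vs))"
          using assms p tens f unfolding brackets_of_def by metis
        then show "br p (tens s vs) (pform fs) = br' p (tens s vs) (pform fs)"
          using B(1)[of _ "tens s vs"] i by (simp add: tpair_eq[OF _ f] sg_neq)
      qed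
    qed
  qed (use bf in \<open>cases "p = 0"; auto simp: bracket_family_def\<close>)
qed

end

section \<open>Tensors representing the form of given maps\<close>

context cyclic_maps begin

lemma W_multilin: assumes n: "n \<ge> 1" shows "multilin esc (*) esp (Suc n) W"
  unfolding multilin_def
proof (intro allI impI, elim conjE)
  fix w i c x y assume a: "length w = Suc n" "set w \<subseteq> esp" "i < Suc n" "x \<in> esp" "y \<in> esp"
  obtain xs z where w: "w = xs @ [z]" using a(1) by (cases w rule: rev_cases) auto
  have l: "length xs = n" "set xs \<subseteq> esp" "z \<in> esp" using a w by auto
  show "W (w[i := esc c x + y]) = c * W (w[i := x]) + W (w[i := y])"
  proof (cases "i = n")
    case True
    then show ?thesis using nf_lin'[OF a(4,5) m_esp] l by (simp add: w list_update_append W_snoc)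
  next
    case False
    then have i: "i < n" using a(3) by simp
    have "m n (xs[i := esc c x + y]) = esc c (m n (xs[i := x])) + m n (xs[i := y])"
      by (rule multilinD[OF m_ml[OF n] l(1,2) i a(4,5)])
    then show ?thesis using nf_lin[OF m_esp m_esp l(3)] l i by (simp add: w list_update_append W_snoc)
  qed
qed

lemma word_esp: "homs G ds as \<Longrightarrow> homs dual es fs \<Longrightarrow> length as = length fs \<Longrightarrow> set (word as fs) \<subseteq> esp"
  using word_hom homs_esp by blast

text \<open>Rotation carries the chosen functional to the end of the word, where the form evaluates
  it at the algebra part of a map; the sign depends only on the letters that are moved past it. The
  component of the degree opposite to the functional is a homogeneous representative.\<close>

lemma W_word_rep:
  assumes p: "p \<ge> 1" and as: "homs G ds as" "length as = p" and es: "length es = p"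
  shows "slot_representable es (\<lambda>fs. W (word as fs))"
  unfolding slot_representable_def
proof (intro allI impI, elim conjE)
  fix fs i assume f: "homs dual es fs" "i < length es"
  have lf: "length fs = p" using homs_length[OF f(1)] es by simp
  have i: "i < p" using f(2) es by simp
  let ?k = "2 * (p - 1 - i) + 1"
  define us vs where "us = take ?k (word as fs)" and "vs = drop (Suc ?k) (word as fs)"
  have lw: "length (word as fs) = 2 * p" using as lf by (simp add: word_length)
  have k: "?k < 2 * p" using i by linarith
  have h: "homs edg (wdeg ds es) (word as fs)" by (rule word_hom) (use as f lf in simp_all)
  have hv: "homs edg (drop (Suc ?k) (wdeg ds es)) vs" unfolding vs_def
    using h unfolding homs_def by (rule list_all2_dropI)
  have hu: "homs edg (take ?k (wdeg ds es)) us" unfolding us_def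
    using h unfolding homs_def by (rule list_all2_takeI)
  have ll: "length us + length vs + 1 = 2 * p" "length us = ?k" using lw k by (simp_all add: us_def vs_def)
  have w: "word as (fs[i := g]) = us @ (0, g) # vs" for g
    using k lw by (simp only: word_update(2)[OF as(2) lf i] us_def vs_def upd_conv_take_nth_drop)
  define \<sigma> where "\<sigma> = (sg ((2 * int p - 1) * (int (length vs) + sum_list (drop (Suc ?k) (wdeg ds es)))) :: 'k)"
  let ?x = "s \<sigma> (fst (m (2 * p - 1) (vs @ us)))"
  have "W (word as (fs[i := g])) = g ?x" if g: "g \<in> dual (es ! i)" for g
  proof -
    have l1: "length us = length (take ?k (wdeg ds es))" using homs_length[OF hu] by simp
    have hz: "homs edg (take ?k (wdeg ds es) @ [es ! i + 1]) (us @ [(0, g)])"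
      using hu g l1 by (simp add: homs_append edg_dual)
    have "length vs + length (us @ [(0, g)]) = 2 * p" using ll by simp
    moreover have "2 \<le> length vs + length (us @ [(0, g)])" using ll p by simp
    ultimately have "W ((us @ [(0, g)]) @ vs) = \<sigma> * W (vs @ us @ [(0, g)])"
      using W_rot[OF hv hz] by (simp add: \<sigma>_def of_nat_add[symmetric] del: of_nat_add)
    moreover have "length (vs @ us) = 2 * p - 1" using ll by simp
    then have "W ((vs @ us) @ [(0, g)]) = g (fst (m (2 * p - 1) (vs @ us)))"
      using gdual_linf[of "snd (m (2 * p - 1) (vs @ us))"] m_esp[of "2 * p - 1" "vs @ us"]
      unfolding W_snoc by (simp add: nat_form_eq esp_iff linf_zero)
    ultimately show ?thesis unfolding w using dual_linf[OF g] by (simp add: linf_scale)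
  qed
  note x = this
  show "\<exists>x\<in>G (- (es ! i)). \<forall>g\<in>dual (es ! i). W (word as (fs[i := g])) = g x"
  proof (intro bexI ballI)
    show "hc ?x (- (es ! i)) \<in> G (- (es ! i))" by (rule hc_props(1))
    fix g assume g: "g \<in> dual (es ! i)"
    show "W (word as (fs[i := g])) = g (hc ?x (- (es ! i)))" unfolding x[OF g] dual_hc[OF g] ..
  qed
qed

text \<open>\<open>?N\<close> contains the degree lists in which the value of the bracket can live.
  For functionals of other degrees the form is zero: either the degree sum is wrong, or some
  functional lives on a zero component and is itself zero.\<close>

lemma bracket_tensor_exists:
  assumes fin: "finite_splittings G" and p: "p \<ge> 1" and as: "homs G ds as" "length as = p"
  shows "\<exists>t\<in>tpow s p. \<forall>es fs. homs dual es fs \<and> length fs = p \<longrightarrow> t (pform fs) = sg (tsg ds es) * W (word as fs)"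
proof -
  let ?N = "{xs. length xs = p \<and> sum_list xs = sum_list ds + 2 - int p \<and> (\<forall>d\<in>set xs. G d \<noteq> {0})}"
  have finN: "finite ?N" using fin by (auto simp: finite_splittings_def)
  define Es where "Es = map uminus ` ?N"
  have finE: "finite Es" using finN by (simp add: Es_def)
  have lE: "length es = p" if "es \<in> Es" for es using that by (auto simp: Es_def)
  have "\<exists>t\<in>tpow s p. (\<forall>fs. homs dual es fs \<longrightarrow> t (pform fs) = W (word as fs)) \<and>
    (\<forall>es' fs. es' \<noteq> es \<and> homs dual es' fs \<and> length fs = p \<longrightarrow> t (pform fs) = 0)" if "es \<in> Es" for es
    by (rule rep_tensor[OF W_word_rep[OF p as lE[OF that]] lE[OF that]])
  then obtain T where T: "\<And>es. es \<in> Es \<Longrightarrow> T es \<in> tpow s p"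
    "\<And>es fs. es \<in> Es \<Longrightarrow> homs dual es fs \<Longrightarrow> T es (pform fs) = W (word as fs)"
    "\<And>es es' fs. es \<in> Es \<Longrightarrow> es' \<noteq> es \<Longrightarrow> homs dual es' fs \<Longrightarrow> length fs = p \<Longrightarrow> T es (pform fs) = 0"
    by metis
  let ?t = "\<Sum>es\<in>Es. tscale (sg (tsg ds es)) (T es)"
  show ?thesis
  proof (intro bexI[of _ ?t] allI impI, elim conjE)
    show "?t \<in> tpow s p" by (intro tpow_sum tpow_scale T(1))
    fix es fs assume f: "homs dual es fs" "length fs = p"
    have e: "?t (pform fs) = (\<Sum>es'\<in>Es. sg (tsg ds es') * T es' (pform fs))"
      by (simp add: sum_fun_app tscale_def)
    have "\<dots> = (\<Sum>es'\<in>Es. if es' = es then sg (tsg ds es) * W (word as fs) else 0)"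
    proof (rule sum.cong[OF refl])
      fix es' assume es': "es' \<in> Es"
      show "sg (tsg ds es') * T es' (pform fs) = (if es' = es then sg (tsg ds es) * W (word as fs) else 0)"
        using T(2)[OF es', of fs] T(3)[OF es' _ f] f(1) by (cases "es' = es") auto
    qed
    also have "\<dots> = sg (tsg ds es) * W (word as fs)"
    proof (cases "es \<in> Es")
      case False
      have "W (word as fs) = 0"
      proof (rule ccontr)
        assume nz: "W (word as fs) \<noteq> 0"
        have sd: "sum_list ds + sum_list es = int p - 2" by (rule W_word_deg[OF p as f nz])
        have le: "length es = p" using homs_length[OF f(1)] f(2) by simp
        have sm: "sum_list (map uminus xs) = - sum_list xs" for xs :: "int list" by (induction xs) auto
        have mm: "map uminus (map uminus es) = es" by (simp add: comp_def)
        have "map uminus es \<notin> ?N"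
        proof
          assume "map uminus es \<in> ?N"
          then have "map uminus (map uminus es) \<in> Es" unfolding Es_def by (rule imageI)
          then show False using False unfolding mm by simp
        qed
        then obtain d where "d \<in> set (map uminus es)" "G d = {0}" using le sd by (auto simp: sm)
        then obtain i where i: "i < p" "G (- (es ! i)) = {0}" using le by (auto simp: in_set_conv_nth)
        have fi: "fs ! i \<in> dual (es ! i)" using homs_nth[OF f(1)] i(1) le by simp
        have "(fs ! i) v = 0" for v
        proof -
          have "hc v (- (es ! i)) = 0" using hc_props(1)[of v "- (es ! i)"] i(2) by simp
          then show ?thesis using dual_hc[OF fi, of v] linf_zero[OF dual_linf[OF fi]] by simp
        qed
        then have z: "fs ! i = 0" by (simp add: fun_eq_iff)
        let ?k = "2 * (p - 1 - i) + 1"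
        have lw: "length (word as fs) = 2 * p" using as f by (simp add: word_length)
        have k: "?k < 2 * p" using i(1) by linarith
        have "word as fs = (word as fs)[?k := (0, fs ! i)]"
          using word_update(2)[OF as(2) f(2) i(1), of "fs ! i"] by (simp only: list_update_id)
        then have "word as fs = (word as fs)[?k := (0, 0)]" unfolding z .
        then have "(word as fs) ! ?k = 0" using k lw by (metis nth_list_update_eq zero_prod_def)
        then have "0 \<in> set (word as fs)" using k lw by (metis nth_mem)
        moreover have "set (word as fs) \<subseteq> esp" by (rule word_esp[OF as(1) f(1)]) (use as f in simp)
        ultimately show False using W_zero nz by blast
      qed
      then show ?thesis using False finE by simp
    qed (use finE in simp)
    finally show "?t (pform fs) = sg (tsg ds es) * W (word as fs)" unfolding e .
  qed
qed

definition bracket_tensor :: "nat \<Rightarrow> int list \<Rightarrow> 'a list \<Rightarrow> ('k, 'a) tensor" where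
  "bracket_tensor p ds as = (if homs G ds as \<and> length as = p then
     SOME t. t \<in> tpow s p \<and> (\<forall>es fs. homs dual es fs \<and> length fs = p \<longrightarrow> t (pform fs) = sg (tsg ds es) * W (word as fs))
     else 0)"

lemma bracket_tensor:
  assumes fin: "finite_splittings G" and p: "p \<ge> 1"
  shows "bracket_tensor p ds as \<in> tpow s p"
    and "homs G ds as \<Longrightarrow> length as = p \<Longrightarrow> homs dual es fs \<Longrightarrow> length fs = p \<Longrightarrow>
      bracket_tensor p ds as (pform fs) = sg (tsg ds es) * W (word as fs)"
proof -
  have S: "bracket_tensor p ds as \<in> tpow s p \<and> (\<forall>es fs. homs dual es fs \<and> length fs = p \<longrightarrow>
      bracket_tensor p ds as (pform fs) = sg (tsg ds es) * W (word as fs))" if "homs G ds as" "length as = p"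
    using someI_ex[OF bracket_tensor_exists[OF fin p that, unfolded Bex_def]] that unfolding bracket_tensor_def by simp
  show "bracket_tensor p ds as \<in> tpow s p"
    using S by (cases "homs G ds as \<and> length as = p") (auto simp: bracket_tensor_def tpow_0)
  show "homs G ds as \<Longrightarrow> length as = p \<Longrightarrow> homs dual es fs \<Longrightarrow> length fs = p \<Longrightarrow>
      bracket_tensor p ds as (pform fs) = sg (tsg ds es) * W (word as fs)" using S by blast
qed

text \<open>The tensors are chosen one by one, but evaluations determine them, and the evaluations
  are linear in each vector because \<open>W\<close> is multilinear.\<close>

lemma bracket_tensor_lin:
  assumes fin: "finite_splittings G" and p: "p \<ge> 1"
    and a: "homs G ds as" "length ds = p" "i < p" "x \<in> G (ds ! i)" "y \<in> G (ds ! i)"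
  shows "bracket_tensor p ds (as[i := s c x + y]) =
    tscale c (bracket_tensor p ds (as[i := x])) + bracket_tensor p ds (as[i := y])"
proof (rule tpow_eqI)
  note B = bracket_tensor[OF fin p]
  show "bracket_tensor p ds (as[i := s c x + y]) \<in> tpow s p"
    "tscale c (bracket_tensor p ds (as[i := x])) + bracket_tensor p ds (as[i := y]) \<in> tpow s p"
    by (intro tpow_add tpow_scale B(1))+
  fix es fs assume f: "homs dual es fs" "length fs = p"
  have la: "length as = p" using homs_length[OF a(1)] a(2) by simp
  have h: "homs G ds (as[i := v])" if "v \<in> G (ds ! i)" for v
    using a(1-3) that la by (auto simp: homs_iff nth_list_update)
  have xy: "s c x + y \<in> G (ds ! i)" using a by (intro G_add G_scale)
  let ?k = "2 * (p - 1 - i)"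
  have "esc c (x, 0) + (y, 0) = (s c x + y, 0)" by (simp add: ext_scale_eq fscale_def fun_eq_iff)
  moreover have "W ((word as fs)[?k := esc c (x, 0) + (y, 0)]) = c * W ((word as fs)[?k := (x, 0)]) + W ((word as fs)[?k := (y, 0)])"
  proof (rule multilinD[OF W_multilin[of "2 * p - 1"]])
    show "set (word as fs) \<subseteq> esp" by (rule word_esp[OF a(1) f(1)]) (use la f in simp)
  qed (use p la f a(3) zero_in_gdual[of s G] in \<open>auto simp: word_length esp_iff\<close>)
  ultimately have "W (word (as[i := s c x + y]) fs) = c * W (word (as[i := x]) fs) + W (word (as[i := y]) fs)"
    by (simp add: word_update(1)[OF la f(2) a(3)])
  then show "bracket_tensor p ds (as[i := s c x + y]) (pform fs) =
      (tscale c (bracket_tensor p ds (as[i := x])) + bracket_tensor p ds (as[i := y])) (pform fs)"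
    using B(2)[OF h[OF xy] _ f] B(2)[OF h[OF a(4)] _ f] B(2)[OF h[OF a(5)] _ f] la
    by (simp add: tscale_def algebra_simps)
qed

text \<open>Linearity within fixed degrees is all that \<open>hext\<close> needs to produce a
  multilinear map, which \<open>tlift\<close> then turns into a linear one.\<close>

lemma brackets_exist: assumes fin: "finite_splittings G" shows "\<exists>br. brackets_of s G m br"
proof -
  let ?T = "\<lambda>p. hext G (bracket_tensor p)"
  define br where "br p t = (if p \<ge> 1 \<and> t \<in> tpow s p then tlift (?T p) t else 0)" for p t
  have hm: "hml p (\<lambda>ds vs. bracket_tensor p ds vs \<phi>)" if p: "p \<ge> 1" for p \<phi>
    unfolding hml_def using bracket_tensor_lin[OF fin p] by (auto simp: tscale_def)
  have T: "tmulti p p (?T p)" if p: "p \<ge> 1" for p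
    unfolding tmulti_def
  proof (intro conjI allI impI)
    show "?T p vs \<in> tpow s p" if "length vs = p" for vs by (rule hext_in[OF bracket_tensor(1)[OF fin p] that])
    show "mlf p (\<lambda>vs. ?T p vs \<phi>)" for \<phi> unfolding hext_app by (rule hext_mlf[OF hm[OF p]])
  qed
  have "bracket_family s br"
    unfolding bracket_family_def br_def using tlift_in[OF T] tpow_add tpow_scale by (auto simp: tlift_lin)
  moreover have "br p (tens s as) (pform fs) = sg (tsg ds es) * W (word as fs)"
    if a: "p \<ge> 1" "homs G ds as" "length as = p" "homs dual es fs" "length fs = p" for p ds as es fs
  proof -
    have ld: "length ds = p" using homs_length[OF a(2)] a(3) by simp
    have "?T p as = bracket_tensor p ds as"
    proof (rule hext_hom[OF a(2)])
      assume z: "0 \<in> set as"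
      show "bracket_tensor p ds as = 0" by (rule ext) (use hml_0[OF hm[OF a(1)] a(2) ld z] in simp)
    qed
    then have "br p (tens s as) = bracket_tensor p ds as"
      using tlift_tens[OF T[OF a(1)] a(3)] tens_in[OF a(3)] a(1) by (simp add: br_def)
    then show ?thesis using bracket_tensor(2)[OF fin a] by simp
  qed
  ultimately have "brackets_of s G m br" unfolding brackets_of_iff by blast
  then show ?thesis by blast
qed

end

text \<open>Equal brackets give equal forms on standard words. One rotation reaches the alternating
  words that begin with a functional, other patterns of even length give zero, and nondegeneracy
  recovers the odd maps. Arity 2 is fixed by manageability, and the other even arities
  vanish.\<close>

lemma brackets_of_inject:
  assumes "cyclic_maps s G m" "cyclic_maps s G m'" "brackets_of s G m br" "brackets_of s G m' br"
  shows "m = m'"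
proof -
  interpret M: cyclic_maps s G m by fact
  interpret M': cyclic_maps s G m' by fact
  have first: "M.W w = M'.W w" if pm: "homs M.edg ds w" "M.pw is w" "distinct_adj is" "\<not> hd is" "even (length w)" "length w \<ge> 2" for ds "is" w
  proof -
    obtain as fs es gs where w: "w = word as fs" "length as = length fs" "homs G es as" "homs M.dual gs fs"
      using M.word_exists[OF pm(1,2,3) _ pm(5)] pm(4) by blast
    have p: "length as \<ge> 1" using pm(6) w(1,2) by (cases as) (auto simp: word_length)
    have "sg (tsg es gs) * M.W w = sg (tsg es gs) * M'.W w"
      using assms(3,4) p w unfolding M.brackets_of_iff M'.brackets_of_iff w(1) by metis
    then show ?thesis by (simp add: sg_neq)
  qed
  have W: "M.W w = M'.W w" if w: "homs M.edg ds w" "M.pw is w" "even (length w)" "length w \<ge> 2" for ds "is" w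
  proof (cases "distinct_adj is")
    case False
    then show ?thesis using M.W_adj[OF w(2-4)] M'.W_adj[OF w(2-4)] by simp
  next
    case True
    show ?thesis
    proof (cases "hd is")
      case False
      then show ?thesis using first[OF w(1,2) True _ w(3,4)] by simp
    next
      case hd: True
      obtain x us where x: "w = x # us" using w(4) by (cases w) auto
      obtain d es where d: "ds = d # es" using homs_length[OF w(1)] x by (cases ds) auto
      have h: "x \<in> M.edg d" "homs M.edg es us" using w(1) by (simp_all add: x d)
      have us: "us \<noteq> []" using w(4) x by auto
      have li: "length is = length w" by (rule M.pw_length[OF w(2)])
      then obtain i j js where i: "is = i # j # js" using w(4) by (cases "is"; cases "tl is") auto
      have le: "length es = length us" using homs_length[OF h(2)] by simp
      have "M.W (us @ [x]) = M'.W (us @ [x])"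
      proof (rule first)
        show "homs M.edg (es @ [d]) (us @ [x])" using h le by (simp add: homs_append)
        show "M.pw (rotate 1 is) (us @ [x])" using M.pw_rotate[OF w(2), of 1] by (simp add: x)
        show "distinct_adj (rotate 1 is)" using alt_rotate1[OF True] w(3) li by simp
        show "\<not> hd (rotate 1 is)" using True hd by (simp add: i)
      qed (use w x in auto)
      then show ?thesis
        unfolding M.W_rot1[OF h(2) us h(1)] M'.W_rot1[OF h(2) us h(1)] x by (simp add: sg_neq)
    qed
  qed
  show ?thesis
  proof (intro ext)
    fix n xs
    show "m n xs = m' n xs"
    proof (cases "n \<ge> 1 \<and> length xs = n \<and> set xs \<subseteq> M.esp")
      case False
      show ?thesis by (rule trans[OF M.m_off[OF False] M'.m_off[OF False, symmetric]])
    next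
      case True
      then have n: "n \<ge> 1" by simp
      let ?D = "\<lambda>xs. M.esc (-1) (m' n xs) + m n xs"
      have ml: "multilin M.esc M.esc M.esp n ?D"
        unfolding multilin_def
        using multilinD[OF M.m_ml[OF n]] multilinD[OF M'.m_ml[OF n]]
        by (simp add: M.E.scale_right_distrib M.E.scale_left_commute algebra_simps)
      have "?D xs \<in> {0}"
      proof (rule multilin_span[OF M.E.vector_space_axioms M.E.vector_space_axioms ml M.esp_span])
        show "M.E.subspace {0}" by (rule M.E.subspace_single_0)
        fix ys assume y: "length ys = n" "set ys \<subseteq> M.purehom"
        then have "set ys \<subseteq> (\<Union>d. M.edg d)" using M.purehom_edg by blast
        then obtain ds where ds: "homs M.edg ds ys" using homs_exists by blast
        consider "n = 2" | "even n" "n \<noteq> 2" | "odd n" by blast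
        then have "m n ys = m' n ys"
        proof cases
          case 1
          then obtain u v where u: "ys = [u, v]" using y(1) by (auto simp: length_Suc_conv numeral_2_eq_2)
          then have "u \<in> M.purehom" "v \<in> M.purehom" using y(2) by auto
          then obtain i j where "u \<in> M.edg i" "v \<in> M.edg j" using M.purehom_edg by metis
          then show ?thesis unfolding 1 u using M.m_2_hom M'.m_2_hom by simp
        next
          case 2
          then show ?thesis using M.m_even M'.m_even by simp
        next
          case 3
          have "M.esc (-1) (m' n ys) + m n ys = 0"
          proof (rule M.nf_nondeg)
            show "M.esc (-1) (m' n ys) + m n ys \<in> M.esp" by (intro M.esp_add M.esp_scale M.m_esp M'.m_esp)
            fix z assume z: "z \<in> M.purehom"
            obtain d where d: "z \<in> M.edg d" using M.purehom_edg[OF z] by blast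
            have "\<exists>is. M.pw is ws" if "set ws \<subseteq> M.purehom" for ws
              using that by (induction ws) (use M.purehom_tB in \<open>auto intro: list_all2_Cons[THEN iffD2]\<close>, blast)
            then obtain "is" where "M.pw is (ys @ [z])" using y(2) z by (metis Un_subset_iff insert_subset empty_subsetI list.set set_append)
            moreover have "homs M.edg (ds @ [d]) (ys @ [z])"
              using ds d homs_length[OF ds] by (simp add: homs_append)
            ultimately have "M.W (ys @ [z]) = M'.W (ys @ [z])" using W 3 y(1) n by simp
            then show "nat_form (M.esc (-1) (m' n ys) + m n ys) z = 0"
              using M.nf_lin[OF M'.m_esp M.m_esp M.edg_esp[OF d], of "-1"] y(1)
              by (simp add: M.W_snoc M'.W_snoc)
          qed
          then show ?thesis by simp
        qed
        then show "?D ys \<in> {0}" by simp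
      qed (use True in auto)
      then show ?thesis by simp
    qed
  qed
qed

theorem theorem6p3:
  fixes s :: "'k::field_char_0 \<Rightarrow> 'a::ring \<Rightarrow> 'a" and G :: "int \<Rightarrow> 'a set"
  assumes "graded_algebra s G"
  shows
    "(\<forall>m\<in>good_manageable_special_pre_CY s G. \<forall>br. brackets_of s G m br \<longrightarrow> double_P_inf s G br) \<and>
     bij_betw (bracket_map s G)
       {m \<in> good_manageable_special_pre_CY s G. \<exists>br. brackets_of s G m br}
       {br. double_P_inf s G br} \<and>
     (finite_splittings G \<longrightarrow>
       (\<forall>m\<in>good_manageable_special_pre_CY s G. \<exists>!br. brackets_of s G m br) \<and>
       bij_betw (bracket_map s G) (good_manageable_special_pre_CY s G) {br. double_P_inf s G br})"
proof -
  let ?S = "good_manageable_special_pre_CY s G" and ?D = "{br. double_P_inf s G br}"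
  let ?S' = "{m \<in> ?S. \<exists>br. brackets_of s G m br}"
  interpret graded_alg s G by unfold_locales fact
  have cm: "cyclic_maps s G m" if "m \<in> ?S" for m by (rule cyclic_maps_GMS[OF assms that])
  have dp: "double_P_inf s G br" if m: "m \<in> ?S" "brackets_of s G m br" for m br
  proof -
    interpret linked s G m br using cm[OF m(1)] m(2) by (simp add: linked_def linked_axioms_def)
    show ?thesis using m(1) double_P_inf_iff_GMS by blast
  qed
  have bm: "bracket_map s G m = br" if "brackets_of s G m br" for m br
    unfolding bracket_map_def using that brackets_of_unique by (intro the_equality) blast+
  \<comment> \<open>Restricted to structures that possess brackets, the bijection holds for every
    grading, since a structure built from brackets possesses them. Finiteness of the splittings then
    makes the restriction void.\<close>
  have bij: "bij_betw (bracket_map s G) ?S' ?D"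
  proof (rule bij_betwI')
    fix m m' assume m: "m \<in> ?S'" "m' \<in> ?S'"
    then obtain br br' where b: "brackets_of s G m br" "brackets_of s G m' br'" by blast
    have "bracket_map s G m = br" "bracket_map s G m' = br'" using b bm by blast+
    then show "bracket_map s G m = bracket_map s G m' \<longleftrightarrow> m = m'"
      using m b brackets_of_inject[OF cm[of m] cm[of m'], of br] by auto
  next
    fix m assume "m \<in> ?S'"
    then show "bracket_map s G m \<in> ?D" using bm dp by auto
  next
    fix br assume "br \<in> ?D"
    then interpret from_bracket s G br by unfold_locales simp
    show "\<exists>m\<in>?S'. br = bracket_map s G m"
      using m_of_GMS m_of_brackets bm by (intro bexI[of _ CY_maps]) auto
  qed
  moreover have "?S' = ?S" if "finite_splittings G"
    using cyclic_maps.brackets_exist[OF cm that] by blast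
  moreover have "\<exists>!br. brackets_of s G m br" if "finite_splittings G" "m \<in> ?S" for m
    using cyclic_maps.brackets_exist[OF cm[OF that(2)] that(1)] brackets_of_unique by blast
  ultimately show ?thesis using dp by (intro conjI ballI allI impI) (simp_all only:)
qed

end
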